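(* Let $Z_n=\sum_{i=1}^n\xi_{S_i}$ ($Z_0=0$) be the random walk in random scenery described in the context, with normalization $a_n$ given there, and let $Z_n^*:=\max_{k=1,\ldots,n}Z_k$. (1) If $\xi_0$ is Gaussian, then for every $m\in\mathbb R$ there exists $c>0$ such that for every $n\ge 2$, $$c^{-1}\frac{a_n}{n\sqrt{\log n}}\le\mathbb P(Z_n^*\le m)\le c\,\frac{a_n}{n}.$$ (2) Assume that $\xi_0$ is bounded from below (i.e. $\mathbb P(\xi_0\ge -b)=1$ for some constant $b$). Then: (2a) for every $m\in\mathbb R$ there exists $c>0$ such that $\mathbb P(Z_n^*\le m)\le c\,a_n/n$ for every $n\ge 1$ (for every $n\ge2$ in the case where $S$ is recurrent and $\alpha=d$); (2b) for every $m\ge 0$ there exists $c>0$ such that $\mathbb P(Z_n^*\le m)\ge c\,a_n/n$ for every $n\ge 1$; (2c) for every $m<0$ such that $\mathbb P(\xi_0\le m)>0$ there exists $c>0$ such that $\mathbb P(Z_n^*\le m)\ge c\,a_n/n$ for every $n\ge 1$.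
   Context: Random walk in random scenery. Let $d\ge1$, let $S=(S_n)_{n\ge 0}$ be a random walk on $\mathbb Z^d$ with $S_0=0$ and i.i.d. steps $X_n=S_n-S_{n-1}$, $n\ge 1$, and let $\xi=(\xi_x)_{x\in\mathbb Z^d}$ be i.i.d. real random variables independent of $S$. $\mathbb P$ is the joint law of $S$ and $\xi$. Standing assumptions: the support of the law of $X_1$ is not contained in a proper subgroup of $\mathbb Z^d$; the closed subgroup of $\mathbb R$ generated by the support of the law of $\xi_0$ is either $\mathbb Z$ or $\mathbb R$; $\xi_0$ is centered and square integrable. If $S$ is recurrent (possible only for $d\in\{1,2\}$), assume moreover that the law of $X_1$ is in the normal domain of attraction of a stable distribution of index $\alpha\in[d,2]$ (if $d=2$: $n^{-1/2}S_n$ converges in distribution to a bidimensional Gaussian random variable; if $d=1<\alpha$: $(n^{-1/\alpha}S_{\lfloor nt\rfloor})_{t\ge0}$ converges in distribution, for the Skorokhod $J_1$ topology, to an $\alpha$-stable Lévy process). The normalization is $$a_n:=\begin{cases}n^{1-\frac1{2\alpha}}&\text{if } S \text{ is recurrent and } d=1,\ \alpha\in(1,2],\\ \sqrt{n\log n}&\text{if } S\text{ is recurrent and }\alpha=d\in\{1,2\},\\ \sqrt n&\text{if } S\text{ is transient.}\end{cases}$$ *)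

theory Defs
  imports "HOL-Probability.Probability"
begin

section \<open>Additive subgroups and supports\<close>

definition add_subgroup :: "'a::ab_group_add set \<Rightarrow> bool" where
  "add_subgroup H \<longleftrightarrow> 0 \<in> H \<and> (\<forall>x\<in>H. \<forall>y\<in>H. x - y \<in> H)"

definition law_support :: "'a::topological_space measure \<Rightarrow> 'a set" where
  "law_support \<mu> = {x. \<forall>U. open U \<and> x \<in> U \<longrightarrow> measure \<mu> U > 0}"

definition generated_closed_subgroup :: "real set \<Rightarrow> real set" where
  "generated_closed_subgroup A = (\<lambda>H. closed H \<and> add_subgroup H) hull A"


section \<open>Convergence in distribution\<close>

text \<open>The random elements \<open>Y n\<close> are defined on \<open>M\<close>, the limit \<open>Y'\<close> on \<open>N\<close>; all of them take
  values in the topological space \<open>T\<close>.\<close>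

definition converges_in_distribution ::
    "'a topology \<Rightarrow> 'w measure \<Rightarrow> (nat \<Rightarrow> 'w \<Rightarrow> 'a) \<Rightarrow> 'v measure \<Rightarrow> ('v \<Rightarrow> 'a) \<Rightarrow> bool" where
  "converges_in_distribution T M Y N Y' \<longleftrightarrow>
     (\<forall>f :: 'a \<Rightarrow> real. continuous_map T euclideanreal f \<and> bounded (f ` topspace T) \<longrightarrow>
        (\<lambda>n. \<integral>\<omega>. f (Y n \<omega>) \<partial>M) \<longlonglongrightarrow> (\<integral>\<omega>. f (Y' \<omega>) \<partial>N))"


section \<open>The Skorokhod space on the half-line and its \<open>J\<^sub>1\<close> topology\<close>

text \<open>Paths are indexed by \<open>[0, \<infinity>)\<close>. They are represented by functions on the whole real line
  whose values at negative times are irrelevant: two paths which agree on \<open>[0, \<infinity>)\<close> are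
  topologically indistinguishable below.\<close>

definition cadlag_paths :: "(real \<Rightarrow> real) set" where
  "cadlag_paths = {x. (\<forall>t\<ge>0. (x \<longlongrightarrow> x t) (at_right t)) \<and>
                      (\<forall>t>0. \<exists>l. (x \<longlongrightarrow> l) (at_left t))}"

text \<open>A strictly increasing bijection of \<open>[0, \<infinity>)\<close> is automatically continuous and fixes \<open>0\<close>.\<close>

definition time_change :: "(real \<Rightarrow> real) \<Rightarrow> bool" where
  "time_change l \<longleftrightarrow> strict_mono_on {0..} l \<and> l ` {0..} = {0..}"

definition J1_tendsto :: "(nat \<Rightarrow> real \<Rightarrow> real) \<Rightarrow> (real \<Rightarrow> real) \<Rightarrow> bool" where
  "J1_tendsto y x \<longleftrightarrow>
     (\<exists>\<Lambda>. (\<forall>n. time_change (\<Lambda> n)) \<and>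
          uniform_limit {0..} \<Lambda> (\<lambda>t. t) sequentially \<and>
          (\<forall>T>0. uniform_limit {0..T} (\<lambda>n t. y n (\<Lambda> n t)) x sequentially))"

text \<open>The \<open>J\<^sub>1\<close> topology is metrizable, hence it is determined by its convergent sequences.\<close>

definition J1_topology :: "(real \<Rightarrow> real) topology" where
  "J1_topology = topology (\<lambda>U. U \<subseteq> cadlag_paths \<and>
     (\<forall>x y. x \<in> U \<and> (\<forall>n. y n \<in> cadlag_paths) \<and> J1_tendsto y x \<longrightarrow>
            (\<forall>\<^sub>F n in sequentially. y n \<in> U)))"

lemma openin_J1_topology:
  "openin J1_topology U \<longleftrightarrow> U \<subseteq> cadlag_paths \<and>
     (\<forall>x y. x \<in> U \<and> (\<forall>n. y n \<in> cadlag_paths) \<and> J1_tendsto y x \<longrightarrow>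
            (\<forall>\<^sub>F n in sequentially. y n \<in> U))"
proof -
  define P where "P = (\<lambda>U. U \<subseteq> cadlag_paths \<and>
     (\<forall>x y. x \<in> U \<and> (\<forall>n. y n \<in> cadlag_paths) \<and> J1_tendsto y x \<longrightarrow>
            (\<forall>\<^sub>F n in sequentially. y n \<in> U)))"
  have "istopology P"
    unfolding istopology_def
  proof (intro conjI allI impI)
    fix S T assume "P S" "P T"
    then show "P (S \<inter> T)"
      unfolding P_def by (auto simp: eventually_conj_iff)
  next
    fix K assume K: "\<forall>S\<in>K. P S"
    show "P (\<Union>K)"
      unfolding P_def
    proof (intro conjI allI impI)
      show "\<Union>K \<subseteq> cadlag_paths"
        using K unfolding P_def by blast
    next
      fix x y
      assume xy: "x \<in> \<Union>K \<and> (\<forall>n. y n \<in> cadlag_paths) \<and> J1_tendsto y x"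
      then obtain S where S: "S \<in> K" "x \<in> S" by blast
      then have "\<forall>\<^sub>F n in sequentially. y n \<in> S"
        using K xy unfolding P_def by blast
      then show "\<forall>\<^sub>F n in sequentially. y n \<in> \<Union>K"
        by (rule eventually_mono) (use S in blast)
    qed
  qed
  then have "openin (topology P) U \<longleftrightarrow> P U"
    by (simp add: topology_inverse')
  then show ?thesis
    unfolding J1_topology_def P_def .
qed

lemma topspace_J1_topology: "topspace J1_topology = cadlag_paths"
proof (rule antisym)
  show "topspace J1_topology \<subseteq> cadlag_paths"
    unfolding topspace_def by (auto simp: openin_J1_topology)
  have "openin J1_topology cadlag_paths"
    by (simp add: openin_J1_topology)
  then show "cadlag_paths \<subseteq> topspace J1_topology"
    by (rule openin_subset)
qed


section \<open>Stable laws and stable processes\<close>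

text \<open>A non-degenerate law such that, for independent copies \<open>X\<^sub>1, X\<^sub>2\<close> of a variable \<open>X\<close> with
  this law, \<open>a X\<^sub>1 + b X\<^sub>2\<close> is distributed as
  \<open>(a\<^sup>\<alpha> + b\<^sup>\<alpha>)\<^sup>1\<^sup>/\<^sup>\<alpha> X + c\<close> for some constant \<open>c\<close>.\<close>

definition stable_law :: "real \<Rightarrow> real measure \<Rightarrow> bool" where
  "stable_law \<alpha> \<mu> \<longleftrightarrow> 0 < \<alpha> \<and> \<alpha> \<le> 2 \<and> real_distribution \<mu> \<and>
     (\<nexists>c. \<mu> = return borel c) \<and>
     (\<forall>a>0. \<forall>b>0. \<exists>c.
        convolution (distr \<mu> borel (\<lambda>x. a * x)) (distr \<mu> borel (\<lambda>x. b * x)) =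
        distr \<mu> borel (\<lambda>x. (a powr \<alpha> + b powr \<alpha>) powr (1 / \<alpha>) * x + c))"

definition levy_process :: "'v measure \<Rightarrow> (real \<Rightarrow> 'v \<Rightarrow> real) \<Rightarrow> bool" where
  "levy_process N L \<longleftrightarrow> prob_space N \<and>
     (\<forall>t\<ge>0. L t \<in> borel_measurable N) \<and>
     (AE \<omega> in N. L 0 \<omega> = 0) \<and>
     (\<forall>\<omega>\<in>space N. (\<lambda>t. L t \<omega>) \<in> cadlag_paths) \<and>
     (\<forall>ts :: nat \<Rightarrow> real. mono ts \<and> 0 \<le> ts 0 \<longrightarrow>
        prob_space.indep_vars N (\<lambda>_. borel) (\<lambda>k \<omega>. L (ts (Suc k)) \<omega> - L (ts k) \<omega>) UNIV) \<and>
     (\<forall>s\<ge>0. \<forall>t\<ge>0. distr N borel (\<lambda>\<omega>. L (s + t) \<omega> - L s \<omega>) = distr N borel (L t))"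

definition stable_levy_process :: "real \<Rightarrow> 'v measure \<Rightarrow> (real \<Rightarrow> 'v \<Rightarrow> real) \<Rightarrow> bool" where
  "stable_levy_process \<alpha> N L \<longleftrightarrow> levy_process N L \<and> stable_law \<alpha> (distr N borel (L 1))"

text \<open>Every non-trivial linear functional has a non-degenerate normal law.\<close>

definition gaussian_law :: "(real ^ 'n) measure \<Rightarrow> bool" where
  "gaussian_law \<nu> \<longleftrightarrow> prob_space \<nu> \<and> sets \<nu> = sets borel \<and>
     (\<forall>u. u \<noteq> 0 \<longrightarrow> (\<exists>m \<sigma>. \<sigma> > 0 \<and> distributed \<nu> lborel (\<lambda>x. u \<bullet> x) (normal_density m \<sigma>)))"


section \<open>Random walk in random scenery\<close>

definition recurrent_walk :: "'w measure \<Rightarrow> (nat \<Rightarrow> 'w \<Rightarrow> int ^ 'n) \<Rightarrow> bool" where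
  "recurrent_walk M S \<longleftrightarrow> (AE \<omega> in M. \<exists>\<^sub>\<infinity>n. S n \<omega> = 0)"

text \<open>The step \<open>X\<^sub>n\<close>, for \<open>n \<ge> 1\<close>.\<close>

definition walk_step :: "(nat \<Rightarrow> 'w \<Rightarrow> int ^ 'n) \<Rightarrow> nat \<Rightarrow> 'w \<Rightarrow> int ^ 'n" where
  "walk_step S n \<omega> = S n \<omega> - S (n - 1) \<omega>"

definition real_vec :: "int ^ 'n \<Rightarrow> real ^ 'n" where
  "real_vec x = (\<chi> i. real_of_int (x $ i))"

text \<open>The dimension is \<open>CARD('n)\<close>. When it is \<open>1\<close> there is exactly one coordinate, so that
  quantifying over coordinates \<open>i\<close> amounts to identifying \<open>\<int>\<^sup>1\<close> with \<open>\<int>\<close>.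
  There is no centering: the convergences are those of \<open>n\<^sup>-\<^sup>1\<^sup>/\<^sup>\<alpha> S\<^sub>n\<close> itself.
  The limiting process may be taken on the space of paths since only its law matters.\<close>

definition normal_stable_attraction ::
    "'w measure \<Rightarrow> (nat \<Rightarrow> 'w \<Rightarrow> int ^ 'n) \<Rightarrow> real \<Rightarrow> bool" where
  "normal_stable_attraction M S \<alpha> \<longleftrightarrow>
     (CARD('n) = 2 \<longrightarrow>
        (\<exists>\<nu> :: (real ^ 'n) measure. gaussian_law \<nu> \<and>
           converges_in_distribution euclidean M
             (\<lambda>n \<omega>. (real n powr (- 1 / 2)) *\<^sub>R real_vec (S n \<omega>)) \<nu> (\<lambda>x. x))) \<and>
     (CARD('n) = 1 \<and> \<alpha> = 1 \<longrightarrow>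
        (\<forall>i. \<exists>\<mu>. stable_law 1 \<mu> \<and>
           weak_conv_m (\<lambda>n. distr M borel (\<lambda>\<omega>. real_of_int (S n \<omega> $ i) / real n)) \<mu>)) \<and>
     (CARD('n) = 1 \<and> 1 < \<alpha> \<longrightarrow>
        (\<forall>i. \<exists>(N :: (real \<Rightarrow> real) measure) L. stable_levy_process \<alpha> N L \<and>
           converges_in_distribution J1_topology M
             (\<lambda>n \<omega> t. real n powr (- 1 / \<alpha>) * real_of_int (S (nat \<lfloor>real n * t\<rfloor>) \<omega> $ i))
             N (\<lambda>\<omega> t. L t \<omega>)))"

locale random_walk_in_random_scenery = prob_space M
  for M :: "'w measure" +
  fixes S :: "nat \<Rightarrow> 'w \<Rightarrow> int ^ 'n" and \<xi> :: "int ^ 'n \<Rightarrow> 'w \<Rightarrow> real" and \<alpha> :: real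
  assumes start: "\<And>\<omega>. \<omega> \<in> space M \<Longrightarrow> S 0 \<omega> = 0"
    and steps_indep: "indep_vars (\<lambda>_. count_space UNIV) (walk_step S) {1..}"
    and steps_ident: "\<And>n. n \<ge> 1 \<Longrightarrow>
      distr M (count_space UNIV) (walk_step S n) = distr M (count_space UNIV) (walk_step S 1)"
    and scenery_indep: "indep_vars (\<lambda>_. borel) \<xi> UNIV"
    and scenery_ident: "\<And>x. distr M borel (\<xi> x) = distr M borel (\<xi> 0)"
    and walk_scenery_indep:
      "indep_set
         (sets (vimage_algebra (space M) (\<lambda>\<omega> n. S n \<omega>) (\<Pi>\<^sub>M n\<in>UNIV. count_space UNIV)))
         (sets (vimage_algebra (space M) (\<lambda>\<omega> x. \<xi> x \<omega>) (\<Pi>\<^sub>M x\<in>UNIV. borel)))"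
    and step_support:
      "\<And>H. add_subgroup H \<Longrightarrow>
         law_support (distr M (count_space UNIV) (walk_step S 1)) \<subseteq> H \<Longrightarrow> H = UNIV"
    and scenery_support:
      "generated_closed_subgroup (law_support (distr M borel (\<xi> 0))) \<in> {\<int>, UNIV}"
    and scenery_integrable: "integrable M (\<xi> 0)"
    and scenery_centered: "expectation (\<xi> 0) = 0"
    and scenery_square_integrable: "integrable M (\<lambda>\<omega>. (\<xi> 0 \<omega>)\<^sup>2)"
    and recurrent_index: "recurrent_walk M S \<Longrightarrow> \<alpha> \<in> {real CARD('n)..2}"
    and recurrent_attraction: "recurrent_walk M S \<Longrightarrow> normal_stable_attraction M S \<alpha>"

text \<open>The parameter \<open>\<alpha>\<close> plays no role when the walk is transient.\<close>

definition rwrs_norm :: "'w measure \<Rightarrow> (nat \<Rightarrow> 'w \<Rightarrow> int ^ 'n) \<Rightarrow> real \<Rightarrow> nat \<Rightarrow> real" where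
  "rwrs_norm M S \<alpha> n =
     (if recurrent_walk M S then
        (if \<alpha> = real CARD('n) then sqrt (real n * ln (real n))
         else real n powr (1 - 1 / (2 * \<alpha>)))
      else sqrt (real n))"

definition rwrs :: "(nat \<Rightarrow> 'w \<Rightarrow> int ^ 'n) \<Rightarrow> (int ^ 'n \<Rightarrow> 'w \<Rightarrow> real) \<Rightarrow> nat \<Rightarrow> 'w \<Rightarrow> real" where
  "rwrs S \<xi> n \<omega> = (\<Sum>i = 1..n. \<xi> (S i \<omega>) \<omega>)"

text \<open>Only meant for \<open>n \<ge> 1\<close>; the value \<open>Z\<^sub>0\<close> is not included in the maximum.\<close>

definition rwrs_max :: "(nat \<Rightarrow> 'w \<Rightarrow> int ^ 'n) \<Rightarrow> (int ^ 'n \<Rightarrow> 'w \<Rightarrow> real) \<Rightarrow> nat \<Rightarrow> 'w \<Rightarrow> real" where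
  "rwrs_max S \<xi> n \<omega> = Max ((\<lambda>k. rwrs S \<xi> k \<omega>) ` {1..n})"

definition persistence_prob ::
    "'w measure \<Rightarrow> (nat \<Rightarrow> 'w \<Rightarrow> int ^ 'n) \<Rightarrow> (int ^ 'n \<Rightarrow> 'w \<Rightarrow> real) \<Rightarrow> real \<Rightarrow> nat \<Rightarrow> real" where
  "persistence_prob M S \<xi> m n = measure M {\<omega> \<in> space M. rwrs_max S \<xi> n \<omega> \<le> m}"

end

theory Submission
  imports Defs
begin

text \<open>Let \<open>M\<^sub>n\<close> be the maximum of \<open>0, Z\<^sub>1, \<dots>, Z\<^sub>n\<close>. The increments of \<open>Z\<close> are stationary and centered, so
  the mean of the negative part of \<open>Z\<^sub>n\<^sub>+\<^sub>1\<^sup>*\<close> equals \<open>E M\<^sub>n\<^sub>+\<^sub>1 - E M\<^sub>n\<close>, which is nonincreasing in \<open>n\<close>. Hence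
  two-sided bounds on \<open>E M\<^sub>n\<close> of order \<open>a\<^sub>n\<close> give two-sided bounds of order \<open>a\<^sub>n / n\<close> on that mean. It
  dominates a multiple of \<open>P (Z\<^sub>n\<^sup>* \<le> m)\<close>, because finitely many low values can be put in front of the
  walk, and it is at most \<open>l P (Z\<^sub>n\<^sup>* \<le> 0)\<close> up to the tail of \<open>\<xi>\<^sub>0\<close> below \<open>- l\<close>; the Gaussian tail needs \<open>l\<close>
  of order \<open>sqrt (log n)\<close>.

  With the Green function \<open>G\<^sub>n\<close> of the walk at the origin, \<open>E M\<^sub>n\<close> is of order \<open>sqrt (n G\<^sub>n)\<close>: from above by the
  maximal inequality of Newman and Wright, from below by a Riesz product of the scenery that turns the
  local times into the inverse square root of the number of visited sites. The order of \<open>G\<^sub>n\<close> comes from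
  the behaviour near the origin of the characteristic function of a step, tested against frequencies
  whose law has a nonnegative characteristic function.\<close>

section \<open>Walks on a countable group\<close>

text \<open>Only convergence in distribution of the rescaled walk is given, and single return
  probabilities cannot be read off from it. Their sums can: the convergence fixes the order of
  \<open>1 - step_char u\<close> near the origin. For the upper bound the frequency law has small
  support, so that no control far from the origin is required, and a nonnegative characteristic
  function, which dominates the indicator of a return. For the lower bound the frequencies are
  uniform, which gives exact inversion; the real part of the resolvent is nonnegative everywhere, so
  its contribution away from the origin may be dropped.

  Monotonicity turns a bound on the sum of the increments of \<open>E M_n\<close> into bounds on
  each of them: from above by averaging over the past, from below by comparing the horizons
  \<open>n\<close> and \<open>(k + 1) n\<close>, with \<open>k\<close> so large that growth of order
  sqrt k beats the ratio of the two constants. The lower bound on \<open>E M_n\<close> needs the sum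
  of \<open>1 / G_j\<close> over \<open>j < n\<close> to be of order \<open>n / G_n\<close>, which
  holds because \<open>G\<close> grows at most like a square root.\<close>

definition walk :: "(nat \<Rightarrow> 'a::ab_group_add) \<Rightarrow> nat \<Rightarrow> 'a" where
  "walk \<omega> n = (\<Sum>i<n. \<omega> i)"

lemma walk_0 [simp]: "walk \<omega> 0 = 0"
  by (simp add: walk_def)

lemma walk_Suc_shift: "walk \<omega> (Suc n) = \<omega> 0 + walk (\<lambda>i. \<omega> (Suc i)) n"
  unfolding walk_def by (subst sum.lessThan_Suc_shift) simp

lemma walk_add_shift: "walk \<omega> (n + k) = walk \<omega> n + walk (\<lambda>i. \<omega> (n + i)) k"
  unfolding walk_def by (induction k) (auto simp: add.assoc)

lemma walk_cong: "(\<And>i. i < n \<Longrightarrow> \<omega> i = \<omega>' i) \<Longrightarrow> walk \<omega> n = walk \<omega>' n"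
  unfolding walk_def by (auto intro: sum.cong)

locale step_law = prob_space \<nu> for \<nu> :: "'a::{ab_group_add,countable} measure" +
  assumes sets_step [simp, measurable_cong]: "sets \<nu> = sets (count_space UNIV)"
begin

abbreviation steps :: "(nat \<Rightarrow> 'a) measure" where
  "steps \<equiv> \<Pi>\<^sub>M i\<in>UNIV. \<nu>"

lemma space_step [simp]: "space \<nu> = UNIV"
  using sets_eq_imp_space_eq[OF sets_step] by simp

lemma space_steps [simp]: "space steps = UNIV"
  by (simp add: space_PiM)

sublocale steps: sequence_space \<nu>
  by unfold_locales

lemma measurable_coord [measurable]: "(\<lambda>\<omega>. \<omega> i) \<in> steps \<rightarrow>\<^sub>M count_space UNIV"
proof -
  have "(\<lambda>\<omega>. \<omega> i) \<in> steps \<rightarrow>\<^sub>M \<nu>" by (rule measurable_component_singleton) simp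
  then show ?thesis by (simp cong: measurable_cong_sets)
qed

lemma measurable_walk [measurable]: "(\<lambda>\<omega>. walk \<omega> n) \<in> steps \<rightarrow>\<^sub>M count_space UNIV"
proof (induction n)
  case (Suc n)
  have "(\<lambda>\<omega>. walk \<omega> n + \<omega> n) \<in> steps \<rightarrow>\<^sub>M count_space UNIV"
    by (rule measurable_compose_countable[where f="\<lambda>x \<omega>. x + \<omega> n" and g="\<lambda>\<omega>. walk \<omega> n", OF _ Suc])
       (rule measurable_compose[OF measurable_coord], simp)
  then show ?case by (simp add: walk_def)
qed simp

lemma sets_walk_eq [measurable]: "{\<omega>. walk \<omega> n = x} \<in> sets steps"
proof -
  have "(\<lambda>\<omega>. walk \<omega> n) -` {x} \<inter> space steps \<in> sets steps"
    by (rule measurable_sets[OF measurable_walk]) simp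
  then show ?thesis by (simp add: vimage_def)
qed

lemma sets_avoid: "finite A \<Longrightarrow> {\<omega>. \<forall>l\<in>A. walk \<omega> l \<noteq> 0} \<in> sets steps"
proof -
  assume A: "finite A"
  have "(\<Union>l\<in>A. {\<omega>. walk \<omega> l = 0}) \<in> sets steps"
    by (intro sets.finite_UN A sets_walk_eq)
  then have "space steps - (\<Union>l\<in>A. {\<omega>. walk \<omega> l = 0}) \<in> sets steps"
    by (rule sets.compl_sets)
  also have "space steps - (\<Union>l\<in>A. {\<omega>. walk \<omega> l = 0}) = {\<omega>. \<forall>l\<in>A. walk \<omega> l \<noteq> 0}"
    by auto
  finally show ?thesis .
qed

lemma measurable_shift [measurable]: "(\<lambda>\<omega> i. \<omega> (n + i)) \<in> steps \<rightarrow>\<^sub>M steps"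
  by (rule measurable_PiM_single') (auto intro!: measurable_component_singleton)

lemma measurable_Suc_shift [measurable]: "(\<lambda>\<omega> i. \<omega> (Suc i)) \<in> steps \<rightarrow>\<^sub>M steps"
  by (rule measurable_PiM_single') (auto intro!: measurable_component_singleton)

lemma distr_Suc_shift: "distr steps steps (\<lambda>\<omega> i. \<omega> (Suc i)) = steps"
  using distr_PiM_reindex[of UNIV "\<lambda>_. \<nu>" Suc UNIV] prob_space_axioms
  by (simp add: restrict_def)

text \<open>Keeping the first \<open>n\<close> steps and replacing the others by an independent
  sequence (\<open>comb_seq\<close>) preserves the law. After this gluing \<open>P\<close> sees only
  the first sequence and \<open>Q\<close> only the second, so the event becomes a rectangle.\<close>

lemma prob_markov:
  assumes [measurable]: "Measurable.pred steps P" "Measurable.pred steps Q"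
    and past: "\<And>\<omega> \<omega>'. (\<And>i. i < n \<Longrightarrow> \<omega> i = \<omega>' i) \<Longrightarrow> P \<omega> = P \<omega>'"
  shows "measure steps {\<omega>. P \<omega> \<and> Q (\<lambda>i. \<omega> (n + i))} = measure steps {\<omega>. P \<omega>} * measure steps {\<omega>. Q \<omega>}"
proof -
  interpret pair_prob_space steps steps ..
  have m: "{\<omega> \<in> space steps. P \<omega> \<and> Q (\<lambda>i. \<omega> (n + i))} \<in> sets steps" by measurable
  have "measure steps {\<omega>. P \<omega> \<and> Q (\<lambda>i. \<omega> (n + i))} =
      measure (distr (steps \<Otimes>\<^sub>M steps) steps (\<lambda>(\<omega>, \<omega>'). comb_seq n \<omega> \<omega>'))
        {\<omega>. P \<omega> \<and> Q (\<lambda>i. \<omega> (n + i))}"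
    by (simp only: steps.PiM_comb_seq)
  also have "\<dots> = measure (steps \<Otimes>\<^sub>M steps) ({\<omega>. P \<omega>} \<times> {\<omega>. Q \<omega>})"
  proof (subst measure_distr)
    show "{\<omega>. P \<omega> \<and> Q (\<lambda>i. \<omega> (n + i))} \<in> sets steps" using m by simp
    have P: "P (comb_seq n \<omega> \<omega>') = P \<omega>" for \<omega> \<omega>'
      by (rule past) (simp add: comb_seq_def)
    have Q: "(\<lambda>i. comb_seq n \<omega> \<omega>' (n + i)) = \<omega>'" for \<omega> \<omega>' :: "nat \<Rightarrow> 'a"
      by (simp add: comb_seq_def)
    have "(\<lambda>(\<omega>, \<omega>'). comb_seq n \<omega> \<omega>') -` {\<omega>. P \<omega> \<and> Q (\<lambda>i. \<omega> (n + i))} =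
        {\<omega>. P \<omega>} \<times> {\<omega>. Q \<omega>}"
      by (auto simp: P Q)
    then show "measure (steps \<Otimes>\<^sub>M steps) ((\<lambda>(\<omega>, \<omega>'). comb_seq n \<omega> \<omega>') -`
        {\<omega>. P \<omega> \<and> Q (\<lambda>i. \<omega> (n + i))} \<inter> space (steps \<Otimes>\<^sub>M steps)) =
        measure (steps \<Otimes>\<^sub>M steps) ({\<omega>. P \<omega>} \<times> {\<omega>. Q \<omega>})"
      by (simp add: space_pair_measure)
  qed (rule measurable_comb_seq)
  also have "\<dots> = measure steps {\<omega>. P \<omega>} * measure steps {\<omega>. Q \<omega>}"
  proof -
    have "{\<omega> \<in> space steps. P \<omega>} \<in> sets steps" "{\<omega> \<in> space steps. Q \<omega>} \<in> sets steps"
      by measurable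
    then show ?thesis
      by (simp add: measure_def steps.P.emeasure_pair_measure_Times enn2real_mult)
  qed
  finally show ?thesis .
qed

section \<open>Return probabilities, Green function and range of the walk\<close>

definition hit :: "nat \<Rightarrow> 'a \<Rightarrow> real" where
  "hit n x = measure steps {\<omega>. walk \<omega> n = x}"

definition green :: "nat \<Rightarrow> real" where
  "green n = (\<Sum>k\<le>n. hit k 0)"

definition avoid :: "nat \<Rightarrow> real" where
  "avoid n = measure steps {\<omega>. \<forall>l\<in>{1..n}. walk \<omega> l \<noteq> 0}"

lemma hit_nonneg [simp]: "0 \<le> hit n x"
  by (simp add: hit_def)

lemma hit_le_1 [simp]: "hit n x \<le> 1"
  by (simp add: hit_def)

lemma hit_0: "hit 0 x = (if x = 0 then 1 else 0)"
  using steps.P.prob_space by (auto simp: hit_def)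

lemma integrable_bounded_step:
  fixes f :: "'a \<Rightarrow> 'b::{banach, second_countable_topology}"
  assumes "\<And>x. norm (f x) \<le> B"
  shows "integrable \<nu> f"
proof (rule integrable_const_bound[where B=B])
  show "f \<in> borel_measurable \<nu>" by (simp cong: measurable_cong_sets)
qed (simp add: assms)

text \<open>The first step is split off, not the last, so the recursion averages over starting
  points; this is the form that the maximum principle below iterates.\<close>

lemma hit_Suc: "hit (Suc n) x = (\<integral>y. hit n (x - y) \<partial>\<nu>)"
proof -
  interpret pair_prob_space \<nu> steps ..
  let ?A = "{(s, \<omega>). s + walk \<omega> n = x}"
  have "hit (Suc n) x = measure (distr (\<nu> \<Otimes>\<^sub>M steps) steps (\<lambda>(s, \<omega>). case_nat s \<omega>)) {\<omega>. walk \<omega> (Suc n) = x}"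
    by (simp only: steps.PiM_iter hit_def)
  also have "\<dots> = measure (\<nu> \<Otimes>\<^sub>M steps) ?A"
    by (subst measure_distr) (auto simp: sets_walk_eq space_pair_measure walk_Suc_shift[symmetric], auto simp: walk_Suc_shift intro!: arg_cong[where f="measure _"])
  also have "\<dots> = (\<integral>y. measure steps (Pair y -` ?A) \<partial>\<nu>)"
  proof -
    have "(\<lambda>z. fst z + walk (snd z) n) \<in> \<nu> \<Otimes>\<^sub>M steps \<rightarrow>\<^sub>M count_space UNIV"
      apply (rule measurable_compose_countable[where f="\<lambda>x z. x + walk (snd z) n" and g="fst"])
       apply (rule measurable_compose[OF measurable_compose[OF measurable_snd measurable_walk]], simp)
      apply (simp cong: measurable_cong_sets)
      done
    then have "(\<lambda>z. fst z + walk (snd z) n) -` {x} \<inter> space (\<nu> \<Otimes>\<^sub>M steps) \<in> sets (\<nu> \<Otimes>\<^sub>M steps)"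
      by (rule measurable_sets) simp
    also have "(\<lambda>z. fst z + walk (snd z) n) -` {x} \<inter> space (\<nu> \<Otimes>\<^sub>M steps) = ?A"
      by (auto simp: space_pair_measure)
    finally have A: "?A \<in> sets (\<nu> \<Otimes>\<^sub>M steps)" .
    have "emeasure (\<nu> \<Otimes>\<^sub>M steps) ?A = (\<integral>\<^sup>+y. ennreal (measure steps (Pair y -` ?A)) \<partial>\<nu>)"
      using A by (simp add: steps.P.emeasure_pair_measure_alt steps.P.emeasure_eq_measure)
    also have "\<dots> = ennreal (\<integral>y. measure steps (Pair y -` ?A) \<partial>\<nu>)"
      by (intro nn_integral_eq_integral integrable_bounded_step[where B=1]) auto
    finally show ?thesis by (simp add: measure_def integral_nonneg)
  qed
  also have "\<dots> = (\<integral>y. hit n (x - y) \<partial>\<nu>)"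
    by (auto simp: hit_def algebra_simps intro!: Bochner_Integration.integral_cong arg_cong[where f="measure _"])
  finally show ?thesis .
qed

lemma integrable_hit: "integrable \<nu> (\<lambda>y. c * hit k (x - y))"
  by (rule integrable_bounded_step[where B="\<bar>c\<bar>"]) (simp add: abs_mult mult_left_le)

lemma integral_step_le:
  fixes f :: "'a \<Rightarrow> real"
  assumes "\<And>x. f x \<le> B" "\<And>x. 0 \<le> f x"
  shows "(\<integral>x. f x \<partial>\<nu>) \<le> B"
proof -
  have "(\<integral>x. f x \<partial>\<nu>) \<le> (\<integral>x. B \<partial>\<nu>)"
    by (intro integral_mono integrable_bounded_step[where B="\<bar>B\<bar>"]) (use assms in \<open>auto intro: order_trans[OF _ abs_ge_self]\<close>)
  then show ?thesis using prob_space by simp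
qed

text \<open>A maximum principle for the discounted Green function, by induction on the horizon.\<close>

lemma green_discount_le:
  assumes r: "0 \<le> r" "r \<le> 1"
  shows "(\<Sum>k<N. r ^ k * hit k x) \<le> (\<Sum>k<N. r ^ k * hit k 0)"
proof (induction N arbitrary: x)
  case (Suc N)
  have mono: "(\<Sum>k<N. r ^ k * hit k 0) \<le> (\<Sum>k<Suc N. r ^ k * hit k 0)"
    using r by simp
  show ?case
  proof (cases "x = 0")
    case False
    have nn: "0 \<le> (\<Sum>k<N. r ^ k * hit k y)" for y
      using r by (intro sum_nonneg) auto
    have "(\<Sum>k<Suc N. r ^ k * hit k x) = (\<Sum>k<N. r ^ Suc k * hit (Suc k) x)"
      by (subst sum.lessThan_Suc_shift) (simp add: hit_0 False)
    also have "\<dots> = (\<Sum>k<N. \<integral>y. r ^ Suc k * hit k (x - y) \<partial>\<nu>)"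
      by (simp only: hit_Suc integral_mult_right_zero)
    also have "\<dots> = (\<integral>y. (\<Sum>k<N. r ^ Suc k * hit k (x - y)) \<partial>\<nu>)"
      by (rule Bochner_Integration.integral_sum[symmetric]) (rule integrable_hit)
    also have "\<dots> = (\<integral>y. r * (\<Sum>k<N. r ^ k * hit k (x - y)) \<partial>\<nu>)"
      by (simp only: sum_distrib_left mult.assoc power_Suc)
    also have "\<dots> \<le> (\<Sum>k<N. r ^ k * hit k 0)"
    proof (rule integral_step_le)
      fix y
      have "r * (\<Sum>k<N. r ^ k * hit k (x - y)) \<le> 1 * (\<Sum>k<N. r ^ k * hit k (x - y))"
        using r nn by (intro mult_right_mono) auto
      also have "\<dots> \<le> (\<Sum>k<N. r ^ k * hit k 0)" using Suc by simp
      finally show "r * (\<Sum>k<N. r ^ k * hit k (x - y)) \<le> (\<Sum>k<N. r ^ k * hit k 0)" .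
      show "0 \<le> r * (\<Sum>k<N. r ^ k * hit k (x - y))" using nn r by simp
    qed
    finally show ?thesis using mono by simp
  qed simp
qed simp

text \<open>Delaying the sum by \<open>n\<close> steps only averages it over starting points, and
  the maximum principle is uniform in the starting point.\<close>

lemma green_discount_shift_le:
  assumes r: "0 \<le> r" "r \<le> 1"
  shows "(\<Sum>k<N. r ^ k * hit (n + k) x) \<le> (\<Sum>k<N. r ^ k * hit k 0)"
proof (induction n arbitrary: x)
  case 0
  then show ?case using green_discount_le[OF r] by simp
next
  case (Suc n)
  have "(\<Sum>k<N. r ^ k * hit (Suc n + k) x) = (\<Sum>k<N. \<integral>y. r ^ k * hit (n + k) (x - y) \<partial>\<nu>)"
    by (simp only: hit_Suc integral_mult_right_zero add_Suc)
  also have "\<dots> = (\<integral>y. (\<Sum>k<N. r ^ k * hit (n + k) (x - y)) \<partial>\<nu>)"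
    by (rule Bochner_Integration.integral_sum[symmetric]) (rule integrable_hit)
  also have "\<dots> \<le> (\<Sum>k<N. r ^ k * hit k 0)"
    by (rule integral_step_le) (use Suc r in \<open>auto intro!: sum_nonneg\<close>)
  finally show ?case .
qed

lemma green_ge_1: "1 \<le> green n"
proof -
  have "hit 0 0 \<le> green n" unfolding green_def
    by (rule member_le_sum) auto
  then show ?thesis by (simp add: hit_0)
qed

lemma green_mono: "m \<le> n \<Longrightarrow> green m \<le> green n"
  unfolding green_def by (intro sum_mono2) auto

text \<open>The discounted sum up to \<open>n + N\<close> splits at \<open>n\<close>: the head is at
  most \<open>green n\<close>, the tail is \<open>r ^ n\<close> times a delayed sum and so at most
  \<open>r ^ n\<close> times the sum up to \<open>N\<close>. Absorbing the tail bounds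
  \<open>green n\<close> from below by discounted sums without a Tauberian theorem.\<close>

lemma green_discount_le_green:
  assumes r: "0 \<le> r" "r < 1" and n: "n > 0"
  shows "(1 - r ^ n) * (\<Sum>k<N. r ^ k * hit k 0) \<le> green n"
proof -
  define A where "A = (\<lambda>N. \<Sum>k<N. r ^ k * hit k 0)"
  have mono: "A N \<le> A (n + N)"
    unfolding A_def using r by (intro sum_mono2) auto
  have "A (n + N) = (\<Sum>k<n. r ^ k * hit k 0) + (\<Sum>k<N. r ^ (n + k) * hit (n + k) 0)"
    unfolding A_def
    by (induction N) (auto simp: add.assoc)
  also have "(\<Sum>k<N. r ^ (n + k) * hit (n + k) 0) = r ^ n * (\<Sum>k<N. r ^ k * hit (n + k) 0)"
    by (simp add: sum_distrib_left power_add mult.assoc)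
  also have "\<dots> \<le> r ^ n * A N"
    unfolding A_def using r green_discount_shift_le[where r=r and N=N and n=n and x=0] by (intro mult_left_mono) auto
  also have "(\<Sum>k<n. r ^ k * hit k 0) \<le> (\<Sum>k<n. hit k 0)"
    using r by (intro sum_mono mult_left_le_one_le) (auto simp: power_le_one)
  also have "\<dots> \<le> green n"
    unfolding green_def by (intro sum_mono2) auto
  finally have "A (n + N) \<le> green n + r ^ n * A N" by simp
  then have "A N - r ^ n * A N \<le> green n" using mono by simp
  then show ?thesis unfolding A_def by (simp add: algebra_simps)
qed

text \<open>Decomposition according to the last visit to the origin up to time \<open>n\<close>,
  which exists because the walk starts there.\<close>

lemma sum_hit_avoid: "(\<Sum>k\<le>n. hit k 0 * avoid (n - k)) = 1"
proof -
  let ?B = "\<lambda>k. {\<omega>::nat \<Rightarrow> 'a. walk \<omega> k = 0 \<and> (\<forall>l\<in>{Suc k..n}. walk \<omega> l \<noteq> 0)}"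
  have mB: "?B k \<in> sets steps" for k
    using sets.Int[OF sets_walk_eq[of k 0] sets_avoid[of "{Suc k..n}"]] by (simp add: Int_def)
  have "measure steps (?B k) = hit k 0 * avoid (n - k)" if "k \<le> n" for k
  proof -
    have "(\<forall>l\<in>{Suc k..n}. walk \<omega> l \<noteq> 0) = (\<forall>l\<in>{1..n-k}. walk (\<lambda>i. \<omega> (k + i)) l \<noteq> 0)"
      if "walk \<omega> k = 0" for \<omega> :: "nat \<Rightarrow> 'a"
    proof -
      have "{Suc k..n} = (+) k ` {1..n-k}"
        using \<open>k \<le> n\<close> by (simp add: image_add_atLeastAtMost)
      then have "(\<forall>l\<in>{Suc k..n}. walk \<omega> l \<noteq> 0) = (\<forall>l\<in>{1..n-k}. walk \<omega> (k + l) \<noteq> 0)"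
        by (simp only: Set.ball_simps(9))
      then show ?thesis using that by (simp add: walk_add_shift)
    qed
    then have "?B k = {\<omega>. walk \<omega> k = 0 \<and> (\<forall>l\<in>{1..n-k}. walk (\<lambda>i. \<omega> (k + i)) l \<noteq> 0)}"
      by blast
    also have "measure steps \<dots> = hit k 0 * avoid (n - k)"
      unfolding hit_def avoid_def
      using sets_walk_eq[of k 0] sets_avoid[of "{1..n - k}"]
      by (intro prob_markov) (auto simp: pred_def cong: walk_cong)
    finally show ?thesis .
  qed
  then have "(\<Sum>k\<le>n. hit k 0 * avoid (n - k)) = (\<Sum>k\<le>n. measure steps (?B k))"
    by simp
  also have "\<dots> = measure steps (\<Union>k\<in>{..n}. ?B k)"
  proof (rule steps.finite_measure_finite_Union[symmetric])
    show "disjoint_family_on ?B {..n}"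
    proof (unfold disjoint_family_on_def, intro ballI impI)
      fix k k' assume "k \<in> {..n}" "k' \<in> {..n}" "k \<noteq> k'"
      then show "?B k \<inter> ?B k' = {}"
        by (cases "k < k'") (auto dest: bspec[of _ _ k] bspec[of _ _ k'])
    qed
  qed (use mB in auto)
  also have "(\<Union>k\<in>{..n}. ?B k) = UNIV"
  proof -
    have "\<exists>k\<le>n. \<omega> \<in> ?B k" for \<omega>
    proof -
      define k where "k = Max {k. k \<le> n \<and> walk \<omega> k = 0}"
      have fin: "finite {k. k \<le> n \<and> walk \<omega> k = 0}" by simp
      have ne: "0 \<in> {k. k \<le> n \<and> walk \<omega> k = 0}" by simp
      have "k \<in> {k. k \<le> n \<and> walk \<omega> k = 0}" unfolding k_def
        using Max_in[OF fin] ne by blast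
      moreover have "walk \<omega> l \<noteq> 0" if "l \<in> {Suc k..n}" for l
      proof
        assume "walk \<omega> l = 0"
        then have "l \<in> {k. k \<le> n \<and> walk \<omega> k = 0}" using that by simp
        from Max_ge[OF fin this] that show False by (simp add: k_def)
      qed
      ultimately show ?thesis by auto
    qed
    then show ?thesis by auto
  qed
  also have "measure steps UNIV = 1" using steps.P.prob_space by simp
  finally show ?thesis .
qed

lemma avoid_antimono: "m \<le> n \<Longrightarrow> avoid n \<le> avoid m"
proof -
  assume "m \<le> n"
  then show ?thesis unfolding avoid_def using sets_avoid[of "{1..m}"]
    by (intro steps.finite_measure_mono) auto
qed

text \<open>In the last-visit decomposition every factor \<open>avoid (n - k)\<close> is at least
  \<open>avoid n\<close>.\<close>

lemma avoid_green_le: "avoid n * green n \<le> 1"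
proof -
  have "avoid n * green n = (\<Sum>k\<le>n. hit k 0 * avoid n)"
    unfolding green_def by (simp add: sum_distrib_left mult.commute)
  also have "\<dots> \<le> (\<Sum>k\<le>n. hit k 0 * avoid (n - k))"
    by (intro sum_mono mult_left_mono avoid_antimono) auto
  finally show ?thesis by (simp add: sum_hit_avoid)
qed

text \<open>Each visited site is counted at its last visit up to time \<open>n\<close>; after a
  visit at time \<open>k\<close> the walk must stay away from its current position for
  \<open>n - k\<close> further steps.\<close>

lemma expectation_range_le:
  "(\<integral>\<omega>. real (card (walk \<omega> ` {1..n})) \<partial>steps) \<le> (\<Sum>j<n. avoid j)"
proof -
  let ?L = "\<lambda>k. {\<omega>::nat \<Rightarrow> 'a. \<forall>l\<in>{1..n-k}. walk (\<lambda>i. \<omega> (k + i)) l \<noteq> 0}"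
  have meas: "?L k \<in> sets steps" for k
    using measurable_sets[OF measurable_shift[of k] sets_avoid[of "{1..n-k}"]] by (simp add: vimage_def)
  have prob: "measure steps (?L k) = avoid (n - k)" for k
  proof -
    have "measure steps {\<omega>. True \<and> (\<forall>l\<in>{1..n-k}. walk (\<lambda>i. \<omega> (k + i)) l \<noteq> 0)} =
        measure steps {\<omega>. True} * avoid (n - k)"
      unfolding avoid_def using sets_avoid[of "{1..n - k}"]
      by (intro prob_markov) (auto simp: pred_def sets.top[of steps, simplified])
    then show ?thesis using steps.P.prob_space by simp
  qed
  have le: "real (card (walk \<omega> ` {1..n})) \<le> (\<Sum>k=1..n. indicator (?L k) \<omega>)" for \<omega>
  proof -
    let ?K = "{k\<in>{1..n}. \<omega> \<in> ?L k}"
    have "walk \<omega> ` {1..n} \<subseteq> walk \<omega> ` ?K"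
    proof
      fix x assume "x \<in> walk \<omega> ` {1..n}"
      then have ne: "{k\<in>{1..n}. walk \<omega> k = x} \<noteq> {}" by auto
      have fin: "finite {k\<in>{1..n}. walk \<omega> k = x}" by simp
      define k where "k = Max {k\<in>{1..n}. walk \<omega> k = x}"
      have k: "k \<in> {1..n}" "walk \<omega> k = x" using Max_in[OF fin ne] by (auto simp: k_def)
      have "walk (\<lambda>i. \<omega> (k + i)) l \<noteq> 0" if "l \<in> {1..n-k}" for l
      proof
        assume "walk (\<lambda>i. \<omega> (k + i)) l = 0"
        then have "k + l \<in> {k\<in>{1..n}. walk \<omega> k = x}"
          using k that by (auto simp: walk_add_shift)
        from Max_ge[OF fin this] that show False by (simp add: k_def)
      qed
      then show "x \<in> walk \<omega> ` ?K" using k by auto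
    qed
    then have "card (walk \<omega> ` {1..n}) \<le> card ?K"
      by (intro order_trans[OF card_mono card_image_le]) simp_all
    also have "?K = {1..n} \<inter> {k. \<omega> \<in> ?L k}" by auto
    also have "real (card \<dots>) = (\<Sum>k=1..n. indicator (?L k) \<omega>)"
      by (simp only: sum.If_cases finite_atLeastAtMost indicator_def of_bool_def) simp
    finally show ?thesis by simp
  qed
  have "(\<integral>\<omega>. real (card (walk \<omega> ` {1..n})) \<partial>steps) \<le> (\<integral>\<omega>. (\<Sum>k=1..n. indicator (?L k) \<omega>) \<partial>steps)"
    using le meas
    by (intro integral_mono' Bochner_Integration.integrable_sum integrable_real_indicator)
      (auto simp: steps.P.emeasure_eq_measure intro!: sum_nonneg)
  also have "\<dots> = (\<Sum>k=1..n. measure steps (?L k))"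
    using meas by (subst Bochner_Integration.integral_sum) (auto simp: steps.P.emeasure_eq_measure)
  also have "\<dots> = (\<Sum>k=1..n. avoid (n - k))" by (simp only: prob)
  also have "\<dots> = (\<Sum>j<n. avoid j)"
    by (rule sum.reindex_bij_witness[where i="\<lambda>j. n - j" and j="\<lambda>k. n - k"]) auto
  finally show ?thesis .
qed

text \<open>A last visit at time \<open>k\<close> forces the walk never to return afterwards, so its
  probability is at most \<open>avoid n\<close>, hence at most \<open>1 / green n\<close>, for every
  \<open>n\<close>. With an unbounded Green function no time can be the last visit.\<close>

lemma infinitely_many_returns:
  assumes unbounded: "\<And>B. \<exists>n. green n > B"
  shows "AE \<omega> in steps. \<exists>\<^sub>\<infinity>n. walk \<omega> n = 0"
proof -
  let ?E = "\<lambda>k. {\<omega>::nat \<Rightarrow> 'a. walk \<omega> k = 0 \<and> (\<forall>l\<in>{Suc k..}. walk \<omega> l \<noteq> 0)}"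
  have meas: "?E k \<in> sets steps" for k
  proof -
    have "?E k = {\<omega>. walk \<omega> k = 0} \<inter> (\<Inter>n. {\<omega>. \<forall>l\<in>{Suc k..n}. walk \<omega> l \<noteq> 0})"
      by (auto, metis atLeastAtMost_iff order_refl)
    also have "\<dots> \<in> sets steps"
      by (intro sets.Int sets_walk_eq sets.countable_INT) (auto intro!: sets_avoid)
    finally show ?thesis .
  qed
  have le: "measure steps (?E k) \<le> avoid n" for k n
  proof -
    have "measure steps (?E k) \<le> measure steps {\<omega>. True \<and> (\<forall>l\<in>{1..n}. walk (\<lambda>i. \<omega> (k + i)) l \<noteq> 0)}"
    proof (rule steps.P.finite_measure_mono)
      show "?E k \<subseteq> {\<omega>. True \<and> (\<forall>l\<in>{1..n}. walk (\<lambda>i. \<omega> (k + i)) l \<noteq> 0)}"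
      proof safe
        fix \<omega> l assume *: "walk \<omega> k = 0" "\<forall>l\<in>{Suc k..}. walk \<omega> l \<noteq> 0" "l \<in> {1..n}"
          "walk (\<lambda>i. \<omega> (k + i)) l = 0"
        then have "walk \<omega> (k + l) = 0" by (simp add: walk_add_shift)
        then show False using *(2,3) by auto
      qed
      show "{\<omega>. True \<and> (\<forall>l\<in>{1..n}. walk (\<lambda>i. \<omega> (k + i)) l \<noteq> 0)} \<in> sets steps"
        using measurable_sets[OF measurable_shift[of k] sets_avoid[of "{1..n}"]] by (simp add: vimage_def)
    qed
    also have "\<dots> = measure steps {\<omega>. True} * avoid n"
      unfolding avoid_def using sets_avoid[of "{1..n}"]
      by (intro prob_markov) (auto simp: pred_def sets.top[of steps, simplified])
    finally show ?thesis using steps.P.prob_space by simp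
  qed
  have "measure steps (?E k) = 0" for k
  proof (rule ccontr)
    assume "measure steps (?E k) \<noteq> 0"
    then have pos: "measure steps (?E k) > 0" by (simp add: zero_less_measure_iff)
    obtain n where n: "green n > 1 / measure steps (?E k)" using unbounded by blast
    have "measure steps (?E k) * green n \<le> avoid n * green n"
      using le green_ge_1[of n] by (intro mult_right_mono) auto
    also have "\<dots> \<le> 1" by (rule avoid_green_le)
    finally show False using n pos by (simp add: field_simps)
  qed
  then have "AE \<omega> in steps. \<omega> \<notin> ?E k" for k
    using meas[of k] by (intro AE_not_in) (auto simp: null_sets_def steps.P.emeasure_eq_measure)
  then have "AE \<omega> in steps. \<forall>k. \<omega> \<notin> ?E k"
    by (simp only: AE_all_countable) simp
  then show ?thesis
  proof eventually_elim
    case (elim \<omega>)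
    show ?case
    proof (rule ccontr)
      assume "\<not> (\<exists>\<^sub>\<infinity>n. walk \<omega> n = 0)"
      then have fin: "finite {n. walk \<omega> n = 0}" by (simp add: INFM_iff_infinite)
      have "0 \<in> {n. walk \<omega> n = 0}" by simp
      then have "Max {n. walk \<omega> n = 0} \<in> {n. walk \<omega> n = 0}" using Max_in[OF fin] by blast
      moreover have "walk \<omega> l \<noteq> 0" if "l \<ge> Suc (Max {n. walk \<omega> n = 0})" for l
      proof
        assume "walk \<omega> l = 0"
        then have "l \<in> {n. walk \<omega> n = 0}" by simp
        from Max_ge[OF fin this] that show False by simp
      qed
      ultimately show False using elim by auto
    qed
  qed
qed

end

section \<open>Sceneries along a fixed path\<close>

lemma integrable_mult_of_square:
  fixes f g :: "'b \<Rightarrow> real"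
  assumes [measurable]: "f \<in> borel_measurable M" "g \<in> borel_measurable M"
    and f: "integrable M (\<lambda>x. (f x)\<^sup>2)" and g: "integrable M (\<lambda>x. (g x)\<^sup>2)"
  shows "integrable M (\<lambda>x. f x * g x)"
proof (rule Bochner_Integration.integrable_bound)
  show "integrable M (\<lambda>x. (f x)\<^sup>2 + (g x)\<^sup>2)" using f g by simp
  have "\<bar>a * b\<bar> \<le> a\<^sup>2 + b\<^sup>2" for a b :: real
  proof -
    have "2 * (\<bar>a\<bar> * \<bar>b\<bar>) \<le> a\<^sup>2 + b\<^sup>2" using sum_squares_bound[of "\<bar>a\<bar>" "\<bar>b\<bar>"] by simp
    moreover have "0 \<le> \<bar>a\<bar> * \<bar>b\<bar>" by simp
    ultimately show ?thesis unfolding abs_mult by linarith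
  qed
  then show "AE x in M. norm (f x * g x) \<le> norm ((f x)\<^sup>2 + (g x)\<^sup>2)"
    by simp
qed simp

lemma integrable_add_square:
  fixes f g :: "'b \<Rightarrow> real"
  assumes [measurable]: "f \<in> borel_measurable M" "g \<in> borel_measurable M"
    and f: "integrable M (\<lambda>x. (f x)\<^sup>2)" and g: "integrable M (\<lambda>x. (g x)\<^sup>2)"
  shows "integrable M (\<lambda>x. (f x + g x)\<^sup>2)"
  using integrable_mult_of_square[OF assms] f g by (simp add: power2_sum mult.assoc)

text \<open>The maximum of the partial sums in the order of the list, the empty sum included. The
  recursion peels off the first entry, which matches the shift of the walk by one step.\<close>

primrec list_max :: "('a \<Rightarrow> real) \<Rightarrow> 'a list \<Rightarrow> real" where
  "list_max \<xi> [] = 0"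
| "list_max \<xi> (x # xs) = max 0 (\<xi> x + list_max \<xi> xs)"

primrec list_total :: "('a \<Rightarrow> real) \<Rightarrow> 'a list \<Rightarrow> real" where
  "list_total \<xi> [] = 0"
| "list_total \<xi> (x # xs) = \<xi> x + list_total \<xi> xs"

text \<open>The number of ordered pairs of positions with equal entries, that is, the sum of the
  squared local times.\<close>

primrec coincidences :: "'a list \<Rightarrow> nat" where
  "coincidences [] = 0"
| "coincidences (x # xs) = 1 + 2 * count_list xs x + coincidences xs"

lemma list_max_nonneg [simp]: "0 \<le> list_max \<xi> xs"
  by (induction xs) auto

lemma list_total_le_max: "list_total \<xi> xs \<le> list_max \<xi> xs"
  by (induction xs) auto

lemma list_max_mono:
  assumes "\<And>x. \<xi> x \<le> \<xi>' x"
  shows "list_max \<xi> xs \<le> list_max \<xi>' xs"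
proof (induction xs)
  case (Cons x xs)
  with assms[of x] show ?case by (auto simp: max_def)
qed simp

text \<open>The total minus a partial sum is a sum over a tail of the list. Hence the difference is
  the minimum of all tail sums, and each of these is monotone in the scenery.\<close>

lemma list_total_minus_max_mono:
  assumes "\<And>x. \<xi> x \<le> \<xi>' x"
  shows "list_total \<xi> xs - list_max \<xi> xs \<le> list_total \<xi>' xs - list_max \<xi>' xs"
proof (induction xs)
  case (Cons x xs)
  have "list_total \<xi> xs \<le> list_total \<xi>' xs"
    using assms by (induction xs) (auto intro: add_mono)
  with Cons assms[of x] show ?case by (auto simp: max_def)
qed simp

lemma list_total_eq_sum: "list_total \<xi> xs = (\<Sum>x\<in>set xs. real (count_list xs x) * \<xi> x)"
proof (induction xs)
  case (Cons a xs)
  have "(\<Sum>x\<in>set (a # xs). real (count_list (a # xs) x) * \<xi> x) =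
      (\<Sum>x\<in>set (a # xs). real (count_list xs x) * \<xi> x) + (\<Sum>x\<in>set (a # xs). if x = a then \<xi> a else 0)"
    by (subst sum.distrib[symmetric]) (auto intro!: sum.cong simp: algebra_simps)
  also have "(\<Sum>x\<in>set (a # xs). if x = a then \<xi> a else 0) = \<xi> a"
    by (subst sum.delta) auto
  also have "(\<Sum>x\<in>set (a # xs). real (count_list xs x) * \<xi> x) = (\<Sum>x\<in>set xs. real (count_list xs x) * \<xi> x)"
    by (rule sum.mono_neutral_right) (auto simp: count_list_0_iff)
  finally show ?case using Cons by simp
qed simp

section \<open>Integration over an independent scenery\<close>

locale scenery_law = prob_space \<mu> for \<mu> :: "real measure" +
  assumes sets_scenery_law [simp, measurable_cong]: "sets \<mu> = sets borel"
    and law_integrable: "integrable \<mu> (\<lambda>y. y)"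
    and law_centered: "(\<integral>y. y \<partial>\<mu>) = 0"
    and law_square_integrable: "integrable \<mu> (\<lambda>y. y\<^sup>2)"
begin

abbreviation sceneries :: "('a \<Rightarrow> real) measure" where
  "sceneries \<equiv> \<Pi>\<^sub>M x\<in>UNIV. \<mu>"

lemma space_law [simp]: "space \<mu> = UNIV"
  using sets_eq_imp_space_eq[OF sets_scenery_law] by simp

lemma space_sceneries [simp]: "space sceneries = UNIV"
  by (simp add: space_PiM)

lemma prob_space_sceneries: "prob_space sceneries"
  by (rule prob_space_PiM) (rule prob_space_axioms)

lemma measurable_site [measurable]: "(\<lambda>\<xi>. \<xi> x) \<in> borel_measurable sceneries"
proof -
  have "(\<lambda>\<xi>. \<xi> x) \<in> sceneries \<rightarrow>\<^sub>M \<mu>" by (rule measurable_component_singleton) simp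
  then show ?thesis by (simp cong: measurable_cong_sets)
qed

lemma distr_site: "distr sceneries \<mu> (\<lambda>\<xi>. \<xi> x) = \<mu>"
  by (rule distr_PiM_component) (use prob_space_axioms in auto)

lemma measurable_update [measurable]: "(\<lambda>(y, \<xi>). \<xi>(x := y)) \<in> \<mu> \<Otimes>\<^sub>M sceneries \<rightarrow>\<^sub>M sceneries"
  by (rule measurable_PiM_single') (auto simp: split_beta' space_PiM)

text \<open>A product law splits into its value at \<open>x\<close> and the rest, and the rest is
  the image of a full scenery under restriction. So one site can be resampled independently, which
  is how single sites are integrated out below.\<close>

lemma distr_update: "distr (\<mu> \<Otimes>\<^sub>M sceneries) sceneries (\<lambda>(y, \<xi>). \<xi>(x := y)) = sceneries"
proof -
  let ?I = "UNIV - {x}"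
  let ?R = "\<lambda>\<xi>. \<lambda>z\<in>?I. \<xi> z"
  have R: "distr sceneries (\<Pi>\<^sub>M z\<in>?I. \<mu>) ?R = (\<Pi>\<^sub>M z\<in>?I. \<mu>)"
    using distr_PiM_reindex[of UNIV "\<lambda>_. \<mu>" id ?I] prob_space_axioms by simp
  have mR: "?R \<in> sceneries \<rightarrow>\<^sub>M (\<Pi>\<^sub>M z\<in>?I. \<mu>)"
    by (rule measurable_restrict) (auto intro: measurable_component_singleton)
  have ps: "prob_space (\<Pi>\<^sub>M z\<in>?I. \<mu>)"
    by (rule prob_space_PiM) (rule prob_space_axioms)
  have "sceneries = distr (\<mu> \<Otimes>\<^sub>M (\<Pi>\<^sub>M z\<in>?I. \<mu>)) sceneries (\<lambda>(y, X). X(x := y))"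
    using distr_pair_PiM_eq_PiM[of ?I "\<lambda>_. \<mu>" x] prob_space_axioms by (simp add: insert_absorb)
  also have "\<mu> \<Otimes>\<^sub>M (\<Pi>\<^sub>M z\<in>?I. \<mu>) = distr (\<mu> \<Otimes>\<^sub>M sceneries) (\<mu> \<Otimes>\<^sub>M (\<Pi>\<^sub>M z\<in>?I. \<mu>)) (\<lambda>(y, \<xi>). (y, ?R \<xi>))"
    using pair_measure_distr[of "\<lambda>y. y" \<mu> \<mu> ?R sceneries "\<Pi>\<^sub>M z\<in>?I. \<mu>"] mR R prob_space_imp_sigma_finite[OF ps]
    by simp
  also have "distr \<dots> sceneries (\<lambda>(y, X). X(x := y)) = distr (\<mu> \<Otimes>\<^sub>M sceneries) sceneries (\<lambda>(y, \<xi>). \<xi>(x := y))"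
  proof (subst distr_distr)
    have "(\<lambda>(y, X). X(x := y)) \<in> \<mu> \<Otimes>\<^sub>M (\<Pi>\<^sub>M z\<in>?I. \<mu>) \<rightarrow>\<^sub>M (\<Pi>\<^sub>M z\<in>insert x ?I. \<mu>)"
      using measurable_compose[OF measurable_pair_swap' measurable_add_dim[where i=x and I="?I" and M="\<lambda>_. \<mu>"]]
      by (simp add: split_beta')
    then show "(\<lambda>(y, X). X(x := y)) \<in> \<mu> \<Otimes>\<^sub>M (\<Pi>\<^sub>M z\<in>?I. \<mu>) \<rightarrow>\<^sub>M sceneries"
      by (simp add: insert_absorb)
    show "(\<lambda>(y, \<xi>). (y, ?R \<xi>)) \<in> \<mu> \<Otimes>\<^sub>M sceneries \<rightarrow>\<^sub>M \<mu> \<Otimes>\<^sub>M (\<Pi>\<^sub>M z\<in>?I. \<mu>)"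
      using mR by measurable
    show "distr (\<mu> \<Otimes>\<^sub>M sceneries) sceneries ((\<lambda>(y, X). X(x := y)) \<circ> (\<lambda>(y, \<xi>). (y, ?R \<xi>))) =
      distr (\<mu> \<Otimes>\<^sub>M sceneries) sceneries (\<lambda>(y, \<xi>). \<xi>(x := y))"
      by (rule arg_cong[where f="distr _ _"]) (auto simp: fun_eq_iff)
  qed
  finally show ?thesis by simp
qed

text \<open>Resampling the site \<open>x\<close> leaves \<open>G\<close> untouched and replaces
  \<open>f\<close> by an independent factor.\<close>

lemma
  fixes f :: "real \<Rightarrow> 'b::{real_normed_field,banach,second_countable_topology}"
  assumes f: "integrable \<mu> f" and G: "integrable sceneries G"
    and indep: "\<And>\<xi> y. G (\<xi>(x := y)) = G \<xi>"
  shows integrable_site_mult: "integrable sceneries (\<lambda>\<xi>. f (\<xi> x) * G \<xi>)"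
    and integral_site_mult: "(\<integral>\<xi>. f (\<xi> x) * G \<xi> \<partial>sceneries) = (\<integral>y. f y \<partial>\<mu>) * (\<integral>\<xi>. G \<xi> \<partial>sceneries)"
proof -
  interpret S: prob_space "sceneries :: ('a \<Rightarrow> real) measure" by (rule prob_space_sceneries)
  interpret pair_prob_space \<mu> "sceneries :: ('a \<Rightarrow> real) measure" ..
  have [measurable]: "f \<in> borel_measurable borel" "G \<in> borel_measurable sceneries"
    using f G by (auto dest: borel_measurable_integrable cong: measurable_cong_sets)
  have pair: "integrable (\<mu> \<Otimes>\<^sub>M sceneries) (\<lambda>(y, \<xi>). f y * G \<xi>)"
    by (subst Fubini_integrable) (use f G in \<open>auto simp: norm_mult split_beta'\<close>)
  have eq: "f (((\<lambda>(y, \<xi>). \<xi>(x := y)) z) x) * G ((\<lambda>(y, \<xi>). \<xi>(x := y)) z) = (\<lambda>(y, \<xi>). f y * G \<xi>) z" for z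
    by (auto simp: indep split: prod.split)
  show "integrable sceneries (\<lambda>\<xi>. f (\<xi> x) * G \<xi>)"
    by (subst distr_update[of x, symmetric], subst integrable_distr_eq) (use pair in \<open>auto simp only: eq, measurable\<close>)
  have "(\<integral>\<xi>. f (\<xi> x) * G \<xi> \<partial>sceneries) = (\<integral>z. (\<lambda>(y, \<xi>). f y * G \<xi>) z \<partial>(\<mu> \<Otimes>\<^sub>M sceneries))"
    by (subst distr_update[of x, symmetric], subst integral_distr) (auto simp only: eq, measurable)
  also have "\<dots> = (\<integral>y. \<integral>\<xi>. f y * G \<xi> \<partial>sceneries \<partial>\<mu>)"
    using integral_fst'[OF pair] by simp
  finally show "(\<integral>\<xi>. f (\<xi> x) * G \<xi> \<partial>sceneries) = (\<integral>y. f y \<partial>\<mu>) * (\<integral>\<xi>. G \<xi> \<partial>sceneries)"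
    by simp
qed

lemma integrable_site: "integrable sceneries (\<lambda>\<xi>. \<xi> x)"
  using integrable_site_mult[of "\<lambda>y. y" "\<lambda>_. 1::real" x] law_integrable
    finite_measure.integrable_const[OF prob_space.finite_measure[OF prob_space_sceneries]] by auto

lemma integrable_site_square: "integrable sceneries (\<lambda>\<xi>. (\<xi> x)\<^sup>2)"
  using integrable_site_mult[of "\<lambda>y. y\<^sup>2" "\<lambda>_. 1::real" x] law_square_integrable
    finite_measure.integrable_const[OF prob_space.finite_measure[OF prob_space_sceneries]] by auto

lemma measurable_list_max [measurable]: "(\<lambda>\<xi>. list_max \<xi> xs) \<in> borel_measurable sceneries"
  by (induction xs) auto

lemma measurable_list_total [measurable]: "(\<lambda>\<xi>. list_total \<xi> xs) \<in> borel_measurable sceneries"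
  by (induction xs) auto

lemma integrable_list_total_square: "integrable sceneries (\<lambda>\<xi>. (list_total \<xi> xs)\<^sup>2)"
  by (induction xs) (auto intro!: integrable_add_square integrable_site_square)

lemma integrable_list_max_square: "integrable sceneries (\<lambda>\<xi>. (list_max \<xi> xs)\<^sup>2)"
proof (induction xs)
  case (Cons x xs)
  have "integrable sceneries (\<lambda>\<xi>. (\<xi> x + list_max \<xi> xs)\<^sup>2)"
    by (intro integrable_add_square integrable_site_square Cons) auto
  then show ?case
    by (rule Bochner_Integration.integrable_bound) (auto simp: max_def)
qed simp

text \<open>With the value at \<open>x\<close> set to zero, \<open>g\<close> becomes independent of
  the centered variable \<open>\<xi> x\<close>, so subtracting it leaves the integral unchanged. The
  remaining integrand is nonnegative pointwise, since a monotone \<open>g\<close> moves in the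
  direction of the sign of \<open>\<xi> x\<close>.\<close>

lemma integral_site_mult_nonneg:
  assumes g: "integrable sceneries (\<lambda>\<xi>. (g \<xi> :: real)\<^sup>2)" and [measurable]: "g \<in> borel_measurable sceneries"
    and mono: "\<And>\<xi> \<xi>'. (\<And>z. \<xi> z \<le> \<xi>' z) \<Longrightarrow> g \<xi> \<le> g \<xi>'"
    and g0: "integrable sceneries (\<lambda>\<xi>. g (\<xi>(x := 0)))"
  shows "0 \<le> (\<integral>\<xi>. \<xi> x * g \<xi> \<partial>sceneries)"
proof -
  have int: "integrable sceneries (\<lambda>\<xi>. \<xi> x * g \<xi>)"
    by (intro integrable_mult_of_square integrable_site_square g) auto
  have int0: "integrable sceneries (\<lambda>\<xi>. \<xi> x * g (\<xi>(x := 0)))"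
    using integrable_site_mult[OF law_integrable g0, of x] by simp
  have "(\<integral>\<xi>. \<xi> x * g (\<xi>(x := 0)) \<partial>sceneries) = 0"
    using integral_site_mult[OF law_integrable g0, of x] by (simp add: law_centered)
  then have "(\<integral>\<xi>. \<xi> x * g \<xi> \<partial>sceneries) = (\<integral>\<xi>. \<xi> x * g \<xi> - \<xi> x * g (\<xi>(x := 0)) \<partial>sceneries)"
    using int int0 by simp
  also have "\<dots> \<ge> 0"
  proof (rule Bochner_Integration.integral_nonneg)
    fix \<xi> :: "'a \<Rightarrow> real"
    have "0 \<le> \<xi> x * (g \<xi> - g (\<xi>(x := 0)))"
    proof (cases "\<xi> x \<ge> 0")
      case True
      then have "g (\<xi>(x := 0)) \<le> g \<xi>" by (intro mono) auto
      with True show ?thesis by simp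
    next
      case False
      then have "g \<xi> \<le> g (\<xi>(x := 0))" by (intro mono) auto
      with False show ?thesis by (intro mult_nonpos_nonpos) auto
    qed
    then show "0 \<le> \<xi> x * g \<xi> - \<xi> x * g (\<xi>(x := 0))" by (simp add: right_diff_distrib)
  qed
  finally show ?thesis .
qed

text \<open>The induction of Newman and Wright; the difference of the total and the maximum is monotone
  in the scenery, hence positively correlated with each of its coordinates.\<close>

lemma integral_list_max_square_le:
  "(\<integral>\<xi>. (list_max \<xi> xs)\<^sup>2 \<partial>sceneries) \<le> (\<integral>\<xi>. (list_total \<xi> xs)\<^sup>2 \<partial>sceneries)"
proof (induction xs)
  case (Cons x xs)
  let ?m = "\<lambda>\<xi>. list_max \<xi> xs" and ?t = "\<lambda>\<xi>. list_total \<xi> xs"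
  note sq = integrable_site_square[of x] integrable_list_max_square[of xs] integrable_list_total_square[of xs]
  have xm: "integrable sceneries (\<lambda>\<xi>. \<xi> x * ?m \<xi>)" and xt: "integrable sceneries (\<lambda>\<xi>. \<xi> x * ?t \<xi>)"
    by (intro integrable_mult_of_square sq; simp)+
  have "0 \<le> (\<integral>\<xi>. \<xi> x * (?t \<xi> - ?m \<xi>) \<partial>sceneries)"
  proof (rule integral_site_mult_nonneg)
    have "integrable sceneries (\<lambda>\<xi>. (?t \<xi> + (- ?m \<xi>))\<^sup>2)"
      by (intro integrable_add_square sq) (use sq in auto)
    then show "integrable sceneries (\<lambda>\<xi>. (?t \<xi> - ?m \<xi>)\<^sup>2)" by simp
    show "?t \<xi> - ?m \<xi> \<le> ?t \<xi>' - ?m \<xi>'" if "\<And>z. \<xi> z \<le> \<xi>' z" for \<xi> \<xi>'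
      by (rule list_total_minus_max_mono) (rule that)
    have [measurable]: "(\<lambda>\<xi>. list_total (\<xi>(x := 0)) ys) \<in> borel_measurable sceneries"
        "(\<lambda>\<xi>. list_max (\<xi>(x := 0)) ys) \<in> borel_measurable sceneries" for ys
      by (induction ys) auto
    have "integrable sceneries (\<lambda>\<xi>. list_total (\<xi>(x := 0)) ys)" for ys
    proof (induction ys)
      case (Cons y ys)
      have "integrable sceneries (\<lambda>\<xi>. (\<xi>(x := 0)) y)"
        by (cases "y = x") (auto intro: integrable_site)
      with Cons show ?case by (auto intro!: Bochner_Integration.integrable_add simp del: fun_upd_apply)
    qed simp
    moreover have "integrable sceneries (\<lambda>\<xi>. list_max (\<xi>(x := 0)) ys)" for ys
    proof (induction ys)
      case (Cons y ys)
      have "integrable sceneries (\<lambda>\<xi>. (\<xi>(x := 0)) y)"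
        by (cases "y = x") (auto intro: integrable_site)
      with Cons show ?case by (auto intro!: integrable_max Bochner_Integration.integrable_add simp del: fun_upd_apply)
    qed simp
    ultimately show "integrable sceneries (\<lambda>\<xi>. ?t (\<xi>(x := 0)) - ?m (\<xi>(x := 0)))"
      by auto
  qed measurable
  \<comment> \<open>So replacing the maximum by the total can only increase the cross term of the
    expanded square.\<close>
  then have le: "(\<integral>\<xi>. \<xi> x * ?m \<xi> \<partial>sceneries) \<le> (\<integral>\<xi>. \<xi> x * ?t \<xi> \<partial>sceneries)"
    using xm xt by (simp add: right_diff_distrib)
  have exp: "(\<integral>\<xi>. (\<xi> x + f \<xi>)\<^sup>2 \<partial>sceneries) =
      (\<integral>\<xi>. (\<xi> x)\<^sup>2 \<partial>sceneries) + 2 * (\<integral>\<xi>. \<xi> x * f \<xi> \<partial>sceneries) + (\<integral>\<xi>. (f \<xi>)\<^sup>2 \<partial>sceneries)"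
    if "integrable sceneries (\<lambda>\<xi>. \<xi> x * f \<xi>)" "integrable sceneries (\<lambda>\<xi>. (f \<xi>)\<^sup>2)" for f
    using that sq(1) by (simp add: power2_sum mult.assoc)
  have "(\<integral>\<xi>. (list_max \<xi> (x # xs))\<^sup>2 \<partial>sceneries) \<le> (\<integral>\<xi>. (\<xi> x + ?m \<xi>)\<^sup>2 \<partial>sceneries)"
  proof (rule integral_mono)
    show "integrable sceneries (\<lambda>\<xi>. (\<xi> x + ?m \<xi>)\<^sup>2)"
      by (intro integrable_add_square sq) auto
    show "(list_max \<xi> (x # xs))\<^sup>2 \<le> (\<xi> x + ?m \<xi>)\<^sup>2" for \<xi>
      by (simp add: max_def)
  qed (rule integrable_list_max_square)
  also have "\<dots> \<le> (\<integral>\<xi>. (\<xi> x + ?t \<xi>)\<^sup>2 \<partial>sceneries)"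
    using le Cons sq xm xt by (simp add: exp)
  finally show ?case by simp
qed simp

lemma integral_site_cross:
  fixes x y :: 'b
  shows "(\<integral>\<xi>. \<xi> x * \<xi> y \<partial>sceneries) = (if x = y then (\<integral>y. y\<^sup>2 \<partial>\<mu>) else 0)"
proof (cases "x = y")
  case True
  have "(\<integral>\<xi>. (\<xi> x)\<^sup>2 * 1 \<partial>sceneries) = (\<integral>y. y\<^sup>2 \<partial>\<mu>) * (\<integral>\<xi>. 1 \<partial>(sceneries :: ('b \<Rightarrow> real) measure))"
    by (rule integral_site_mult[OF law_square_integrable])
      (auto intro!: finite_measure.integrable_const prob_space.finite_measure prob_space_sceneries)
  then show ?thesis using True prob_space.prob_space[OF prob_space_sceneries[where 'a='b]]
    by (simp add: power2_eq_square)
next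
  case False
  then show ?thesis
    using integral_site_mult[OF law_integrable integrable_site, of x y] by (simp add: law_centered)
qed

lemma integral_list_total_square:
  "(\<integral>\<xi>. (list_total \<xi> xs)\<^sup>2 \<partial>sceneries) = (\<integral>y. y\<^sup>2 \<partial>\<mu>) * real (coincidences xs)"
proof (induction xs)
  case (Cons x xs)
  let ?t = "\<lambda>\<xi>. list_total \<xi> xs"
  note sq = integrable_site_square[of x] integrable_list_total_square[of xs]
  have xt: "integrable sceneries (\<lambda>\<xi>. \<xi> x * ?t \<xi>)"
    by (intro integrable_mult_of_square sq; simp)
  have cross: "integrable sceneries (\<lambda>\<xi>. \<xi> x * list_total \<xi> ys)
      \<and> (\<integral>\<xi>. \<xi> x * list_total \<xi> ys \<partial>sceneries) = (\<integral>y. y\<^sup>2 \<partial>\<mu>) * real (count_list ys x)" for ys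
  proof (induction ys)
    case (Cons y ys)
    have "integrable sceneries (\<lambda>\<xi>. \<xi> x * \<xi> y)"
      by (intro integrable_mult_of_square integrable_site_square) auto
    with Cons show ?case by (auto simp: distrib_left integral_site_cross)
  qed simp
  have "(\<integral>\<xi>. (list_total \<xi> (x # xs))\<^sup>2 \<partial>sceneries) =
      (\<integral>\<xi>. (\<xi> x)\<^sup>2 \<partial>sceneries) + 2 * (\<integral>\<xi>. \<xi> x * ?t \<xi> \<partial>sceneries) + (\<integral>\<xi>. (?t \<xi>)\<^sup>2 \<partial>sceneries)"
    using sq xt by (simp add: power2_sum mult.assoc)
  also have "(\<integral>\<xi>. (\<xi> x)\<^sup>2 \<partial>sceneries) = (\<integral>y. y\<^sup>2 \<partial>\<mu>)"
    using integral_site_cross[of x x] by (simp add: power2_eq_square)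
  finally show ?case using Cons cross[of xs] by (simp add: algebra_simps)
qed simp

text \<open>Duality with the Riesz product of the factors \<open>1 + \<i> \<theta> h (\<xi> x)\<close>, where \<open>h\<close> is half the centered sign:
  for \<open>\<theta>\<^sup>2 = 1 / card A\<close> its modulus is at most \<open>exp (1/2)\<close>.\<close>

lemma integral_abs_weighted_ge:
  fixes A :: "'b set"
  assumes A: "finite A" "A \<noteq> {}" and m: "m = (\<integral>y. \<bar>y\<bar> \<partial>\<mu>)"
  shows "m * (\<Sum>x\<in>A. a x) / (2 * exp (1/2) * sqrt (card A)) \<le> (\<integral>\<xi>. \<bar>\<Sum>x\<in>A. a x * \<xi> x\<bar> \<partial>sceneries)"
proof -
  interpret S: prob_space "sceneries :: ('b \<Rightarrow> real) measure" by (rule prob_space_sceneries)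
  define \<theta> where "\<theta> = 1 / sqrt (card A)"
  have cA: "card A > 0" using A by (simp add: card_gt_0_iff)
  \<comment> \<open>Centering keeps the mean of every factor of the product equal to 1, and halving
    keeps \<open>h\<close> bounded by 1. As the law is centered, \<open>y * h y\<close> still has
    mean \<open>m / 2\<close>.\<close>
  define h where "h y = (sgn y - (\<integral>z. sgn z \<partial>\<mu>)) / 2" for y :: real
  have [measurable]: "(sgn :: real \<Rightarrow> real) \<in> borel_measurable \<mu>"
    by (simp cong: measurable_cong_sets)
  have [measurable]: "h \<in> borel_measurable borel" unfolding h_def by measurable
  have hm [simp]: "h \<in> borel_measurable \<mu>" "(\<lambda>y. y * h y) \<in> borel_measurable \<mu>"
    by (simp_all cong: measurable_cong_sets)
  have int_sgn: "integrable \<mu> (sgn :: real \<Rightarrow> real)"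
    by (rule integrable_const_bound[where B=1]) (auto simp: abs_sgn_eq)
  have abs_sgn: "\<bar>\<integral>z. sgn z \<partial>\<mu>\<bar> \<le> (1::real)"
  proof -
    have "norm (\<integral>z. sgn z \<partial>\<mu>) \<le> (\<integral>z. norm (sgn z :: real) \<partial>\<mu>)" by (rule integral_norm_bound)
    also have "\<dots> \<le> (\<integral>z. 1 \<partial>\<mu>)"
      by (intro integral_mono') (auto simp: abs_sgn_eq)
    also have "\<dots> = 1" using prob_space by simp
    finally show ?thesis by simp
  qed
  have h_bound: "\<bar>h y\<bar> \<le> 1" for y
  proof -
    have "\<bar>(a - b) / 2\<bar> \<le> 1" if "\<bar>a\<bar> \<le> 1" "\<bar>b\<bar> \<le> 1" for a b :: real
      using that by (simp add: abs_le_iff)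
    moreover have "\<bar>sgn y\<bar> \<le> 1" by (simp add: abs_sgn_eq)
    ultimately show ?thesis using abs_sgn unfolding h_def by blast
  qed
  have int_h: "integrable \<mu> h"
    by (rule integrable_const_bound[where B=1]) (use h_bound in auto)
  have h0: "(\<integral>y. h y \<partial>\<mu>) = 0"
    unfolding h_def using int_sgn prob_space by simp
  have int_yh: "integrable \<mu> (\<lambda>y. y * h y)"
    by (rule Bochner_Integration.integrable_bound[OF law_integrable])
      (use h_bound in \<open>auto simp: abs_mult mult_left_le\<close>)
  have yh: "(\<integral>y. y * h y \<partial>\<mu>) = m / 2"
  proof -
    have "(\<integral>y. y * h y \<partial>\<mu>) = (\<integral>y. \<bar>y\<bar> / 2 - (\<integral>z. sgn z \<partial>\<mu>) / 2 * y \<partial>\<mu>)"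
      by (intro Bochner_Integration.integral_cong)
        (auto simp: h_def abs_real_def sgn_if field_simps)
    also have "\<dots> = m / 2" using law_integrable by (simp add: law_centered m)
    finally show ?thesis .
  qed
  \<comment> \<open>The perturbation is imaginary: it changes the mean of \<open>y * u y\<close> to
    first order in \<theta>, but the modulus of \<open>u y\<close> only to second order, so the
    product over \<open>card A\<close> sites stays bounded.\<close>
  define u where "u y = Complex 1 (\<theta> * h y)" for y
  have u_eq: "u y = 1 + \<i> * complex_of_real (\<theta> * h y)" for y
    by (simp add: u_def complex_eq_iff)
  have int_u: "integrable \<mu> u" and u1: "(\<integral>y. u y \<partial>\<mu>) = 1"
    and int_yu: "integrable \<mu> (\<lambda>y. complex_of_real y * u y)"
    and yu: "(\<integral>y. complex_of_real y * u y \<partial>\<mu>) = \<i> * complex_of_real (\<theta> * m / 2)"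
  proof -
    show "integrable \<mu> u" unfolding u_eq using int_h by (simp del: of_real_mult)
    show "(\<integral>y. u y \<partial>\<mu>) = 1" unfolding u_eq using int_h h0 prob_space by (simp del: of_real_mult)
    have eq: "complex_of_real y * u y = complex_of_real y + \<i> * complex_of_real (\<theta> * (y * h y))" for y
      by (simp add: u_eq algebra_simps)
    have i2: "integrable \<mu> (\<lambda>y. \<i> * complex_of_real (\<theta> * (y * h y)))"
      using int_yh by (intro integrable_mult_right integrable_of_real) auto
    show "integrable \<mu> (\<lambda>y. complex_of_real y * u y)"
      unfolding eq using law_integrable i2 by (intro Bochner_Integration.integrable_add integrable_of_real) auto
    show "(\<integral>y. complex_of_real y * u y \<partial>\<mu>) = \<i> * complex_of_real (\<theta> * m / 2)"
      unfolding eq using law_integrable i2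
      by (subst Bochner_Integration.integral_add) (auto simp: law_centered yh simp del: of_real_mult)
  qed
  have [measurable]: "u \<in> borel_measurable borel"
    using int_u by (auto dest: borel_measurable_integrable cong: measurable_cong_sets)
  have prod: "integrable sceneries (\<lambda>\<xi>. \<Prod>x\<in>B. u (\<xi> x)) \<and> (\<integral>\<xi>. (\<Prod>x\<in>B. u (\<xi> x)) \<partial>sceneries) = 1"
    if "finite B" for B :: "'b set"
    using that
  proof induction
    case (insert x B)
    have "(\<Prod>z\<in>B. u ((\<xi>(x := y)) z)) = (\<Prod>z\<in>B. u (\<xi> z))" for \<xi> y
      using insert.hyps by (intro prod.cong) auto
    with insert show ?case
      using integrable_site_mult[OF int_u, of "\<lambda>\<xi>. \<Prod>x\<in>B. u (\<xi> x)" x]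
        integral_site_mult[OF int_u, of "\<lambda>\<xi>. \<Prod>x\<in>B. u (\<xi> x)" x]
      by (simp add: u1)
  qed (use S.prob_space in auto)
  define g where "g \<xi> = (\<Prod>x\<in>A. u (\<xi> x))" for \<xi> :: "'b \<Rightarrow> real"
  have site: "integrable sceneries (\<lambda>\<xi>. complex_of_real (\<xi> x) * g \<xi>)
      \<and> (\<integral>\<xi>. complex_of_real (\<xi> x) * g \<xi> \<partial>sceneries) = \<i> * complex_of_real (\<theta> * m / 2)" if x: "x \<in> A" for x
  proof -
    have "(\<Prod>z\<in>A - {x}. u ((\<xi>(x := y)) z)) = (\<Prod>z\<in>A - {x}. u (\<xi> z))" for \<xi> y
      by (intro prod.cong) auto
    moreover have "g \<xi> = u (\<xi> x) * (\<Prod>z\<in>A - {x}. u (\<xi> z))" for \<xi>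
      unfolding g_def using A x by (subst prod.remove) auto
    then have "(\<lambda>\<xi>. complex_of_real (\<xi> x) * g \<xi>) =
        (\<lambda>\<xi>. complex_of_real (\<xi> x) * u (\<xi> x) * (\<Prod>z\<in>A - {x}. u (\<xi> z)))"
      by (simp add: mult.assoc)
    ultimately show ?thesis
      using integrable_site_mult[OF int_yu, of "\<lambda>\<xi>. \<Prod>z\<in>A - {x}. u (\<xi> z)" x]
        integral_site_mult[OF int_yu, of "\<lambda>\<xi>. \<Prod>z\<in>A - {x}. u (\<xi> z)" x] prod[of "A - {x}"] A
      by (simp add: yu)
  qed
  have g_bound: "norm (g \<xi>) \<le> exp (1/2)" for \<xi>
  proof -
    have "norm (u y) \<le> exp (\<theta>\<^sup>2 / 2)" for y
    proof -
      have "(norm (u y))\<^sup>2 = 1 + \<theta>\<^sup>2 * (h y)\<^sup>2"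
        by (simp add: u_def cmod_power2 power_mult_distrib)
      also have "\<dots> \<le> 1 + \<theta>\<^sup>2"
        using h_bound[of y] by (simp add: mult_left_le abs_square_le_1)
      also have "\<dots> \<le> exp (\<theta>\<^sup>2)" by (rule exp_ge_add_one_self)
      also have "\<dots> = (exp (\<theta>\<^sup>2 / 2))\<^sup>2" by (simp flip: exp_double)
      finally show ?thesis by (rule power2_le_imp_le) simp
    qed
    then have "norm (g \<xi>) \<le> (\<Prod>x\<in>A. exp (\<theta>\<^sup>2 / 2))"
      unfolding g_def prod_norm[symmetric] by (intro prod_mono) auto
    also have "\<dots> = exp (1/2)"
      using cA by (simp add: \<theta>_def power_divide flip: exp_of_nat_mult)
    finally show ?thesis .
  qed
  define Y where "Y \<xi> = (\<Sum>x\<in>A. a x * \<xi> x)" for \<xi> :: "'b \<Rightarrow> real"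
  have int_Y: "integrable sceneries Y"
    unfolding Y_def by (intro Bochner_Integration.integrable_sum integrable_mult_right integrable_site)
  have eq: "complex_of_real (Y \<xi>) * g \<xi> = (\<Sum>x\<in>A. complex_of_real (a x) * (complex_of_real (\<xi> x) * g \<xi>))" for \<xi>
    by (simp add: Y_def sum_distrib_right mult.assoc)
  have "(\<integral>\<xi>. complex_of_real (Y \<xi>) * g \<xi> \<partial>sceneries) =
      (\<Sum>x\<in>A. complex_of_real (a x) * (\<i> * complex_of_real (\<theta> * m / 2)))"
    unfolding eq
  proof (subst Bochner_Integration.integral_sum)
    show "integrable sceneries (\<lambda>\<xi>. complex_of_real (a x) * (complex_of_real (\<xi> x) * g \<xi>))" if "x \<in> A" for x
      using site[OF that] by (intro integrable_mult_right) blast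
    show "(\<Sum>x\<in>A. \<integral>\<xi>. complex_of_real (a x) * (complex_of_real (\<xi> x) * g \<xi>) \<partial>sceneries) =
        (\<Sum>x\<in>A. complex_of_real (a x) * (\<i> * complex_of_real (\<theta> * m / 2)))"
      using site by (intro sum.cong refl) (simp only: integral_mult_right_zero)
  qed
  also have "\<dots> = \<i> * complex_of_real (\<theta> * m / 2 * (\<Sum>x\<in>A. a x))"
    by (simp add: sum_distrib_left sum_distrib_right mult_ac)
  finally have val: "(\<integral>\<xi>. complex_of_real (Y \<xi>) * g \<xi> \<partial>sceneries) = \<i> * complex_of_real (\<theta> * m / 2 * (\<Sum>x\<in>A. a x))" .
  have "\<theta> * m / 2 * (\<Sum>x\<in>A. a x) \<le> norm (\<integral>\<xi>. complex_of_real (Y \<xi>) * g \<xi> \<partial>sceneries)"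
    unfolding val norm_mult norm_of_real by simp
  also have "\<dots> \<le> (\<integral>\<xi>. norm (complex_of_real (Y \<xi>) * g \<xi>) \<partial>sceneries)"
    by (rule integral_norm_bound)
  also have "\<dots> \<le> (\<integral>\<xi>. exp (1/2) * \<bar>Y \<xi>\<bar> \<partial>sceneries)"
    using int_Y g_bound
    by (intro integral_mono' integrable_mult_right integrable_abs)
      (auto simp: norm_mult mult.commute[of "\<bar>Y _\<bar>"] intro!: mult_right_mono)
  finally have "\<theta> * m / 2 * (\<Sum>x\<in>A. a x) \<le> exp (1/2) * (\<integral>\<xi>. \<bar>Y \<xi>\<bar> \<partial>sceneries)"
    by simp
  then have "\<theta> * m / 2 * (\<Sum>x\<in>A. a x) / exp (1/2) \<le> (\<integral>\<xi>. \<bar>Y \<xi>\<bar> \<partial>sceneries)"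
    by (simp add: pos_divide_le_eq mult_ac)
  also have "\<theta> * m / 2 * (\<Sum>x\<in>A. a x) / exp (1/2) = m * (\<Sum>x\<in>A. a x) / (2 * exp (1/2) * sqrt (card A))"
    by (simp add: \<theta>_def)
  finally show ?thesis unfolding Y_def .
qed

lemma emeasure_law_le_1: "emeasure \<mu> C \<le> 1"
  using emeasure_space[of \<mu> C] by (simp only: emeasure_space_1)

text \<open>In the coordinate \<open>x\<close> a decreasing event is a lower set of the line, and of
  two such sets one contains the other. Their intersection is the smaller one, whose mass is at
  least the product of the two masses; integration over the other coordinates preserves
  this.\<close>

lemma prob_site_le_inter_ge:
  fixes B :: "('b \<Rightarrow> real) set"
  assumes B: "B \<in> sets sceneries" and down: "\<And>\<xi> \<xi>'. \<xi>' \<in> B \<Longrightarrow> (\<And>z. \<xi> z \<le> \<xi>' z) \<Longrightarrow> \<xi> \<in> B"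
  shows "measure \<mu> {..e} * measure sceneries B \<le> measure sceneries ({\<xi>. \<xi> x \<le> e} \<inter> B)"
proof -
  interpret S: prob_space "sceneries :: ('b \<Rightarrow> real) measure" by (rule prob_space_sceneries)
  interpret P: pair_prob_space \<mu> "sceneries :: ('b \<Rightarrow> real) measure" ..
  interpret Q: pair_prob_space "sceneries :: ('b \<Rightarrow> real) measure" \<mu> ..
  let ?U = "\<lambda>(y, \<xi>). \<xi>(x := y)"
  have A: "{\<xi>. \<xi> x \<le> e} \<in> sets sceneries"
    using measurable_sets[OF measurable_site[of x], of "{..e}"] by (simp add: vimage_def)
  have upd: "emeasure sceneries C = (\<integral>\<^sup>+\<xi>. emeasure \<mu> {y. \<xi>(x := y) \<in> C} \<partial>sceneries)"
    if C: "C \<in> sets sceneries" for C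
  proof -
    have m: "?U -` C \<inter> space (\<mu> \<Otimes>\<^sub>M sceneries) \<in> sets (\<mu> \<Otimes>\<^sub>M sceneries)"
      by (rule measurable_sets[OF measurable_update C])
    have "emeasure sceneries C = emeasure (distr (\<mu> \<Otimes>\<^sub>M sceneries) sceneries ?U) C"
      by (simp only: distr_update)
    also have "\<dots> = emeasure (\<mu> \<Otimes>\<^sub>M sceneries) (?U -` C \<inter> space (\<mu> \<Otimes>\<^sub>M sceneries))"
      by (rule emeasure_distr[OF measurable_update C])
    also have "\<dots> = (\<integral>\<^sup>+\<xi>. emeasure \<mu> ((\<lambda>y. (y, \<xi>)) -` (?U -` C \<inter> space (\<mu> \<Otimes>\<^sub>M sceneries))) \<partial>sceneries)"
      by (rule P.emeasure_pair_measure_alt2[OF m])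
    finally show ?thesis by (simp add: vimage_def space_pair_measure)
  qed
  have sec: "{y. \<xi>(x := y) \<in> B} \<in> sets \<mu>" for \<xi>
  proof -
    have "(\<lambda>y. \<xi>(x := y)) \<in> \<mu> \<rightarrow>\<^sub>M sceneries"
      by (rule measurable_PiM_single') (auto simp: space_PiM)
    from measurable_sets[OF this B] show ?thesis by (simp add: vimage_def)
  qed
  have "emeasure \<mu> {..e} * emeasure sceneries B = (\<integral>\<^sup>+\<xi>. emeasure \<mu> {..e} * emeasure \<mu> {y. \<xi>(x := y) \<in> B} \<partial>sceneries)"
  proof -
    have "(\<lambda>\<xi>. emeasure \<mu> {y. \<xi>(x := y) \<in> B}) \<in> borel_measurable sceneries"
      using Q.measurable_emeasure_Pair1[of "(\<lambda>(\<xi>, y). \<xi>(x := y)) -` B \<inter> space (sceneries \<Otimes>\<^sub>M \<mu>)"]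
        measurable_sets[OF measurable_compose[OF measurable_pair_swap' measurable_update] B, of x]
      by (simp add: vimage_def space_pair_measure split_beta')
    then show ?thesis by (subst upd[OF B]) (simp add: nn_integral_cmult)
  qed
  also have "\<dots> \<le> (\<integral>\<^sup>+\<xi>. emeasure \<mu> {y. \<xi>(x := y) \<in> {\<xi>. \<xi> x \<le> e} \<inter> B} \<partial>sceneries)"
  proof (rule nn_integral_mono)
    fix \<xi> :: "'b \<Rightarrow> real"
    let ?D = "{y. \<xi>(x := y) \<in> B}"
    have le1: "emeasure \<mu> C \<le> 1" for C by (rule emeasure_law_le_1)
    have D: "y' \<in> ?D" if "y \<in> ?D" "y' \<le> y" for y y'
      using that down[of "\<xi>(x := y)" "\<xi>(x := y')"] by auto
    have "{..e} \<subseteq> ?D \<or> ?D \<subseteq> {..e}"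
    proof (cases "\<exists>y\<in>?D. e \<le> y")
      case True
      then obtain y where y: "y \<in> ?D" "e \<le> y" by blast
      have "{..e} \<subseteq> ?D"
      proof
        fix y' assume "y' \<in> {..e}"
        then show "y' \<in> ?D" using D[OF y(1)] y(2) by simp
      qed
      then show ?thesis ..
    next
      case False
      then have "?D \<subseteq> {..e}" by (auto simp: not_le intro: less_imp_le)
      then show ?thesis ..
    qed
    then have "emeasure \<mu> {..e} * emeasure \<mu> ?D \<le> emeasure \<mu> ({..e} \<inter> ?D)"
    proof
      assume "{..e} \<subseteq> ?D"
      then have "{..e} \<inter> ?D = {..e}" by auto
      then show ?thesis using mult_left_mono[OF le1[of ?D], of "emeasure \<mu> {..e}"] by simp
    next
      assume "?D \<subseteq> {..e}"
      then have "{..e} \<inter> ?D = ?D" by auto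
      then show ?thesis using mult_right_mono[OF le1[of "{..e}"], of "emeasure \<mu> ?D"] by simp
    qed
    also have "{..e} \<inter> ?D = {y. \<xi>(x := y) \<in> {\<xi>. \<xi> x \<le> e} \<inter> B}" by auto
    finally show "emeasure \<mu> {..e} * emeasure \<mu> ?D \<le> emeasure \<mu> {y. \<xi>(x := y) \<in> {\<xi>. \<xi> x \<le> e} \<inter> B}" .
  qed
  also have "\<dots> = emeasure sceneries ({\<xi>. \<xi> x \<le> e} \<inter> B)"
    by (rule upd[symmetric]) (intro sets.Int A B)
  finally show ?thesis
    by (simp add: emeasure_eq_measure S.emeasure_eq_measure flip: ennreal_mult'')
qed

end

section \<open>Order of the Green function\<close>

lemma norm_cis_diff_le: "norm (cis a - cis b) \<le> \<bar>a - b\<bar>"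
proof -
  have "cis a - cis b = cis b * (cis (a - b) - 1)"
    by (simp add: right_diff_distrib cis_mult)
  then have "norm (cis a - cis b) = norm (cis (a - b) - 1)"
    by (simp add: norm_mult)
  also have "\<dots> \<le> \<bar>a - b\<bar>"
    using iexp_approx1[of "a - b" 0] by (simp add: cis_conv_exp)
  finally show ?thesis .
qed

text \<open>If all powers of \<open>w\<close> up to the \<open>n\<close>-th stay close to \<open>1\<close>, then the geometric sum has real
  part at least \<open>n / 2\<close>, which forces \<open>w\<close> to be within \<open>1 / n\<close> of \<open>1\<close>.\<close>

lemma near_one_of_powers_near_one:
  fixes w :: complex
  assumes "n \<ge> 1" and close: "\<And>k. k \<le> n \<Longrightarrow> norm (w ^ k - 1) \<le> 1/2"
  shows "norm (1 - w) \<le> 1 / real n"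
proof -
  let ?S = "\<Sum>k<n. w ^ k"
  have "Re (w ^ k) \<ge> 1/2" if "k < n" for k
    using close[of k] that abs_Re_le_cmod[of "w ^ k - 1"] by simp
  then have "real n * (1/2) \<le> (\<Sum>k<n. Re (w ^ k))"
    using sum_mono[of "{..<n}" "\<lambda>_. 1/2 :: real" "\<lambda>k. Re (w ^ k)"] by simp
  also have "\<dots> = Re ?S" by simp
  also have "\<dots> \<le> norm ?S" by (rule complex_Re_le_cmod)
  finally have S: "real n / 2 \<le> norm ?S" by simp
  have "norm (1 - w) * (real n / 2) \<le> norm (1 - w) * norm ?S"
    using S by (intro mult_left_mono) auto
  also have "\<dots> = norm (1 - w ^ n)"
    by (simp add: one_diff_power_eq norm_mult)
  also have "\<dots> \<le> 1/2" using close[of n] by (simp add: norm_minus_commute)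
  finally show ?thesis using assms(1) by (simp add: field_simps)
qed

lemma real_vec_add: "real_vec (x + y) = real_vec x + real_vec y"
  by (simp add: real_vec_def vec_eq_iff)

lemma real_vec_0 [simp]: "real_vec 0 = 0"
  by (simp add: real_vec_def vec_eq_iff)

section \<open>Characteristic functions of the steps and of the walk\<close>

locale lattice_walk = step_law \<nu> for \<nu> :: "(int ^ 'n) measure"
begin

definition step_char :: "real ^ 'n \<Rightarrow> complex" where
  "step_char u = (\<integral>x. cis (u \<bullet> real_vec x) \<partial>\<nu>)"

lemma norm_step_char_le: "norm (step_char u) \<le> 1"
proof -
  have "norm (step_char u) \<le> (\<integral>x. norm (cis (u \<bullet> real_vec x)) \<partial>\<nu>)"
    unfolding step_char_def by (rule integral_norm_bound)
  then show ?thesis using prob_space by simp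
qed

lemma step_char_0 [simp]: "step_char 0 = 1"
  using prob_space by (simp add: step_char_def)

lemma integrable_bounded_steps:
  fixes f :: "int ^ 'n \<Rightarrow> 'b::{banach, second_countable_topology}"
  assumes "\<And>x. norm (f x) \<le> B"
  shows "integrable steps (\<lambda>\<omega>. f (walk \<omega> k))"
proof (rule steps.P.integrable_const_bound[where B=B])
  show "(\<lambda>\<omega>. f (walk \<omega> k)) \<in> borel_measurable steps"
    by (rule measurable_compose[OF measurable_walk]) simp
qed (simp add: assms)

lemma walk_char: "(\<integral>\<omega>. cis (u \<bullet> real_vec (walk \<omega> k)) \<partial>steps) = step_char u ^ k"
proof (induction k)
  case 0
  then show ?case using steps.P.prob_space by simp
next
  case (Suc k)
  interpret P: pair_prob_space \<nu> steps ..
  let ?f = "\<lambda>\<omega>. cis (u \<bullet> real_vec (walk \<omega> (Suc k)))"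
  have mf: "?f \<in> borel_measurable steps"
    by (rule measurable_compose[OF measurable_walk]) simp
  have m1: "(\<lambda>x. cis (u \<bullet> real_vec x)) \<in> borel_measurable \<nu>"
    by (simp cong: measurable_cong_sets)
  have m2: "(\<lambda>\<omega>. cis (u \<bullet> real_vec (walk \<omega> k))) \<in> borel_measurable steps"
    by (rule measurable_compose[OF measurable_walk]) simp
  have split: "?f ((\<lambda>(s, \<omega>). case_nat s \<omega>) z) = (\<lambda>z. cis (u \<bullet> real_vec (fst z)) * cis (u \<bullet> real_vec (walk (snd z) k))) z" for z
    by (auto simp: walk_Suc_shift real_vec_add inner_add_right cis_mult split: prod.split)
  have int: "integrable (\<nu> \<Otimes>\<^sub>M steps) (\<lambda>z. cis (u \<bullet> real_vec (fst z)) * cis (u \<bullet> real_vec (walk (snd z) k)))"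
    by (rule P.integrable_const_bound[where B=1])
      (simp_all add: norm_mult borel_measurable_times[OF measurable_compose[OF measurable_fst m1] measurable_compose[OF measurable_snd m2]])
  have "(\<integral>\<omega>. ?f \<omega> \<partial>steps) = (\<integral>\<omega>. ?f \<omega> \<partial>(distr (\<nu> \<Otimes>\<^sub>M steps) steps (\<lambda>(s, \<omega>). case_nat s \<omega>)))"
    by (simp only: steps.PiM_iter)
  also have "\<dots> = (\<integral>z. cis (u \<bullet> real_vec (fst z)) * cis (u \<bullet> real_vec (walk (snd z) k)) \<partial>(\<nu> \<Otimes>\<^sub>M steps))"
  proof (subst integral_distr[OF _ mf])
    show "(\<lambda>(s, \<omega>). case_nat s \<omega>) \<in> \<nu> \<Otimes>\<^sub>M steps \<rightarrow>\<^sub>M steps" by measurable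
  qed (simp only: split)
  also have "\<dots> = (\<integral>x. \<integral>\<omega>. cis (u \<bullet> real_vec x) * cis (u \<bullet> real_vec (walk \<omega> k)) \<partial>steps \<partial>\<nu>)"
    using P.integral_fst'[OF int] by simp
  also have "\<dots> = step_char u * step_char u ^ k"
    by (simp add: Suc step_char_def)
  finally show ?case by simp
qed

lemma scaled_walk_char:
  "(\<integral>\<omega>. cis (u \<bullet> (c *\<^sub>R real_vec (walk \<omega> k))) \<partial>steps) = step_char (c *\<^sub>R u) ^ k"
  using walk_char[of "c *\<^sub>R u" k] by simp

lemma sets_walk_pred: "{\<omega>. P (walk \<omega> n)} \<in> sets steps"
proof -
  have "(\<lambda>\<omega>. walk \<omega> n) -` {x. P x} \<inter> space steps \<in> sets steps"
    by (rule measurable_sets[OF measurable_walk]) simp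
  then show ?thesis by (simp add: vimage_def)
qed

end

text \<open>The common outcome of the different attraction hypotheses: tightness of the rescaled
  walk and, at every nonzero frequency, a limit of modulus less than 1. Tightness gives
  equicontinuity, and together they give a contraction that is uniform on compact sets away from
  0.\<close>

locale attracted_walk = lattice_walk \<nu> for \<nu> :: "(int ^ 'n) measure" +
  fixes \<alpha> :: real
  assumes index_pos: "\<alpha> > 0"
    and tight: "\<And>e. e > 0 \<Longrightarrow> \<exists>K>0. \<forall>n\<ge>1.
      measure steps {\<omega>. norm (real_vec (walk \<omega> n)) > K * real n powr (1 / \<alpha>)} \<le> e"
    and limit_char: "\<And>u. u \<noteq> 0 \<Longrightarrow> \<exists>z. norm z < 1 \<and>
      (\<lambda>n. step_char (real n powr (- 1 / \<alpha>) *\<^sub>R u) ^ n) \<longlonglongrightarrow> z"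
begin

definition scaled_char :: "nat \<Rightarrow> real ^ 'n \<Rightarrow> complex" where
  "scaled_char n u = step_char (real n powr (- 1 / \<alpha>) *\<^sub>R u) ^ n"

text \<open>Where the rescaled walk is at most \<open>K\<close>, the two exponentials differ by at
  most \<open>norm (s - t) * K\<close>, elsewhere by at most 2. The tail level \<open>e / 4\<close>
  and the radius \<open>e / (2 * K)\<close> make each part at most \<open>e / 2\<close>.\<close>

lemma scaled_char_equicontinuous:
  assumes "e > 0"
  obtains d where "d > 0" "\<And>n s t. n \<ge> 1 \<Longrightarrow> norm (s - t) \<le> d \<Longrightarrow> norm (scaled_char n s - scaled_char n t) \<le> e"
proof -
  obtain K where K: "K > 0" "\<And>n. n \<ge> 1 \<Longrightarrow>
      measure steps {\<omega>. norm (real_vec (walk \<omega> n)) > K * real n powr (1 / \<alpha>)} \<le> e / 4"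
    using tight[of "e / 4"] assms by auto
  have "norm (scaled_char n s - scaled_char n t) \<le> e" if n: "n \<ge> 1" and st: "norm (s - t) \<le> e / (2 * K)" for n s t
  proof -
    define W where "W \<omega> = real n powr (- 1 / \<alpha>) *\<^sub>R real_vec (walk \<omega> n)" for \<omega> :: "nat \<Rightarrow> int ^ 'n"
    let ?B = "{\<omega>. norm (real_vec (walk \<omega> n)) > K * real n powr (1 / \<alpha>)}"
    have B: "?B \<in> sets steps" by (rule sets_walk_pred)
    have int: "integrable steps (\<lambda>\<omega>. cis (u \<bullet> W \<omega>))" for u
      unfolding W_def by (rule integrable_bounded_steps[where B=1]) simp
    have pt: "norm (cis (s \<bullet> W \<omega>) - cis (t \<bullet> W \<omega>)) \<le> e / 2 + 2 * indicator ?B \<omega>" for \<omega>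
    proof (cases "\<omega> \<in> ?B")
      case True
      have "norm (cis (s \<bullet> W \<omega>) - cis (t \<bullet> W \<omega>)) \<le> 2"
        using norm_triangle_ineq4[of "cis (s \<bullet> W \<omega>)" "cis (t \<bullet> W \<omega>)"] by simp
      with True assms show ?thesis by simp
    next
      case False
      then have "norm (W \<omega>) \<le> real n powr (- 1 / \<alpha>) * (K * real n powr (1 / \<alpha>))"
        by (simp add: W_def mult_left_mono)
      also have "\<dots> = K"
        using n by (simp add: mult.left_commute[of _ K] flip: powr_add)
      finally have WK: "norm (W \<omega>) \<le> K" .
      have "norm (cis (s \<bullet> W \<omega>) - cis (t \<bullet> W \<omega>)) \<le> \<bar>s \<bullet> W \<omega> - t \<bullet> W \<omega>\<bar>"
        by (rule norm_cis_diff_le)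
      also have "\<dots> = \<bar>(s - t) \<bullet> W \<omega>\<bar>" by (simp add: inner_diff_left)
      also have "\<dots> \<le> norm (s - t) * norm (W \<omega>)" by (rule Cauchy_Schwarz_ineq2)
      also have "\<dots> \<le> e / (2 * K) * K"
        using st WK K(1) assms by (intro mult_mono) auto
      also have "\<dots> = e / 2" using K(1) by simp
      finally show ?thesis using False by simp
    qed
    have "scaled_char n s - scaled_char n t = (\<integral>\<omega>. cis (s \<bullet> W \<omega>) - cis (t \<bullet> W \<omega>) \<partial>steps)"
      using int by (simp add: scaled_char_def W_def scaled_walk_char[symmetric])
    also have "norm \<dots> \<le> (\<integral>\<omega>. norm (cis (s \<bullet> W \<omega>) - cis (t \<bullet> W \<omega>)) \<partial>steps)"
      by (rule integral_norm_bound)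
    also have "\<dots> \<le> (\<integral>\<omega>. e / 2 + 2 * indicator ?B \<omega> \<partial>steps)"
      using int pt B
      by (intro integral_mono integrable_norm Bochner_Integration.integrable_diff Bochner_Integration.integrable_add
          integrable_mult_right integrable_real_indicator) (auto simp: steps.P.emeasure_eq_measure)
    also have "\<dots> = e / 2 + 2 * measure steps ?B"
      using B steps.P.prob_space by (subst Bochner_Integration.integral_add) (auto simp: steps.P.emeasure_eq_measure)
    also have "\<dots> \<le> e" using K(2)[OF n] by simp
    finally show ?thesis .
  qed
  then show ?thesis using that[of "e / (2 * K)"] assms K(1) by simp
qed

text \<open>A frequency \<open>u\<close> is \<open>k powr (- 1 / \<alpha>)\<close> times a frequency
  which stays in the equicontinuity ball as long as \<open>k\<close> is at most of order
  \<open>norm u powr (- \<alpha>)\<close>. So all these powers of \<open>step_char u\<close> are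
  close to 1, and their number controls the distance of \<open>step_char u\<close> itself from
  1.\<close>

lemma step_char_near_one:
  obtains C d where "C > 0" "d > 0" "\<And>u. norm u \<le> d \<Longrightarrow> norm (1 - step_char u) \<le> C * norm u powr \<alpha>"
proof -
  obtain d where d: "d > 0" "\<And>n s t. n \<ge> 1 \<Longrightarrow> norm (s - t) \<le> d \<Longrightarrow> norm (scaled_char n s - scaled_char n t) \<le> 1/2"
    using scaled_char_equicontinuous[of "1/2"] by auto
  have "norm (1 - step_char u) \<le> 2 / d powr \<alpha> * norm u powr \<alpha>" if u: "norm u \<le> d" for u
  proof (cases "u = 0")
    case False
    define y where "y = (d / norm u) powr \<alpha>"
    have y1: "y \<ge> 1" unfolding y_def using u False index_pos d(1) by (intro ge_one_powr_ge_zero) (auto simp: field_simps)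
    define n where "n = nat \<lfloor>y\<rfloor>"
    have n: "n \<ge> 1" "real n \<le> y" "y \<le> 2 * real n"
    proof -
      have "1 \<le> \<lfloor>y\<rfloor>" using y1 by simp
      then have *: "real n = of_int \<lfloor>y\<rfloor>" "1 \<le> real_of_int \<lfloor>y\<rfloor>" by (simp_all add: n_def)
      then show "n \<ge> 1" "real n \<le> y" "y \<le> 2 * real n" by linarith+
    qed
    have "norm (step_char u ^ k - 1) \<le> 1/2" if k: "k \<le> n" for k
    proof (cases "k = 0")
      case False
      have "real k powr (1 / \<alpha>) \<le> y powr (1 / \<alpha>)"
        using k n index_pos by (intro powr_mono2) auto
      also have "\<dots> = d / norm u" unfolding y_def using d index_pos \<open>u \<noteq> 0\<close> by (simp add: powr_powr)
      finally have "norm (real k powr (1 / \<alpha>) *\<^sub>R u - 0) \<le> d"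
        using \<open>u \<noteq> 0\<close> by (simp add: field_simps)
      then have "norm (scaled_char k (real k powr (1 / \<alpha>) *\<^sub>R u) - scaled_char k 0) \<le> 1/2"
        using False by (intro d(2)) auto
      then show ?thesis using False by (simp add: scaled_char_def flip: powr_add)
    qed simp
    then have "norm (1 - step_char u) \<le> 1 / real n"
      by (rule near_one_of_powers_near_one[OF n(1)])
    also have "\<dots> \<le> 2 / y" using n y1 by (simp add: field_simps)
    also have "\<dots> = 2 / d powr \<alpha> * norm u powr \<alpha>"
      using d False by (simp add: y_def powr_divide)
    finally show ?thesis .
  qed simp
  then show ?thesis using d(1) that[of "2 / d powr \<alpha>" d] by simp
qed

text \<open>At each point of \<open>A\<close> the limit has modulus below 1. Equicontinuity spreads
  this over a ball whose radius does not depend on \<open>n\<close>, and compactness leaves finitely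
  many balls.\<close>

lemma scaled_char_away_from_one:
  assumes A: "compact A" "0 \<notin> A"
  obtains e N where "e > 0" "\<And>n u. n \<ge> N \<Longrightarrow> u \<in> A \<Longrightarrow> norm (scaled_char n u) \<le> 1 - e"
proof -
  have "\<exists>r e N. r > 0 \<and> e > 0 \<and> (\<forall>n\<ge>N. \<forall>s\<in>ball u r. norm (scaled_char n s) \<le> 1 - e)" if "u \<in> A" for u
  proof -
    have "u \<noteq> 0" using that A(2) by blast
    from limit_char[OF this] obtain z where z: "norm z < 1" "(\<lambda>n. scaled_char n u) \<longlonglongrightarrow> z"
      unfolding scaled_char_def by blast
    define e where "e = (1 - norm z) / 3"
    have e: "e > 0" using z by (simp add: e_def)
    have "(\<lambda>n. norm (scaled_char n u)) \<longlonglongrightarrow> norm z" using z(2) by (rule tendsto_norm)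
    then have "\<forall>\<^sub>F n in sequentially. norm (scaled_char n u) < norm z + e"
      using e by (intro order_tendstoD) auto
    then obtain N where N: "\<And>n. n \<ge> N \<Longrightarrow> norm (scaled_char n u) < norm z + e"
      by (auto simp: eventually_sequentially)
    obtain d where d: "d > 0" "\<And>n s t. n \<ge> 1 \<Longrightarrow> norm (s - t) \<le> d \<Longrightarrow> norm (scaled_char n s - scaled_char n t) \<le> e"
      using scaled_char_equicontinuous[OF e] by auto
    have "norm (scaled_char n s) \<le> 1 - e" if n: "n \<ge> max N 1" and s: "s \<in> ball u d" for n s
    proof -
      have "norm (scaled_char n s) \<le> norm (scaled_char n u) + norm (scaled_char n s - scaled_char n u)"
        using norm_triangle_sub by blast
      moreover have "norm (scaled_char n s - scaled_char n u) \<le> e"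
        using n s by (intro d(2)) (auto simp: dist_norm norm_minus_commute)
      ultimately show ?thesis using N[of n] n by (simp add: e_def field_simps)
    qed
    then show ?thesis using d(1) e by blast
  qed
  then obtain r e N where rN: "\<And>u. u \<in> A \<Longrightarrow> r u > 0" "\<And>u. u \<in> A \<Longrightarrow> e u > (0::real)"
      "\<And>u n s. u \<in> A \<Longrightarrow> n \<ge> N u \<Longrightarrow> s \<in> ball u (r u) \<Longrightarrow> norm (scaled_char n s) \<le> 1 - e u"
    by metis
  obtain D where D: "D \<subseteq> A" "finite D" "A \<subseteq> (\<Union>u\<in>D. ball u (r u))"
  proof (rule compactE_image[OF A(1), of A "\<lambda>u. ball u (r u)"])
    show "A \<subseteq> (\<Union>u\<in>A. ball u (r u))" using rN(1) by force
  qed auto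
  define e' where "e' = Min (insert 1 (e ` D))"
  define N' where "N' = Max (insert 0 (N ` D))"
  have "e' > 0" unfolding e'_def using D rN(2) by (subst Min_gr_iff) auto
  moreover have "norm (scaled_char n u) \<le> 1 - e'" if nu: "n \<ge> N'" "u \<in> A" for n u
  proof -
    obtain v where v: "v \<in> D" "u \<in> ball v (r v)" using D(3) nu(2) by auto
    have "N v \<le> N'" "e' \<le> e v" unfolding N'_def e'_def using D(2) v(1) by auto
    then show ?thesis using rN(3)[of v n u] v D(1) nu(1) by force
  qed
  ultimately show ?thesis using that by blast
qed

text \<open>With \<open>n\<close> about \<open>norm u powr (- \<alpha>)\<close> the rescaled
  frequency lies in a fixed annulus, so the \<open>n\<close>-th power of the modulus is at most
  \<open>1 - e\<close>. By Bernoulli's inequality the modulus itself is then at most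
  \<open>1 - e / n\<close>.\<close>

lemma one_minus_step_char_ge:
  obtains c d where "c > 0" "d > 0" "\<And>u. norm u \<le> d \<Longrightarrow> c * norm u powr \<alpha> \<le> 1 - norm (step_char u)"
proof -
  \<comment> \<open>The outer radius absorbs the rounding of \<open>norm u powr (- \<alpha>)\<close>
    to an integer, which at most doubles it.\<close>
  let ?A = "cball 0 (2 powr (1 / \<alpha>)) - ball 0 1 :: (real ^ 'n) set"
  have "compact ?A" by (intro compact_diff) auto
  then obtain e N where e: "e > 0" "\<And>n u. n \<ge> N \<Longrightarrow> u \<in> ?A \<Longrightarrow> norm (scaled_char n u) \<le> 1 - e"
    using scaled_char_away_from_one[of ?A] by auto
  \<comment> \<open>So small that the integer \<open>n\<close> chosen below is at least
    \<open>N\<close>.\<close>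
  define d where "d = real (N + 1) powr (- 1 / \<alpha>)"
  have d: "d > 0" "d \<le> 1" unfolding d_def using index_pos by (auto simp: powr_minus_divide ge_one_powr_ge_zero)
  have "e / 2 * norm u powr \<alpha> \<le> 1 - norm (step_char u)" if u: "norm u \<le> d" for u
  proof (cases "u = 0")
    case False
    define y where "y = norm u powr (- \<alpha>)"
    have "d powr (- \<alpha>) \<le> y" unfolding y_def using u False index_pos by (intro powr_mono2') auto
    then have yN: "y \<ge> real (N + 1)" unfolding d_def using index_pos by (simp add: powr_powr)
    define n where "n = nat \<lceil>y\<rceil>"
    have n: "n \<ge> N" "n \<ge> 1" "y \<le> real n" "real n \<le> 2 * y"
    proof -
      have "1 \<le> \<lceil>y\<rceil>" using yN by linarith
      then have *: "real n = of_int \<lceil>y\<rceil>" by (simp add: n_def)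
      then show "y \<le> real n" "real n \<le> 2 * y" "n \<ge> N" "n \<ge> 1" using yN by linarith+
    qed
    have y_inv: "y powr (1 / \<alpha>) = 1 / norm u"
      unfolding y_def powr_powr using index_pos False by (simp add: powr_minus_divide)
    have "1 \<le> real n powr (1 / \<alpha>) * norm u"
    proof -
      have "y powr (1 / \<alpha>) \<le> real n powr (1 / \<alpha>)" using n yN index_pos by (intro powr_mono2) auto
      then show ?thesis using False by (simp add: y_inv field_simps)
    qed
    moreover have "real n powr (1 / \<alpha>) * norm u \<le> 2 powr (1 / \<alpha>)"
    proof -
      have "real n powr (1 / \<alpha>) \<le> (2 * y) powr (1 / \<alpha>)" using n yN index_pos by (intro powr_mono2) auto
      also have "\<dots> = 2 powr (1 / \<alpha>) / norm u" using yN by (simp add: powr_mult y_inv)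
      finally show ?thesis using False by (simp add: field_simps)
    qed
    ultimately have "real n powr (1 / \<alpha>) *\<^sub>R u \<in> ?A" by simp
    from e(2)[OF n(1) this] have "norm (step_char u) ^ n \<le> 1 - e"
      using n(2) by (simp add: scaled_char_def norm_power flip: powr_add)
    moreover have "1 - e < norm (step_char u) ^ n" if less: "1 - e / real n < norm (step_char u)"
    proof (cases "e \<le> real n")
      case True
      have "1 - e = 1 + real n * (- e / real n)" using n(2) by simp
      also have "\<dots> \<le> (1 + (- e / real n)) ^ n"
        using True n(2) by (intro Bernoulli_inequality) (simp add: field_simps)
      also have "\<dots> < norm (step_char u) ^ n"
        using less True n(2) by (intro power_strict_mono) (auto simp: field_simps)
      finally show ?thesis .
    next
      case False
      then have "1 - e < 0" using n(2) by linarith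
      also have "0 \<le> norm (step_char u) ^ n" by simp
      finally show ?thesis .
    qed
    ultimately have "e / real n \<le> 1 - norm (step_char u)" by linarith
    moreover have "e / 2 * norm u powr \<alpha> \<le> e / real n"
    proof -
      have "norm u powr \<alpha> = 1 / y" by (simp add: y_def powr_minus_divide)
      moreover have "e / (2 * y) \<le> e / real n"
        using n e(1) yN by (intro divide_left_mono) auto
      ultimately show ?thesis by simp
    qed
    ultimately show ?thesis by linarith
  qed simp
  then show ?thesis using that[of "e / 2" d] e(1) d(1) by simp
qed

end

section \<open>Test laws for the frequencies\<close>

definition nonneg_char :: "real measure \<Rightarrow> bool" where
  "nonneg_char b \<longleftrightarrow> (\<forall>t. \<exists>r\<ge>0. char b t = complex_of_real r)"

lemma measurable_cis [measurable]: "cis \<in> borel_measurable borel"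
  by (intro borel_measurable_continuous_onI continuous_intros)

lemma measure_uniform_interval:
  fixes a :: real
  assumes "a > 0"
  shows "measure (uniform_measure lborel {-a..a}) {x..y} = (if max (-a) x \<le> min a y then (min a y - max (-a) x) / (2 * a) else 0)"
proof -
  have "{-a..a} \<inter> {x..y} = {max (-a) x..min a y}" by auto
  then show ?thesis using assms by (subst measure_uniform_measure) auto
qed

lemma prob_space_uniform_interval: "a > 0 \<Longrightarrow> prob_space (uniform_measure lborel {-a..a::real})"
  by (intro prob_space_uniform_measure) auto

text \<open>The law of the difference of two independent uniform variables on an interval of length
  \<open>d\<close>: its characteristic function is the squared modulus of that of the uniform law,
  and its density is bounded by \<open>1 / d\<close>.\<close>

lemma exists_nonneg_char_distribution:
  assumes "d > (0::real)"
  obtains b where "real_distribution b" "nonneg_char b" "AE x in b. \<bar>x\<bar> \<le> d"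
    "\<And>\<rho>. 0 \<le> \<rho> \<Longrightarrow> measure b {-\<rho>..\<rho>} \<le> 2 / d * \<rho>"
proof -
  define U where "U = uniform_measure lborel {-(d/2)..d/2::real}"
  have sU [measurable_cong, simp]: "sets U = sets borel" and spU [simp]: "space U = UNIV"
    by (simp_all add: U_def)
  interpret U: prob_space U unfolding U_def using assms by (intro prob_space_uniform_interval) auto
  interpret UU: pair_prob_space U U ..
  have msub: "(\<lambda>(x, y). x - y) \<in> borel_measurable (U \<Otimes>\<^sub>M U)" by measurable
  define b where "b = distr (U \<Otimes>\<^sub>M U) borel (\<lambda>(x, y). x - y)"
  have rd: "real_distribution b"
    unfolding b_def by (rule UU.real_distribution_distr[OF msub])
  have "\<exists>r\<ge>0. char b t = complex_of_real r" for t
  proof -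
    define D where "D = (\<integral>x. cis (t * x) \<partial>U)"
    have int: "integrable (U \<Otimes>\<^sub>M U) (\<lambda>z. cis (t * fst z) * cis (- (t * snd z)))"
      by (rule UU.integrable_const_bound[where B=1]) (auto simp: norm_mult)
    have "char b t = (\<integral>z. cis (t * fst z) * cis (- (t * snd z)) \<partial>(U \<Otimes>\<^sub>M U))"
      unfolding char_def b_def
      by (subst integral_distr[OF msub]) (auto simp: cis_mult cis_conv_exp[symmetric] right_diff_distrib split_beta' simp flip: of_real_mult of_real_diff)
    also have "\<dots> = (\<integral>x. \<integral>y. cis (t * x) * cis (- (t * y)) \<partial>U \<partial>U)"
      using UU.integral_fst'[OF int] by simp
    also have "\<dots> = D * (\<integral>y. cis (- (t * y)) \<partial>U)"
      by (simp add: D_def)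
    also have "(\<integral>y. cis (- (t * y)) \<partial>U) = cnj D"
      unfolding D_def by (simp add: cis_cnj[symmetric] del: cis_cnj)
    also have "D * cnj D = complex_of_real ((norm D)\<^sup>2)"
      by (simp add: complex_mult_cnj cmod_power2)
    finally show ?thesis by (intro exI[of _ "(norm D)\<^sup>2"]) simp
  qed
  then have nc: "nonneg_char b" by (simp add: nonneg_char_def)
  have AU: "AE x in U. \<bar>x\<bar> \<le> d / 2"
    unfolding U_def by (rule AE_uniform_measureI) auto
  have "AE z in U \<Otimes>\<^sub>M U. \<bar>fst z - snd z\<bar> \<le> d"
  proof (rule UU.AE_pair_measure)
    show "{z \<in> space (U \<Otimes>\<^sub>M U). \<bar>fst z - snd z\<bar> \<le> d} \<in> sets (U \<Otimes>\<^sub>M U)" by measurable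
    show "AE x in U. AE y in U. \<bar>fst (x, y) - snd (x, y)\<bar> \<le> d"
      using AU
    proof eventually_elim
      case (elim x)
      from AU show ?case by eventually_elim (use elim in auto)
    qed
  qed
  then have ae: "AE x in b. \<bar>x\<bar> \<le> d"
    unfolding b_def by (subst AE_distr_iff[OF msub]) (auto simp: split_beta')
  have "measure b {-\<rho>..\<rho>} \<le> 2 / d * \<rho>" if \<rho>: "0 \<le> \<rho>" for \<rho>
  proof -
    let ?A = "{z. \<bar>fst z - snd z\<bar> \<le> \<rho>}"
    have mA: "?A \<in> sets (U \<Otimes>\<^sub>M U)"
    proof -
      have "{z\<in>space (U \<Otimes>\<^sub>M U). \<bar>fst z - snd z\<bar> \<le> \<rho>} \<in> sets (U \<Otimes>\<^sub>M U)" by measurable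
      then show ?thesis by (simp add: space_pair_measure)
    qed
    have "emeasure b {-\<rho>..\<rho>} = emeasure (U \<Otimes>\<^sub>M U) ?A"
      unfolding b_def by (subst emeasure_distr[OF msub]) (auto simp: space_pair_measure intro!: arg_cong[where f="emeasure _"])
    also have "\<dots> = (\<integral>\<^sup>+x. emeasure U (Pair x -` ?A) \<partial>U)"
      by (rule U.emeasure_pair_measure_alt[OF mA])
    also have "\<dots> \<le> (\<integral>\<^sup>+x. ennreal (2 / d * \<rho>) \<partial>U)"
    proof (rule nn_integral_mono)
      fix x
      have "Pair x -` ?A = {x - \<rho>..x + \<rho>}" by auto
      then have "emeasure U (Pair x -` ?A) = ennreal (measure U {x - \<rho>..x + \<rho>})"
        by (simp add: U.emeasure_eq_measure)
      also have "measure U {x - \<rho>..x + \<rho>} \<le> 2 / d * \<rho>"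
      proof -
        have "min (d / 2) (x + \<rho>) - max (- (d / 2)) (x - \<rho>) \<le> 2 * \<rho>" by linarith
        from divide_right_mono[OF this, of d] show ?thesis
          unfolding U_def using measure_uniform_interval[of "d/2" "x - \<rho>" "x + \<rho>"] assms \<rho> by auto
      qed
      finally show "emeasure U (Pair x -` ?A) \<le> ennreal (2 / d * \<rho>)"
        by (simp add: ennreal_leI)
    qed
    also have "\<dots> = ennreal (2 / d * \<rho>)" using U.emeasure_space_1 by simp
    finally show ?thesis
      using assms \<rho>
      by (simp add: finite_measure.emeasure_eq_measure[OF prob_space.finite_measure[OF real_distribution.axioms(1)[OF rd]]])
  qed
  then show ?thesis using that rd nc ae by blast
qed

text \<open>Orthogonality of the integer frequencies: it makes averaging over uniform frequencies an
  exact inversion formula for return probabilities.\<close>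

lemma char_uniform_pi:
  "char (uniform_measure lborel {-pi..pi}) (of_int x) = (if x = 0 then 1 else 0)"
proof -
  let ?U = "uniform_measure lborel {-pi..pi}"
  interpret U: prob_space ?U by (intro prob_space_uniform_interval) simp
  show ?thesis
  proof (cases "x = 0")
    case True
    then show ?thesis using U.prob_space by (simp add: char_def)
  next
    case False
    have U_eq: "?U = density lborel (\<lambda>y. ennreal (indicator {-pi..pi} y / (2 * pi)))"
      unfolding uniform_measure_def using inverse_ennreal[of "2 * pi"]
      by (intro density_cong) (auto simp: indicator_def divide_ennreal_def inverse_eq_divide)
    have "char ?U (of_int x) = (\<integral>y. iexp (of_int x * y) \<partial>density lborel (\<lambda>y. ennreal (indicator {-pi..pi} y / (2 * pi))))"
      by (simp only: char_def U_eq)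
    also have "\<dots> = (\<integral>y. (indicator {-pi..pi} y / (2 * pi)) *\<^sub>R iexp (of_int x * y) \<partial>lborel)"
      by (subst integral_density) auto
    also have "\<dots> = complex_of_real (1 / (2 * pi)) * (\<integral>y. indicator {-pi..pi} y *\<^sub>R iexp (of_int x * y) \<partial>lborel)"
      by (subst integral_mult_right_zero[symmetric]) (auto simp: scaleR_conv_of_real intro!: Bochner_Integration.integral_cong)
    also have "(\<integral>y. indicator {-pi..pi} y *\<^sub>R iexp (of_int x * y) \<partial>lborel) =
        iexp (of_int x * pi) / (\<i> * of_int x) - iexp (of_int x * (- pi)) / (\<i> * of_int x)"
    proof (rule integral_FTC_atLeastAtMost)
      show "continuous_on {-pi..pi} (\<lambda>y. iexp (of_int x * y))"
        by (intro continuous_intros)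
      show "((\<lambda>y. iexp (of_int x * y) / (\<i> * of_int x)) has_vector_derivative iexp (of_int x * y)) (at y within {-pi..pi})" for y
        using False by (auto intro!: derivative_eq_intros has_vector_derivative_real_field simp: field_simps)
    qed simp
    also have "iexp (of_int x * pi) = iexp (of_int x * (- pi))"
    proof -
      have "iexp (of_int x * pi) = cis (of_int x * pi)" by (simp add: cis_conv_exp)
      also have "\<dots> = cis (of_int x * (- pi))"
        by (simp add: complex_eq_iff sin_times_pi_eq_0)
      finally show ?thesis by (simp add: cis_conv_exp)
    qed
    finally show ?thesis using False by simp
  qed
qed

context lattice_walk
begin

abbreviation frequencies :: "real measure \<Rightarrow> ('n \<Rightarrow> real) measure" where
  "frequencies b \<equiv> \<Pi>\<^sub>M i\<in>UNIV. b"

context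
  fixes b :: "real measure"
  assumes b: "real_distribution b"
begin

interpretation b: real_distribution b by (rule b)

interpretation F: product_sigma_finite "\<lambda>_::'n. b" ..

interpretation FP: finite_product_prob_space "\<lambda>_::'n. b" UNIV
  by unfold_locales simp

lemma measurable_frequency: "(\<lambda>\<tau>. \<tau> i) \<in> borel_measurable (frequencies b)"
proof -
  have "(\<lambda>\<tau>. \<tau> i) \<in> frequencies b \<rightarrow>\<^sub>M b" by (rule measurable_component_singleton) simp
  then show ?thesis by (simp cong: measurable_cong_sets)
qed

lemma prob_space_frequencies: "prob_space (frequencies b)"
  by (rule prob_space_PiM) (rule b.prob_space_axioms)

lemma frequencies_char:
  "(\<integral>\<tau>. cis ((\<chi> i. \<tau> i) \<bullet> real_vec x) \<partial>(frequencies b)) = (\<Prod>i\<in>UNIV. char b (of_int (x $ i)))"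
proof -
  have "(\<integral>\<tau>. cis ((\<chi> i. \<tau> i) \<bullet> real_vec x) \<partial>(frequencies b)) =
      (\<integral>\<tau>. (\<Prod>i\<in>UNIV. iexp (of_int (x $ i) * \<tau> i)) \<partial>(frequencies b))"
    by (simp add: inner_vec_def real_vec_def cis_conv_exp sum_distrib_left exp_sum[symmetric] mult.commute mult.left_commute)
  also have "\<dots> = (\<Prod>i\<in>UNIV. \<integral>y. iexp (of_int (x $ i) * y) \<partial>b)"
    by (rule F.product_integral_prod) (auto intro!: b.integrable_iexp)
  finally show ?thesis by (simp add: char_def)
qed

lemma measurable_frequency_walk:
  "(\<lambda>z. cis ((\<chi> i. fst z i) \<bullet> real_vec (walk (snd z) k))) \<in> borel_measurable (frequencies b \<Otimes>\<^sub>M steps)"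
proof -
  have [measurable]: "(\<lambda>z. fst z i) \<in> borel_measurable (frequencies b \<Otimes>\<^sub>M steps)" for i :: 'n
    by (rule measurable_compose[OF measurable_fst measurable_frequency])
  have [measurable]: "(\<lambda>z. real_of_int (walk (snd z) k $ i)) \<in> borel_measurable (frequencies b \<Otimes>\<^sub>M steps)" for i :: 'n
    by (rule measurable_compose[OF measurable_snd measurable_compose[OF measurable_walk]]) simp
  show ?thesis unfolding inner_vec_def real_vec_def by simp measurable
qed

lemma measurable_frequency_char: "(\<lambda>\<tau>. step_char (\<chi> i. \<tau> i)) \<in> borel_measurable (frequencies b)"
proof -
  have "(\<lambda>\<tau>. \<integral>\<omega>. cis ((\<chi> i. \<tau> i) \<bullet> real_vec (walk \<omega> 1)) \<partial>steps) \<in> borel_measurable (frequencies b)"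
    using measurable_frequency_walk[of 1] by (intro steps.P.borel_measurable_lebesgue_integral) (simp add: split_beta')
  then show ?thesis by (simp only: walk_char power_one_right)
qed

lemma integrable_frequency_char: "integrable (frequencies b) (\<lambda>\<tau>. step_char (\<chi> i. \<tau> i) ^ k)"
  by (rule finite_measure.integrable_const_bound[OF prob_space.finite_measure[OF prob_space_frequencies], where B=1])
    (auto simp: norm_power power_le_one norm_step_char_le intro!: borel_measurable_power measurable_frequency_char)

text \<open>Parseval's relation, by Fubini: a power of the step characteristic function averaged
  over frequencies is a test function averaged over the walk. Both bounds on the Green function
  start here, with different laws \<open>b\<close>.\<close>

lemma integral_frequency_char:
  "(\<integral>\<tau>. step_char (\<chi> i. \<tau> i) ^ k \<partial>(frequencies b)) =
   (\<integral>\<omega>. (\<Prod>i\<in>UNIV. char b (of_int (walk \<omega> k $ i))) \<partial>steps)"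
proof -
  interpret FR: prob_space "frequencies b" by (rule prob_space_frequencies)
  interpret P: pair_prob_space "frequencies b" steps ..
  have int: "integrable (frequencies b \<Otimes>\<^sub>M steps) (\<lambda>(\<tau>, \<omega>). cis ((\<chi> i. \<tau> i) \<bullet> real_vec (walk \<omega> k)))"
    using measurable_frequency_walk[of k]
    by (intro P.integrable_const_bound[where B=1]) (simp_all add: split_beta')
  have "(\<integral>\<tau>. step_char (\<chi> i. \<tau> i) ^ k \<partial>(frequencies b)) =
      (\<integral>\<tau>. \<integral>\<omega>. cis ((\<chi> i. \<tau> i) \<bullet> real_vec (walk \<omega> k)) \<partial>steps \<partial>(frequencies b))"
    by (simp only: walk_char)
  also have "\<dots> = (\<integral>\<omega>. \<integral>\<tau>. cis ((\<chi> i. \<tau> i) \<bullet> real_vec (walk \<omega> k)) \<partial>(frequencies b) \<partial>steps)"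
    by (rule P.Fubini_integral[OF int, symmetric])
  finally show ?thesis by (simp only: frequencies_char)
qed

lemma frequency_box:
  shows "measure (frequencies b) {\<tau>. \<forall>i. \<bar>\<tau> i\<bar> \<le> \<rho>} = measure b {-\<rho>..\<rho>} ^ CARD('n)"
    and "{\<tau>. \<forall>i. \<bar>\<tau> i\<bar> \<le> \<rho>} \<in> sets (frequencies b)"
proof -
  have eq: "{\<tau>. \<forall>i. \<bar>\<tau> i\<bar> \<le> \<rho>} = (\<Pi>\<^sub>E i\<in>UNIV. {-\<rho>..\<rho>})"
    by (auto simp: PiE_def Pi_def abs_le_iff minus_le_iff[of "_ _" \<rho>])
  show "measure (frequencies b) {\<tau>. \<forall>i. \<bar>\<tau> i\<bar> \<le> \<rho>} = measure b {-\<rho>..\<rho>} ^ CARD('n)"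
    unfolding eq by (subst FP.finite_measure_PiM_emb) auto
  show "{\<tau>. \<forall>i. \<bar>\<tau> i\<bar> \<le> \<rho>} \<in> sets (frequencies b)"
    unfolding eq by (rule sets_PiM_I_finite) auto
qed

end

end

text \<open>The sum is at most \<open>n + 1\<close> and at most \<open>1 / (1 - x)\<close>, and the
  smaller of these is controlled by the number of \<open>k\<close> in \<open>1..n\<close> with
  \<open>k * s \<le> 1\<close>. In the form of a count the bound can be averaged over a random
  \<open>s\<close> term by term.\<close>

lemma geometric_sum_le:
  fixes x s c :: real
  assumes x: "0 \<le> x" and c: "0 < c" "c \<le> 1" and s: "0 \<le> s" "c * s \<le> 1 - x"
  shows "(\<Sum>k\<le>n. x ^ k) \<le> (1 + real (card {k\<in>{1..n}. real k * s \<le> 1})) / c"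
proof -
  let ?J = "{k\<in>{1..n}. real k * s \<le> 1}"
  have x1: "x \<le> 1" using s c by (smt (verit) mult_nonneg_nonneg)
  show ?thesis
  proof (cases "?J = {1..n}")
    case True
    have "(\<Sum>k\<le>n. x ^ k) \<le> (\<Sum>k\<le>n. 1)"
      using x x1 by (intro sum_mono power_le_one) auto
    also have "\<dots> = 1 + real n" by simp
    also have "\<dots> \<le> (1 + real n) / c"
      using c mult_right_mono[of c 1 "1 + real n"] by (simp add: pos_le_divide_eq mult.commute)
    finally show ?thesis using True by simp
  next
    case False
    define j where "j = card ?J"
    have "?J \<subset> {1..n}" using False by auto
    then have "j < n" unfolding j_def using psubset_card_mono[of "{1..n}" ?J] by simp
    \<comment> \<open>The condition is inherited by smaller indices, so the set consists of the
      first \<open>j\<close> of them and \<open>j + 1\<close> violates it.\<close>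
    have "1 < real (j + 1) * s"
    proof (rule ccontr)
      assume "\<not> 1 < real (j + 1) * s"
      then have le: "real (j + 1) * s \<le> 1" by simp
      have "{1..j+1} \<subseteq> ?J"
      proof
        fix k assume k: "k \<in> {1..j+1}"
        then have "real k * s \<le> real (j + 1) * s" using s by (intro mult_right_mono) auto
        then show "k \<in> ?J" using le k \<open>j < n\<close> by auto
      qed
      then have "j + 1 \<le> j" unfolding j_def using card_mono[of ?J "{1..card ?J + 1}"] by simp
      then show False by simp
    qed
    then have s0: "s > 0" using s by (cases "s = 0") auto
    then have "0 < c * s" using c by simp
    then have xs: "x < 1" using s by linarith
    have "(1 - x) * (\<Sum>k\<le>n. x ^ k) = 1 - x ^ Suc n"
      using one_diff_power_eq[of x "Suc n"] by (simp add: lessThan_Suc_atMost)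
    also have "\<dots> \<le> 1" using x by simp
    finally have "(\<Sum>k\<le>n. x ^ k) \<le> 1 / (1 - x)" using xs by (simp add: field_simps)
    also have "\<dots> \<le> 1 / (c * s)" using s \<open>0 < c * s\<close> by (intro divide_left_mono) auto
    also have "\<dots> \<le> (1 + real j) / c"
      using \<open>1 < real (j + 1) * s\<close> s0 c by (simp add: field_simps)
    finally show ?thesis by (simp add: j_def)
  qed
qed

context attracted_walk
begin

text \<open>By positivity of the test law, \<open>hit k 0\<close> is at most the mean of the
  \<open>k\<close>-th power of the modulus of \<open>step_char\<close>. The sum over
  \<open>k\<close> is geometric with ratio at most \<open>1 - c * norm u powr \<alpha>\<close>,
  hence bounded by a count of the \<open>k\<close> for which the frequency lies in a box of side of
  order \<open>k powr (- 1 / \<alpha>)\<close>. The probability of this box gives the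
  summand.\<close>

lemma green_le:
  obtains C where "C > 0" "\<And>n. green n \<le> C * (1 + (\<Sum>k=1..n. real k powr (- real CARD('n) / \<alpha>)))"
proof -
  obtain c0 d where cd: "c0 > 0" "d > 0" "\<And>u. norm u \<le> d \<Longrightarrow> c0 * norm u powr \<alpha> \<le> 1 - norm (step_char u)"
    using one_minus_step_char_ge by blast
  define c where "c = min c0 1"
  have c: "c > 0" "c \<le> 1" using cd(1) by (auto simp: c_def)
  have cu: "c * norm u powr \<alpha> \<le> 1 - norm (step_char u)" if "norm u \<le> d" for u
    using cd(3)[OF that] mult_right_mono[of c c0 "norm u powr \<alpha>"] by (simp add: c_def)
  \<comment> \<open>Dividing by the dimension bounds the sum of the moduli of the coordinates, and
    with it the norm of the frequency, by \<open>d\<close>.\<close>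
  obtain b where b: "real_distribution b" and nc: "nonneg_char b" and ae: "AE x in b. \<bar>x\<bar> \<le> d / CARD('n)"
    and box: "\<And>\<rho>. 0 \<le> \<rho> \<Longrightarrow> measure b {-\<rho>..\<rho>} \<le> 2 / (d / CARD('n)) * \<rho>"
    using exists_nonneg_char_distribution[of "d / CARD('n)"] cd(2) by auto
  interpret b: real_distribution b by (rule b)
  define K where "K = 2 / (d / CARD('n))"
  have K: "K > 0" using cd(2) by (simp add: K_def)
  let ?F = "frequencies b"
  interpret F: prob_space ?F by (rule prob_space_frequencies[OF b])
  let ?phi = "\<lambda>\<tau>. step_char (\<chi> i. \<tau> i)"
  let ?B = "\<lambda>k. {\<tau>::'n \<Rightarrow> real. \<forall>i. \<bar>\<tau> i\<bar> \<le> real k powr (- 1 / \<alpha>)}"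
  have mphi: "integrable ?F (\<lambda>\<tau>. norm (?phi \<tau>) ^ k)" for k
    using integrable_norm[OF integrable_frequency_char[OF b, of k]] by (simp add: norm_power)
  have hit_le: "hit k 0 \<le> (\<integral>\<tau>. norm (?phi \<tau>) ^ k \<partial>?F)" for k
  proof -
    define Q where "Q \<omega> = (\<Prod>i\<in>UNIV. char b (of_int (walk \<omega> k $ i)))" for \<omega> :: "nat \<Rightarrow> int ^ 'n"
    have Q_le: "norm (Q \<omega>) \<le> 1" for \<omega>
      unfolding Q_def prod_norm[symmetric] by (intro prod_le_1) (auto simp: b.cmod_char_le_1)
    have int: "integrable steps Q"
    proof (rule steps.P.integrable_const_bound[where B=1])
      show "Q \<in> borel_measurable steps"
        unfolding Q_def by (rule measurable_compose[OF measurable_walk]) simp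
    qed (simp add: Q_le)
    \<comment> \<open>\<open>Q\<close> is the test function at the position of the walk: real,
      nonnegative, and equal to 1 at the origin.\<close>
    have QR: "indicator {\<omega>. walk \<omega> k = 0} \<omega> \<le> Re (Q \<omega>)" for \<omega>
    proof -
      have "\<exists>r\<ge>0. Q \<omega> = complex_of_real r"
      proof -
        obtain r where r: "\<And>t. r t \<ge> 0" "\<And>t. char b t = complex_of_real (r t)"
          using nc unfolding nonneg_char_def by metis
        then show ?thesis unfolding Q_def by (intro exI[of _ "\<Prod>i\<in>UNIV. r (of_int (walk \<omega> k $ i))"]) (auto intro: prod_nonneg)
      qed
      moreover have "Q \<omega> = 1" if "walk \<omega> k = 0"
        unfolding Q_def that using b.char_zero by simp
      ultimately show ?thesis by (auto simp: indicator_def)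
    qed
    have "hit k 0 = (\<integral>\<omega>. indicator {\<omega>. walk \<omega> k = 0} \<omega> \<partial>steps)"
      using sets_walk_eq[of k 0] by (simp add: hit_def steps.P.emeasure_eq_measure)
    also have "\<dots> \<le> (\<integral>\<omega>. Re (Q \<omega>) \<partial>steps)"
      using int QR sets_walk_eq[of k 0]
      by (intro integral_mono integrable_Re integrable_real_indicator) (auto simp: steps.P.emeasure_eq_measure)
    also have "\<dots> = Re (\<integral>\<tau>. ?phi \<tau> ^ k \<partial>?F)"
    proof -
      have "(\<integral>\<tau>. ?phi \<tau> ^ k \<partial>?F) = (\<integral>\<omega>. Q \<omega> \<partial>steps)"
        unfolding Q_def by (rule integral_frequency_char[OF b])
      then show ?thesis using int by simp
    qed
    also have "\<dots> \<le> norm (\<integral>\<tau>. ?phi \<tau> ^ k \<partial>?F)" by (rule complex_Re_le_cmod)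
    also have "\<dots> \<le> (\<integral>\<tau>. norm (?phi \<tau> ^ k) \<partial>?F)" by (rule integral_norm_bound)
    finally show ?thesis by (simp add: norm_power)
  qed
  have "AE \<tau> in ?F. \<forall>i\<in>UNIV. \<bar>\<tau> i\<bar> \<le> d / CARD('n)"
    using ae by (intro eventually_ball_finite ballI AE_PiM_component b.prob_space_axioms) auto
  then have ae_norm: "AE \<tau> in ?F. norm ((\<chi> i. \<tau> i) :: real ^ 'n) \<le> d"
  proof eventually_elim
    case (elim \<tau>)
    have "norm ((\<chi> i. \<tau> i) :: real ^ 'n) \<le> (\<Sum>i\<in>UNIV. \<bar>\<tau> i\<bar>)"
      using norm_le_l1_cart[of "(\<chi> i. \<tau> i) :: real ^ 'n"] by simp
    also have "\<dots> \<le> (\<Sum>i\<in>(UNIV::'n set). d / CARD('n))" using elim by (intro sum_mono) auto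
    finally show ?case by simp
  qed
  have pt: "(\<Sum>k\<le>n. norm (?phi \<tau>) ^ k) \<le> (1 + (\<Sum>k=1..n. indicator (?B k) \<tau>)) / c"
    if "norm ((\<chi> i. \<tau> i) :: real ^ 'n) \<le> d" for \<tau> n
  proof -
    define v :: "real ^ 'n" where "v = (\<chi> i. \<tau> i)"
    have "(\<Sum>k\<le>n. norm (step_char v) ^ k) \<le> (1 + real (card {k\<in>{1..n}. real k * norm v powr \<alpha> \<le> 1})) / c"
      using cu[of v] that c by (intro geometric_sum_le) (auto simp: v_def)
    also have "card {k\<in>{1..n}. real k * norm v powr \<alpha> \<le> 1} \<le> card {k\<in>{1..n}. \<tau> \<in> ?B k}"
    proof (intro card_mono subsetI)
      fix k assume k: "k \<in> {k\<in>{1..n}. real k * norm v powr \<alpha> \<le> 1}"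
      then have "norm v powr \<alpha> \<le> real k powr (- 1)" by (simp add: powr_minus_divide field_simps)
      then have "(norm v powr \<alpha>) powr (1 / \<alpha>) \<le> (real k powr (- 1)) powr (1 / \<alpha>)"
        using index_pos by (intro powr_mono2) auto
      then have "norm v \<le> real k powr (- 1 / \<alpha>)"
        using index_pos unfolding powr_powr by simp
      moreover have "\<bar>\<tau> i\<bar> \<le> norm v" for i
        using component_le_norm_cart[of v i] by (simp add: v_def)
      ultimately show "k \<in> {k\<in>{1..n}. \<tau> \<in> ?B k}" using k by (auto intro: order_trans)
    qed simp
    also have "real (card {k\<in>{1..n}. \<tau> \<in> ?B k}) = (\<Sum>k=1..n. indicator (?B k) \<tau>)"
    proof -
      have "{k\<in>{1..n}. \<tau> \<in> ?B k} = {1..n} \<inter> {k. \<tau> \<in> ?B k}" by auto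
      then show ?thesis by (simp only: indicator_def of_bool_def sum.If_cases finite_atLeastAtMost) simp
    qed
    finally show ?thesis using c by (simp add: v_def divide_right_mono)
  qed
  have mB: "?B k \<in> sets ?F" for k by (rule frequency_box(2)[OF b])
  have prB: "measure ?F (?B k) \<le> K ^ CARD('n) * real k powr (- real CARD('n) / \<alpha>)" if "k \<ge> 1" for k
  proof -
    have "measure ?F (?B k) \<le> (K * real k powr (- 1 / \<alpha>)) ^ CARD('n)"
      unfolding frequency_box(1)[OF b] K_def by (intro power_mono box) auto
    also have "\<dots> = K ^ CARD('n) * real k powr (- real CARD('n) / \<alpha>)"
      using that by (simp add: power_mult_distrib powr_power)
    finally show ?thesis .
  qed
  define C where "C = (1 + K ^ CARD('n)) / c"
  have "green n \<le> C * (1 + (\<Sum>k=1..n. real k powr (- real CARD('n) / \<alpha>)))" for n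
  proof -
    have "green n \<le> (\<Sum>k\<le>n. \<integral>\<tau>. norm (?phi \<tau>) ^ k \<partial>?F)"
      unfolding green_def by (intro sum_mono hit_le)
    also have "\<dots> = (\<integral>\<tau>. (\<Sum>k\<le>n. norm (?phi \<tau>) ^ k) \<partial>?F)"
      by (rule Bochner_Integration.integral_sum[symmetric]) (rule mphi)
    also have "\<dots> \<le> (\<integral>\<tau>. (1 + (\<Sum>k=1..n. indicator (?B k) \<tau>)) / c \<partial>?F)"
    proof (rule integral_mono_AE)
      show "integrable ?F (\<lambda>\<tau>. \<Sum>k\<le>n. norm (?phi \<tau>) ^ k)"
        by (intro Bochner_Integration.integrable_sum mphi)
      show "integrable ?F (\<lambda>\<tau>. (1 + (\<Sum>k=1..n. indicator (?B k) \<tau>)) / c)"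
        using mB by (intro integrable_divide Bochner_Integration.integrable_add Bochner_Integration.integrable_sum
            integrable_real_indicator) (auto simp: F.emeasure_eq_measure)
      show "AE \<tau> in ?F. (\<Sum>k\<le>n. norm (?phi \<tau>) ^ k) \<le> (1 + (\<Sum>k=1..n. indicator (?B k) \<tau>)) / c"
        using ae_norm by eventually_elim (rule pt)
    qed
    also have "\<dots> = (1 + (\<Sum>k=1..n. measure ?F (?B k))) / c"
    proof -
      have "(\<integral>\<tau>. 1 + (\<Sum>k=1..n. indicator (?B k) \<tau>) \<partial>?F) = 1 + (\<Sum>k=1..n. measure ?F (?B k))"
        using mB F.prob_space
        by (subst Bochner_Integration.integral_add) (auto simp: F.emeasure_eq_measure)
      then show ?thesis by simp
    qed
    also have "\<dots> \<le> (1 + (\<Sum>k=1..n. K ^ CARD('n) * real k powr (- real CARD('n) / \<alpha>))) / c"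
      using c prB by (intro divide_right_mono add_left_mono sum_mono) auto
    also have "\<dots> \<le> C * (1 + (\<Sum>k=1..n. real k powr (- real CARD('n) / \<alpha>)))"
    proof -
      define s where "s = (\<Sum>k=1..n. real k powr (- real CARD('n) / \<alpha>))"
      have "s \<ge> 0" unfolding s_def by (intro sum_nonneg) auto
      moreover have "K ^ CARD('n) \<ge> 0" using K by simp
      ultimately have "1 + K ^ CARD('n) * s \<le> (1 + K ^ CARD('n)) * (1 + s)"
        by (simp add: algebra_simps)
      then show ?thesis using c unfolding s_def C_def by (simp add: sum_distrib_left[symmetric] divide_right_mono)
    qed
    finally show ?thesis .
  qed
  moreover have "C > 0" unfolding C_def using c K by (simp add: add_pos_nonneg)
  ultimately show ?thesis using that by blast
qed

end

section \<open>Lower bound on the Green function through the resolvent\<close>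

lemma Re_resolvent:
  fixes z :: complex
  shows "Re (1 / (1 - z)) = (1 - Re z) / (norm (1 - z))\<^sup>2"
  by (simp add: Re_divide cmod_power2)

text \<open>The truncation error of the geometric series is uniform in \<open>z\<close>, so it can
  be subtracted before averaging over frequencies and sent to zero afterwards.\<close>

lemma Re_geometric_sum_ge:
  fixes z :: complex
  assumes "norm z \<le> r" "r < 1"
  shows "Re (1 / (1 - z)) - r ^ N / (1 - r) \<le> Re (\<Sum>k<N. z ^ k)"
proof -
  have r0: "0 \<le> r" using assms(1) norm_ge_zero order_trans by blast
  have z1: "z \<noteq> 1" using assms by auto
  have n1: "1 - r \<le> norm (1 - z)"
    using norm_triangle_ineq2[of 1 z] assms(1) by simp
  have "(\<Sum>k<N. z ^ k) = 1 / (1 - z) - z ^ N / (1 - z)"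
    using z1 one_diff_power_eq[of z N] by (simp add: field_simps)
  then have "Re (\<Sum>k<N. z ^ k) = Re (1 / (1 - z)) - Re (z ^ N / (1 - z))"
    by (simp only: minus_complex.sel)
  moreover have "Re (z ^ N / (1 - z)) \<le> norm (z ^ N / (1 - z))" by (rule complex_Re_le_cmod)
  moreover have "norm (z ^ N / (1 - z)) \<le> r ^ N / (1 - r)"
    unfolding norm_divide norm_power using assms n1 r0
    by (intro frac_le power_mono) auto
  ultimately show ?thesis by linarith
qed

context attracted_walk
begin

text \<open>At the discount \<open>r = 1 - 1 / n\<close> the discounted Green function is, up to
  truncation, the mean real part of the resolvent. This is nonnegative, and for small
  \<open>v\<close> both \<open>1 - Re z\<close> and \<open>norm (1 - z)\<close> are of order
  \<open>(1 - r) + norm v powr \<alpha>\<close>, so it is at least of the order of the inverse of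
  that quantity, which again dominates a count of boxes.\<close>

lemma green_ge:
  obtains c where "c > 0" "\<And>n. n \<ge> 2 \<Longrightarrow> c * (\<Sum>k=1..n. real k powr (- real CARD('n) / \<alpha>)) \<le> green n"
proof -
  obtain c0 d0 where cd: "c0 > 0" "d0 > 0" "\<And>u. norm u \<le> d0 \<Longrightarrow> c0 * norm u powr \<alpha> \<le> 1 - norm (step_char u)"
    using one_minus_step_char_ge by blast
  obtain C0 d1 where Cd: "C0 > 0" "d1 > 0" "\<And>u. norm u \<le> d1 \<Longrightarrow> norm (1 - step_char u) \<le> C0 * norm u powr \<alpha>"
    using step_char_near_one by blast
  define d where "d = min 1 (min d0 d1)"
  have d: "0 < d" "d \<le> 1" "d \<le> d0" "d \<le> d1" using cd Cd by (auto simp: d_def)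
  define c1 where "c1 = min 1 (c0 / 2)"
  define C1 where "C1 = max 1 C0"
  have c1: "c1 > 0" "c1 \<le> 1" "c1 \<le> c0 / 2" and C1: "C1 \<ge> 1" "C1 \<ge> C0" using cd by (auto simp: c1_def C1_def)
  define c3 where "c3 = c1 / (2 * C1\<^sup>2)"
  have c3: "c3 > 0" using c1 C1 by (simp add: c3_def)
  let ?D = "real CARD('n)"
  define b where "b = uniform_measure lborel {-pi..pi}"
  interpret b: prob_space b unfolding b_def by (rule prob_space_uniform_interval) simp
  have b: "real_distribution b"
    by (intro real_distribution.intro b.prob_space_axioms real_distribution_axioms.intro) (simp_all add: b_def)
  let ?F = "frequencies b"
  interpret F: prob_space ?F by (rule prob_space_frequencies[OF b])
  let ?phi = "\<lambda>\<tau>. step_char (\<chi> i. \<tau> i)"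
  \<comment> \<open>In a box with this half-side the norm of the frequency is at most
    \<open>d * k powr (- 1 / \<alpha>)\<close>, hence within reach of both estimates of
    \<open>step_char\<close>.\<close>
  define \<rho> where "\<rho> k = d * real k powr (- 1 / \<alpha>) / ?D" for k :: nat
  let ?B = "\<lambda>k. {\<tau>::'n \<Rightarrow> real. \<forall>i. \<bar>\<tau> i\<bar> \<le> \<rho> k}"
  have mB: "?B k \<in> sets ?F" for k by (rule frequency_box(2)[OF b])
  have hit: "complex_of_real (hit k 0) = (\<integral>\<tau>. ?phi \<tau> ^ k \<partial>?F)" for k
  proof -
    have "(\<Prod>i\<in>UNIV. char b (of_int (x $ i))) = complex_of_real (indicator {0} x)" for x :: "int ^ 'n"
    proof (cases "x = 0")
      case False
      then obtain i where "x $ i \<noteq> 0" by (auto simp: vec_eq_iff)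
      then have "char b (of_int (x $ i)) = 0" unfolding b_def by (simp only: char_uniform_pi) simp
      with False show ?thesis by (auto intro!: prod_zero)
    qed (simp add: b_def char_uniform_pi[of 0, simplified])
    then have "(\<integral>\<tau>. ?phi \<tau> ^ k \<partial>?F) = (\<integral>\<omega>. complex_of_real (indicator {0} (walk \<omega> k)) \<partial>steps)"
      by (simp only: integral_frequency_char[OF b])
    also have "\<dots> = complex_of_real (\<integral>\<omega>. indicator {\<omega>. walk \<omega> k = 0} \<omega> \<partial>steps)"
      by (subst integral_complex_of_real[symmetric]) (auto simp: indicator_def intro!: Bochner_Integration.integral_cong)
    also have "(\<integral>\<omega>. indicator {\<omega>. walk \<omega> k = 0} \<omega> \<partial>steps) = hit k 0"
      using sets_walk_eq[of k 0] by (simp add: hit_def steps.P.emeasure_eq_measure)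
    finally show ?thesis by simp
  qed
  have pt: "c3 * (\<Sum>k=1..n. indicator (?B k) \<tau>) \<le> Re (1 / (1 - complex_of_real (1 - 1 / real n) * ?phi \<tau>))"
    if n: "n \<ge> 2" for n \<tau>
  proof -
    define r where "r = 1 - 1 / real n"
    have r: "1/2 \<le> r" "r < 1" using n by (auto simp: r_def field_simps)
    define v :: "real ^ 'n" where "v = (\<chi> i. \<tau> i)"
    define z where "z = complex_of_real r * step_char v"
    define s where "s = norm v powr \<alpha>"
    have Rephi: "Re (step_char v) \<le> norm (step_char v)" by (rule complex_Re_le_cmod)
    have Rez: "Re z = r * Re (step_char v)" by (simp add: z_def)
    define J where "J = {k\<in>{1..n}. \<tau> \<in> ?B k}"
    have sumJ: "(\<Sum>k=1..n. indicator (?B k) \<tau>) = real (card J)"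
    proof -
      have "J = {1..n} \<inter> {k. \<tau> \<in> ?B k}" by (auto simp: J_def)
      then show ?thesis by (simp only: indicator_def of_bool_def sum.If_cases finite_atLeastAtMost) simp
    qed
    have "c3 * real (card J) \<le> Re (1 / (1 - z))"
    proof (cases "J = {}")
      case True
      have "r * Re (step_char v) \<le> 1 * 1"
      proof -
        have "r * Re (step_char v) \<le> r * 1"
          using r Rephi norm_step_char_le[of v] by (intro mult_left_mono) linarith+
        then show ?thesis using r by linarith
      qed
      then have "Re (1 / (1 - z)) \<ge> 0" unfolding Re_resolvent Rez by simp
      with True show ?thesis by simp
    next
      case False
      have finJ: "finite J" by (simp add: J_def)
      \<comment> \<open>The largest index whose box contains the frequency: it dominates
        \<open>card J\<close> and carries the sharpest bound on the norm.\<close>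
      define k where "k = Max J"
      have kJ: "k \<in> J" unfolding k_def using finJ False by simp
      have "J \<subseteq> {1..k}" using finJ by (auto simp: k_def J_def)
      then have cardJ: "card J \<le> k" using card_mono[of "{1..k}" J] by simp
      have cJ0: "card J > 0" using finJ False by (simp add: card_gt_0_iff)
      have k: "1 \<le> k" "k \<le> n" and kB: "\<And>i. \<bar>\<tau> i\<bar> \<le> \<rho> k" using kJ by (auto simp: J_def)
      have "norm v \<le> (\<Sum>i\<in>UNIV. \<bar>\<tau> i\<bar>)"
        using norm_le_l1_cart[of v] by (simp add: v_def)
      also have "\<dots> \<le> (\<Sum>i\<in>(UNIV::'n set). \<rho> k)" using kB by (intro sum_mono) auto
      also have "\<dots> = d * real k powr (- 1 / \<alpha>)" by (simp add: \<rho>_def)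
      finally have vk: "norm v \<le> d * real k powr (- 1 / \<alpha>)" .
      have "real k powr (- 1 / \<alpha>) \<le> 1"
        using k index_pos by (simp add: powr_minus_divide ge_one_powr_ge_zero)
      then have "norm v \<le> d" using vk d mult_left_le[of "real k powr (- 1 / \<alpha>)" d] by linarith
      have "norm v \<le> real k powr (- 1 / \<alpha>)"
        using vk d mult_left_le_one_le[of "real k powr (- 1 / \<alpha>)" d] by simp
      then have "s \<le> (real k powr (- 1 / \<alpha>)) powr \<alpha>"
        unfolding s_def using index_pos by (intro powr_mono2) auto
      also have "\<dots> = 1 / real k" using index_pos k unfolding powr_powr by (simp add: powr_minus_divide)
      also have "\<dots> \<le> 1 / real (card J)" using cardJ cJ0 by (intro divide_left_mono) auto
      finally have sJ: "s \<le> 1 / real (card J)" .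
      have "1 - r \<le> 1 / real (card J)"
        unfolding r_def using cardJ k cJ0 by (auto intro!: divide_left_mono)
      with sJ have rs: "(1 - r) + s \<le> 2 / real (card J)" by simp
      have s0: "s \<ge> 0" by (simp add: s_def)
      have rs0: "(1 - r) + s > 0" using r s0 by simp
      \<comment> \<open>Multiplying by \<open>r\<close> costs a factor at least 1/2, which is why
        \<open>c1\<close> is at most \<open>c0 / 2\<close>.\<close>
      have num: "c1 * ((1 - r) + s) \<le> 1 - Re z"
      proof -
        have "c0 * s \<le> 1 - Re (step_char v)"
          using cd(3)[of v] \<open>norm v \<le> d\<close> d Rephi by (simp add: s_def)
        then have "r * (c0 * s) \<le> r * (1 - Re (step_char v))" using r by (intro mult_left_mono) auto
        moreover have "c1 * s \<le> r * (c0 * s)"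
        proof -
          have "c1 \<le> r * c0" using c1 r cd(1) mult_right_mono[of "1/2" r c0] by linarith
          then show ?thesis using s0 by (metis mult.assoc mult_right_mono)
        qed
        moreover have "c1 * (1 - r) \<le> 1 - r" using c1 r by (simp add: mult_left_le_one_le)
        ultimately show ?thesis unfolding Rez by (simp add: algebra_simps)
      qed
      have den: "norm (1 - z) \<le> C1 * ((1 - r) + s)"
      proof -
        have "1 - z = complex_of_real (1 - r) + complex_of_real r * (1 - step_char v)"
          by (simp add: z_def algebra_simps)
        also have "norm \<dots> \<le> norm (complex_of_real (1 - r)) + norm (complex_of_real r * (1 - step_char v))"
          by (rule norm_triangle_ineq)
        also have "\<dots> = (1 - r) + r * norm (1 - step_char v)"
          using r by (simp only: norm_mult norm_of_real)
        also have "r * norm (1 - step_char v) \<le> 1 * (C0 * s)"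
          using r Cd(3)[of v] \<open>norm v \<le> d\<close> d by (intro mult_mono) (auto simp: s_def)
        also have "1 * (C0 * s) \<le> C1 * s" using C1 s0 by (simp add: mult_right_mono)
        also have "(1 - r) + C1 * s \<le> C1 * ((1 - r) + s)"
          using C1 r mult_right_mono[of 1 C1 "1 - r"] by (simp add: algebra_simps)
        finally show ?thesis by simp
      qed
      have "norm z < 1"
      proof -
        have "norm z \<le> r * 1" unfolding z_def norm_mult using r norm_step_char_le[of v]
          by (intro mult_mono) auto
        then show ?thesis using r by simp
      qed
      then have den0: "norm (1 - z) > 0" by auto
      have "c3 * real (card J) = c1 / C1\<^sup>2 * (real (card J) / 2)" by (simp add: c3_def)
      also have "\<dots> \<le> c1 / C1\<^sup>2 * (1 / ((1 - r) + s))"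
        using rs rs0 cJ0 c1 by (intro mult_left_mono) (auto simp: field_simps)
      also have "\<dots> = c1 * ((1 - r) + s) / (C1 * ((1 - r) + s))\<^sup>2"
        using rs0 by (simp add: power2_eq_square power_mult_distrib)
      also have "\<dots> \<le> (1 - Re z) / (norm (1 - z))\<^sup>2"
      proof (rule frac_le)
        show "(norm (1 - z))\<^sup>2 \<le> (C1 * ((1 - r) + s))\<^sup>2" using den by (intro power_mono) auto
        show "0 \<le> 1 - Re z" using num mult_nonneg_nonneg[of c1 "(1 - r) + s"] c1 rs0 by linarith
      qed (use num den0 in auto)
      finally show ?thesis unfolding Re_resolvent .
    qed
    then show ?thesis unfolding sumJ z_def r_def v_def .
  qed
  have prB: "measure ?F (?B k) = (d / (?D * pi)) ^ CARD('n) * real k powr (- ?D / \<alpha>)" if k: "k \<ge> 1" for k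
  proof -
    have "real k powr (- 1 / \<alpha>) \<le> 1"
      using k index_pos by (simp add: powr_minus_divide ge_one_powr_ge_zero)
    then have "d * real k powr (- 1 / \<alpha>) \<le> 1" using d by (intro mult_le_one) auto
    moreover have "?D \<ge> 1"
      using zero_less_card_finite[where 'a='n] by linarith
    ultimately have "d * real k powr (- 1 / \<alpha>) \<le> ?D" by linarith
    then have "\<rho> k \<le> 1" unfolding \<rho>_def by (simp add: divide_le_eq)
    then have "\<rho> k \<le> pi" using pi_ge_two by linarith
    moreover have "0 \<le> \<rho> k" using d by (simp add: \<rho>_def)
    ultimately have "measure b {-\<rho> k..\<rho> k} = \<rho> k / pi"
      unfolding b_def using measure_uniform_interval[of pi "- \<rho> k" "\<rho> k"] by simp
    then have "measure ?F (?B k) = (\<rho> k / pi) ^ CARD('n)"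
      unfolding frequency_box(1)[OF b] by simp
    also have "\<rho> k / pi = d / (?D * pi) * real k powr (- 1 / \<alpha>)" by (simp add: \<rho>_def)
    also have "\<dots> ^ CARD('n) = (d / (?D * pi)) ^ CARD('n) * real k powr (- ?D / \<alpha>)"
      using k unfolding power_mult_distrib by (simp add: powr_power)
    finally show ?thesis .
  qed
  define q where "q = (d / (?D * pi)) ^ CARD('n)"
  have q: "q > 0" using d by (simp add: q_def)
  have "c3 * q / 2 * (\<Sum>k=1..n. real k powr (- ?D / \<alpha>)) \<le> green n" if n: "n \<ge> 2" for n
  proof -
    define r where "r = 1 - 1 / real n"
    have r: "1/2 \<le> r" "r < 1" "0 \<le> r" using n by (auto simp: r_def field_simps)
    define H where "H = (\<Sum>k=1..n. real k powr (- ?D / \<alpha>))"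
    have A: "c3 * q * H - r ^ N / (1 - r) \<le> (\<Sum>k<N. r ^ k * hit k 0)" for N
    proof -
      let ?S = "\<lambda>\<tau>. \<Sum>k<N. (complex_of_real r * ?phi \<tau>) ^ k"
      have intS: "integrable ?F ?S"
        unfolding power_mult_distrib
        by (intro Bochner_Integration.integrable_sum integrable_mult_right integrable_frequency_char[OF b])
      have "complex_of_real (\<Sum>k<N. r ^ k * hit k 0) = (\<Sum>k<N. \<integral>\<tau>. complex_of_real (r ^ k) * ?phi \<tau> ^ k \<partial>?F)"
        by (simp add: hit)
      also have "\<dots> = (\<integral>\<tau>. ?S \<tau> \<partial>?F)"
        by (subst Bochner_Integration.integral_sum[symmetric])
          (auto intro!: integrable_mult_right integrable_frequency_char[OF b] simp: power_mult_distrib)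
      finally have "(\<Sum>k<N. r ^ k * hit k 0) = Re (\<integral>\<tau>. ?S \<tau> \<partial>?F)"
        by (metis Re_complex_of_real)
      also have "\<dots> = (\<integral>\<tau>. Re (?S \<tau>) \<partial>?F)" using intS by (rule integral_Re[symmetric])
      also have "\<dots> \<ge> (\<integral>\<tau>. c3 * (\<Sum>k=1..n. indicator (?B k) \<tau>) - r ^ N / (1 - r) \<partial>?F)"
      proof (rule integral_mono)
        show "integrable ?F (\<lambda>\<tau>. c3 * (\<Sum>k=1..n. indicator (?B k) \<tau>) - r ^ N / (1 - r))"
          using mB by (intro Bochner_Integration.integrable_diff integrable_mult_right Bochner_Integration.integrable_sum
            integrable_real_indicator) (auto simp: F.emeasure_eq_measure)
        show "integrable ?F (\<lambda>\<tau>. Re (?S \<tau>))" using intS by (rule integrable_Re)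
        fix \<tau>
        have "norm (complex_of_real r * ?phi \<tau>) \<le> r * 1"
          unfolding norm_mult using r norm_step_char_le by (intro mult_mono) auto
        then have "Re (1 / (1 - complex_of_real r * ?phi \<tau>)) - r ^ N / (1 - r) \<le> Re (?S \<tau>)"
          using r by (intro Re_geometric_sum_ge) auto
        then show "c3 * (\<Sum>k=1..n. indicator (?B k) \<tau>) - r ^ N / (1 - r) \<le> Re (?S \<tau>)"
          using pt[OF n, of \<tau>] unfolding r_def by linarith
      qed
      also have "(\<integral>\<tau>. c3 * (\<Sum>k=1..n. indicator (?B k) \<tau>) - r ^ N / (1 - r) \<partial>?F) =
          c3 * (\<Sum>k=1..n. measure ?F (?B k)) - r ^ N / (1 - r)"
        using mB F.prob_space
        by (subst Bochner_Integration.integral_diff) (auto simp: F.emeasure_eq_measure)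
      also have "(\<Sum>k=1..n. measure ?F (?B k)) = q * H"
        unfolding H_def sum_distrib_left q_def by (intro sum.cong refl prB) auto
      finally show ?thesis by (simp add: mult.assoc)
    qed
    have B: "(1 - r ^ n) * (\<Sum>k<N. r ^ k * hit k 0) \<le> green n" for N
      using green_discount_le_green[of r n N] r n by simp
    \<comment> \<open>At this discount \<open>r ^ n\<close> is at most \<open>exp (-1)\<close>, so
      the factor \<open>1 - r ^ n\<close> costs only a constant.\<close>
    have rn: "r ^ n \<le> 1/2"
    proof -
      have "r ^ n \<le> exp (- 1 / real n) ^ n"
        using r exp_ge_add_one_self[of "- 1 / real n"] by (intro power_mono) (auto simp: r_def)
      also have "\<dots> = exp (-1)" using n by (simp flip: exp_of_nat_mult)
      also have "\<dots> \<le> 1/2" using exp_ge_add_one_self[of 1] by (simp add: exp_minus field_simps)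
      finally show ?thesis .
    qed
    have "(1 - r ^ n) * (c3 * q * H - r ^ N / (1 - r)) \<le> green n" for N
    proof -
      have "(1 - r ^ n) * (c3 * q * H - r ^ N / (1 - r)) \<le> (1 - r ^ n) * (\<Sum>k<N. r ^ k * hit k 0)"
        using A[of N] rn by (intro mult_left_mono) linarith+
      then show ?thesis using B[of N] by linarith
    qed
    moreover have "(\<lambda>N. (1 - r ^ n) * (c3 * q * H - r ^ N / (1 - r))) \<longlonglongrightarrow> (1 - r ^ n) * (c3 * q * H - 0 / (1 - r))"
      using r by (intro tendsto_intros LIMSEQ_power_zero) auto
    ultimately have "(1 - r ^ n) * (c3 * q * H) \<le> green n"
      by (intro LIMSEQ_le_const2[where X="\<lambda>N. (1 - r ^ n) * (c3 * q * H - r ^ N / (1 - r))"]) auto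
    moreover have "1/2 * (c3 * q * H) \<le> (1 - r ^ n) * (c3 * q * H)"
    proof (rule mult_right_mono)
      have "H \<ge> 0" unfolding H_def by (intro sum_nonneg) auto
      then show "0 \<le> c3 * q * H" using c3 q by simp
    qed (use rn in simp)
    ultimately show ?thesis by (simp add: H_def)
  qed
  then show ?thesis using that[of "c3 * q / 2"] c3 q by simp
qed

end

section \<open>Marginals of limits in the \<open>J\<^sub>1\<close> topology\<close>

lemma left_limit_close:
  fixes x :: "real \<Rightarrow> real"
  assumes l: "(x \<longlongrightarrow> l) (at_left t)" and "a < t" and near: "\<And>s. a < s \<Longrightarrow> s < t \<Longrightarrow> \<bar>x s - y\<bar> \<le> e"
  shows "\<bar>l - y\<bar> \<le> e"
proof (rule tendsto_upperbound[where F="at_left t"])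
  show "((\<lambda>s. \<bar>x s - y\<bar>) \<longlongrightarrow> \<bar>l - y\<bar>) (at_left t)"
    by (intro tendsto_intros l)
  show "\<forall>\<^sub>F s in at_left t. \<bar>x s - y\<bar> \<le> e"
    using near \<open>a < t\<close> by (auto simp: eventually_at_left_field)
qed simp

text \<open>One-sided limits make the jumps of size at least \<open>e\<close> isolated, so a bounded
  interval contains finitely many of them. Every discontinuity is a jump of size at least
  \<open>1 / (m + 1)\<close> for some \<open>m\<close>.\<close>

lemma countable_discontinuities_cadlag:
  assumes x: "x \<in> cadlag_paths"
  shows "countable {t. 0 < t \<and> \<not> isCont x t}"
proof -
  define D where "D e = {t. 0 < t \<and> (\<exists>l. (x \<longlongrightarrow> l) (at_left t) \<and> \<bar>x t - l\<bar> \<ge> e)}" for e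
  have right: "(x \<longlongrightarrow> x t) (at_right t)" if "t \<ge> 0" for t
    using x that by (auto simp: cadlag_paths_def)
  have isolated: "\<exists>r>0. \<forall>t\<in>D e. t \<noteq> s \<longrightarrow> \<bar>t - s\<bar> \<ge> r" if e: "e > 0" for e s
  proof -
    \<comment> \<open>Where the path stays within \<open>e / 4\<close> of a fixed level, both its
      value and its left limit do, and they cannot be \<open>e\<close> apart.\<close>
    have small: "t \<notin> D e" if near: "\<And>z. a < z \<Longrightarrow> z < b \<Longrightarrow> \<bar>x z - y\<bar> \<le> e / 4" and t: "a < t" "t < b" for a b t y
    proof
      assume "t \<in> D e"
      then obtain l where l: "(x \<longlongrightarrow> l) (at_left t)" "\<bar>x t - l\<bar> \<ge> e" by (auto simp: D_def)
      have "\<bar>l - y\<bar> \<le> e / 4" by (rule left_limit_close[OF l(1) t(1)]) (use near t in auto)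
      moreover have "\<bar>x t - y\<bar> \<le> e / 4" using near t by blast
      ultimately show False using l(2) e by linarith
    qed
    have "\<exists>b>s. \<forall>t. s < t \<and> t < b \<longrightarrow> t \<notin> D e"
    proof (cases "s \<ge> 0")
      case True
      have "\<forall>\<^sub>F z in at_right s. dist (x z) (x s) < e / 4"
        using right[OF True] e by (intro tendstoD) auto
      then obtain b where "b > s" "\<And>z. s < z \<Longrightarrow> z < b \<Longrightarrow> dist (x z) (x s) < e / 4"
        by (auto simp: eventually_at_right_field)
      then show ?thesis using small[of s b "x s"] by (intro exI[of _ b]) (auto simp: dist_real_def less_imp_le)
    next
      case False
      then show ?thesis by (intro exI[of _ 0]) (auto simp: D_def)
    qed
    then obtain b where b: "b > s" "\<And>t. s < t \<Longrightarrow> t < b \<Longrightarrow> t \<notin> D e" by blast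
    have "\<exists>a<s. \<forall>t. a < t \<and> t < s \<longrightarrow> t \<notin> D e"
    proof (cases "s > 0")
      case True
      then obtain l where l: "(x \<longlongrightarrow> l) (at_left s)" using x by (auto simp: cadlag_paths_def)
      have "\<forall>\<^sub>F z in at_left s. dist (x z) l < e / 4"
        using l e by (intro tendstoD) auto
      then obtain a where "a < s" "\<And>z. a < z \<Longrightarrow> z < s \<Longrightarrow> dist (x z) l < e / 4"
        by (auto simp: eventually_at_left_field)
      then show ?thesis using small[of a s l] by (intro exI[of _ a]) (auto simp: dist_real_def less_imp_le)
    next
      case False
      then show ?thesis by (intro exI[of _ "s - 1"]) (auto simp: D_def)
    qed
    then obtain a where a: "a < s" "\<And>t. a < t \<Longrightarrow> t < s \<Longrightarrow> t \<notin> D e" by blast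
    have "\<bar>t - s\<bar> \<ge> min (b - s) (s - a)" if "t \<in> D e" "t \<noteq> s" for t
    proof -
      have "t \<le> a \<or> b \<le> t" using that a(2)[of t] b(2)[of t] by (meson linorder_cases not_le)
      then show ?thesis using a(1) b(1) by linarith
    qed
    then show ?thesis using a b by (intro exI[of _ "min (b - s) (s - a)"]) auto
  qed
  have "countable (D e)" if e: "e > 0" for e
  proof -
    have nl: "\<not> s islimpt D e" for s
    proof -
      obtain r where "r > 0" "\<And>t. t \<in> D e \<Longrightarrow> t \<noteq> s \<Longrightarrow> \<bar>t - s\<bar> \<ge> r" using isolated[OF e, of s] by blast
      then show ?thesis unfolding islimpt_approachable by (force simp: dist_real_def)
    qed
    have "finite ({- real m..real m} \<inter> D e)" for m
      by (rule finite_not_islimpt_in_compact) (use nl in auto)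
    then have "countable (\<Union>m. {- real m..real m} \<inter> D e)"
      by (intro countable_UN) (auto intro: countable_finite)
    moreover have "D e \<subseteq> (\<Union>m. {- real m..real m} \<inter> D e)"
    proof
      fix t assume t: "t \<in> D e"
      obtain m where "real m \<ge> \<bar>t\<bar>" using real_arch_simple by blast
      then have "t \<in> {- real m..real m} \<inter> D e" using t by auto
      then show "t \<in> (\<Union>m. {- real m..real m} \<inter> D e)" by blast
    qed
    ultimately show ?thesis using countable_subset by blast
  qed
  then have "countable (\<Union>m. D (1 / real (Suc m)))" by (intro countable_UN) auto
  moreover have "{t. 0 < t \<and> \<not> isCont x t} \<subseteq> (\<Union>m. D (1 / real (Suc m)))"
  proof
    fix t assume "t \<in> {t. 0 < t \<and> \<not> isCont x t}"
    then have t: "0 < t" "\<not> isCont x t" by auto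
    obtain l where l: "(x \<longlongrightarrow> l) (at_left t)" using x t by (auto simp: cadlag_paths_def)
    have "l \<noteq> x t"
      using l right[of t] t by (auto simp: isCont_def filterlim_split_at)
    then obtain m where "1 / real (Suc m) < \<bar>x t - l\<bar>"
      using nat_approx_posE[of "\<bar>x t - l\<bar>"] by auto
    then show "t \<in> (\<Union>m. D (1 / real (Suc m)))" using t l by (auto simp: D_def intro!: exI[of _ m] less_imp_le)
  qed
  ultimately show ?thesis using countable_subset by blast
qed

text \<open>Let \<open>s n\<close> be the time that the \<open>n\<close>-th time change sends to
  \<open>t\<close>. Then \<open>y n t\<close> is close to \<open>x (s n)\<close>, and
  \<open>s n\<close> tends to \<open>t\<close>, where \<open>x\<close> is continuous.\<close>

lemma J1_tendsto_at_continuity_point: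
  assumes conv: "J1_tendsto y x" and t: "0 < t" and cont: "isCont x t"
  shows "(\<lambda>n. y n t) \<longlonglongrightarrow> x t"
proof -
  obtain \<Lambda> where tc: "\<And>n. time_change (\<Lambda> n)" and id: "uniform_limit {0..} \<Lambda> (\<lambda>t. t) sequentially"
    and unif: "\<And>T. T > 0 \<Longrightarrow> uniform_limit {0..T} (\<lambda>n t. y n (\<Lambda> n t)) x sequentially"
    using conv unfolding J1_tendsto_def by blast
  have "\<exists>s\<ge>0. \<Lambda> n s = t" for n
    using tc[of n] t unfolding time_change_def by (metis atLeast_iff imageE less_imp_le)
  then obtain s where s: "\<And>n. s n \<ge> 0" "\<And>n. \<Lambda> n (s n) = t" by metis
  have st: "s \<longlonglongrightarrow> t"
  proof (rule tendstoI)
    fix e :: real assume "e > 0"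
    from uniform_limitD[OF id this] show "\<forall>\<^sub>F n in sequentially. dist (s n) t < e"
      by eventually_elim (use s in \<open>force simp: dist_commute\<close>)
  qed
  then have xs: "(\<lambda>n. x (s n)) \<longlonglongrightarrow> x t" by (rule isCont_tendsto_compose[OF cont])
  have "(\<lambda>n. y n t - x (s n)) \<longlonglongrightarrow> 0"
  proof (rule tendstoI)
    fix e :: real assume e: "e > 0"
    have "\<forall>\<^sub>F n in sequentially. s n < t + 1" using st by (rule order_tendstoD) simp
    moreover have "\<forall>\<^sub>F n in sequentially. \<forall>z\<in>{0..t + 1}. dist (y n (\<Lambda> n z)) (x z) < e"
      using t by (intro uniform_limitD[OF unif e]) simp
    ultimately show "\<forall>\<^sub>F n in sequentially. dist (y n t - x (s n)) 0 < e"
    proof eventually_elim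
      case (elim n)
      then have "s n \<in> {0..t + 1}" using s(1)[of n] by simp
      with elim have "dist (y n (\<Lambda> n (s n))) (x (s n)) < e" by blast
      then show ?case by (simp add: s(2) dist_real_def)
    qed
  qed
  from tendsto_add[OF this xs] show ?thesis by simp
qed

text \<open>A substitute for the evaluation at \<open>c\<close>: an average over a window ignores
  the countably many jump times of the limit path, at which J1 convergence need not give convergence
  of values.\<close>

definition window_mean :: "(real \<Rightarrow> real) \<Rightarrow> real \<Rightarrow> real \<Rightarrow> (real \<Rightarrow> real) \<Rightarrow> real" where
  "window_mean g c h x = (\<integral>s. indicator {0..h} s * g (x (c + s)) \<partial>lborel) / h"

lemma AE_window:
  fixes C :: "real set"
  assumes C: "countable C" and c: "c \<ge> 0" and P: "\<And>t. 0 < t \<Longrightarrow> t \<notin> C \<Longrightarrow> P t"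
  shows "AE s in lborel. s \<in> {0..h} \<longrightarrow> P (c + s)"
proof -
  have "AE s in lborel. s \<notin> insert 0 ((\<lambda>t. t - c) ` C)"
    using C by (intro AE_not_in countable_imp_null_set_lborel) auto
  then show ?thesis
  proof eventually_elim
    case (elim s)
    show ?case
    proof
      assume "s \<in> {0..h}"
      with elim have "0 < s" by (simp add: less_le)
      with c have "0 < c + s" by linarith
      moreover have "c + s \<notin> C" using elim by force
      ultimately show "P (c + s)" by (rule P)
    qed
  qed
qed

text \<open>The path is continuous off a countable set of positive times. Its values at negative
  times are arbitrary, so these are cut off, and the time 0 is treated separately.\<close>

lemma cadlag_measurable:
  assumes x: "x \<in> cadlag_paths" and c: "c \<ge> 0" and g: "continuous_on UNIV g"
  shows "(\<lambda>s. indicator {0..h} s * (g (x (c + s)) :: real)) \<in> borel_measurable borel"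
proof -
  let ?C = "{t. 0 < t \<and> \<not> isCont x t}"
  have "(\<lambda>t. if t > 0 then x t else 0) \<in> borel_measurable borel"
  proof (rule borel_measurable_continuous_countable_exceptions)
    show "countable (insert 0 ?C)" using countable_discontinuities_cadlag[OF x] by simp
    show "continuous_on (- insert 0 ?C) (\<lambda>t. if t > 0 then x t else 0)"
    proof (intro continuous_at_imp_continuous_on ballI)
      fix t assume t: "t \<in> - insert 0 ?C"
      show "isCont (\<lambda>t. if t > 0 then x t else 0) t"
      proof (cases "t > 0")
        case True
        have "\<forall>\<^sub>F s in nhds t. (if s > 0 then x s else 0) = x s"
          using eventually_nhds_in_open[of "{0<..}" t] True by (auto elim: eventually_mono)
        then have "isCont (\<lambda>t. if t > 0 then x t else 0) t = isCont x t" by (rule isCont_cong)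
        then show ?thesis using t True by simp
      next
        case False
        then have "\<forall>\<^sub>F s in nhds t. (if s > 0 then x s else 0) = 0"
          using eventually_nhds_in_open[of "{..<0}" t] t by (auto elim!: eventually_mono)
        then have "isCont (\<lambda>t. if t > 0 then x t else 0) t = isCont (\<lambda>_. 0 :: real) t" by (rule isCont_cong)
        then show ?thesis by simp
      qed
    qed
  qed
  then have [measurable]: "(\<lambda>t. if t > 0 then x t else 0) \<in> borel_measurable borel" .
  have [measurable]: "g \<in> borel_measurable borel" using g by (rule borel_measurable_continuous_onI)
  have "(\<lambda>s. indicator {0<..h} s * g ((\<lambda>t. if t > 0 then x t else 0) (c + s)) + indicator ({0..h} \<inter> {0}) s * g (x c)) \<in> borel_measurable borel"
    by measurable
  also have "(\<lambda>s. indicator {0<..h} s * g ((\<lambda>t. if t > 0 then x t else 0) (c + s)) + indicator ({0..h} \<inter> {0}) s * g (x c)) =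
      (\<lambda>s. indicator {0..h} s * g (x (c + s)))"
    using c by (auto simp: fun_eq_iff indicator_def)
  finally show ?thesis .
qed

lemma integrable_window: "integrable lborel (\<lambda>s. B * indicator {0..h::real} s :: real)"
  by (intro integrable_mult_right integrable_real_indicator) (auto simp: emeasure_lborel_Icc_eq)

lemma abs_window_mean_le:
  assumes "\<And>y. \<bar>g y\<bar> \<le> B" "h > 0"
  shows "\<bar>window_mean g c h x\<bar> \<le> B"
proof -
  have "0 \<le> B" using assms(1)[of 0] by linarith
  have "norm (\<integral>s. indicator {0..h} s * g (x (c + s)) \<partial>lborel) \<le> (\<integral>s. norm (indicator {0..h} s * g (x (c + s))) \<partial>lborel)"
    by (rule integral_norm_bound)
  also have "\<dots> \<le> (\<integral>s. B * indicator {0..h} s \<partial>lborel)"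
    using \<open>0 \<le> B\<close> assms(1) by (intro integral_mono' integrable_window) (auto simp: indicator_def)
  also have "\<dots> = B * h" using assms(2) by simp
  finally show ?thesis using assms(2) by (simp add: window_mean_def divide_le_eq)
qed

text \<open>Openness in \<open>J1_topology\<close> is a condition on convergent sequences, so
  sequential continuity is enough. It follows by dominated convergence from convergence at almost
  every time of the window.\<close>

lemma continuous_map_window_mean:
  assumes g: "continuous_on UNIV g" "\<And>y. \<bar>g y\<bar> \<le> B" and c: "c \<ge> 0" and h: "h > 0"
  shows "continuous_map J1_topology euclideanreal (window_mean g c h)"
proof -
  have lim: "(\<lambda>n. window_mean g c h (y n)) \<longlonglongrightarrow> window_mean g c h x"
    if x: "x \<in> cadlag_paths" and y: "\<And>n. y n \<in> cadlag_paths" and conv: "J1_tendsto y x" for x y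
  proof -
    have "AE s in lborel. s \<in> {0..h} \<longrightarrow> (\<lambda>n. y n (c + s)) \<longlonglongrightarrow> x (c + s)"
      by (rule AE_window[OF countable_discontinuities_cadlag[OF x] c])
        (auto intro: J1_tendsto_at_continuity_point[OF conv])
    then have ae: "AE s in lborel. (\<lambda>n. indicator {0..h} s * g (y n (c + s))) \<longlonglongrightarrow> indicator {0..h} s * g (x (c + s))"
    proof eventually_elim
      case (elim s)
      show ?case
      proof (cases "s \<in> {0..h}")
        case True
        then have "(\<lambda>n. g (y n (c + s))) \<longlonglongrightarrow> g (x (c + s))"
          using elim g(1) by (intro isCont_tendsto_compose[of _ g]) (auto simp: continuous_on_eq_continuous_at)
        then show ?thesis by (rule tendsto_mult_left)
      qed simp
    qed
    have "(\<lambda>n. \<integral>s. indicator {0..h} s * g (y n (c + s)) \<partial>lborel) \<longlonglongrightarrow> (\<integral>s. indicator {0..h} s * g (x (c + s)) \<partial>lborel)"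
    proof (rule integral_dominated_convergence[where w="\<lambda>s. B * indicator {0..h} s"])
      show "(\<lambda>s. indicator {0..h} s * g (x (c + s))) \<in> borel_measurable lborel"
        using cadlag_measurable[OF x c g(1)] by simp
      show "(\<lambda>s. indicator {0..h} s * g (y n (c + s))) \<in> borel_measurable lborel" for n
        using cadlag_measurable[OF y c g(1)] by simp
      show "AE s in lborel. norm (indicator {0..h} s * g (y n (c + s))) \<le> B * indicator {0..h} s" for n
        by (rule AE_I2) (use g(2) in \<open>simp add: indicator_def\<close>)
    qed (fact integrable_window ae)+
    then show ?thesis unfolding window_mean_def using h by (intro tendsto_divide) auto
  qed
  show ?thesis
    unfolding continuous_map_def topspace_J1_topology
  proof (intro conjI allI impI)
    fix V assume "openin euclideanreal V"
    then have V: "open V" by simp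
    show "openin J1_topology {x \<in> cadlag_paths. window_mean g c h x \<in> V}"
      unfolding openin_J1_topology
    proof (intro conjI allI impI)
      fix x y assume *: "x \<in> {x \<in> cadlag_paths. window_mean g c h x \<in> V} \<and> (\<forall>n. y n \<in> cadlag_paths) \<and> J1_tendsto y x"
      then have "\<forall>\<^sub>F n in sequentially. window_mean g c h (y n) \<in> V"
        using lim[of x y] V by (intro topological_tendstoD) auto
      then show "\<forall>\<^sub>F n in sequentially. y n \<in> {x \<in> cadlag_paths. window_mean g c h x \<in> V}"
        using * by (auto elim: eventually_mono)
    qed auto
  qed auto
qed

lemma window_mean_at_start:
  assumes x: "x \<in> cadlag_paths" and g: "continuous_on UNIV g" "\<And>y. \<bar>g y\<bar> \<le> B" and c: "c \<ge> 0"
  shows "(\<lambda>j. window_mean g c (1 / real (Suc j)) x) \<longlonglongrightarrow> g (x c)"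
proof (rule tendstoI)
  fix e :: real assume e: "e > 0"
  have "((\<lambda>t. g (x t)) \<longlongrightarrow> g (x c)) (at_right c)"
    using x c g(1) by (intro isCont_tendsto_compose[of _ g]) (auto simp: continuous_on_eq_continuous_at cadlag_paths_def)
  from tendstoD[OF this, of "e / 2"] e obtain b where b: "b > c" "\<And>t. c < t \<Longrightarrow> t < b \<Longrightarrow> dist (g (x t)) (g (x c)) < e / 2"
    by (auto simp: eventually_at_right_field)
  have "dist (window_mean g c h x) (g (x c)) < e" if h: "0 < h" "h < b - c" for h
  proof -
    let ?f = "\<lambda>s. indicator {0..h} s * g (x (c + s))"
    have int: "integrable lborel ?f"
      by (rule Bochner_Integration.integrable_bound[OF integrable_window[of B h]])
        (use cadlag_measurable[OF x c g(1)] g(2) in \<open>auto simp: indicator_def intro: order_trans[OF _ abs_ge_self]\<close>)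
    have int2: "integrable lborel (\<lambda>s. g (x c) * indicator {0..h} s)" by (rule integrable_window)
    have near: "\<bar>g (x (c + s)) - g (x c)\<bar> \<le> e / 2" if "s \<in> {0..h}" for s
      using b(2)[of "c + s"] that h e by (cases "s = 0") (auto simp: dist_real_def less_imp_le)
    have "\<bar>(\<integral>s. ?f s \<partial>lborel) - g (x c) * h\<bar> = \<bar>\<integral>s. ?f s - g (x c) * indicator {0..h} s \<partial>lborel\<bar>"
      using int int2 h by simp
    also have "\<dots> \<le> (\<integral>s. \<bar>?f s - g (x c) * indicator {0..h} s\<bar> \<partial>lborel)"
      using integral_norm_bound[of lborel "\<lambda>s. ?f s - g (x c) * indicator {0..h} s"] by simp
    also have "\<dots> \<le> (\<integral>s. e / 2 * indicator {0..h} s \<partial>lborel)"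
      using near e by (intro integral_mono' integrable_window) (auto simp: indicator_def)
    also have "\<dots> = e / 2 * h" using h by simp
    finally have "\<bar>(\<integral>s. ?f s \<partial>lborel) - g (x c) * h\<bar> / h \<le> e / 2" using h by (simp add: divide_le_eq)
    also have "\<bar>(\<integral>s. ?f s \<partial>lborel) - g (x c) * h\<bar> / h = \<bar>window_mean g c h x - g (x c)\<bar>"
    proof -
      have "window_mean g c h x - g (x c) = ((\<integral>s. ?f s \<partial>lborel) - g (x c) * h) / h"
        using h by (simp add: window_mean_def diff_divide_distrib)
      then show ?thesis using h by simp
    qed
    finally show ?thesis using e by (simp add: dist_real_def)
  qed
  moreover have "\<forall>\<^sub>F j in sequentially. 1 / real (Suc j) < b - c"
    using LIMSEQ_inverse_real_of_nat b(1) by (intro order_tendstoD(2)[where y=0]) (auto simp: inverse_eq_divide)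
  ultimately show "\<forall>\<^sub>F j in sequentially. dist (window_mean g c (1 / real (Suc j)) x) (g (x c)) < e"
    by (auto elim: eventually_mono)
qed

text \<open>Joint measurability in time and outcome comes from right-continuity: the process is the
  limit of its values at grid times approaching from the right, and each approximation uses only
  countably many times.\<close>

lemma measurable_window_mean_process:
  fixes N :: "'v measure" and L :: "real \<Rightarrow> 'v \<Rightarrow> real" and g :: "real \<Rightarrow> real"
  assumes L: "\<And>t. t \<ge> 0 \<Longrightarrow> L t \<in> borel_measurable N"
    and cadlag: "\<And>\<omega>. \<omega> \<in> space N \<Longrightarrow> (\<lambda>t. L t \<omega>) \<in> cadlag_paths"
    and g: "continuous_on UNIV g" and c: "c \<ge> 0"
  shows "(\<lambda>\<omega>. window_mean g c h (\<lambda>t. L t \<omega>)) \<in> borel_measurable N"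
proof -
  have [measurable]: "g \<in> borel_measurable borel" using g by (rule borel_measurable_continuous_onI)
  \<comment> \<open>Adding 1 after rounding down keeps the grid time strictly to the right of
    \<open>s\<close>, as the limit along \<open>at_right\<close> requires.\<close>
  define q where "q m s = (real_of_int \<lfloor>real (Suc m) * s\<rfloor> + 1) / real (Suc m)" for m s
  define u where "u m z = L (c + max 0 (q m (snd z))) (fst z)" for m and z :: "'v \<times> real"
  have q_gt: "q m s > s" and q_le: "q m s \<le> s + 1 / real (Suc m)" for m s
  proof -
    have "real (Suc m) * s < real_of_int \<lfloor>real (Suc m) * s\<rfloor> + 1" by linarith
    then show "q m s > s" unfolding q_def by (simp add: field_simps)
    have "real_of_int \<lfloor>real (Suc m) * s\<rfloor> + 1 \<le> real (Suc m) * s + 1" by linarith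
    then have "q m s \<le> (real (Suc m) * s + 1) / real (Suc m)"
      unfolding q_def by (rule divide_right_mono) simp
    also have "\<dots> = s + 1 / real (Suc m)" by (simp only: add_divide_distrib) simp
    finally show "q m s \<le> s + 1 / real (Suc m)" .
  qed
  have mu: "u m \<in> borel_measurable (N \<Otimes>\<^sub>M lborel)" for m
  proof -
    have "(\<lambda>z. L (c + max 0 ((real_of_int k + 1) / real (Suc m))) (fst z)) \<in> borel_measurable (N \<Otimes>\<^sub>M lborel)" for k
      by (rule measurable_compose[OF measurable_fst L]) (use c in auto)
    moreover have "(\<lambda>z. \<lfloor>real (Suc m) * snd z\<rfloor>) \<in> N \<Otimes>\<^sub>M lborel \<rightarrow>\<^sub>M count_space UNIV"
      by measurable
    ultimately show ?thesis
      unfolding u_def q_def by (rule measurable_compose_countable)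
  qed
  have "(\<lambda>z. indicator {0..h} (snd z) * g (L (c + snd z) (fst z))) \<in> borel_measurable (N \<Otimes>\<^sub>M lborel)"
  proof (rule borel_measurable_LIMSEQ_real)
    fix z :: "'v \<times> real" assume "z \<in> space (N \<Otimes>\<^sub>M lborel)"
    then have \<omega>: "fst z \<in> space N" by (auto simp: space_pair_measure)
    show "(\<lambda>m. indicator {0..h} (snd z) * g (u m z)) \<longlonglongrightarrow> indicator {0..h} (snd z) * g (L (c + snd z) (fst z))"
    proof (cases "snd z \<in> {0..h}")
      case True
      define s where "s = snd z"
      have s: "s \<ge> 0" using True by (simp add: s_def)
      have "(\<lambda>m. q m s) \<longlonglongrightarrow> s"
      proof (rule real_tendsto_sandwich[where f="\<lambda>_. s" and h="\<lambda>m. s + 1 / real (Suc m)"])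
        show "(\<lambda>m. s + 1 / real (Suc m)) \<longlonglongrightarrow> s"
          using tendsto_add[OF tendsto_const LIMSEQ_inverse_real_of_nat, of s] by (simp add: inverse_eq_divide)
        show "\<forall>\<^sub>F m in sequentially. s \<le> q m s"
          using q_gt by (intro always_eventually allI less_imp_le)
        show "\<forall>\<^sub>F m in sequentially. q m s \<le> s + 1 / real (Suc m)"
          using q_le by (intro always_eventually allI)
      qed simp
      then have "filterlim (\<lambda>m. c + q m s) (at_right (c + s)) sequentially"
        using q_gt by (intro tendsto_imp_filterlim_at_right tendsto_intros always_eventually) auto
      moreover have "((\<lambda>t. L t (fst z)) \<longlongrightarrow> L (c + s) (fst z)) (at_right (c + s))"
        using cadlag[OF \<omega>] c s by (auto simp: cadlag_paths_def)
      ultimately have "(\<lambda>m. L (c + q m s) (fst z)) \<longlonglongrightarrow> L (c + s) (fst z)"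
        by (rule filterlim_compose[rotated])
      moreover have "u m z = L (c + q m s) (fst z)" for m
        using q_gt[of s m] s by (simp add: u_def s_def)
      ultimately have "(\<lambda>m. u m z) \<longlonglongrightarrow> L (c + snd z) (fst z)" by (simp add: s_def)
      then have "(\<lambda>m. g (u m z)) \<longlonglongrightarrow> g (L (c + snd z) (fst z))"
        using g by (intro isCont_tendsto_compose[of _ g]) (auto simp: continuous_on_eq_continuous_at)
      then show ?thesis by (rule tendsto_mult_left)
    qed simp
  next
    show "(\<lambda>z. indicator {0..h} (snd z) * g (u m z)) \<in> borel_measurable (N \<Otimes>\<^sub>M lborel)" for m
      using mu[of m] by measurable
  qed
  then have "(\<lambda>\<omega>. \<integral>s. indicator {0..h} s * g (L (c + s) \<omega>) \<partial>lborel) \<in> borel_measurable N"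
    by (intro lborel.borel_measurable_lebesgue_integral) (simp add: split_beta')
  then show ?thesis unfolding window_mean_def by measurable
qed

text \<open>The evaluation at time \<open>1\<close> is not continuous for the \<open>J\<^sub>1\<close> topology, but the averages over a
  short window after time \<open>1\<close> are. The stationarity of the increments bounds the error of the
  averaging by an average over a window after time \<open>0\<close>.\<close>

lemma marginal_convergence:
  fixes Y :: "nat \<Rightarrow> 'w \<Rightarrow> real" and L :: "real \<Rightarrow> 'v \<Rightarrow> real"
    and g K :: "real \<Rightarrow> real" and \<beta> :: real
  assumes M: "prob_space M" and Y: "\<And>k. Y k \<in> borel_measurable M"
    and stat: "\<And>n k. distr M borel (\<lambda>\<omega>. Y (n + k) \<omega> - Y n \<omega>) = distr M borel (Y k)"
    and L: "levy_process N L"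
    and conv: "converges_in_distribution J1_topology M
      (\<lambda>n \<omega> t. real n powr \<beta> * Y (nat \<lfloor>real n * t\<rfloor>) \<omega>) N (\<lambda>\<omega> t. L t \<omega>)"
    and g: "continuous_on UNIV g" "\<And>y. \<bar>g y\<bar> \<le> 1"
    and K: "continuous_on UNIV K" "\<And>y. \<bar>K y\<bar> \<le> 2" "K 0 = 0"
    and gK: "\<And>y z. \<bar>g y - g z\<bar> \<le> K (y - z)"
  shows "(\<lambda>n. \<integral>\<omega>. g (real n powr \<beta> * Y n \<omega>) \<partial>M) \<longlonglongrightarrow> (\<integral>\<omega>. g (L 1 \<omega>) \<partial>N)"
proof -
  interpret M: prob_space M by (rule M)
  interpret N: prob_space N using L by (simp add: levy_process_def)
  have mL: "\<And>t. t \<ge> 0 \<Longrightarrow> L t \<in> borel_measurable N" and L0: "AE \<omega> in N. L 0 \<omega> = 0"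
    and cad: "\<And>\<omega>. \<omega> \<in> space N \<Longrightarrow> (\<lambda>t. L t \<omega>) \<in> cadlag_paths"
    using L by (auto simp: levy_process_def)
  have K_nonneg: "0 \<le> K y" and K_le: "K y \<le> 2" for y
    using gK[of y 0] K(2)[of y] by simp_all
  note Y [measurable]
  have gm [measurable]: "g \<in> borel_measurable borel" and Km [measurable]: "K \<in> borel_measurable borel"
    using g(1) K(1) by (auto intro: borel_measurable_continuous_onI)
  define W where "W n \<omega> t = real n powr \<beta> * Y (nat \<lfloor>real n * t\<rfloor>) \<omega>" for n \<omega> t
  define A where "A n = (\<integral>\<omega>. g (real n powr \<beta> * Y n \<omega>) \<partial>M)" for n
  have mW: "(\<lambda>z. W n (fst z) (c + snd z)) \<in> borel_measurable (M \<Otimes>\<^sub>M lborel)" for n c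
  proof -
    have "(\<lambda>z. real n powr \<beta> * Y k (fst z)) \<in> borel_measurable (M \<Otimes>\<^sub>M lborel)" for k
      by measurable
    moreover have "(\<lambda>z. nat \<lfloor>real n * (c + snd z)\<rfloor>) \<in> M \<Otimes>\<^sub>M lborel \<rightarrow>\<^sub>M count_space UNIV"
      by measurable
    ultimately show ?thesis unfolding W_def by (rule measurable_compose_countable)
  qed
  interpret PM: pair_sigma_finite M lborel ..
  have fub: "h * (\<integral>\<omega>. window_mean G c h (W n \<omega>) \<partial>M) = (\<integral>s. indicator {0..h} s * (\<integral>\<omega>. G (W n \<omega> (c + s)) \<partial>M) \<partial>lborel)"
    and fub_int: "integrable lborel (\<lambda>s. indicator {0..h} s * (\<integral>\<omega>. G (W n \<omega> (c + s)) \<partial>M))"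
    if G: "G \<in> borel_measurable borel" "\<And>y. \<bar>G y\<bar> \<le> 2" and h: "h > 0" for G c h n
  proof -
    note G(1) [measurable]
    have m: "(\<lambda>z. indicator {0..h} (snd z) * G (W n (fst z) (c + snd z))) \<in> borel_measurable (M \<Otimes>\<^sub>M lborel)"
      using mW[of n c] by measurable
    have int: "integrable (M \<Otimes>\<^sub>M lborel) (\<lambda>(\<omega>, s). indicator {0..h} s * G (W n \<omega> (c + s)))"
    proof (rule Bochner_Integration.integrable_bound)
      show "integrable (M \<Otimes>\<^sub>M lborel) (\<lambda>z. 2 * indicator (space M \<times> {0..h}) z :: real)"
        using h by (intro integrable_mult_right integrable_real_indicator)
          (auto simp: lborel.emeasure_pair_measure_Times M.emeasure_space_1)
      show "AE z in M \<Otimes>\<^sub>M lborel. norm (case z of (\<omega>, s) \<Rightarrow> indicator {0..h} s * G (W n \<omega> (c + s))) \<le>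
          norm (2 * indicator (space M \<times> {0..h}) z :: real)"
        by (rule AE_I2) (use G(2) in \<open>auto simp: indicator_def space_pair_measure\<close>)
    qed (use m in \<open>simp add: split_beta'\<close>)
    have "h * (\<integral>\<omega>. window_mean G c h (W n \<omega>) \<partial>M) = (\<integral>\<omega>. \<integral>s. indicator {0..h} s * G (W n \<omega> (c + s)) \<partial>lborel \<partial>M)"
      using h by (simp add: window_mean_def)
    also have "\<dots> = (\<integral>s. \<integral>\<omega>. indicator {0..h} s * G (W n \<omega> (c + s)) \<partial>M \<partial>lborel)"
      by (rule PM.Fubini_integral[OF int, symmetric])
    finally show "h * (\<integral>\<omega>. window_mean G c h (W n \<omega>) \<partial>M) = (\<integral>s. indicator {0..h} s * (\<integral>\<omega>. G (W n \<omega> (c + s)) \<partial>M) \<partial>lborel)"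
      by simp
    show "integrable lborel (\<lambda>s. indicator {0..h} s * (\<integral>\<omega>. G (W n \<omega> (c + s)) \<partial>M))"
      using PM.integrable_snd[OF int] by simp
  qed
  have approx: "\<bar>A n - (\<integral>\<omega>. window_mean g 1 h (W n \<omega>) \<partial>M)\<bar> \<le> (\<integral>\<omega>. window_mean K 0 h (W n \<omega>) \<partial>M)"
    if h: "h > 0" for n h
  proof -
    have g2: "\<bar>g y\<bar> \<le> 2" for y using g(2)[of y] by linarith
    have diff: "\<bar>A n - (\<integral>\<omega>. g (W n \<omega> (1 + s)) \<partial>M)\<bar> \<le> (\<integral>\<omega>. K (W n \<omega> s) \<partial>M)" if s: "s \<ge> 0" for s
    proof -
      define k where "k = nat \<lfloor>real n * s\<rfloor>"
      \<comment> \<open>As \<open>n\<close> is an integer, rounding affects only the part after time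
        1. The elapsed number of steps is exactly the \<open>k\<close> of the window at time 0, and
        stationarity applies.\<close>
      have fl: "nat \<lfloor>real n * (1 + s)\<rfloor> = n + k"
      proof -
        have "real n * (1 + s) = of_int (int n) + real n * s" by (simp add: algebra_simps)
        then have "\<lfloor>real n * (1 + s)\<rfloor> = int n + \<lfloor>real n * s\<rfloor>" by (simp only: int_add_floor)
        then show ?thesis using s by (simp add: k_def nat_add_distrib)
      qed
      have "\<bar>A n - (\<integral>\<omega>. g (W n \<omega> (1 + s)) \<partial>M)\<bar> = \<bar>\<integral>\<omega>. g (real n powr \<beta> * Y n \<omega>) - g (real n powr \<beta> * Y (n + k) \<omega>) \<partial>M\<bar>"
        unfolding A_def W_def fl
        by (subst Bochner_Integration.integral_diff) (auto intro!: M.integrable_const_bound[where B=1] simp: g(2))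
      also have "\<dots> \<le> (\<integral>\<omega>. \<bar>g (real n powr \<beta> * Y (n + k) \<omega>) - g (real n powr \<beta> * Y n \<omega>)\<bar> \<partial>M)"
        using integral_norm_bound[of M "\<lambda>\<omega>. g (real n powr \<beta> * Y n \<omega>) - g (real n powr \<beta> * Y (n + k) \<omega>)"]
        by (simp add: abs_minus_commute)
      also have "\<dots> \<le> (\<integral>\<omega>. K (real n powr \<beta> * (Y (n + k) \<omega> - Y n \<omega>)) \<partial>M)"
        using gK by (intro integral_mono' M.integrable_const_bound[where B=2]) (auto simp: K_le K_nonneg right_diff_distrib)
      also have "\<dots> = (\<integral>y. K (real n powr \<beta> * y) \<partial>distr M borel (\<lambda>\<omega>. Y (n + k) \<omega> - Y n \<omega>))"
        by (subst integral_distr) auto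
      also have "\<dots> = (\<integral>\<omega>. K (W n \<omega> s) \<partial>M)"
        unfolding stat W_def k_def[symmetric] by (subst integral_distr) auto
      finally show ?thesis .
    qed
    have iA: "integrable lborel (\<lambda>s. A n * indicator {0..h} s)" by (rule integrable_window)
    note i1 = fub_int[OF gm g2 h, of n 1] and i2 = fub_int[OF Km K(2) h, of n 0]
    define X where "X = (\<integral>s. A n * indicator {0..h} s - indicator {0..h} s * (\<integral>\<omega>. g (W n \<omega> (1 + s)) \<partial>M) \<partial>lborel)"
    have X: "h * (A n - (\<integral>\<omega>. window_mean g 1 h (W n \<omega>) \<partial>M)) = X"
      unfolding X_def using iA i1 h unfolding right_diff_distrib fub[OF gm g2 h]
      by (subst Bochner_Integration.integral_diff) auto
    have "\<bar>X\<bar> \<le> (\<integral>s. \<bar>A n * indicator {0..h} s - indicator {0..h} s * (\<integral>\<omega>. g (W n \<omega> (1 + s)) \<partial>M)\<bar> \<partial>lborel)"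
      unfolding X_def
      using integral_norm_bound[of lborel "\<lambda>s. A n * indicator {0..h} s - indicator {0..h} s * (\<integral>\<omega>. g (W n \<omega> (1 + s)) \<partial>M)"]
      by simp
    also have "\<dots> \<le> (\<integral>s. indicator {0..h} s * (\<integral>\<omega>. K (W n \<omega> (0 + s)) \<partial>M) \<partial>lborel)"
    proof (rule integral_mono)
      show "integrable lborel (\<lambda>s. \<bar>A n * indicator {0..h} s - indicator {0..h} s * (\<integral>\<omega>. g (W n \<omega> (1 + s)) \<partial>M)\<bar>)"
        using iA i1 by (intro integrable_abs Bochner_Integration.integrable_diff)
      show "integrable lborel (\<lambda>s. indicator {0..h} s * (\<integral>\<omega>. K (W n \<omega> (0 + s)) \<partial>M))" by (rule i2)
      show "\<bar>A n * indicator {0..h} s - indicator {0..h} s * (\<integral>\<omega>. g (W n \<omega> (1 + s)) \<partial>M)\<bar> \<le>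
          indicator {0..h} s * (\<integral>\<omega>. K (W n \<omega> (0 + s)) \<partial>M)" for s
      proof (cases "s \<in> {0..h}")
        case True
        then show ?thesis using diff[of s] by simp
      qed simp
    qed
    also have "\<dots> = h * (\<integral>\<omega>. window_mean K 0 h (W n \<omega>) \<partial>M)"
      by (rule fub[OF Km K(2) h, symmetric])
    finally have "h * \<bar>A n - (\<integral>\<omega>. window_mean g 1 h (W n \<omega>) \<partial>M)\<bar> \<le> h * (\<integral>\<omega>. window_mean K 0 h (W n \<omega>) \<partial>M)"
      using h by (simp only: X[symmetric] abs_mult abs_of_pos)
    then show ?thesis using h by (simp only: mult_le_cancel_left_pos)
  qed
  have wconv: "(\<lambda>n. \<integral>\<omega>. window_mean G c h (W n \<omega>) \<partial>M) \<longlonglongrightarrow> (\<integral>\<omega>. window_mean G c h (\<lambda>t. L t \<omega>) \<partial>N)"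
    if G: "continuous_on UNIV G" "\<And>y. \<bar>G y\<bar> \<le> 2" and c: "c \<ge> 0" and h: "h > 0" for G c h
  proof -
    have "bounded (window_mean G c h ` topspace J1_topology)"
      unfolding bounded_iff using abs_window_mean_le[OF G(2) h] by (intro exI[of _ 2]) auto
    then show ?thesis
      using conv continuous_map_window_mean[OF G c h] unfolding converges_in_distribution_def W_def by blast
  qed
  have wlim: "(\<lambda>j. \<integral>\<omega>. window_mean G c (1 / real (Suc j)) (\<lambda>t. L t \<omega>) \<partial>N) \<longlonglongrightarrow> (\<integral>\<omega>. G (L c \<omega>) \<partial>N)"
    if G: "continuous_on UNIV G" "\<And>y. \<bar>G y\<bar> \<le> 2" and c: "c \<ge> 0" for G c
  proof (rule integral_dominated_convergence[where w="\<lambda>_. 2"])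
    show "(\<lambda>\<omega>. G (L c \<omega>)) \<in> borel_measurable N"
      using mL[OF c] borel_measurable_continuous_onI[OF G(1)] by (rule measurable_compose)
    show "(\<lambda>\<omega>. window_mean G c (1 / real (Suc j)) (\<lambda>t. L t \<omega>)) \<in> borel_measurable N" for j
      by (rule measurable_window_mean_process[OF mL cad G(1) c])
    show "AE \<omega> in N. (\<lambda>j. window_mean G c (1 / real (Suc j)) (\<lambda>t. L t \<omega>)) \<longlonglongrightarrow> G (L c \<omega>)"
      by (rule AE_I2) (rule window_mean_at_start[OF cad G c])
    show "AE \<omega> in N. norm (window_mean G c (1 / real (Suc j)) (\<lambda>t. L t \<omega>)) \<le> 2" for j
      using abs_window_mean_le[OF G(2)] by (intro AE_I2) auto
  qed simp
  have g2: "\<bar>g y\<bar> \<le> 2" for y using g(2)[of y] by linarith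
  have K0: "(\<integral>\<omega>. K (L 0 \<omega>) \<partial>N) = 0"
    using L0 K(3) by (intro integral_eq_zero_AE) (auto elim: eventually_mono)
  define B where "B j = (\<integral>\<omega>. window_mean g 1 (1 / real (Suc j)) (\<lambda>t. L t \<omega>) \<partial>N)" for j
  define E where "E j = (\<integral>\<omega>. window_mean K 0 (1 / real (Suc j)) (\<lambda>t. L t \<omega>) \<partial>N)" for j
  have BE: "B \<longlonglongrightarrow> (\<integral>\<omega>. g (L 1 \<omega>) \<partial>N)" "E \<longlonglongrightarrow> 0"
    using wlim[OF g(1) g2, of 1] wlim[OF K(1,2), of 0] K0 by (simp_all add: B_def[abs_def] E_def[abs_def])
  have "A \<longlonglongrightarrow> (\<integral>\<omega>. g (L 1 \<omega>) \<partial>N)"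
  proof (rule tendstoI)
    fix e :: real assume e: "e > 0"
    have "\<forall>\<^sub>F j in sequentially. dist (B j) (\<integral>\<omega>. g (L 1 \<omega>) \<partial>N) < e / 4 \<and> dist (E j) 0 < e / 4"
      using tendstoD[OF BE(1), of "e / 4"] tendstoD[OF BE(2), of "e / 4"] e by (auto intro: eventually_conj)
    then obtain j where j: "dist (B j) (\<integral>\<omega>. g (L 1 \<omega>) \<partial>N) < e / 4" "dist (E j) 0 < e / 4"
      by (auto simp: eventually_sequentially)
    \<comment> \<open>The window is fixed before \<open>n\<close> tends to infinity. Of the four
      quarters of \<open>e\<close>, two bound the error of averaging and two the distance from the
      window mean of \<open>g\<close> to the limit.\<close>
    define h where "h = 1 / real (Suc j)"
    have h: "h > 0" by (simp add: h_def)
    have "\<forall>\<^sub>F n in sequentially. dist (\<integral>\<omega>. window_mean g 1 h (W n \<omega>) \<partial>M) (B j) < e / 4"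
      using tendstoD[OF wconv[OF g(1) g2, of 1 h], of "e / 4"] e h by (simp add: B_def h_def)
    moreover have "\<forall>\<^sub>F n in sequentially. dist (\<integral>\<omega>. window_mean K 0 h (W n \<omega>) \<partial>M) (E j) < e / 4"
      using tendstoD[OF wconv[OF K(1,2), of 0 h], of "e / 4"] e h by (simp add: E_def h_def)
    ultimately show "\<forall>\<^sub>F n in sequentially. dist (A n) (\<integral>\<omega>. g (L 1 \<omega>) \<partial>N) < e"
    proof eventually_elim
      case (elim n)
      then show ?case using approx[OF h, of n] j unfolding dist_real_def by linarith
    qed
  qed
  then show ?thesis by (simp add: A_def[abs_def])
qed

section \<open>Stationarity and the expected maximum\<close>

definition sites :: "(nat \<Rightarrow> 'a::ab_group_add) \<Rightarrow> nat \<Rightarrow> 'a list" where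
  "sites \<omega> n = map (walk \<omega>) [1..<Suc n]"

lemma sites_0 [simp]: "sites \<omega> 0 = []"
  by (simp add: sites_def)

lemma length_sites [simp]: "length (sites \<omega> n) = n"
  by (simp add: sites_def)

lemma set_sites: "set (sites \<omega> n) = walk \<omega> ` {1..n}"
  by (auto simp: sites_def)

lemma sites_Suc: "sites \<omega> (Suc n) = \<omega> 0 # map ((+) (\<omega> 0)) (sites (\<lambda>i. \<omega> (Suc i)) n)"
proof -
  have "sites \<omega> (Suc n) = walk \<omega> 1 # map (walk \<omega>) (map Suc [1..<Suc n])"
    unfolding sites_def by (subst map_Suc_upt) (simp add: upt_conv_Cons del: upt_Suc)
  also have "map (walk \<omega>) (map Suc [1..<Suc n]) = map ((+) (\<omega> 0)) (sites (\<lambda>i. \<omega> (Suc i)) n)"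
    by (simp add: sites_def walk_Suc_shift del: upt_Suc)
  finally show ?thesis by (simp add: walk_def)
qed

lemma sites_snoc: "sites \<omega> (Suc n) = sites \<omega> n @ [walk \<omega> (Suc n)]"
  by (simp add: sites_def)

lemma list_max_map: "list_max \<xi> (map f xs) = list_max (\<lambda>x. \<xi> (f x)) xs"
  by (induction xs) auto

lemma list_max_append_ge: "list_max \<xi> xs \<le> list_max \<xi> (xs @ ys)"
  by (induction xs) (auto simp: max_def)

lemma count_list_map_inj: "inj f \<Longrightarrow> count_list (map f xs) (f x) = count_list xs x"
  by (induction xs) (auto simp: inj_eq)

lemma coincidences_map: "inj f \<Longrightarrow> coincidences (map f xs) = coincidences xs"
  by (induction xs) (auto simp: count_list_map_inj)

text \<open>The tangent at \<theta> of the convex function \<open>1 / sqrt t\<close>; in terms of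
  the square roots the gap is a positive multiple of \<open>(a - b)^2 * (2 * a + b)\<close>. Being
  affine in \<open>t\<close>, the tangent can be averaged, which serves as Jensen's inequality for
  the size of the range.\<close>

lemma tangent_inverse_sqrt:
  fixes t :: real
  shows "0 < \<theta> \<Longrightarrow> 0 < t \<Longrightarrow> 3 / (2 * sqrt \<theta>) - t / (2 * \<theta> * sqrt \<theta>) \<le> 1 / sqrt t"
proof -
  assume \<theta>: "0 < \<theta>" and t: "0 < t"
  define a where "a = sqrt \<theta>"
  define b where "b = sqrt t"
  have a: "a > 0" "\<theta> = a\<^sup>2" and b: "b > 0" "t = b\<^sup>2" using \<theta> t by (auto simp: a_def b_def)
  have "0 \<le> (a - b)\<^sup>2 * (2 * a + b)" using a b by (intro mult_nonneg_nonneg) auto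
  then have "3 * a\<^sup>2 * b - b\<^sup>2 * b \<le> 2 * a\<^sup>2 * a"
    by (simp add: power2_eq_square algebra_simps)
  then have "(3 * a\<^sup>2 * b - b\<^sup>2 * b) / (2 * a\<^sup>2 * a * b) \<le> 2 * a\<^sup>2 * a / (2 * a\<^sup>2 * a * b)"
    using a b by (intro divide_right_mono) auto
  also have "2 * a\<^sup>2 * a / (2 * a\<^sup>2 * a * b) = 1 / b" using a by simp
  also have "(3 * a\<^sup>2 * b - b\<^sup>2 * b) / (2 * a\<^sup>2 * a * b) = 3 / (2 * a) - b\<^sup>2 / (2 * a\<^sup>2 * a)"
    using a b by (simp add: diff_divide_distrib power2_eq_square)
  finally show ?thesis unfolding a_def[symmetric] b_def[symmetric] a(2) b(2) using a b by simp
qed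

section \<open>The walk and the scenery on one product space\<close>

locale rwrs_space = W: step_law \<nu> + Sc: scenery_law \<mu>
  for \<nu> :: "'a::{ab_group_add,countable} measure" and \<mu> :: "real measure"
begin

abbreviation sceneries :: "('a \<Rightarrow> real) measure" where
  "sceneries \<equiv> \<Pi>\<^sub>M x\<in>UNIV. \<mu>"

abbreviation joint :: "((nat \<Rightarrow> 'a) \<times> ('a \<Rightarrow> real)) measure" where
  "joint \<equiv> W.steps \<Otimes>\<^sub>M sceneries"

sublocale S: prob_space sceneries
  by (rule Sc.prob_space_sceneries)

sublocale P: pair_prob_space W.steps sceneries
  by unfold_locales

lemma space_joint [simp]: "space joint = UNIV"
  by (simp add: space_pair_measure)

text \<open>The environment seen from the walker after one step. Its invariance,
  \<open>distr_T\<close>, carries the stationarity of the increments of Z.\<close>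

definition T :: "(nat \<Rightarrow> 'a) \<times> ('a \<Rightarrow> real) \<Rightarrow> (nat \<Rightarrow> 'a) \<times> ('a \<Rightarrow> real)" where
  "T z = ((\<lambda>i. fst z (Suc i)), (\<lambda>x. snd z (fst z 0 + x)))"

definition running_max :: "nat \<Rightarrow> (nat \<Rightarrow> 'a) \<times> ('a \<Rightarrow> real) \<Rightarrow> real" where
  "running_max n z = list_max (snd z) (sites (fst z) n)"

text \<open>The maximum of the partial sums over the times \<open>1, \<dots>, n + 1\<close>.\<close>

definition strict_max :: "nat \<Rightarrow> (nat \<Rightarrow> 'a) \<times> ('a \<Rightarrow> real) \<Rightarrow> real" where
  "strict_max n z = snd z (fst z 0) + running_max n (T z)"

lemma running_max_Suc: "running_max (Suc n) z = max 0 (strict_max n z)"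
  by (simp add: running_max_def strict_max_def T_def sites_Suc list_max_map)

lemma running_max_0 [simp]: "running_max 0 z = 0"
  by (simp add: running_max_def)

lemma running_max_nonneg [simp]: "0 \<le> running_max n z"
  by (simp add: running_max_def)

lemma running_max_mono: "running_max n z \<le> running_max (Suc n) z"
  unfolding running_max_def sites_snoc by (rule list_max_append_ge)

lemma strict_max_mono: "strict_max n z \<le> strict_max (Suc n) z"
  using running_max_mono by (simp add: strict_max_def)

lemma strict_max_ge: "snd z (fst z 0) \<le> strict_max n z"
  by (simp add: strict_max_def)

lemma measurable_into_law: "measurable K \<mu> = borel_measurable K"
  by (rule measurable_cong_sets) simp_all

lemma measurable_visited_site:
  assumes "f \<in> W.steps \<rightarrow>\<^sub>M count_space UNIV"
  shows "(\<lambda>z. snd z (f (fst z))) \<in> borel_measurable joint"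
proof (rule measurable_compose_countable[where f="\<lambda>x z. snd z x" and g="\<lambda>z. f (fst z)"])
  show "(\<lambda>z. snd z x) \<in> borel_measurable joint" for x
    by (rule measurable_compose[OF measurable_snd Sc.measurable_site])
  show "(\<lambda>z. f (fst z)) \<in> joint \<rightarrow>\<^sub>M count_space UNIV"
    by (rule measurable_compose[OF measurable_fst assms])
qed

lemma measurable_first_site [measurable]: "(\<lambda>z. snd z (fst z 0)) \<in> borel_measurable joint"
  by (rule measurable_visited_site[OF W.measurable_coord])

lemma measurable_running_max [measurable]: "running_max n \<in> borel_measurable joint"
proof -
  have "(\<lambda>z. list_max (snd z) (map (walk (fst z)) ks)) \<in> borel_measurable joint" for ks
  proof (induction ks)
    case (Cons k ks)
    have "(\<lambda>z. snd z (walk (fst z) k)) \<in> borel_measurable joint"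
      by (rule measurable_visited_site[OF W.measurable_walk])
    with Cons show ?case unfolding list.map list_max.simps
      by (intro borel_measurable_max borel_measurable_add borel_measurable_const)
  qed simp
  then show ?thesis by (simp add: running_max_def[abs_def] sites_def)
qed

lemma measurable_T [measurable]: "T \<in> joint \<rightarrow>\<^sub>M joint"
proof -
  have "(\<lambda>z. (\<lambda>x. snd z (fst z 0 + x))) \<in> joint \<rightarrow>\<^sub>M sceneries"
  proof (rule measurable_PiM_single')
    fix x
    have "(\<lambda>\<omega>. \<omega> 0 + x) \<in> W.steps \<rightarrow>\<^sub>M count_space UNIV"
      by (rule measurable_compose[OF W.measurable_coord]) simp
    from measurable_visited_site[OF this]
    show "(\<lambda>z. snd z (fst z 0 + x)) \<in> joint \<rightarrow>\<^sub>M \<mu>"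
      by (simp only: measurable_into_law)
  qed simp
  moreover have "(\<lambda>z. (\<lambda>i. fst z (Suc i))) \<in> joint \<rightarrow>\<^sub>M W.steps"
    by (rule measurable_compose[OF measurable_fst W.measurable_Suc_shift])
  ultimately show ?thesis unfolding T_def[abs_def] by (rule measurable_Pair[rotated])
qed

lemma measurable_strict_max [measurable]: "strict_max n \<in> borel_measurable joint"
  unfolding strict_max_def[abs_def]
  by (intro borel_measurable_add measurable_first_site measurable_compose[OF measurable_T measurable_running_max])

lemma distr_translate: "distr sceneries sceneries (\<lambda>\<xi> x. \<xi> (a + x)) = sceneries"
  using distr_PiM_reindex[of UNIV "\<lambda>_. \<mu>" "(+) a" UNIV] Sc.prob_space_axioms
  by (simp add: restrict_def)

lemma measurable_translate: "(\<lambda>\<xi> x. \<xi> (a + x)) \<in> sceneries \<rightarrow>\<^sub>M sceneries"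
  by (rule measurable_PiM_single') (auto intro!: measurable_component_singleton)

text \<open>For a fixed walk the scenery is translated by a fixed vector, which preserves a product
  of identical laws; after that, dropping the first step preserves the law of the steps.\<close>

lemma distr_T: "distr joint joint T = joint"
proof (rule measure_eqI)
  fix A assume "A \<in> sets (distr joint joint T)"
  then have A [measurable]: "A \<in> sets joint" by simp
  have TA: "T -` A \<in> sets joint" using measurable_sets[OF measurable_T A] by simp
  have sec: "Pair \<omega> -` A \<in> sets sceneries" for \<omega> by (rule sets_Pair1[OF A])
  have h: "(\<lambda>\<omega>. emeasure sceneries (Pair \<omega> -` A)) \<in> borel_measurable W.steps"
    by (rule S.measurable_emeasure_Pair[OF A])
  have "emeasure (distr joint joint T) A = emeasure joint (T -` A)"
    by (simp add: emeasure_distr)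
  also have "\<dots> = (\<integral>\<^sup>+\<omega>. emeasure sceneries (Pair \<omega> -` (T -` A)) \<partial>W.steps)"
    by (rule S.emeasure_pair_measure_alt[OF TA])
  also have "\<dots> = (\<integral>\<^sup>+\<omega>. emeasure sceneries (Pair (\<lambda>i. \<omega> (Suc i)) -` A) \<partial>W.steps)"
  proof (rule nn_integral_cong)
    fix \<omega>
    have "Pair \<omega> -` (T -` A) = (\<lambda>\<xi> x. \<xi> (\<omega> 0 + x)) -` (Pair (\<lambda>i. \<omega> (Suc i)) -` A) \<inter> space sceneries"
      by (auto simp: T_def)
    also have "emeasure sceneries \<dots> = emeasure (distr sceneries sceneries (\<lambda>\<xi> x. \<xi> (\<omega> 0 + x))) (Pair (\<lambda>i. \<omega> (Suc i)) -` A)"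
      by (rule emeasure_distr[symmetric, OF measurable_translate sec])
    finally show "emeasure sceneries (Pair \<omega> -` (T -` A)) = emeasure sceneries (Pair (\<lambda>i. \<omega> (Suc i)) -` A)"
      by (simp only: distr_translate)
  qed
  also have "\<dots> = (\<integral>\<^sup>+\<omega>. emeasure sceneries (Pair \<omega> -` A) \<partial>distr W.steps W.steps (\<lambda>\<omega> i. \<omega> (Suc i)))"
    by (rule nn_integral_distr[symmetric]) (simp_all add: W.measurable_Suc_shift h)
  also have "\<dots> = emeasure joint A"
    unfolding W.distr_Suc_shift by (rule S.emeasure_pair_measure_alt[OF A, symmetric])
  finally show "emeasure (distr joint joint T) A = emeasure joint A" .
qed simp

lemma integral_T: "f \<in> borel_measurable joint \<Longrightarrow> (\<integral>z. f (T z) \<partial>joint) = (\<integral>z. f z \<partial>joint)"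
  for f :: "_ \<Rightarrow> real"
  using integral_distr[of T joint joint f] by (simp add: distr_T)

lemma integrable_T: "integrable joint f \<Longrightarrow> integrable joint (\<lambda>z. f (T z))"
  for f :: "_ \<Rightarrow> real"
  using integrable_distr[of T joint joint f] by (simp add: distr_T)

lemma distr_first_site: "distr joint \<mu> (\<lambda>z. snd z (fst z 0)) = \<mu>"
proof (rule measure_eqI)
  fix A assume "A \<in> sets (distr joint \<mu> (\<lambda>z. snd z (fst z 0)))"
  then have A: "A \<in> sets \<mu>" by simp
  have m: "(\<lambda>z. snd z (fst z 0)) \<in> joint \<rightarrow>\<^sub>M \<mu>"
    using measurable_first_site by (simp only: measurable_into_law)
  have mA: "(\<lambda>z. snd z (fst z 0)) -` A \<in> sets joint" using measurable_sets[OF m A] by simp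
  have "emeasure (distr joint \<mu> (\<lambda>z. snd z (fst z 0))) A = emeasure joint ((\<lambda>z. snd z (fst z 0)) -` A)"
    using emeasure_distr[OF m A] by simp
  also have "\<dots> = (\<integral>\<^sup>+\<omega>. emeasure sceneries (Pair \<omega> -` ((\<lambda>z. snd z (fst z 0)) -` A)) \<partial>W.steps)"
    by (rule S.emeasure_pair_measure_alt[OF mA])
  also have "\<dots> = (\<integral>\<^sup>+\<omega>. emeasure \<mu> A \<partial>W.steps)"
  proof (rule nn_integral_cong)
    fix \<omega> :: "nat \<Rightarrow> 'a"
    have mx: "(\<lambda>\<xi>. \<xi> (\<omega> 0)) \<in> sceneries \<rightarrow>\<^sub>M \<mu>" by (rule measurable_component_singleton) simp
    have "emeasure sceneries (Pair \<omega> -` ((\<lambda>z. snd z (fst z 0)) -` A)) = emeasure (distr sceneries \<mu> (\<lambda>\<xi>. \<xi> (\<omega> 0))) A"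
      using emeasure_distr[OF mx A] by (simp add: vimage_def)
    then show "emeasure sceneries (Pair \<omega> -` ((\<lambda>z. snd z (fst z 0)) -` A)) = emeasure \<mu> A"
      by (simp only: Sc.distr_site)
  qed
  also have "\<dots> = emeasure \<mu> A" using W.steps.P.emeasure_space_1 by simp
  finally show "emeasure (distr joint \<mu> (\<lambda>z. snd z (fst z 0))) A = emeasure \<mu> A" .
qed simp

lemma
  fixes f :: "real \<Rightarrow> real"
  assumes [measurable]: "f \<in> borel_measurable borel"
  shows integral_first_site: "(\<integral>z. f (snd z (fst z 0)) \<partial>joint) = (\<integral>y. f y \<partial>\<mu>)"
    and integrable_first_site: "integrable \<mu> f \<Longrightarrow> integrable joint (\<lambda>z. f (snd z (fst z 0)))"
proof -
  have m: "(\<lambda>z. snd z (fst z 0)) \<in> joint \<rightarrow>\<^sub>M \<mu>"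
    using measurable_first_site by (simp only: measurable_into_law)
  have f: "f \<in> borel_measurable \<mu>" by (simp cong: measurable_cong_sets)
  show "(\<integral>z. f (snd z (fst z 0)) \<partial>joint) = (\<integral>y. f y \<partial>\<mu>)"
    using integral_distr[OF m f] by (simp add: distr_first_site)
  show "integrable \<mu> f \<Longrightarrow> integrable joint (\<lambda>z. f (snd z (fst z 0)))"
    using integrable_distr[OF m, of f] by (simp add: distr_first_site)
qed

lemma integrable_first: "integrable joint (\<lambda>z. snd z (fst z 0))"
  by (rule integrable_first_site[OF _ Sc.law_integrable]) simp

lemma integral_first: "(\<integral>z. snd z (fst z 0) \<partial>joint) = 0"
  using integral_first_site[of "\<lambda>y. y"] by (simp add: Sc.law_centered)

lemma integrable_running_max: "integrable joint (running_max n)"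
proof (induction n)
  case (Suc n)
  have "integrable joint (\<lambda>z. snd z (fst z 0) + running_max n (T z))"
    by (rule Bochner_Integration.integrable_add[OF integrable_first integrable_T[OF Suc]])
  from integrable_max[OF integrable_zero this] show ?case
    by (simp only: running_max_Suc[abs_def] strict_max_def)
qed (simp add: running_max_def[abs_def])

lemma integrable_strict_max: "integrable joint (strict_max n)"
  unfolding strict_max_def[abs_def]
  by (rule Bochner_Integration.integrable_add[OF integrable_first integrable_T[OF integrable_running_max]])

section \<open>The expected maximum and its increments\<close>

definition expected_max :: "nat \<Rightarrow> real" where
  "expected_max n = (\<integral>z. running_max n z \<partial>joint)"

text \<open>Off by one: \<open>strict_max n\<close> runs over the times 1 to \<open>n + 1\<close>,
  so this is the mean negative part for the horizon \<open>n + 1\<close>.\<close>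

definition deficit :: "nat \<Rightarrow> real" where
  "deficit n = (\<integral>z. max 0 (- strict_max n z) \<partial>joint)"

lemma integrable_deficit: "integrable joint (\<lambda>z. max 0 (- strict_max n z))"
  by (rule integrable_max[OF integrable_zero Bochner_Integration.integrable_minus[OF integrable_strict_max]])

text \<open>The negative part of a number \<open>x\<close> is \<open>max 0 x - x\<close>. For
  \<open>x\<close> equal to \<open>strict_max n\<close>, the first term is
  \<open>running_max (Suc n)\<close>, while the second has the mean of \<open>running_max n\<close>,
  because the first site is centered and \<open>T\<close> preserves the law.\<close>

lemma deficit_eq: "deficit n = expected_max (Suc n) - expected_max n"
proof -
  have "deficit n = (\<integral>z. running_max (Suc n) z - strict_max n z \<partial>joint)"
    unfolding deficit_def running_max_Suc by (intro Bochner_Integration.integral_cong) auto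
  also have "\<dots> = expected_max (Suc n) - (\<integral>z. strict_max n z \<partial>joint)"
    unfolding expected_max_def
    by (rule Bochner_Integration.integral_diff[OF integrable_running_max integrable_strict_max])
  also have "(\<integral>z. strict_max n z \<partial>joint) = expected_max n"
    unfolding strict_max_def expected_max_def
    by (subst Bochner_Integration.integral_add[OF integrable_first integrable_T[OF integrable_running_max]])
      (simp only: integral_first integral_T[OF measurable_running_max] add_0_left)
  finally show ?thesis .
qed

lemma deficit_antimono: "m \<le> n \<Longrightarrow> deficit n \<le> deficit m"
proof (rule lift_Suc_antimono_le[of deficit])
  fix n
  show "deficit (Suc n) \<le> deficit n"
    unfolding deficit_def
  proof (intro integral_mono integrable_deficit)
    show "max 0 (- strict_max (Suc n) z) \<le> max 0 (- strict_max n z)" for z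
      using strict_max_mono[of n z] by linarith
  qed
qed

lemma sum_deficit: "(\<Sum>j<n. deficit j) = expected_max n"
proof (induction n)
  case (Suc n)
  then show ?case by (simp add: deficit_eq)
qed (simp add: expected_max_def)

lemma deficit_le: "real (Suc n) * deficit n \<le> expected_max (Suc n)"
proof -
  have "real (Suc n) * deficit n = (\<Sum>j<Suc n. deficit n)" by simp
  also have "\<dots> \<le> (\<Sum>j<Suc n. deficit j)"
    by (intro sum_mono deficit_antimono) auto
  finally show ?thesis by (simp only: sum_deficit)
qed

lemma deficit_ge: "expected_max (n + k) - expected_max n \<le> real k * deficit n"
proof (induction k)
  case (Suc k)
  have "expected_max (n + Suc k) - expected_max n = deficit (n + k) + (expected_max (n + k) - expected_max n)"
    by (simp add: deficit_eq)
  also have "\<dots> \<le> deficit n + real k * deficit n"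
    using Suc deficit_antimono[of n "n + k"] by simp
  finally show ?case by (simp add: algebra_simps)
qed simp

lemma
  fixes f :: "(nat \<Rightarrow> 'a) \<Rightarrow> real"
  assumes "integrable W.steps f"
  shows integrable_step_shift: "integrable W.steps (\<lambda>\<omega>. f (\<lambda>i. \<omega> (Suc i)))"
    and integral_step_shift: "(\<integral>\<omega>. f (\<lambda>i. \<omega> (Suc i)) \<partial>W.steps) = (\<integral>\<omega>. f \<omega> \<partial>W.steps)"
  using integrable_distr[OF W.measurable_Suc_shift, of f] integral_distr[OF W.measurable_Suc_shift, of f]
    borel_measurable_integrable[OF assms] assms by (simp_all add: W.distr_Suc_shift)

text \<open>Seen from the first site, later coincidences with it are returns of the shifted walk to
  the origin; the rest of the list has the law of a shorter one.\<close>

lemma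
  shows integrable_coincidences: "integrable W.steps (\<lambda>\<omega>. real (coincidences (sites \<omega> n)))"
    and expected_coincidences_le: "(\<integral>\<omega>. real (coincidences (sites \<omega> n)) \<partial>W.steps) \<le> 2 * real n * W.green n"
proof (induction n)
  case (Suc n)
  \<comment> \<open>One for the first site itself and two for each return to it; the mean is
    \<open>2 * green n - 1\<close>.\<close>
  define F :: "(nat \<Rightarrow> 'a) \<Rightarrow> real" where "F \<omega> = 1 + 2 * (\<Sum>k=1..n. indicator {\<omega>. walk \<omega> k = 0} \<omega>)" for \<omega> :: "nat \<Rightarrow> 'a"
  have int: "integrable W.steps (\<lambda>\<omega>. indicator {\<omega>. walk \<omega> k = 0} \<omega> :: real)" for k
    using W.sets_walk_eq[of k 0] by (intro integrable_real_indicator) (auto simp: W.steps.P.emeasure_eq_measure)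
  have intF: "integrable W.steps F"
    unfolding F_def by (intro Bochner_Integration.integrable_add integrable_mult_right Bochner_Integration.integrable_sum int) simp
  have "(\<integral>\<omega>. F \<omega> \<partial>W.steps) = 1 + 2 * (\<Sum>k=1..n. W.hit k 0)"
    unfolding F_def using int W.sets_walk_eq[of _ 0] W.steps.P.prob_space
    by (subst Bochner_Integration.integral_add) (auto simp: W.hit_def)
  also have "\<dots> = 2 * W.green n - 1"
  proof -
    have "W.green n = W.hit 0 0 + (\<Sum>k=1..n. W.hit k 0)"
      unfolding W.green_def by (simp add: atMost_atLeast0 sum.atLeast_Suc_atMost)
    then show ?thesis by (simp add: W.hit_0)
  qed
  finally have F_le: "(\<integral>\<omega>. F \<omega> \<partial>W.steps) \<le> 2 * W.green n" by simp
  have split: "real (coincidences (sites \<omega> (Suc n))) =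
      F (\<lambda>i. \<omega> (Suc i)) + real (coincidences (sites (\<lambda>i. \<omega> (Suc i)) n))" for \<omega>
  proof -
    let ?s = "\<lambda>i. \<omega> (Suc i)"
    have "count_list (map ((+) (\<omega> 0)) (sites ?s n)) (\<omega> 0) = count_list (sites ?s n) 0"
      using count_list_map_inj[of "(+) (\<omega> 0)" "sites ?s n" 0] by simp
    also have "real \<dots> = (\<Sum>k=1..n. indicator {\<omega>. walk \<omega> k = 0} ?s)"
      by (induction n) (auto simp: sites_snoc indicator_def)
    finally show ?thesis by (simp add: sites_Suc F_def coincidences_map)
  qed
  note shift = integrable_step_shift[OF intF] integrable_step_shift[OF Suc(1)]
  {
    case 1
    show ?case unfolding split using shift by (rule Bochner_Integration.integrable_add)
  next
    case 2
    have "(\<integral>\<omega>. real (coincidences (sites \<omega> (Suc n))) \<partial>W.steps) =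
        (\<integral>\<omega>. F \<omega> \<partial>W.steps) + (\<integral>\<omega>. real (coincidences (sites \<omega> n)) \<partial>W.steps)"
      unfolding split using Bochner_Integration.integral_add[OF shift]
        integral_step_shift[OF intF] integral_step_shift[OF Suc(1)] by simp
    also have "\<dots> \<le> 2 * W.green n + 2 * real n * W.green n" using F_le Suc(2) by linarith
    also have "\<dots> = 2 * real (Suc n) * W.green n" by (simp add: algebra_simps)
    also have "\<dots> \<le> 2 * real (Suc n) * W.green (Suc n)"
      by (intro mult_left_mono W.green_mono) auto
    finally show ?case .
  }
qed simp_all

definition law_variance :: real where "law_variance = (\<integral>y. y\<^sup>2 \<partial>\<mu>)"
definition law_abs_mean :: real where "law_abs_mean = (\<integral>y. \<bar>y\<bar> \<partial>\<mu>)"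

lemma law_variance_nonneg: "0 \<le> law_variance" and law_abs_mean_nonneg: "0 \<le> law_abs_mean"
  by (simp_all add: law_variance_def law_abs_mean_def)

lemma running_max_pair: "running_max n (\<omega>, \<xi>) = list_max \<xi> (sites \<omega> n)"
  by (simp add: running_max_def)

lemma expected_max_fubini:
  "expected_max n = (\<integral>\<omega>. \<integral>\<xi>. list_max \<xi> (sites \<omega> n) \<partial>sceneries \<partial>W.steps)"
  and integrable_expected_max_fubini:
    "integrable W.steps (\<lambda>\<omega>. \<integral>\<xi>. list_max \<xi> (sites \<omega> n) \<partial>sceneries)"
  unfolding expected_max_def
  using P.integral_fst'[OF integrable_running_max[of n]] P.integrable_fst'[OF integrable_running_max[of n]]
  by (simp_all add: running_max_pair)

lemma integrable_list_max: "integrable sceneries (\<lambda>\<xi>. list_max \<xi> xs)"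
proof (induction xs)
  case (Cons x xs)
  then show ?case by (auto intro!: integrable_max Bochner_Integration.integrable_add Sc.integrable_site)
qed simp

lemma integrable_list_total: "integrable sceneries (\<lambda>\<xi>. list_total \<xi> xs)"
  by (induction xs) (auto intro!: Bochner_Integration.integrable_add Sc.integrable_site)

lemma integral_site: "(\<integral>\<xi>. \<xi> x \<partial>sceneries) = 0"
  using Sc.integral_site_mult[OF Sc.law_integrable, of "\<lambda>_. 1" x] S.prob_space by (simp add: Sc.law_centered)

lemma integral_list_total: "(\<integral>\<xi>. list_total \<xi> xs \<partial>sceneries) = 0"
  by (induction xs) (auto simp: integral_site Sc.integrable_site integrable_list_total)

text \<open>From \<open>E Y \<le> (E Y\<^sup>2 + t\<^sup>2) / (2 t)\<close>, which avoids the Cauchy-Schwarz inequality.\<close>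

lemma expected_max_le: "expected_max n \<le> sqrt (2 * (law_variance + 1) * real n * W.green n)"
proof (cases "n = 0")
  case False
  define t where "t = sqrt (2 * (law_variance + 1) * real n * W.green n)"
  have pos: "2 * (law_variance + 1) * real n * W.green n > 0"
    using False law_variance_nonneg W.green_ge_1[of n] by (intro mult_pos_pos) auto
  then have t: "t > 0" "t\<^sup>2 = 2 * (law_variance + 1) * real n * W.green n" by (simp_all add: t_def)
  have "(\<integral>\<xi>. list_max \<xi> xs \<partial>sceneries) \<le> (law_variance * real (coincidences xs) + t\<^sup>2) / (2 * t)" for xs
  proof -
    have "y \<le> (y\<^sup>2 + t\<^sup>2) / (2 * t)" for y
      using t(1) sum_squares_bound[of y t] by (simp add: field_simps)
    then have "(\<integral>\<xi>. list_max \<xi> xs \<partial>sceneries) \<le> (\<integral>\<xi>. ((list_max \<xi> xs)\<^sup>2 + t\<^sup>2) / (2 * t) \<partial>sceneries)"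
      by (intro integral_mono integrable_list_max integrable_divide Bochner_Integration.integrable_add
          Sc.integrable_list_max_square) auto
    also have "\<dots> = ((\<integral>\<xi>. (list_max \<xi> xs)\<^sup>2 \<partial>sceneries) + t\<^sup>2) / (2 * t)"
      using Sc.integrable_list_max_square[of xs] S.prob_space by simp
    also have "\<dots> \<le> (law_variance * real (coincidences xs) + t\<^sup>2) / (2 * t)"
      using Sc.integral_list_max_square_le[of xs] Sc.integral_list_total_square[of xs] t(1)
      by (intro divide_right_mono) (auto simp: law_variance_def)
    finally show ?thesis .
  qed
  then have "expected_max n \<le> (\<integral>\<omega>. (law_variance * real (coincidences (sites \<omega> n)) + t\<^sup>2) / (2 * t) \<partial>W.steps)"
    unfolding expected_max_fubini
    by (intro integral_mono integrable_expected_max_fubini integrable_divide Bochner_Integration.integrable_add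
        integrable_mult_right integrable_coincidences) auto
  also have "\<dots> = (law_variance * (\<integral>\<omega>. real (coincidences (sites \<omega> n)) \<partial>W.steps) + t\<^sup>2) / (2 * t)"
    using integrable_coincidences[of n] W.steps.P.prob_space by simp
  also have "\<dots> \<le> (t\<^sup>2 + t\<^sup>2) / (2 * t)"
  proof (intro divide_right_mono add_right_mono)
    have "law_variance * (\<integral>\<omega>. real (coincidences (sites \<omega> n)) \<partial>W.steps) \<le> law_variance * (2 * real n * W.green n)"
      by (intro mult_left_mono expected_coincidences_le law_variance_nonneg)
    also have "\<dots> \<le> (law_variance + 1) * (2 * real n * W.green n)"
      using W.green_ge_1[of n] by (intro mult_right_mono) auto
    finally show "law_variance * (\<integral>\<omega>. real (coincidences (sites \<omega> n)) \<partial>W.steps) \<le> t\<^sup>2"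
      by (simp add: t(2) algebra_simps)
  qed (use t in auto)
  also have "\<dots> = t" using t(1) by (simp add: power2_eq_square)
  finally show ?thesis by (simp add: t_def)
qed (simp add: expected_max_def)

text \<open>Along a fixed path the total is centered, so its positive part has half the mean of its
  modulus. The Riesz product bounds the latter below by a multiple of \<open>n / sqrt R\<close>, as
  the local times add up to \<open>n\<close>. The mean of the range \<open>R\<close> is at most the
  sum of the \<open>avoid j\<close>, and convexity of the inverse square root lets \<open>R\<close>
  be replaced by a bound on its mean.\<close>

lemma expected_max_ge:
  assumes n: "n \<ge> 1"
  shows "law_abs_mean / (4 * exp (1/2)) * (real n / sqrt (\<Sum>j<n. 1 / W.green j)) \<le> expected_max n"
proof -
  define c where "c = law_abs_mean / (4 * exp (1/2))"
  have c0: "c \<ge> 0" by (simp add: c_def law_abs_mean_nonneg)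
  define \<theta> where "\<theta> = (\<Sum>j<n. 1 / W.green j)"
  have "1 / W.green 0 > 0" using W.green_ge_1[of 0] by simp
  then have \<theta>: "\<theta> > 0" unfolding \<theta>_def using n W.green_ge_1
    by (intro sum_pos2[of _ 0]) (auto intro!: divide_nonneg_nonneg order_trans[OF zero_le_one])
  define R where "R \<omega> = real (card (walk \<omega> ` {1..n}))" for \<omega> :: "nat \<Rightarrow> 'a"
  have R_pos: "R \<omega> > 0" for \<omega> unfolding R_def using n by (simp add: card_gt_0_iff)
  have R_le: "R \<omega> \<le> real n" for \<omega>
    unfolding R_def using card_image_le[of "{1..n}" "walk \<omega>"] by simp
  have inner: "c * real n / sqrt (R \<omega>) \<le> (\<integral>\<xi>. list_max \<xi> (sites \<omega> n) \<partial>sceneries)" for \<omega>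
  proof -
    let ?xs = "sites \<omega> n"
    have ne: "set ?xs \<noteq> {}" using n by (simp add: set_sites)
    have "law_abs_mean * (\<Sum>x\<in>set ?xs. real (count_list ?xs x)) / (2 * exp (1/2) * sqrt (card (set ?xs))) \<le>
        (\<integral>\<xi>. \<bar>\<Sum>x\<in>set ?xs. real (count_list ?xs x) * \<xi> x\<bar> \<partial>sceneries)"
      by (rule Sc.integral_abs_weighted_ge) (use ne in \<open>auto simp: law_abs_mean_def\<close>)
    also have "(\<Sum>x\<in>set ?xs. real (count_list ?xs x)) = real n"
      using sum_count_set[of ?xs "set ?xs"] by (simp flip: of_nat_sum)
    also have "real (card (set ?xs)) = R \<omega>" by (simp add: R_def set_sites)
    also have "(\<lambda>\<xi>. \<bar>\<Sum>x\<in>set ?xs. real (count_list ?xs x) * \<xi> x\<bar>) = (\<lambda>\<xi>. \<bar>list_total \<xi> ?xs\<bar>)"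
      by (simp add: list_total_eq_sum)
    finally have "law_abs_mean * real n / (2 * exp (1/2) * sqrt (R \<omega>)) \<le> (\<integral>\<xi>. \<bar>list_total \<xi> ?xs\<bar> \<partial>sceneries)" .
    also have "\<dots> = (\<integral>\<xi>. 2 * max 0 (list_total \<xi> ?xs) - list_total \<xi> ?xs \<partial>sceneries)"
      by (intro Bochner_Integration.integral_cong) auto
    also have "\<dots> = 2 * (\<integral>\<xi>. max 0 (list_total \<xi> ?xs) \<partial>sceneries)"
      using integrable_list_total[of ?xs] integral_list_total[of ?xs] by simp
    also have "(\<integral>\<xi>. max 0 (list_total \<xi> ?xs) \<partial>sceneries) \<le> (\<integral>\<xi>. list_max \<xi> ?xs \<partial>sceneries)"
      using integrable_list_total[of ?xs] list_total_le_max[of _ ?xs]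
      by (intro integral_mono integrable_list_max) auto
    finally show ?thesis by (simp add: c_def)
  qed
  have mR: "R \<in> borel_measurable W.steps"
  proof -
    have "(\<lambda>\<omega>. card (set (map (walk \<omega>) ks) \<union> X)) \<in> W.steps \<rightarrow>\<^sub>M count_space UNIV" for ks and X :: "'a set"
    proof (induction ks arbitrary: X)
      case (Cons k ks)
      have "(\<lambda>\<omega>. card (set (map (walk \<omega>) ks) \<union> insert (walk \<omega> k) X)) \<in> W.steps \<rightarrow>\<^sub>M count_space UNIV"
        by (rule measurable_compose_countable[where f="\<lambda>x \<omega>. card (set (map (walk \<omega>) ks) \<union> insert x X)" and g="\<lambda>\<omega>. walk \<omega> k"])
          (rule Cons, rule W.measurable_walk)
      then show ?case by simp
    qed simp
    from this[of "[1..<Suc n]" "{}"] have "(\<lambda>\<omega>. card (walk \<omega> ` {1..n})) \<in> W.steps \<rightarrow>\<^sub>M count_space UNIV"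
      by (simp add: atLeastLessThanSuc_atLeastAtMost del: upt_Suc)
    then show ?thesis unfolding R_def by (rule measurable_compose) simp
  qed
  have intR: "integrable W.steps R"
    by (rule W.steps.P.integrable_const_bound[where B="real n"]) (use R_le mR in \<open>auto simp: R_def\<close>)
  have ER: "(\<integral>\<omega>. R \<omega> \<partial>W.steps) \<le> \<theta>"
  proof -
    have "(\<integral>\<omega>. R \<omega> \<partial>W.steps) \<le> (\<Sum>j<n. W.avoid j)"
      unfolding R_def by (rule W.expectation_range_le)
    also have "\<dots> \<le> \<theta>"
      unfolding \<theta>_def
    proof (intro sum_mono)
      fix j
      have "W.green j > 0" using W.green_ge_1[of j] by linarith
      then show "W.avoid j \<le> 1 / W.green j" using W.avoid_green_le[of j] by (simp add: le_divide_eq)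
    qed
    finally show ?thesis .
  qed
  \<comment> \<open>The tangent at \<theta> decreases in \<open>R\<close>, so an upper bound on the
    mean of \<open>R\<close> works in the right direction.\<close>
  have "c * real n * (1 / sqrt \<theta>) \<le> c * real n * (3 / (2 * sqrt \<theta>) - (\<integral>\<omega>. R \<omega> \<partial>W.steps) / (2 * \<theta> * sqrt \<theta>))"
  proof (intro mult_left_mono)
    have "(\<integral>\<omega>. R \<omega> \<partial>W.steps) / (2 * \<theta> * sqrt \<theta>) \<le> \<theta> / (2 * \<theta> * sqrt \<theta>)"
      using ER \<theta> by (intro divide_right_mono) auto
    also have "\<dots> = 1 / (2 * sqrt \<theta>)" using \<theta> by simp
    finally show "1 / sqrt \<theta> \<le> 3 / (2 * sqrt \<theta>) - (\<integral>\<omega>. R \<omega> \<partial>W.steps) / (2 * \<theta> * sqrt \<theta>)"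
      by simp
  qed (use c0 in auto)
  also have "\<dots> = (\<integral>\<omega>. c * real n * (3 / (2 * sqrt \<theta>) - R \<omega> / (2 * \<theta> * sqrt \<theta>)) \<partial>W.steps)"
    using intR W.steps.P.prob_space by simp
  also have "\<dots> \<le> expected_max n"
    unfolding expected_max_fubini
  proof (rule integral_mono)
    show "integrable W.steps (\<lambda>\<omega>. c * real n * (3 / (2 * sqrt \<theta>) - R \<omega> / (2 * \<theta> * sqrt \<theta>)))"
      using intR by auto
    show "integrable W.steps (\<lambda>\<omega>. \<integral>\<xi>. list_max \<xi> (sites \<omega> n) \<partial>sceneries)"
      by (rule integrable_expected_max_fubini)
    fix \<omega>
    have "c * real n * (3 / (2 * sqrt \<theta>) - R \<omega> / (2 * \<theta> * sqrt \<theta>)) \<le> c * real n * (1 / sqrt (R \<omega>))"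
      using tangent_inverse_sqrt[OF \<theta> R_pos] c0 by (intro mult_left_mono) auto
    also have "\<dots> \<le> (\<integral>\<xi>. list_max \<xi> (sites \<omega> n) \<partial>sceneries)" using inner[of \<omega>] by simp
    finally show "c * real n * (3 / (2 * sqrt \<theta>) - R \<omega> / (2 * \<theta> * sqrt \<theta>)) \<le> (\<integral>\<xi>. list_max \<xi> (sites \<omega> n) \<partial>sceneries)" .
  qed
  finally show ?thesis by (simp add: c_def \<theta>_def)
qed

text \<open>For a fixed walk, a low value at the first site is positively correlated with a low maximum of
  the shifted process, even if the walk returns to that site.\<close>

lemma strict_max_prepend:
  "measure \<mu> {..e} * measure joint {z. strict_max n z \<le> t} \<le> measure joint {z. strict_max (Suc n) z \<le> e + max 0 t}"
proof -
  let ?B = "{z. strict_max n z \<le> t}"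
  let ?A = "{z. snd z (fst z 0) \<le> e \<and> strict_max n (T z) \<le> t}"
  have mB: "?B \<in> sets joint"
  proof -
    have "{z\<in>space joint. strict_max n z \<le> t} \<in> sets joint" by measurable
    then show ?thesis by simp
  qed
  have mTB: "T -` ?B \<in> sets joint" using measurable_sets[OF measurable_T mB] by simp
  have mA: "?A \<in> sets joint"
  proof -
    have "{z\<in>space joint. snd z (fst z 0) \<le> e} \<in> sets joint" by measurable
    from sets.Int[OF this mTB] show ?thesis by (simp add: vimage_def Int_def)
  qed
  have "emeasure \<mu> {..e} * emeasure joint ?B = emeasure \<mu> {..e} * emeasure joint (T -` ?B)"
    using emeasure_distr[OF measurable_T mB] by (simp add: distr_T)
  also have "\<dots> = (\<integral>\<^sup>+\<omega>. emeasure \<mu> {..e} * emeasure sceneries (Pair \<omega> -` (T -` ?B)) \<partial>W.steps)"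
    using S.emeasure_pair_measure_alt[OF mTB] S.measurable_emeasure_Pair[OF mTB] by (simp add: nn_integral_cmult)
  also have "\<dots> \<le> (\<integral>\<^sup>+\<omega>. emeasure sceneries (Pair \<omega> -` ?A) \<partial>W.steps)"
  proof (rule nn_integral_mono)
    fix \<omega> :: "nat \<Rightarrow> 'a"
    let ?C = "Pair \<omega> -` (T -` ?B)"
    have "measure \<mu> {..e} * measure sceneries ?C \<le> measure sceneries ({\<xi>. \<xi> (\<omega> 0) \<le> e} \<inter> ?C)"
    proof (rule Sc.prob_site_le_inter_ge)
      show "?C \<in> sets sceneries" by (rule sets_Pair1[OF mTB])
      fix \<xi> \<xi>' :: "'a \<Rightarrow> real" assume "\<xi>' \<in> ?C" and le: "\<And>z. \<xi> z \<le> \<xi>' z"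
      then have "strict_max n (T (\<omega>, \<xi>')) \<le> t" by simp
      moreover have "strict_max n (T (\<omega>, \<xi>)) \<le> strict_max n (T (\<omega>, \<xi>'))"
        unfolding strict_max_def running_max_def T_def fst_conv snd_conv by (intro add_mono le list_max_mono)
      ultimately show "\<xi> \<in> ?C" by simp
    qed
    also have "{\<xi>. \<xi> (\<omega> 0) \<le> e} \<inter> ?C = Pair \<omega> -` ?A" by auto
    finally show "emeasure \<mu> {..e} * emeasure sceneries ?C \<le> emeasure sceneries (Pair \<omega> -` ?A)"
      by (simp add: Sc.emeasure_eq_measure S.emeasure_eq_measure flip: ennreal_mult'')
  qed
  also have "\<dots> = emeasure joint ?A" by (rule S.emeasure_pair_measure_alt[OF mA, symmetric])
  finally have "measure \<mu> {..e} * measure joint ?B \<le> measure joint ?A"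
    by (simp add: Sc.emeasure_eq_measure P.emeasure_eq_measure flip: ennreal_mult'')
  also have "\<dots> \<le> measure joint {z. strict_max (Suc n) z \<le> e + max 0 t}"
  proof (rule P.finite_measure_mono)
    show "?A \<subseteq> {z. strict_max (Suc n) z \<le> e + max 0 t}"
      by (auto simp: strict_max_def[of "Suc n"] running_max_Suc)
    have "{z\<in>space joint. strict_max (Suc n) z \<le> e + max 0 t} \<in> sets joint" by measurable
    then show "{z. strict_max (Suc n) z \<le> e + max 0 t} \<in> sets joint" by simp
  qed
  finally show ?thesis .
qed

end

section \<open>From the Green function to the mean deficit\<close>

lemma sum_inverse_sqrt_le: "(\<Sum>j=1..n. 1 / sqrt (real j)) \<le> 2 * sqrt (real n)"
proof (induction n)
  case (Suc n)
  define a where "a = sqrt (real n)"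
  define b where "b = sqrt (real (Suc n))"
  have ab: "0 \<le> a" "0 < b" "a\<^sup>2 = real n" "b\<^sup>2 = real n + 1" by (auto simp: a_def b_def)
  have "0 \<le> (b - a)\<^sup>2" by simp
  then have "2 * a * b \<le> 2 * b\<^sup>2 - 1" using ab by (simp add: power2_diff algebra_simps)
  then have "1 / b \<le> 2 * b - 2 * a" using ab by (simp add: field_simps power2_eq_square)
  with Suc show ?case by (simp add: a_def b_def)
qed simp

text \<open>\<open>L\<close> is the order of the Green function, kept abstract so that one argument
  covers the logarithmic, the polynomial and the transient case. \<open>L_regular\<close> says that
  it grows at most like a square root; the factor 2 makes room for the logarithm.\<close>

locale green_profile = rwrs_space \<nu> \<mu>
  for \<nu> :: "'a::{ab_group_add,countable} measure" and \<mu> :: "real measure" +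
  fixes L :: "nat \<Rightarrow> real" and e0 c0 C0 :: real
  assumes nondeg: "e0 < 0" "measure \<mu> {..e0} > 0"
    and L_ge_1: "\<And>n. n \<ge> 1 \<Longrightarrow> 1 \<le> L n"
    and L_mono: "\<And>m n. 1 \<le> m \<Longrightarrow> m \<le> n \<Longrightarrow> L m \<le> L n"
    and L_regular: "\<And>j n. 1 \<le> j \<Longrightarrow> j \<le> n \<Longrightarrow> L n \<le> 2 * sqrt (real n / real j) * L j"
    and c0: "c0 > 0" and C0: "C0 > 0"
    and green_bounds: "\<And>n. n \<ge> 1 \<Longrightarrow> c0 * L n \<le> W.green n" "\<And>n. n \<ge> 1 \<Longrightarrow> W.green n \<le> C0 * L n"
begin

definition scale :: "nat \<Rightarrow> real" where
  "scale n = sqrt (real n * L n)"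

lemma scale_pos: "n \<ge> 1 \<Longrightarrow> scale n > 0"
  using L_ge_1[of n] by (auto simp: scale_def intro!: mult_pos_pos)

lemma scale_multiple: "n \<ge> 1 \<Longrightarrow> k \<ge> 1 \<Longrightarrow> sqrt (real k) * scale n \<le> scale (k * n)"
proof -
  assume n: "n \<ge> 1" and k: "k \<ge> 1"
  have "L n \<le> L (k * n)" using n k by (intro L_mono) auto
  then have "real k * (real n * L n) \<le> real (k * n) * L (k * n)"
    using n k by (simp add: mult.assoc mult_left_mono)
  then show ?thesis unfolding scale_def real_sqrt_mult[symmetric] by (rule real_sqrt_le_mono)
qed

lemma law_abs_mean_pos: "law_abs_mean > 0"
proof -
  have A: "{..e0} \<in> sets \<mu>" by simp
  have "0 < - e0 * measure \<mu> {..e0}" using nondeg by (intro mult_pos_pos) auto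
  also have "\<dots> = (\<integral>y. - e0 * indicator {..e0} y \<partial>\<mu>)" using A by simp
  also have "\<dots> \<le> (\<integral>y. \<bar>y\<bar> \<partial>\<mu>)"
  proof (rule integral_mono)
    show "integrable \<mu> (\<lambda>y. - e0 * indicator {..e0} y)"
      using A by (intro integrable_mult_right integrable_real_indicator) (auto simp: Sc.emeasure_eq_measure)
    show "integrable \<mu> (\<lambda>y. \<bar>y\<bar>)" using Sc.law_integrable by (rule integrable_abs)
    show "- e0 * indicator {..e0} y \<le> \<bar>y\<bar>" for y using nondeg(1) by (auto simp: indicator_def)
  qed
  finally show ?thesis by (simp add: law_abs_mean_def)
qed

lemma expected_max_upper: "expected_max n \<le> sqrt (2 * (law_variance + 1) * C0) * scale n"
proof (cases "n = 0")
  case False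
  have "expected_max n \<le> sqrt (2 * (law_variance + 1) * real n * W.green n)" by (rule expected_max_le)
  also have "\<dots> \<le> sqrt ((2 * (law_variance + 1) * C0) * (real n * L n))"
  proof (rule real_sqrt_le_mono)
    have "2 * (law_variance + 1) * real n * W.green n \<le> 2 * (law_variance + 1) * real n * (C0 * L n)"
      using False law_variance_nonneg green_bounds(2)[of n] by (intro mult_left_mono mult_nonneg_nonneg) auto
    then show "2 * (law_variance + 1) * real n * W.green n \<le> (2 * (law_variance + 1) * C0) * (real n * L n)"
      by (simp add: mult_ac)
  qed
  finally show ?thesis by (simp add: scale_def real_sqrt_mult)
qed (simp add: expected_max_def scale_def)

text \<open>\<open>L_regular\<close> bounds \<open>1 / L j\<close> by
  \<open>2 * sqrt (n / j) / L n\<close>, and the \<open>1 / sqrt j\<close> sum to order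
  \<open>sqrt n\<close>. The term for \<open>j = 0\<close>, which the profile does not cover, is at
  most 1 and is absorbed through \<open>L_regular\<close> at \<open>j = 1\<close>.\<close>

lemma sum_inverse_green_le:
  assumes n: "n \<ge> 1"
  shows "(\<Sum>j<n. 1 / W.green j) \<le> (2 * L 1 + 4 / c0) * (real n / L n)"
proof -
  have Ln: "L n > 0" using L_ge_1[OF n] by simp
  obtain m where m: "n = Suc m" using n by (cases n) auto
  have le: "1 / W.green j \<le> 2 * sqrt (real n) / (c0 * L n) * (1 / sqrt (real j))" if j: "j \<in> {1..m}" for j
  proof -
    have j1: "1 \<le> j" "j \<le> n" using j m by auto
    have Lj: "L j > 0" using L_ge_1[OF j1(1)] by simp
    have "1 / W.green j \<le> 1 / (c0 * L j)"
      using green_bounds(1)[OF j1(1)] c0 Lj W.green_ge_1[of j] by (intro divide_left_mono) auto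
    also have "\<dots> \<le> 2 * sqrt (real n / real j) / (c0 * L n)"
    proof -
      have "c0 * L n \<le> c0 * (2 * sqrt (real n / real j) * L j)"
        using L_regular[OF j1] c0 by (intro mult_left_mono) auto
      then show ?thesis using c0 Lj Ln by (simp add: field_simps)
    qed
    finally show ?thesis by (simp add: real_sqrt_divide mult_ac)
  qed
  have "(\<Sum>j<n. 1 / W.green j) = 1 / W.green 0 + (\<Sum>j=1..m. 1 / W.green j)"
  proof -
    have "{..<n} = insert 0 {1..m}" using m by auto
    then show ?thesis by simp
  qed
  also have "1 / W.green 0 \<le> 1" using W.green_ge_1[of 0] by simp
  also have "(\<Sum>j=1..m. 1 / W.green j) \<le> (\<Sum>j=1..m. 2 * sqrt (real n) / (c0 * L n) * (1 / sqrt (real j)))"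
    by (rule sum_mono) (rule le)
  also have "\<dots> = 2 * sqrt (real n) / (c0 * L n) * (\<Sum>j=1..m. 1 / sqrt (real j))"
    by (rule sum_distrib_left[symmetric])
  also have "\<dots> \<le> 2 * sqrt (real n) / (c0 * L n) * (2 * sqrt (real n))"
  proof (rule mult_left_mono)
    have "(\<Sum>j=1..m. 1 / sqrt (real j)) \<le> 2 * sqrt (real m)" by (rule sum_inverse_sqrt_le)
    also have "\<dots> \<le> 2 * sqrt (real n)" using m by simp
    finally show "(\<Sum>j=1..m. 1 / sqrt (real j)) \<le> 2 * sqrt (real n)" .
  qed (use c0 Ln in simp)
  also have "\<dots> = 4 / c0 * (real n / L n)" by simp
  also have "1 \<le> 2 * L 1 * (real n / L n)"
  proof -
    have "L n \<le> 2 * sqrt (real n) * L 1" using L_regular[of 1 n] n by simp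
    also have "\<dots> \<le> 2 * real n * L 1"
    proof (intro mult_right_mono mult_left_mono)
      have "sqrt (real n) * 1 \<le> sqrt (real n) * sqrt (real n)" using n by (intro mult_left_mono) auto
      then show "sqrt (real n) \<le> real n" by simp
    qed (use L_ge_1[of 1] in auto)
    finally show ?thesis using Ln by (simp add: field_simps)
  qed
  finally show ?thesis by (simp only: distrib_right)
qed

lemma expected_max_lower:
  obtains c where "c > 0" "\<And>n. n \<ge> 1 \<Longrightarrow> c * scale n \<le> expected_max n"
proof -
  define B where "B = 2 * L 1 + 4 / c0"
  have B: "B > 0" unfolding B_def using L_ge_1[of 1] c0 by (intro add_pos_pos) auto
  define m where "m = law_abs_mean / (4 * exp (1/2))"
  have m: "m > 0" using law_abs_mean_pos by (simp add: m_def)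
  have "m / sqrt B * scale n \<le> expected_max n" if n: "n \<ge> 1" for n
  proof -
    have Ln: "L n > 0" using L_ge_1[OF n] by simp
    define s where "s = (\<Sum>j<n. 1 / W.green j)"
    have "1 / W.green 0 \<le> s" unfolding s_def using n W.green_ge_1
      by (intro member_le_sum) (auto intro: order_trans[OF zero_le_one])
    then have s0: "s > 0" using W.green_ge_1[of 0] by (smt (verit) zero_less_divide_1_iff)
    have "m / sqrt B * scale n = m * (real n / sqrt (B * (real n / L n)))"
    proof -
      have "real n / sqrt (real n / L n) = (real n / sqrt (real n)) * sqrt (L n)"
        by (simp add: real_sqrt_divide)
      then have "real n / sqrt (real n / L n) = sqrt (real n) * sqrt (L n)"
        by (simp only: real_div_sqrt of_nat_0_le_iff)
      then have *: "real n / sqrt (real n / L n) = scale n"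
        by (simp only: scale_def real_sqrt_mult)
      have "m * (real n / sqrt (B * (real n / L n))) = m / sqrt B * (real n / sqrt (real n / L n))"
        unfolding real_sqrt_mult[of B] by simp
      then show ?thesis by (simp only: *)
    qed
    also have "\<dots> \<le> m * (real n / sqrt s)"
      using sum_inverse_green_le[OF n] m s0 B
      by (intro mult_left_mono divide_left_mono) (auto simp: s_def B_def)
    also have "\<dots> \<le> expected_max n" unfolding m_def s_def by (rule expected_max_ge[OF n])
    finally show ?thesis .
  qed
  then show ?thesis using that[of "m / sqrt B"] m B by simp
qed

lemma deficit_upper:
  obtains C where "C > 0" "\<And>n. deficit n \<le> C * (scale (Suc n) / real (Suc n))"
proof -
  define C where "C = sqrt (2 * (law_variance + 1) * C0)"
  have "C > 0" unfolding C_def using law_variance_nonneg C0 by (intro real_sqrt_gt_zero mult_pos_pos) auto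
  moreover have "deficit n \<le> C * (scale (Suc n) / real (Suc n))" for n
    using deficit_le[of n] expected_max_upper[of "Suc n"] by (simp add: C_def field_simps)
  ultimately show ?thesis using that by blast
qed

text \<open>Over \<open>k * n\<close> further steps the expected maximum grows by at least
  \<open>c2 * scale n\<close>, once \<open>sqrt (Suc k)\<close> exceeds twice the ratio of the upper
  constant \<open>c2\<close> to the lower constant \<open>c1\<close>. Each increment on that stretch
  is at most \<open>deficit n\<close>.\<close>

lemma deficit_lower:
  obtains c where "c > 0" "\<And>n. n \<ge> 1 \<Longrightarrow> c * (scale n / real n) \<le> deficit n"
proof -
  obtain c1 where c1: "c1 > 0" "\<And>n. n \<ge> 1 \<Longrightarrow> c1 * scale n \<le> expected_max n"
    using expected_max_lower by blast
  define c2 where "c2 = sqrt (2 * (law_variance + 1) * C0)"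
  have c2: "c2 > 0" unfolding c2_def using law_variance_nonneg C0 by (intro real_sqrt_gt_zero mult_pos_pos) auto
  obtain k where k: "real k \<ge> (2 * c2 / c1)\<^sup>2" using real_arch_simple by blast
  have "(2 * c2 / c1)\<^sup>2 > 0" using c1 c2 by simp
  then have k1: "k \<ge> 1" using k by (cases k) auto
  have sk: "2 * c2 / c1 \<le> sqrt (real (Suc k))" using k by (intro real_le_rsqrt) simp
  have "c2 / real k * (scale n / real n) \<le> deficit n" if n: "n \<ge> 1" for n
  proof -
    have "c2 * scale n = 2 * c2 * scale n - c2 * scale n" by simp
    also have "2 * c2 * scale n \<le> c1 * (sqrt (real (Suc k)) * scale n)"
      using mult_right_mono[OF sk, of "c1 * scale n"] c1(1) scale_pos[OF n] by (simp add: mult_ac)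
    also have "\<dots> \<le> c1 * scale (Suc k * n)"
      using scale_multiple[OF n, of "Suc k"] c1(1) by (intro mult_left_mono) auto
    also have "\<dots> \<le> expected_max (n + k * n)"
      using c1(2)[of "Suc k * n"] n by simp
    also have "c2 * scale n \<ge> expected_max n" unfolding c2_def by (rule expected_max_upper)
    finally have "c2 * scale n \<le> expected_max (n + k * n) - expected_max n" by simp
    also have "\<dots> \<le> real (k * n) * deficit n" by (rule deficit_ge)
    finally show ?thesis using n k1 by (simp add: field_simps)
  qed
  then show ?thesis using that[of "c2 / real k"] c2 k1 by simp
qed

end

section \<open>Persistence probabilities compared with the mean deficit\<close>

context rwrs_space
begin

text \<open>As for \<open>deficit\<close>, the index \<open>n\<close> stands for the horizon
  \<open>n + 1\<close>.\<close>

definition persist :: "nat \<Rightarrow> real \<Rightarrow> real" where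
  "persist n t = measure joint {z. strict_max n z \<le> t}"

lemma sets_strict_max_le: "{z. strict_max n z \<le> t} \<in> sets joint"
proof -
  have "{z\<in>space joint. strict_max n z \<le> t} \<in> sets joint" by measurable
  then show ?thesis by simp
qed

lemma persist_mono: "s \<le> t \<Longrightarrow> persist n s \<le> persist n t"
  unfolding persist_def by (intro P.finite_measure_mono sets_strict_max_le) auto

lemma persist_antimono: "m \<le> n \<Longrightarrow> persist n t \<le> persist m t"
proof (rule lift_Suc_antimono_le[of "\<lambda>n. persist n t"])
  show "persist (Suc n) t \<le> persist n t" for n
    unfolding persist_def using strict_max_mono order_trans
    by (intro P.finite_measure_mono sets_strict_max_le) blast
qed

lemma persist_nonneg [simp]: "0 \<le> persist n t"
  by (simp add: persist_def)

text \<open>Each prepended value turns the level \<open>t\<close> into \<open>e + max 0 t\<close>: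
  the level drops by \<open>- e\<close> while it is nonnegative, and is stuck at \<open>e\<close>
  once it is negative.\<close>

lemma persist_iterate:
  assumes "e < 0"
  shows "measure \<mu> {..e} ^ k * persist n m \<le> persist (n + k) (max e (m + real k * e))"
proof (induction k)
  case 0
  then show ?case by (simp add: persist_mono)
next
  case (Suc k)
  have "measure \<mu> {..e} ^ Suc k * persist n m \<le> measure \<mu> {..e} * persist (n + k) (max e (m + real k * e))"
    using Suc by (simp add: mult.assoc mult_left_mono)
  also have "\<dots> \<le> persist (Suc (n + k)) (e + max 0 (max e (m + real k * e)))"
    unfolding persist_def by (rule strict_max_prepend)
  also have "e + max 0 (max e (m + real k * e)) = max e (m + real (Suc k) * e)"
    using assms by (auto simp: max_def algebra_simps)
  finally show ?case by simp
qed

text \<open>Once the level has been pushed down to \<open>e < 0\<close>, the event forces the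
  negative part to be at least \<open>- e\<close>, and Markov's inequality applies. The
  \<open>k\<close> additional steps are harmless since \<open>deficit\<close> is
  nonincreasing.\<close>

lemma persist_le_deficit:
  assumes e: "e < 0" "measure \<mu> {..e} > 0"
  obtains C where "C > 0" "\<And>n. persist n m \<le> C * deficit n"
proof -
  obtain k where k: "real k > (m - e) / (- e)" using reals_Archimedean2 by blast
  then have mk: "m + real k * e \<le> e" using e(1) by (simp add: field_simps)
  define p where "p = measure \<mu> {..e} ^ k"
  have p: "p > 0" using e(2) by (simp add: p_def)
  have "persist n m \<le> 1 / (p * (- e)) * deficit n" for n
  proof -
    have "p * persist n m \<le> persist (n + k) e"
      using persist_iterate[OF e(1), of k n m] mk by (simp add: p_def max_def)
    also have "(- e) * persist (n + k) e \<le> deficit (n + k)"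
    proof -
      have "(- e) * persist (n + k) e = (\<integral>z. (- e) * indicator {z. strict_max (n + k) z \<le> e} z \<partial>joint)"
        using sets_strict_max_le by (simp add: persist_def)
      also have "\<dots> \<le> deficit (n + k)"
        unfolding deficit_def
      proof (rule integral_mono)
        show "integrable joint (\<lambda>z. (- e) * indicator {z. strict_max (n + k) z \<le> e} z)"
          using sets_strict_max_le by (intro integrable_mult_right integrable_real_indicator) (auto simp: P.emeasure_eq_measure)
        show "(- e) * indicator {z. strict_max (n + k) z \<le> e} z \<le> max 0 (- strict_max (n + k) z)" for z
          by (auto simp: indicator_def)
      qed (rule integrable_deficit)
      finally show ?thesis .
    qed
    then have "persist (n + k) e \<le> deficit (n + k) / (- e)" using e(1) by (simp add: field_simps)
    also have "\<dots> \<le> deficit n / (- e)" using deficit_antimono[of n "n + k"] e(1) by (intro divide_right_mono) auto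
    finally have "p * persist n m \<le> deficit n / (- e)" .
    then have "p * persist n m / p \<le> deficit n / (- e) / p" using p by (intro divide_right_mono) auto
    then show ?thesis using p by (simp add: mult.commute)
  qed
  moreover have "1 / (p * (- e)) > 0" using p e(1) by (intro divide_pos_pos mult_pos_pos) auto
  ultimately show ?thesis using that by blast
qed

text \<open>The negative part vanishes unless the maximum is at most 0, and it never exceeds the
  modulus of a negative first value. So it is at most \<open>l\<close> on the persistence event,
  except where the first value lies below \<open>- l\<close>.\<close>

lemma deficit_le_persist:
  assumes l: "l \<ge> 0"
  shows "deficit n \<le> l * persist n 0 + (\<integral>y. \<bar>y\<bar> * indicator {..<- l} y \<partial>\<mu>)"
proof -
  let ?f = "\<lambda>y::real. \<bar>y\<bar> * indicator {..<- l} y"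
  have f: "?f \<in> borel_measurable borel" by measurable
  have intf: "integrable \<mu> ?f"
    by (rule Bochner_Integration.integrable_bound[OF integrable_abs[OF Sc.law_integrable]])
      (auto simp: indicator_def measurable_into_law cong: measurable_cong_sets)
  note int_tail = integrable_first_site[OF f intf]
  have int_ind: "integrable joint (\<lambda>z. l * indicator {z. strict_max n z \<le> 0} z)"
    using sets_strict_max_le by (intro integrable_mult_right integrable_real_indicator) (auto simp: P.emeasure_eq_measure)
  have "deficit n \<le> (\<integral>z. l * indicator {z. strict_max n z \<le> 0} z + ?f (snd z (fst z 0)) \<partial>joint)"
    unfolding deficit_def
  proof (rule integral_mono[OF integrable_deficit Bochner_Integration.integrable_add[OF int_ind int_tail]])
    fix z
    show "max 0 (- strict_max n z) \<le> l * indicator {z. strict_max n z \<le> 0} z + ?f (snd z (fst z 0))"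
      using strict_max_ge[of z n] l by (auto simp: indicator_def)
  qed
  also have "\<dots> = l * persist n 0 + (\<integral>y. ?f y \<partial>\<mu>)"
    using Bochner_Integration.integral_add[OF int_ind int_tail] integral_first_site[OF f] sets_strict_max_le
    by (simp add: persist_def)
  finally show ?thesis .
qed

end

section \<open>Walks attracted to a stable law\<close>

text \<open>Levy's continuity theorem gives weak convergence, and the continuous cutoffs
  \<open>f K\<close>, equal to 1 up to \<open>K\<close> and to 0 beyond \<open>2 * K\<close>,
  transfer the tail bound of the limit to all large \<open>n\<close>. The finitely many remaining
  laws are tight one by one.\<close>

lemma tight_of_char_convergence:
  assumes M: "\<And>n. real_distribution (M n)" and M': "real_distribution M'"
    and conv: "\<And>t. (\<lambda>n. char (M n) t) \<longlonglongrightarrow> char M' t" and e: "e > 0"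
  obtains K where "K > 0" "\<And>n. measure (M n) {y. \<bar>y\<bar> > K} \<le> e"
proof -
  interpret Mn: real_distribution "M n" for n by (rule M)
  interpret M': real_distribution M' by (rule M')
  have weak: "weak_conv_m M M'" by (rule levy_continuity[OF M M' conv])
  define f where "f K y = max 0 (min 1 (2 - \<bar>y\<bar> / K))" for K y :: real
  have f01: "0 \<le> f K y" "f K y \<le> 1" for K y by (auto simp: f_def)
  have fc: "isCont (f K) y" if "K > 0" for K y
    unfolding f_def[abs_def] using that by (intro continuous_intros) auto
  have fm [measurable]: "f K \<in> borel_measurable borel" for K
    unfolding f_def[abs_def] by measurable
  have ge: "1 - (\<integral>y. f K y \<partial>N) \<ge> measure N {y. \<bar>y\<bar> > 2 * K}" if N: "real_distribution N" and K: "K > 0" for N K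
  proof -
    interpret N: real_distribution N by (rule N)
    have A: "{y. \<bar>y\<bar> > 2 * K} \<in> sets N" by simp
    have i1: "integrable N (f K)" by (rule N.integrable_const_bound[where B=1]) (auto simp: f01)
    have "measure N {y. \<bar>y\<bar> > 2 * K} = (\<integral>y. indicator {y. \<bar>y\<bar> > 2 * K} y \<partial>N)" using A by simp
    also have "\<dots> \<le> (\<integral>y. 1 - f K y \<partial>N)"
    proof (rule integral_mono)
      show "integrable N (\<lambda>y. indicator {y. \<bar>y\<bar> > 2 * K} y :: real)"
        using A by (intro integrable_real_indicator) (auto simp: N.emeasure_eq_measure)
      show "integrable N (\<lambda>y. 1 - f K y)" using i1 by simp
      show "indicator {y. \<bar>y\<bar> > 2 * K} y \<le> 1 - f K y" for y
        using K f01[of K y] by (auto simp: indicator_def f_def field_simps)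
    qed
    also have "\<dots> = 1 - (\<integral>y. f K y \<partial>N)" using i1 N.prob_space by simp
    finally show ?thesis .
  qed
  have "(\<lambda>j. \<integral>y. f (real (Suc j)) y \<partial>M') \<longlonglongrightarrow> (\<integral>y. 1 \<partial>M')"
  proof (rule integral_dominated_convergence[where w="\<lambda>_. 1"])
    show "AE y in M'. (\<lambda>j. f (real (Suc j)) y) \<longlonglongrightarrow> 1"
    proof (rule AE_I2)
      fix y
      have "\<forall>\<^sub>F j in sequentially. f (real (Suc j)) y = 1"
      proof -
        obtain j0 where "real j0 \<ge> \<bar>y\<bar>" using real_arch_simple by blast
        then have "f (real (Suc j)) y = 1" if "j \<ge> j0" for j
        proof -
          have "\<bar>y\<bar> / real (Suc j) \<le> 1" using that \<open>real j0 \<ge> \<bar>y\<bar>\<close> by (simp add: divide_le_eq)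
          then show ?thesis by (simp add: f_def)
        qed
        then show ?thesis by (auto simp: eventually_sequentially)
      qed
      then show "(\<lambda>j. f (real (Suc j)) y) \<longlonglongrightarrow> 1" by (rule tendsto_eventually)
    qed
  qed (auto simp: f01)
  then have "\<forall>\<^sub>F j in sequentially. (\<integral>y. f (real (Suc j)) y \<partial>M') > 1 - e"
    using e M'.prob_space by (intro order_tendstoD(1)) auto
  then obtain j where j: "(\<integral>y. f (real (Suc j)) y \<partial>M') > 1 - e" by (auto simp: eventually_sequentially)
  define K where "K = real (Suc j)"
  have "(\<lambda>n. \<integral>y. f K y \<partial>M n) \<longlonglongrightarrow> (\<integral>y. f K y \<partial>M')"
    by (rule weak_conv_imp_integral_bdd_continuous_conv[OF M M' weak fc, where B=1]) (simp_all add: f01 K_def)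
  then have "\<forall>\<^sub>F n in sequentially. (\<integral>y. f K y \<partial>M n) > 1 - e"
    using j by (intro order_tendstoD(1)) (auto simp: K_def)
  then obtain N where N: "\<And>n. n \<ge> N \<Longrightarrow> (\<integral>y. f K y \<partial>M n) > 1 - e" by (auto simp: eventually_sequentially)
  have "\<exists>k. measure (M n) {y. \<bar>y\<bar> > real k} \<le> e" for n
  proof -
    have "(\<lambda>k. measure (M n) {y. \<bar>y\<bar> > real k}) \<longlonglongrightarrow> measure (M n) (\<Inter>k. {y. \<bar>y\<bar> > real k})"
      by (rule Mn.finite_Lim_measure_decseq) (auto simp: decseq_def)
    also have "(\<Inter>k. {y. \<bar>y\<bar> > real k}) = {}"
    proof -
      have "\<exists>k. \<not> \<bar>y\<bar> > real k" for y using real_arch_simple[of "\<bar>y\<bar>"] by (auto simp: not_less)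
      then show ?thesis by blast
    qed
    finally have "\<forall>\<^sub>F k in sequentially. measure (M n) {y. \<bar>y\<bar> > real k} < e"
      using e by (intro order_tendstoD(2)[where y=0]) auto
    then show ?thesis by (auto simp: eventually_sequentially intro: less_imp_le)
  qed
  then obtain k where k: "\<And>n. measure (M n) {y. \<bar>y\<bar> > real (k n)} \<le> e" by metis
  define K' where "K' = max (2 * K) (\<Sum>n<N. real (k n))"
  have "measure (M n) {y. \<bar>y\<bar> > K'} \<le> e" for n
  proof (cases "n \<ge> N")
    case True
    have "measure (M n) {y. \<bar>y\<bar> > K'} \<le> measure (M n) {y. \<bar>y\<bar> > 2 * K}"
      by (intro Mn.finite_measure_mono) (auto simp: K'_def)
    also have "\<dots> \<le> e" using ge[OF M[of n], of K] N[OF True] by (simp add: K_def)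
    finally show ?thesis .
  next
    case False
    then have "real (k n) \<le> (\<Sum>n<N. real (k n))" by (intro member_le_sum) auto
    then have "measure (M n) {y. \<bar>y\<bar> > K'} \<le> measure (M n) {y. \<bar>y\<bar> > real (k n)}"
      by (intro Mn.finite_measure_mono) (auto simp: K'_def)
    then show ?thesis using k[of n] by linarith
  qed
  moreover have "K' > 0" by (auto simp: K'_def K_def less_max_iff_disj)
  ultimately show ?thesis using that by blast
qed

text \<open>The equality case of the triangle inequality: after rotation by the conjugate of
  \<open>char N t\<close> the integrand has modulus 1 and mean 1, so its real part is 1 almost
  surely.\<close>

lemma AE_cis_eq_of_norm_char_eq_1:
  assumes N: "real_distribution N" and eq: "norm (char N t) = 1"
  shows "AE x in N. cis (t * x) = char N t"
proof -
  interpret N: real_distribution N by (rule N)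
  let ?c = "char N t"
  have int: "integrable N (\<lambda>x. cis (t * x))"
    by (rule N.integrable_const_bound[where B=1]) auto
  have char_eq: "?c = (\<integral>x. cis (t * x) \<partial>N)" by (simp add: char_def cis_conv_exp)
  define w where "w x = cnj ?c * cis (t * x)" for x
  have int_w: "integrable N w" unfolding w_def[abs_def] using int by (rule integrable_mult_right)
  have "(\<integral>x. w x \<partial>N) = cnj ?c * ?c" by (simp add: w_def char_eq)
  also have "\<dots> = complex_of_real ((norm ?c)\<^sup>2)"
    by (simp only: complex_norm_square mult.commute)
  finally have "Re (\<integral>x. w x \<partial>N) = 1" by (simp add: eq)
  then have zero: "(\<integral>x. 1 - Re (w x) \<partial>N) = 0"
    using int_w N.prob_space by (subst Bochner_Integration.integral_diff) (auto intro: integrable_Re)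
  have norm_w: "norm (w x) = 1" for x by (simp add: w_def norm_mult eq)
  have le: "Re (w x) \<le> 1" for x using complex_Re_le_cmod[of "w x"] by (simp add: norm_w)
  have "AE x in N. 1 - Re (w x) = 0"
    using int_w le zero by (subst integral_nonneg_eq_0_iff_AE[symmetric]) (auto intro: integrable_Re)
  then show ?thesis
  proof eventually_elim
    case (elim x)
    then have "w x = 1" using norm_w[of x] by (auto simp: complex_eq_iff cmod_def)
    then have "?c * cnj ?c * cis (t * x) = ?c" by (simp add: w_def mult.assoc)
    moreover have "?c * cnj ?c = 1"
      using complex_norm_square[of ?c] by (simp add: eq)
    ultimately show ?case by simp
  qed
qed

text \<open>A law whose characteristic function has modulus \<open>1\<close> along a null sequence of frequencies is
  carried by lattices of arbitrarily large mesh, hence by a point.\<close>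

lemma degenerate_of_norm_char_eq_1:
  assumes N: "real_distribution N" and t: "\<And>j::nat. t j \<noteq> 0" "t \<longlonglongrightarrow> 0"
    and eq: "\<And>j. norm (char N (t j)) = 1"
  shows "\<exists>c. N = return borel c"
proof -
  interpret N: real_distribution N by (rule N)
  have ae: "AE x in N. \<forall>j. cis (t j * x) = char N (t j)"
    by (simp only: AE_all_countable) (intro allI AE_cis_eq_of_norm_char_eq_1 N eq)
  \<comment> \<open>An almost sure property holds at some point, which becomes the candidate for the
    atom.\<close>
  have "\<exists>x0. \<forall>j. cis (t j * x0) = char N (t j)"
  proof (rule ccontr)
    assume "\<not> ?thesis"
    then have "AE x in N. False" using ae by (intro eventually_mono[OF ae]) blast
    then show False by simp
  qed
  then obtain x0 where x0: "\<And>j. cis (t j * x0) = char N (t j)" by blast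
  have "AE x in N. x = x0"
    using ae
  proof eventually_elim
    case (elim x)
    show "x = x0"
    proof (rule ccontr)
      assume ne: "x \<noteq> x0"
      \<comment> \<open>For large \<open>j\<close> the angle is nonzero but smaller than 1, where
        the cosine is strictly below 1.\<close>
      have "(\<lambda>j. t j * (x - x0)) \<longlonglongrightarrow> 0 * (x - x0)" by (intro tendsto_intros t)
      then have "\<forall>\<^sub>F j in sequentially. dist (t j * (x - x0)) 0 < 1"
        by (intro tendstoD) auto
      then obtain j where j: "\<bar>t j * (x - x0)\<bar> < 1" by (auto simp: eventually_sequentially)
      have "cis (t j * (x - x0)) = cis (t j * x) / cis (t j * x0)"
        by (simp add: right_diff_distrib cis_divide)
      also have "\<dots> = 1" using elim x0 by (metis cis_neq_zero divide_self)
      finally have "cos (t j * (x - x0)) = 1" by (simp add: complex_eq_iff)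
      then have "cos \<bar>t j * (x - x0)\<bar> = 1" by simp
      moreover have "cos \<bar>t j * (x - x0)\<bar> < cos 0"
        using j ne t(1)[of j] pi_ge_two by (intro cos_monotone_0_pi) auto
      ultimately show False by simp
    qed
  qed
  then have "N = return N x0" by (rule N.AE_eq_constD)
  also have "return N x0 = return borel x0" by (rule return_cong) simp
  finally show ?thesis by blast
qed

lemma norm_char_normal_less_1:
  assumes N: "prob_space N" and X: "distributed N lborel X (normal_density m \<sigma>)" and \<sigma>: "\<sigma> > 0"
  shows "norm (\<integral>x. cis (X x) \<partial>N) < 1"
proof -
  interpret N: prob_space N by (rule N)
  define Y where "Y x = (X x - m) / \<sigma>" for x
  have Y: "distributed N lborel Y std_normal_density"
    using X N.normal_standard_normal_convert[OF \<sigma>, of X m] by (simp add: Y_def[abs_def])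
  have mY [measurable]: "Y \<in> borel_measurable N" using distributed_measurable[OF Y] by simp
  have D: "distr N borel Y = std_normal_distribution"
    using distributed_distr_eq_density[OF Y] by (simp cong: distr_cong)
  have "(\<integral>x. cis (X x) \<partial>N) = (\<integral>x. cis m * cis (\<sigma> * Y x) \<partial>N)"
    using \<sigma> by (intro Bochner_Integration.integral_cong) (auto simp: Y_def cis_mult)
  also have "\<dots> = cis m * (\<integral>x. cis (\<sigma> * Y x) \<partial>N)" by simp
  also have "(\<integral>x. cis (\<sigma> * Y x) \<partial>N) = char (distr N borel Y) \<sigma>"
    unfolding char_def by (subst integral_distr) (auto simp: cis_conv_exp)
  also have "\<dots> = exp (- (\<sigma>\<^sup>2) / 2)"
    unfolding D by (simp add: char_std_normal_distribution)
  finally have "norm (\<integral>x. cis (X x) \<partial>N) = exp (- (\<sigma>\<^sup>2) / 2)"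
    by (simp add: norm_mult)
  also have "\<dots> < 1" using \<sigma> by simp
  finally show ?thesis .
qed

section \<open>Criteria for attraction in terms of characteristic functions\<close>

context lattice_walk
begin

text \<open>Tightness is checked coordinate by coordinate: if the norm exceeds
  \<open>K' * n powr (1 / a)\<close>, with \<open>K'\<close> the sum of the bounds
  \<open>K i\<close>, then some rescaled coordinate exceeds its own bound.\<close>

lemma attracted_walkI:
  fixes m :: "'n \<Rightarrow> real measure" and \<psi> :: "real ^ 'n \<Rightarrow> complex"
  assumes a: "a > 0"
    and m: "\<And>i. real_distribution (m i)"
    and coord: "\<And>i t. (\<lambda>n. \<integral>\<omega>. cis (t * (real n powr (- 1 / a) * of_int (walk \<omega> n $ i))) \<partial>steps) \<longlonglongrightarrow> char (m i) t"
    and lim: "\<And>u. u \<noteq> 0 \<Longrightarrow> (\<lambda>n. step_char (real n powr (- 1 / a) *\<^sub>R u) ^ n) \<longlonglongrightarrow> \<psi> u"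
    and less: "\<And>u. u \<noteq> 0 \<Longrightarrow> norm (\<psi> u) < 1"
  shows "attracted_walk \<nu> a"
proof
  show "a > 0" by (rule a)
  show "\<exists>z. norm z < 1 \<and> (\<lambda>n. step_char (real n powr (- 1 / a) *\<^sub>R u) ^ n) \<longlonglongrightarrow> z" if "u \<noteq> 0" for u
    using lim[OF that] less[OF that] by blast
  fix e :: real assume e: "e > 0"
  define c where "c n x i = real n powr (- 1 / a) * of_int (x $ i)" for n and x :: "int ^ 'n" and i
  have mc: "(\<lambda>\<omega>. c n (walk \<omega> n) i) \<in> borel_measurable steps" for n i
    by (rule measurable_compose[OF measurable_walk]) simp
  define D where "D i n = distr steps borel (\<lambda>\<omega>. c n (walk \<omega> n) i)" for i n
  have rd: "real_distribution (D i n)" for i n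
    unfolding D_def by (rule steps.P.real_distribution_distr[OF mc])
  have charD: "char (D i n) t = (\<integral>\<omega>. cis (t * c n (walk \<omega> n) i) \<partial>steps)" for i n t
    unfolding char_def D_def by (subst integral_distr[OF mc]) (auto simp: cis_conv_exp)
  have "\<exists>K>0. \<forall>n. measure (D i n) {y. \<bar>y\<bar> > K} \<le> e / CARD('n)" for i
  proof (rule tight_of_char_convergence[of "D i" "m i" "e / CARD('n)"])
    show "(\<lambda>n. char (D i n) t) \<longlonglongrightarrow> char (m i) t" for t
      unfolding charD using coord[of t i] by (simp add: c_def)
  qed (use rd m e in auto)
  then obtain K where K: "\<And>i. K i > 0" "\<And>i n. measure (D i n) {y. \<bar>y\<bar> > K i} \<le> e / CARD('n)" by metis
  define K' where "K' = (\<Sum>i\<in>UNIV. K i)"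
  have K': "K' > 0" unfolding K'_def by (intro sum_pos K(1)) auto
  have "measure steps {\<omega>. norm (real_vec (walk \<omega> n)) > K' * real n powr (1 / a)} \<le> e" if n: "n \<ge> 1" for n
  proof -
    let ?E = "\<lambda>i. {\<omega>. \<bar>c n (walk \<omega> n) i\<bar> > K i}"
    have sE: "?E i \<in> sets steps" for i by (rule sets_walk_pred)
    have "{\<omega>. norm (real_vec (walk \<omega> n)) > K' * real n powr (1 / a)} \<subseteq> (\<Union>i. ?E i)"
    proof
      fix \<omega> :: "nat \<Rightarrow> int ^ 'n"
      assume "\<omega> \<in> {\<omega>. norm (real_vec (walk \<omega> n)) > K' * real n powr (1 / a)}"
      then have gt: "norm (real_vec (walk \<omega> n)) > K' * real n powr (1 / a)" by simp
      show "\<omega> \<in> (\<Union>i. ?E i)"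
      proof (rule ccontr)
        assume "\<omega> \<notin> (\<Union>i. ?E i)"
        then have le: "\<bar>c n (walk \<omega> n) i\<bar> \<le> K i" for i by (auto simp: not_less)
        have "\<bar>real_vec (walk \<omega> n) $ i\<bar> \<le> K i * real n powr (1 / a)" for i
        proof -
          have "real_vec (walk \<omega> n) $ i = real n powr (1 / a) * c n (walk \<omega> n) i"
            using n by (simp add: c_def real_vec_def mult.assoc[symmetric] flip: powr_add)
          then show ?thesis using mult_right_mono[OF le[of i], of "real n powr (1 / a)"] by (simp add: abs_mult mult.commute)
        qed
        then have "(\<Sum>i\<in>UNIV. \<bar>real_vec (walk \<omega> n) $ i\<bar>) \<le> K' * real n powr (1 / a)"
          unfolding K'_def sum_distrib_right by (intro sum_mono) auto
        then show False using gt norm_le_l1_cart[of "real_vec (walk \<omega> n)"] by linarith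
      qed
    qed
    then have "measure steps {\<omega>. norm (real_vec (walk \<omega> n)) > K' * real n powr (1 / a)} \<le> measure steps (\<Union>i. ?E i)"
      using sE by (intro steps.P.finite_measure_mono) auto
    also have "\<dots> \<le> (\<Sum>i\<in>UNIV. measure steps (?E i))"
      using sE by (intro steps.P.finite_measure_subadditive_finite) auto
    also have "\<dots> \<le> (\<Sum>i\<in>(UNIV::'n set). e / CARD('n))"
    proof (rule sum_mono)
      fix i
      have "measure (D i n) {y. \<bar>y\<bar> > K i} = measure steps (?E i)"
        unfolding D_def by (subst measure_distr[OF mc]) (auto simp: vimage_def)
      then show "measure steps (?E i) \<le> e / CARD('n)" using K(2)[of i n] by simp
    qed
    also have "\<dots> = e" by simp
    finally show ?thesis .
  qed
  then show "\<exists>K>0. \<forall>n\<ge>1. measure steps {\<omega>. norm (real_vec (walk \<omega> n)) > K * real n powr (1 / a)} \<le> e"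
    using K' by blast
qed

lemma inner_real_vec_one_dim:
  fixes i :: 'n
  assumes "CARD('n) = 1"
  shows "u \<bullet> real_vec x = u $ i * of_int (x $ i)"
proof -
  have U: "(UNIV :: 'n set) = {i}"
    using assms by (metis UNIV_I card_1_singletonE singletonD)
  show ?thesis unfolding inner_vec_def U by (simp add: real_vec_def)
qed

text \<open>Comparing the times \<open>n\<close> and \<open>2 * n\<close> shows that the limit
  satisfies \<open>char m (q * t) = (char m t)^2\<close> with \<open>q = 2 powr (1 / a)\<close>. If
  its modulus were 1 at some nonzero \<open>t\<close>, it would be 1 along the null sequence
  \<open>t / q ^ j\<close>, and the limit law would be a point mass.\<close>

lemma attracted_walk_one_dim:
  fixes i :: 'n
  assumes d: "CARD('n) = 1" and a: "a > 0" and m: "real_distribution m" and nondeg: "\<nexists>c. m = return borel c"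
    and conv: "\<And>t. (\<lambda>n. \<integral>\<omega>. cis (t * (real n powr (- 1 / a) * of_int (walk \<omega> n $ i))) \<partial>steps) \<longlonglongrightarrow> char m t"
  shows "attracted_walk \<nu> a"
proof -
  interpret m: real_distribution m by (rule m)
  define \<phi> where "\<phi> n t = step_char (real n powr (- 1 / a) *\<^sub>R (\<chi> j. t)) ^ n" for n t
  have \<phi>: "\<phi> n t = (\<integral>\<omega>. cis (t * (real n powr (- 1 / a) * of_int (walk \<omega> n $ i))) \<partial>steps)" for n t
    unfolding \<phi>_def scaled_walk_char[symmetric]
    by (simp add: inner_real_vec_one_dim[OF d, of _ _ i] mult.left_commute)
  have lim: "(\<lambda>n. \<phi> n t) \<longlonglongrightarrow> char m t" for t
    unfolding \<phi> by (rule conv)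
  define q where "q = (2::real) powr (1 / a)"
  have q: "q > 1" unfolding q_def using a by (intro gr_one_powr) auto
  have scaling: "char m (q * t) = (char m t)\<^sup>2" for t
  proof -
    have "(\<lambda>n. \<phi> (2 * n) (q * t)) \<longlonglongrightarrow> char m (q * t)"
      using lim by (rule filterlim_compose) (auto simp: filterlim_at_top_imp_at_infinity mult_nat_left_at_top)
    moreover have "\<phi> (2 * n) (q * t) = (\<phi> n t)\<^sup>2" for n
    proof -
      have "real (2 * n) powr (- 1 / a) * (q * t) = real n powr (- 1 / a) * t"
      proof -
        have "(2::real) powr (- 1 / a) * q = 1" by (simp add: q_def flip: powr_add)
        then show ?thesis by (simp add: powr_mult mult_ac)
      qed
      then have "real (2 * n) powr (- 1 / a) *\<^sub>R ((\<chi> j. q * t) :: real ^ 'n) = real n powr (- 1 / a) *\<^sub>R (\<chi> j. t)"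
        by (simp add: vec_eq_iff)
      then show ?thesis unfolding \<phi>_def by (simp only: power_even_eq)
    qed
    ultimately have "(\<lambda>n. (\<phi> n t)\<^sup>2) \<longlonglongrightarrow> char m (q * t)" by simp
    moreover have "(\<lambda>n. (\<phi> n t)\<^sup>2) \<longlonglongrightarrow> (char m t)\<^sup>2" by (intro tendsto_intros lim)
    ultimately show ?thesis by (rule LIMSEQ_unique)
  qed
  have less: "norm (char m t) < 1" if t: "t \<noteq> 0" for t
  proof (rule ccontr)
    assume "\<not> norm (char m t) < 1"
    then have t1: "norm (char m t) = 1" using m.cmod_char_le_1[of t] by linarith
    have "norm (char m (t / q ^ j)) = 1" for j
    proof (induction j)
      case (Suc j)
      have "q * (t / q ^ Suc j) = t / q ^ j" using q by simp
      with scaling[of "t / q ^ Suc j"] Suc have "(norm (char m (t / q ^ Suc j)))\<^sup>2 = 1"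
        by (metis norm_power)
      then show ?case by (simp add: power2_eq_1_iff) (metis norm_ge_zero not_one_le_zero neg_0_le_iff_le)
    qed (simp add: t1)
    moreover have "(\<lambda>j. t / q ^ j) \<longlonglongrightarrow> 0"
      using q by (intro LIMSEQ_divide_realpow_zero) auto
    ultimately show False
      using degenerate_of_norm_char_eq_1[OF m, of "\<lambda>j. t / q ^ j"] t q nondeg by simp
  qed
  have i_eq: "j = i" for j :: 'n using d by (metis UNIV_I card_1_singletonE singletonD)
  have vec: "(\<chi> j. u $ i) = u" for u :: "real ^ 'n" 
  proof -
    have "u $ i = u $ j" for j using i_eq[of j] by simp
    then show ?thesis by (simp add: vec_eq_iff)
  qed
  show ?thesis
  proof (rule attracted_walkI[where m="\<lambda>_. m" and \<psi>="\<lambda>u. char m (u $ i)"])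
    show "a > 0" by (rule a)
    show "real_distribution m" by (rule m)
    show "(\<lambda>n. \<integral>\<omega>. cis (t * (real n powr (- 1 / a) * of_int (walk \<omega> n $ j))) \<partial>steps) \<longlonglongrightarrow> char m t" for j t
      using conv[of t] i_eq[of j] by simp
    show "(\<lambda>n. step_char (real n powr (- 1 / a) *\<^sub>R u) ^ n) \<longlonglongrightarrow> char m (u $ i)" for u
      using lim[of "u $ i"] unfolding \<phi>_def vec .
    show "norm (char m (u $ i)) < 1" if "u \<noteq> 0" for u
    proof (rule less)
      show "u $ i \<noteq> 0"
      proof
        assume "u $ i = 0"
        then have "u $ j = 0" for j using i_eq[of j] by simp
        then show False using that by (simp add: vec_eq_iff)
      qed
    qed
  qed
qed

text \<open>The frequencies \<open>axis i t\<close> recover the coordinates, and every nonzero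
  frequency sees a nondegenerate normal law, whose characteristic function has modulus below 1
  there.\<close>

lemma attracted_walk_gaussian:
  fixes N :: "(real ^ 'n) measure"
  assumes N: "gaussian_law N"
    and conv: "\<And>u. (\<lambda>n. \<integral>\<omega>. cis (u \<bullet> (real n powr (- 1 / 2) *\<^sub>R real_vec (walk \<omega> n))) \<partial>steps) \<longlonglongrightarrow> (\<integral>x. cis (u \<bullet> x) \<partial>N)"
  shows "attracted_walk \<nu> 2"
proof -
  interpret N: prob_space N using N by (simp add: gaussian_law_def)
  have sN [measurable_cong]: "sets N = sets borel" using N by (simp add: gaussian_law_def)
  have mi: "(\<lambda>x. x $ i) \<in> borel_measurable N" for i :: 'n by (simp cong: measurable_cong_sets)
  have ax: "axis i t \<bullet> x = t * x $ i" for i t and x :: "real ^ 'n"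
    by (simp add: inner_axis' )
  show ?thesis
  proof (rule attracted_walkI[where m="\<lambda>i. distr N borel (\<lambda>x. x $ i)" and \<psi>="\<lambda>u. \<integral>x. cis (u \<bullet> x) \<partial>N"])
    show "real_distribution (distr N borel (\<lambda>x. x $ i))" for i
      by (rule N.real_distribution_distr[OF mi])
    show "(\<lambda>n. \<integral>\<omega>. cis (t * (real n powr (- 1 / 2) * of_int (walk \<omega> n $ i))) \<partial>steps)
        \<longlonglongrightarrow> char (distr N borel (\<lambda>x. x $ i)) t" for i t
    proof -
      have "char (distr N borel (\<lambda>x. x $ i)) t = (\<integral>x. cis (axis i t \<bullet> x) \<partial>N)"
        unfolding char_def by (subst integral_distr[OF mi]) (auto simp: cis_conv_exp ax)
      then show ?thesis using conv[of "axis i t"] by (simp add: ax real_vec_def mult.left_commute)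
    qed
    show "(\<lambda>n. step_char (real n powr (- 1 / 2) *\<^sub>R u) ^ n) \<longlonglongrightarrow> (\<integral>x. cis (u \<bullet> x) \<partial>N)" for u
      using conv[of u] by (simp only: scaled_walk_char)
    show "norm (\<integral>x. cis (u \<bullet> x) \<partial>N) < 1" if u: "u \<noteq> 0" for u
    proof -
      obtain m \<sigma> where "\<sigma> > 0" "distributed N lborel (\<lambda>x. u \<bullet> x) (normal_density m \<sigma>)"
        using N u unfolding gaussian_law_def by blast
      then show ?thesis using norm_char_normal_less_1[OF N.prob_space_axioms] by blast
    qed
  qed simp
qed

end

text \<open>In the cases that occur, the order of the sum of \<open>k powr (- d / \<alpha>)\<close>
  over \<open>k\<close> up to \<open>n\<close>. The 1 added to the logarithm keeps the value at
  \<open>n = 1\<close> away from zero.\<close>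

definition growth :: "nat \<Rightarrow> real \<Rightarrow> nat \<Rightarrow> real" where
  "growth d \<alpha> n = (if \<alpha> = real d then 1 + ln (real n) else real n powr (1 - 1 / \<alpha>))"

lemma growth_ge_1: "1 \<le> n \<Longrightarrow> 1 \<le> \<alpha> \<Longrightarrow> 1 \<le> growth d \<alpha> n"
  by (auto simp: growth_def intro!: ge_one_powr_ge_zero)

lemma growth_mono: "1 \<le> m \<Longrightarrow> m \<le> n \<Longrightarrow> 1 \<le> \<alpha> \<Longrightarrow> growth d \<alpha> m \<le> growth d \<alpha> n"
  by (auto simp: growth_def intro!: powr_mono2)

text \<open>In the logarithmic case \<open>1 + ln\<close> is submultiplicative on numbers at least
  1, and \<open>1 + ln y \<le> 2 * sqrt y\<close>, whence the factor 2. Otherwise the exponent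
  \<open>1 - 1 / \<alpha>\<close> is at most 1/2 because \<open>\<alpha> \<le> 2\<close>.\<close>

lemma growth_regular:
  assumes j: "1 \<le> j" "j \<le> n" and \<alpha>: "1 \<le> \<alpha>" "\<alpha> \<le> 2"
  shows "growth d \<alpha> n \<le> 2 * sqrt (real n / real j) * growth d \<alpha> j"
proof -
  define y where "y = real n / real j"
  have y: "y \<ge> 1" using j by (simp add: y_def)
  have n: "real n = y * real j" using j by (simp add: y_def)
  show ?thesis
  proof (cases "\<alpha> = real d")
    case True
    have "ln (sqrt y) \<le> sqrt y - 1" using y by (intro ln_le_minus_one) simp
    then have ln_y: "1 + ln y \<le> 2 * sqrt y" using y by (simp add: ln_sqrt)
    have "0 \<le> ln y" "0 \<le> ln (real j)" using y j by auto
    then have "0 \<le> ln y * ln (real j)" by (rule mult_nonneg_nonneg)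
    moreover have "ln (real n) = ln y + ln (real j)" using y j by (simp add: n ln_mult)
    ultimately have "1 + ln (real n) \<le> (1 + ln y) * (1 + ln (real j))" by (simp add: algebra_simps)
    also have "\<dots> \<le> 2 * sqrt y * (1 + ln (real j))" using ln_y j by (intro mult_right_mono) auto
    finally show ?thesis using True by (simp add: growth_def y_def)
  next
    case False
    have "real n powr (1 - 1 / \<alpha>) = y powr (1 - 1 / \<alpha>) * real j powr (1 - 1 / \<alpha>)"
      using y by (simp add: n powr_mult)
    also have "y powr (1 - 1 / \<alpha>) \<le> y powr (1 / 2)"
      using \<alpha> y by (intro powr_mono) (auto simp: field_simps)
    also have "\<dots> = sqrt y" using y by (simp add: powr_half_sqrt)
    also have "sqrt y \<le> 2 * sqrt y" using y by simp
    finally show ?thesis using False by (simp add: growth_def y_def mult_right_mono)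
  qed
qed

text \<open>By concavity of the power, each term is at most the increment of
  \<open>n powr \<beta> / \<beta>\<close>. The inequality needed is Young's, with the weights
  \<beta> and \<open>1 - \<beta>\<close>, at the ratio of consecutive integers.\<close>

lemma sum_powr_le:
  assumes \<beta>: "0 < \<beta>" "\<beta> < 1"
  shows "(\<Sum>k=1..n. real k powr (\<beta> - 1)) \<le> real n powr \<beta> / \<beta>"
proof (induction n)
  case (Suc n)
  have step: "\<beta> * real (Suc n) powr (\<beta> - 1) + real n powr \<beta> \<le> real (Suc n) powr \<beta>"
  proof (cases "n = 0")
    case False
    define x where "x = real n / real (Suc n)"
    have x: "x > 0" using False by (simp add: x_def)
    have "x powr \<beta> * 1 powr (1 - \<beta>) \<le> \<beta> * x + (1 - \<beta>) * 1"
      by (rule Youngs_inequality_0) (use \<beta> x in auto)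
    then have "\<beta> * (1 - x) + x powr \<beta> \<le> 1" by (simp add: algebra_simps)
    then have "(\<beta> * (1 - x) + x powr \<beta>) * real (Suc n) powr \<beta> \<le> 1 * real (Suc n) powr \<beta>"
      by (rule mult_right_mono) simp
    moreover have "1 - x = 1 / real (Suc n)" by (simp add: x_def field_simps)
    moreover have "x powr \<beta> * real (Suc n) powr \<beta> = real n powr \<beta>"
      unfolding x_def by (simp flip: powr_mult)
    moreover have "1 / real (Suc n) * real (Suc n) powr \<beta> = real (Suc n) powr (\<beta> - 1)"
      by (simp add: powr_diff)
    ultimately show ?thesis by (simp only: distrib_right mult.assoc mult_1)
  qed (use \<beta> in simp)
  have "(\<Sum>k=1..Suc n. real k powr (\<beta> - 1)) \<le> real n powr \<beta> / \<beta> + real (Suc n) powr (\<beta> - 1)"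
    using Suc by simp
  also have "\<dots> = (\<beta> * real (Suc n) powr (\<beta> - 1) + real n powr \<beta>) / \<beta>"
    using \<beta> by (simp add: add_divide_distrib)
  also have "\<dots> \<le> real (Suc n) powr \<beta> / \<beta>" using step \<beta> by (intro divide_right_mono) auto
  finally show ?case .
qed (use \<beta> in simp)

text \<open>For \<open>\<alpha> = d\<close> this is the harmonic sum. Otherwise
  \<open>d = 1\<close>, since \<open>d = 2\<close> forces \<open>\<alpha> = 2\<close>; then
  \<open>n\<close> times the smallest term already gives the lower bound.\<close>

lemma sum_powr_growth:
  assumes d: "d = 1 \<or> d = 2" and \<alpha>: "real d \<le> \<alpha>" "\<alpha> \<le> 2"
  obtains A where "A > 0" "\<And>n. n \<ge> 1 \<Longrightarrow> growth d \<alpha> n \<le> 2 * (\<Sum>k=1..n. real k powr (- real d / \<alpha>))"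
    "\<And>n. n \<ge> 1 \<Longrightarrow> (\<Sum>k=1..n. real k powr (- real d / \<alpha>)) \<le> A * growth d \<alpha> n"
proof (cases "\<alpha> = real d")
  case True
  have H: "(\<Sum>k=1..n. real k powr (- real d / \<alpha>)) = harm n" for n
    using True d by (auto simp: harm_def powr_minus intro!: sum.cong)
  have upper: "harm n \<le> 1 + ln (real n)" if n: "n \<ge> 1" for n
  proof -
    obtain m where m: "n = Suc m" using n by (cases n) auto
    have "harm (Suc m) - ln (real (Suc m)) \<le> harm (Suc 0) - ln (real (Suc 0))"
      using decseq_harm_diff_ln unfolding decseq_def by blast
    then show ?thesis by (simp add: m harm_def)
  qed
  have lower: "1 + ln (real n) \<le> 2 * harm n" if n: "n \<ge> 1" for n
  proof -
    have "harm 1 \<le> (harm n :: real)" using n by (rule harm_mono)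
    then have "1 \<le> (harm n :: real)" by (simp add: harm_def)
    moreover have "ln (real n) \<le> ln (real n + 1)" using n by simp
    ultimately show ?thesis using ln_le_harm[of n] by linarith
  qed
  show ?thesis
  proof (rule that[of 1])
    show "growth d \<alpha> n \<le> 2 * (\<Sum>k=1..n. real k powr (- real d / \<alpha>))" if "n \<ge> 1" for n
      unfolding H using lower[OF that] True by (simp add: growth_def)
    show "(\<Sum>k=1..n. real k powr (- real d / \<alpha>)) \<le> 1 * growth d \<alpha> n" if "n \<ge> 1" for n
      unfolding H using upper[OF that] True by (simp add: growth_def)
  qed simp
next
  case False
  then have d1: "d = 1" and \<alpha>1: "\<alpha> > 1" using d \<alpha> by auto
  define \<beta> where "\<beta> = 1 - 1 / \<alpha>"
  have \<beta>: "0 < \<beta>" "\<beta> < 1" using \<alpha>1 by (auto simp: \<beta>_def)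
  have e: "- real d / \<alpha> = \<beta> - 1" by (simp add: d1 \<beta>_def)
  have f1: "growth d \<alpha> n \<le> (\<Sum>k=1..n. real k powr (\<beta> - 1))" if n: "n \<ge> 1" for n
  proof -
    have "growth d \<alpha> n = (\<Sum>k=1..n. real n powr (\<beta> - 1))"
      using False n by (simp add: growth_def \<beta>_def powr_diff powr_minus_divide)
    also have "\<dots> \<le> (\<Sum>k=1..n. real k powr (\<beta> - 1))"
      using \<beta> by (intro sum_mono powr_mono2') auto
    finally show ?thesis .
  qed
  have f2: "(\<Sum>k=1..n. real k powr (\<beta> - 1)) \<le> 1 / \<beta> * growth d \<alpha> n" for n
    using sum_powr_le[OF \<beta>, of n] False by (simp add: growth_def \<beta>_def)
  have f3: "0 \<le> (\<Sum>k=1..n. real k powr (\<beta> - 1))" for n by (intro sum_nonneg) auto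
  show ?thesis
  proof (rule that[of "1 / \<beta>"])
    show "growth d \<alpha> n \<le> 2 * (\<Sum>k=1..n. real k powr (- real d / \<alpha>))" if "n \<ge> 1" for n
      unfolding e using f1[OF that] f3[of n] by linarith
    show "(\<Sum>k=1..n. real k powr (- real d / \<alpha>)) \<le> 1 / \<beta> * growth d \<alpha> n" for n
      unfolding e by (rule f2)
  qed (use \<beta> in simp)
qed

context attracted_walk
begin

lemma green_growth:
  assumes d: "CARD('n) = 1 \<or> CARD('n) = 2" and \<alpha>: "real CARD('n) \<le> \<alpha>" "\<alpha> \<le> 2"
  obtains c C where "c > 0" "C > 0"
    "\<And>n. n \<ge> 1 \<Longrightarrow> c * growth CARD('n) \<alpha> n \<le> green n"
    "\<And>n. n \<ge> 1 \<Longrightarrow> green n \<le> C * growth CARD('n) \<alpha> n"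
proof -
  let ?H = "\<lambda>n. \<Sum>k=1..n. real k powr (- real CARD('n) / \<alpha>)"
  let ?L = "growth CARD('n) \<alpha>"
  have \<alpha>1: "1 \<le> \<alpha>" using d \<alpha> by auto
  obtain A where A: "A > 0" "\<And>n. n \<ge> 1 \<Longrightarrow> ?L n \<le> 2 * ?H n" "\<And>n. n \<ge> 1 \<Longrightarrow> ?H n \<le> A * ?L n"
    using sum_powr_growth[OF d \<alpha>] by blast
  obtain C where C: "C > 0" "\<And>n. green n \<le> C * (1 + ?H n)" using green_le by blast
  obtain c where c: "c > 0" "\<And>n. n \<ge> 2 \<Longrightarrow> c * ?H n \<le> green n" using green_ge by blast
  have "min 1 (c / 2) * ?L n \<le> green n" if n: "n \<ge> 1" for n
  proof (cases "n = 1")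
    case True
    have "?L 1 = 1" by (simp add: growth_def)
    then show ?thesis using green_ge_1[of n] True by simp
  next
    case False
    have "min 1 (c / 2) * ?L n \<le> c / 2 * (2 * ?H n)"
      using A(2)[OF n] growth_ge_1[OF n \<alpha>1, of "CARD('n)"] c(1) by (intro mult_mono) auto
    also have "\<dots> \<le> green n" using c(2)[of n] n False by simp
    finally show ?thesis .
  qed
  moreover have "green n \<le> C * (1 + A) * ?L n" if n: "n \<ge> 1" for n
  proof -
    have "1 + ?H n \<le> (1 + A) * ?L n"
      using A(3)[OF n] growth_ge_1[OF n \<alpha>1, of "CARD('n)"] by (simp add: distrib_right)
    then have "C * (1 + ?H n) \<le> C * ((1 + A) * ?L n)" using C(1) by (intro mult_left_mono) auto
    then show ?thesis using C(2)[of n] by (simp add: mult.assoc)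
  qed
  moreover have "min 1 (c / 2) > 0" "C * (1 + A) > 0" using c(1) C(1) A(1) by auto
  ultimately show ?thesis using that by blast
qed

end

section \<open>Persistence probabilities\<close>

lemma list_max_eq_Max:
  "list_max \<xi> (map s [0..<n]) = Max ((\<lambda>k. \<Sum>i<k. \<xi> (s i)) ` {..n})"
proof (induction n arbitrary: s)
  case (Suc n)
  let ?g = "\<lambda>k. \<Sum>i<k. \<xi> (s (Suc i))"
  have "map s [0..<Suc n] = s 0 # map (\<lambda>i. s (Suc i)) [0..<n]"
    by (simp only: upt_conv_Cons zero_less_Suc list.map map_Suc_upt[symmetric] map_map comp_def)
  then have "list_max \<xi> (map s [0..<Suc n]) = max 0 (\<xi> (s 0) + Max (?g ` {..n}))"
    by (simp add: Suc)
  also have "\<xi> (s 0) + Max (?g ` {..n}) = Max ((\<lambda>k. \<xi> (s 0) + ?g k) ` {..n})"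
    using Max_add_commute[of "{..n}" ?g "\<xi> (s 0)"] by (simp add: add.commute)
  also have "max 0 \<dots> = Max (insert 0 ((\<lambda>k. \<xi> (s 0) + ?g k) ` {..n}))" by simp
  also have "insert 0 ((\<lambda>k. \<xi> (s 0) + ?g k) ` {..n}) = (\<lambda>k. \<Sum>i<k. \<xi> (s i)) ` {..Suc n}"
    unfolding atMost_Suc_eq_insert_0 image_insert image_image by (simp add: sum.lessThan_Suc_shift del: sum.lessThan_Suc)
  finally show ?case .
qed simp

text \<open>The density of variance \<open>\<sigma>^2\<close> is \<open>sqrt 2\<close> times the one
  of variance \<open>2 * \<sigma>^2\<close> times \<open>exp (- s)\<close> squared, with
  \<open>s = y^2 / (8 * \<sigma>^2)\<close>. One factor \<open>exp (- s)\<close> absorbs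
  \<open>\<bar>y\<bar>\<close> at the cost of \<open>sqrt 8 * \<sigma>\<close>, the other gives the
  decay in \<open>l\<close>, and \<open>sqrt 2 * sqrt 8 = 4\<close>.\<close>

lemma normal_tail_le:
  assumes \<sigma>: "\<sigma> > 0" and l: "l \<ge> 0"
  shows "(\<integral>y. normal_density 0 \<sigma> y * (\<bar>y\<bar> * indicator {..<- l} y) \<partial>lborel) \<le> 4 * \<sigma> * exp (- (l\<^sup>2 / (8 * \<sigma>\<^sup>2)))"
proof -
  let ?N = "normal_density 0 (sqrt 2 * \<sigma>)"
  let ?c = "4 * \<sigma> * exp (- (l\<^sup>2 / (8 * \<sigma>\<^sup>2)))"
  have int: "integrable lborel ?N" using \<sigma> by simp
  have pt: "normal_density 0 \<sigma> y * (\<bar>y\<bar> * indicator {..<- l} y) \<le> ?c * ?N y" for y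
  proof (cases "y < - l")
    case True
    define s where "s = y\<^sup>2 / (8 * \<sigma>\<^sup>2)"
    have N_eq: "normal_density 0 \<sigma> y = sqrt 2 * ?N y * exp (- s) * exp (- s)"
    proof -
      have "exp (- (y\<^sup>2) / (2 * \<sigma>\<^sup>2)) = exp (- (y\<^sup>2) / (2 * (sqrt 2 * \<sigma>)\<^sup>2)) * exp (- s) * exp (- s)"
        unfolding exp_add[symmetric] using \<sigma> by (simp add: s_def power_mult_distrib field_simps)
      moreover have "1 / sqrt (2 * pi * \<sigma>\<^sup>2) = sqrt 2 * (1 / sqrt (2 * pi * (sqrt 2 * \<sigma>)\<^sup>2))"
      proof -
        have "2 * pi * (sqrt 2 * \<sigma>)\<^sup>2 = 2 * (2 * pi * \<sigma>\<^sup>2)" by (simp add: power_mult_distrib)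
        then have "sqrt (2 * pi * (sqrt 2 * \<sigma>)\<^sup>2) = sqrt 2 * sqrt (2 * pi * \<sigma>\<^sup>2)"
          by (simp only: real_sqrt_mult[of 2 "2 * pi * \<sigma>\<^sup>2"])
        then show ?thesis by simp
      qed
      ultimately show ?thesis by (simp add: normal_density_def mult.assoc)
    qed
    have y_le: "\<bar>y\<bar> * exp (- s) \<le> sqrt 8 * \<sigma>"
    proof -
      define r where "r = \<bar>y\<bar> / (sqrt 8 * \<sigma>)"
      have r: "r \<ge> 0" "s = r\<^sup>2" using \<sigma> by (auto simp: r_def s_def power_divide power_mult_distrib)
      have "r \<le> 1 + r\<^sup>2" using sum_squares_bound[of r 1] r by simp
      also have "\<dots> \<le> exp (r\<^sup>2)" by (rule exp_ge_add_one_self)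
      finally have "r * exp (- s) \<le> 1" using r by (simp add: exp_minus field_simps)
      then have "r * exp (- s) * (sqrt 8 * \<sigma>) \<le> 1 * (sqrt 8 * \<sigma>)" using \<sigma> by (intro mult_right_mono) auto
      then show ?thesis using \<sigma> by (simp add: r_def)
    qed
    have exp_le: "exp (- s) \<le> exp (- (l\<^sup>2 / (8 * \<sigma>\<^sup>2)))"
    proof -
      have "l\<^sup>2 \<le> y\<^sup>2" using True l by (intro abs_le_square_iff[THEN iffD1]) auto
      then show ?thesis using \<sigma> by (simp add: s_def divide_right_mono)
    qed
    have "exp (- s) * (\<bar>y\<bar> * exp (- s)) \<le> exp (- (l\<^sup>2 / (8 * \<sigma>\<^sup>2))) * (sqrt 8 * \<sigma>)"
      by (rule mult_mono[OF exp_le y_le]) auto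
    then have "sqrt 2 * ?N y * (exp (- s) * (\<bar>y\<bar> * exp (- s))) \<le> sqrt 2 * ?N y * (exp (- (l\<^sup>2 / (8 * \<sigma>\<^sup>2))) * (sqrt 8 * \<sigma>))"
      by (rule mult_left_mono) auto
    also have "\<dots> = (sqrt 2 * sqrt 8) * \<sigma> * exp (- (l\<^sup>2 / (8 * \<sigma>\<^sup>2))) * ?N y" by simp
    also have "sqrt 2 * sqrt 8 = (4::real)" by (simp flip: real_sqrt_mult)
    finally show ?thesis using True by (simp add: N_eq mult_ac)
  qed (use \<sigma> in simp)
  have "(\<integral>y. normal_density 0 \<sigma> y * (\<bar>y\<bar> * indicator {..<- l} y) \<partial>lborel) \<le> (\<integral>y. ?c * ?N y \<partial>lborel)"
    using pt \<sigma> int by (intro integral_mono') auto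
  also have "\<dots> = ?c" using \<sigma> by simp
  finally show ?thesis .
qed

lemma converges_in_distribution_cis:
  fixes Y :: "nat \<Rightarrow> 'w \<Rightarrow> real ^ 'n"
  assumes M: "prob_space M" and N: "prob_space N" "sets N = sets borel"
    and Y: "\<And>n. Y n \<in> borel_measurable M"
    and conv: "converges_in_distribution euclidean M Y N (\<lambda>x. x)"
  shows "(\<lambda>n. \<integral>\<omega>. cis (u \<bullet> Y n \<omega>) \<partial>M) \<longlonglongrightarrow> (\<integral>x. cis (u \<bullet> x) \<partial>N)"
proof -
  interpret M: prob_space M by (rule M)
  interpret N: prob_space N by (rule N)
  have split: "(\<integral>\<omega>. cis (u \<bullet> Z \<omega>) \<partial>P) = complex_of_real (\<integral>\<omega>. cos (u \<bullet> Z \<omega>) \<partial>P) + \<i> * complex_of_real (\<integral>\<omega>. sin (u \<bullet> Z \<omega>) \<partial>P)"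
    if P: "prob_space P" and Z: "Z \<in> borel_measurable P" for P :: "'b measure" and Z :: "'b \<Rightarrow> real ^ 'n"
  proof -
    interpret P: prob_space P by (rule P)
    note Z [measurable]
    have "integrable P (\<lambda>\<omega>. cis (u \<bullet> Z \<omega>))" by (rule P.integrable_const_bound[where B=1]) auto
    from integral_Re[OF this] integral_Im[OF this] show ?thesis by (simp add: complex_eq_iff)
  qed
  have "(\<lambda>n. \<integral>\<omega>. f (u \<bullet> Y n \<omega>) \<partial>M) \<longlonglongrightarrow> (\<integral>x. f (u \<bullet> x) \<partial>N)"
    if "f = cos \<or> f = sin" for f :: "real \<Rightarrow> real"
  proof -
    have "continuous_map euclidean euclideanreal (\<lambda>x. f (u \<bullet> x))"
      using that by (auto intro!: continuous_intros)
    moreover have "bounded ((\<lambda>x. f (u \<bullet> x)) ` topspace euclidean)"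
      unfolding bounded_iff using that by (intro exI[of _ 1]) auto
    ultimately show ?thesis using conv unfolding converges_in_distribution_def by blast
  qed
  then have "(\<lambda>n. complex_of_real (\<integral>\<omega>. cos (u \<bullet> Y n \<omega>) \<partial>M) + \<i> * complex_of_real (\<integral>\<omega>. sin (u \<bullet> Y n \<omega>) \<partial>M))
      \<longlonglongrightarrow> complex_of_real (\<integral>x. cos (u \<bullet> x) \<partial>N) + \<i> * complex_of_real (\<integral>x. sin (u \<bullet> x) \<partial>N)"
    by (intro tendsto_intros) auto
  then show ?thesis
    using split[OF M Y] split[of N "\<lambda>x. x"] N by (simp cong: measurable_cong_sets)
qed

section \<open>Transfer of the given walk and scenery to the product space\<close>

context random_walk_in_random_scenery
begin

definition \<nu> :: "(int ^ 'n) measure" where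
  "\<nu> = distr M (count_space UNIV) (walk_step S 1)"

definition \<mu> :: "real measure" where
  "\<mu> = distr M borel (\<xi> 0)"

definition increments :: "'w \<Rightarrow> nat \<Rightarrow> int ^ 'n" where
  "increments \<omega> i = walk_step S (Suc i) \<omega>"

abbreviation "paths \<equiv> (\<Pi>\<^sub>M i\<in>(UNIV :: nat set). count_space (UNIV :: (int ^ 'n) set))"
abbreviation "fields \<equiv> (\<Pi>\<^sub>M x\<in>(UNIV :: (int ^ 'n) set). (borel :: real measure))"

lemma measurable_walk_step: "n \<ge> 1 \<Longrightarrow> walk_step S n \<in> M \<rightarrow>\<^sub>M count_space UNIV"
  using steps_indep unfolding indep_vars_def by auto

lemma measurable_scenery: "\<xi> x \<in> borel_measurable M"
  using scenery_indep unfolding indep_vars_def by auto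

lemma walk_increments: "\<omega> \<in> space M \<Longrightarrow> walk (increments \<omega>) n = S n \<omega>"
proof (induction n)
  case (Suc n)
  then show ?case by (simp add: walk_def increments_def walk_step_def)
qed (simp add: start)

lemma measurable_increments: "increments \<in> M \<rightarrow>\<^sub>M paths"
  unfolding increments_def[abs_def]
  by (rule measurable_PiM_single') (auto intro: measurable_walk_step)

lemma measurable_fields: "(\<lambda>\<omega> x. \<xi> x \<omega>) \<in> M \<rightarrow>\<^sub>M fields"
  by (rule measurable_PiM_single') (auto intro: measurable_scenery)

sublocale step: lattice_walk \<nu>
  by (intro lattice_walk.intro step_law.intro step_law_axioms.intro)
    (auto simp: \<nu>_def intro!: prob_space_distr measurable_walk_step)

lemma sets_paths: "sets step.steps = sets paths"
  by (rule sets_PiM_cong) auto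

lemma measurable_from_paths: "measurable paths N = measurable step.steps N"
  and measurable_into_paths: "measurable N paths = measurable N step.steps"
  by (rule measurable_cong_sets; simp add: sets_paths)+

sublocale field: scenery_law \<mu>
proof (intro scenery_law.intro scenery_law_axioms.intro)
  show "prob_space \<mu>" unfolding \<mu>_def by (rule prob_space_distr) (rule measurable_scenery)
  show "integrable \<mu> (\<lambda>y. y)" unfolding \<mu>_def
    by (subst integrable_distr_eq) (use measurable_scenery scenery_integrable in auto)
  show "(\<integral>y. y \<partial>\<mu>) = 0" unfolding \<mu>_def
    by (subst integral_distr) (use measurable_scenery scenery_centered in auto)
  show "integrable \<mu> (\<lambda>y. y\<^sup>2)" unfolding \<mu>_def
    by (subst integrable_distr_eq) (use measurable_scenery scenery_square_integrable in auto)
qed (simp add: \<mu>_def)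

sublocale R: rwrs_space \<nu> \<mu> ..

lemma sets_fields: "sets R.sceneries = sets fields"
  by (rule sets_PiM_cong) auto

text \<open>The steps are numbered from 1 and the coordinates of the path space from 0; the law is
  transported by reindexing along \<open>Suc\<close>.\<close>

lemma distr_increments: "distr M paths increments = step.steps"
proof -
  let ?K = "\<Pi>\<^sub>M i\<in>{1..}. count_space (UNIV :: (int ^ 'n) set)"
  let ?X = "\<lambda>\<omega>. \<lambda>i\<in>{1..}. walk_step S i \<omega>"
  have K: "distr M ?K ?X = (\<Pi>\<^sub>M i\<in>{1..}. \<nu>)"
  proof -
    have "indep_vars (\<lambda>_. count_space UNIV) (walk_step S) {1..} \<longleftrightarrow>
        distr M ?K ?X = (\<Pi>\<^sub>M i\<in>{1..}. distr M (count_space UNIV) (walk_step S i))"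
    proof (rule indep_vars_iff_distr_eq_PiM')
      show "{1..} \<noteq> ({} :: nat set)" by (metis atLeast_iff empty_iff order_refl)
      show "walk_step S i \<in> M \<rightarrow>\<^sub>M count_space UNIV" if "i \<in> {1..}" for i
        using that by (intro measurable_walk_step) simp
    qed
    with steps_indep have "distr M ?K ?X = (\<Pi>\<^sub>M i\<in>{1..}. distr M (count_space UNIV) (walk_step S i))"
      by blast
    also have "\<dots> = (\<Pi>\<^sub>M i\<in>{1..}. \<nu>)"
      unfolding \<nu>_def by (rule PiM_cong[OF refl]) (rule steps_ident, simp)
    finally show ?thesis .
  qed
  have mX: "?X \<in> M \<rightarrow>\<^sub>M ?K"
    by (rule measurable_restrict, rule measurable_walk_step) simp
  have mS: "(\<lambda>\<omega> n. \<omega> (Suc n)) \<in> ?K \<rightarrow>\<^sub>M paths"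
  proof (rule measurable_PiM_single')
    show "(\<lambda>\<omega>. \<omega> (Suc n)) \<in> ?K \<rightarrow>\<^sub>M count_space UNIV" for n
      by (rule measurable_component_singleton) simp
  qed simp
  have "step.steps = distr (\<Pi>\<^sub>M i\<in>{1..}. \<nu>) step.steps (\<lambda>\<omega> n. \<omega> (Suc n))"
    using distr_PiM_reindex[of "{1..}" "\<lambda>_. \<nu>" Suc UNIV] step.prob_space_axioms
    by (simp add: restrict_def)
  also have "\<dots> = distr (distr M ?K ?X) paths (\<lambda>\<omega> n. \<omega> (Suc n))"
    unfolding K by (rule distr_cong) (auto simp: sets_paths)
  also have "\<dots> = distr M paths ((\<lambda>\<omega> n. \<omega> (Suc n)) \<circ> ?X)"
    by (rule distr_distr[OF mS mX])
  also have "(\<lambda>\<omega> n. \<omega> (Suc n)) \<circ> ?X = increments"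
    by (auto simp: increments_def fun_eq_iff)
  finally show ?thesis ..
qed

lemma distr_fields: "distr M fields (\<lambda>\<omega> x. \<xi> x \<omega>) = R.sceneries"
proof -
  have "indep_vars (\<lambda>_. borel) \<xi> UNIV \<longleftrightarrow>
      distr M fields (\<lambda>\<omega>. \<lambda>x\<in>UNIV. \<xi> x \<omega>) = (\<Pi>\<^sub>M x\<in>UNIV. distr M borel (\<xi> x))"
    by (rule indep_vars_iff_distr_eq_PiM') (simp_all add: measurable_scenery)
  with scenery_indep have "distr M fields (\<lambda>\<omega>. \<lambda>x\<in>UNIV. \<xi> x \<omega>) = (\<Pi>\<^sub>M x\<in>UNIV. distr M borel (\<xi> x))"
    by blast
  also have "\<dots> = R.sceneries"
    unfolding \<mu>_def by (rule PiM_cong[OF refl]) (rule scenery_ident)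
  finally show ?thesis by (simp add: restrict_def)
qed

lemma measurable_S: "S n \<in> M \<rightarrow>\<^sub>M count_space UNIV"
proof -
  have "(\<lambda>\<omega>. walk (increments \<omega>) n) \<in> M \<rightarrow>\<^sub>M count_space UNIV"
    using measurable_increments unfolding measurable_into_paths by (rule measurable_compose[OF _ step.measurable_walk])
  then show ?thesis by (rule measurable_cong[THEN iffD1, rotated]) (simp add: walk_increments)
qed

text \<open>Independence is given for the positions of the walk; the increments are a measurable
  function \<open>?D\<close> of the positions, so probabilities of rectangles still factor.\<close>

lemma distr_joint: "distr M (paths \<Otimes>\<^sub>M fields) (\<lambda>\<omega>. (increments \<omega>, \<lambda>x. \<xi> x \<omega>)) = R.joint"
proof -
  let ?D = "\<lambda>(s :: nat \<Rightarrow> int ^ 'n) i. s (Suc i) - s i"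
  let ?X = "\<lambda>\<omega>. (increments \<omega>, \<lambda>x. \<xi> x \<omega>)"
  have mD: "?D \<in> paths \<rightarrow>\<^sub>M paths"
  proof (rule measurable_PiM_single')
    fix i :: nat
    have c: "(\<lambda>s. s k) \<in> paths \<rightarrow>\<^sub>M count_space UNIV" for k :: nat
      by (rule measurable_component_singleton) simp
    show "(\<lambda>s. s (Suc i) - s i) \<in> paths \<rightarrow>\<^sub>M count_space UNIV"
    proof (rule measurable_compose_countable[where f="\<lambda>x s. s (Suc i) - x" and g="\<lambda>s. s i"])
      show "(\<lambda>s. s (Suc i) - x) \<in> paths \<rightarrow>\<^sub>M count_space UNIV" for x
        by (rule measurable_compose[OF c]) simp
    qed (rule c)
  qed simp
  have mX: "?X \<in> M \<rightarrow>\<^sub>M paths \<Otimes>\<^sub>M fields"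
    by (rule measurable_Pair[OF measurable_increments measurable_fields])
  have "distr M paths increments \<Otimes>\<^sub>M distr M fields (\<lambda>\<omega> x. \<xi> x \<omega>) = distr M (paths \<Otimes>\<^sub>M fields) ?X"
  proof (rule pair_measure_eqI)
    show "sigma_finite_measure (distr M paths increments)"
      by (intro prob_space_imp_sigma_finite prob_space_distr measurable_increments)
    show "sigma_finite_measure (distr M fields (\<lambda>\<omega> x. \<xi> x \<omega>))"
      by (intro prob_space_imp_sigma_finite prob_space_distr measurable_fields)
    show "sets (distr M paths increments \<Otimes>\<^sub>M distr M fields (\<lambda>\<omega> x. \<xi> x \<omega>)) = sets (distr M (paths \<Otimes>\<^sub>M fields) ?X)"
      by (simp cong: sets_pair_measure_cong)
    fix A B assume "A \<in> sets (distr M paths increments)" "B \<in> sets (distr M fields (\<lambda>\<omega> x. \<xi> x \<omega>))"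
    then have A: "A \<in> sets paths" and B: "B \<in> sets fields" by simp_all
    have DA: "?D -` A \<in> sets paths" using measurable_sets[OF mD A] by (simp add: space_PiM)
    have eqA: "increments -` A \<inter> space M = (\<lambda>\<omega> n. S n \<omega>) -` (?D -` A) \<inter> space M"
      by (simp add: vimage_def increments_def[abs_def] walk_step_def)
    have "prob ((increments -` A \<inter> space M) \<inter> ((\<lambda>\<omega> x. \<xi> x \<omega>) -` B \<inter> space M)) =
        prob (increments -` A \<inter> space M) * prob ((\<lambda>\<omega> x. \<xi> x \<omega>) -` B \<inter> space M)"
      unfolding eqA by (intro indep_setD[OF walk_scenery_indep] in_vimage_algebra DA B)
    moreover have "?X -` (A \<times> B) \<inter> space M = (increments -` A \<inter> space M) \<inter> ((\<lambda>\<omega> x. \<xi> x \<omega>) -` B \<inter> space M)"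
      by auto
    ultimately show "emeasure (distr M paths increments) A * emeasure (distr M fields (\<lambda>\<omega> x. \<xi> x \<omega>)) B =
        emeasure (distr M (paths \<Otimes>\<^sub>M fields) ?X) (A \<times> B)"
      by (simp only: emeasure_distr[OF measurable_increments A] emeasure_distr[OF measurable_fields B]
          emeasure_distr[OF mX pair_measureI[OF A B]] emeasure_eq_measure ennreal_mult'[symmetric] measure_nonneg)
  qed
  then show ?thesis by (simp only: distr_increments distr_fields)
qed

text \<open>Every partial sum from time 1 on contains the first value. Once it is taken out, the
  partial sums of the following \<open>n\<close> values remain, now with the empty sum among
  them.\<close>

lemma rwrs_max_eq:
  assumes "\<omega> \<in> space M"
  shows "rwrs_max S \<xi> (Suc n) \<omega> = R.strict_max n (increments \<omega>, \<lambda>x. \<xi> x \<omega>)"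
proof -
  define s where "s i = S (Suc i) \<omega>" for i
  let ?x = "\<lambda>x. \<xi> x \<omega>"
  have Z: "rwrs S \<xi> (Suc k) \<omega> = ?x (s 0) + (\<Sum>i<k. ?x (s (Suc i)))" for k
  proof -
    have "rwrs S \<xi> (Suc k) \<omega> = (\<Sum>i<Suc k. ?x (s i))"
      unfolding rwrs_def s_def by (rule sum.reindex_bij_witness[where i=Suc and j="\<lambda>i. i - 1"]) auto
    then show ?thesis by (simp only: sum.lessThan_Suc_shift)
  qed
  have "{1..Suc n} = Suc ` {..n}" by (simp add: image_Suc_atMost)
  then have "rwrs_max S \<xi> (Suc n) \<omega> = Max ((\<lambda>k. ?x (s 0) + (\<Sum>i<k. ?x (s (Suc i)))) ` {..n})"
    unfolding rwrs_max_def by (simp only: image_image Z)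
  also have "\<dots> = ?x (s 0) + Max ((\<lambda>k. \<Sum>i<k. ?x (s (Suc i))) ` {..n})"
    using Max_add_commute[of "{..n}" "\<lambda>k. \<Sum>i<k. ?x (s (Suc i))" "?x (s 0)"] by (simp add: add.commute)
  also have "\<dots> = ?x (s 0) + list_max ?x (map (\<lambda>i. s (Suc i)) [0..<n])"
    by (simp only: list_max_eq_Max)
  also have "map (\<lambda>i. s (Suc i)) [0..<n] = map (\<lambda>k. walk (increments \<omega>) (Suc k)) [1..<Suc n]"
    unfolding map_Suc_upt[symmetric, of 0, simplified] map_map comp_def s_def walk_increments[OF assms] One_nat_def map_Suc_upt[symmetric]
    by simp
  also have "?x (s 0) + list_max ?x \<dots> = R.strict_max n (increments \<omega>, ?x)"
  proof -
    have "s 0 = increments \<omega> 0"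
      using assms walk_increments[OF assms, of 1] by (simp add: s_def walk_def)
    then show ?thesis
      by (simp add: R.strict_max_def R.running_max_def R.T_def sites_def walk_Suc_shift list_max_map del: upt_Suc)
  qed
  finally show ?thesis .
qed

lemma persistence_prob_eq: "persistence_prob M S \<xi> m (Suc n) = R.persist n m"
proof -
  let ?\<Phi> = "\<lambda>\<omega>. (increments \<omega>, \<lambda>x. \<xi> x \<omega>)"
  have m: "?\<Phi> \<in> M \<rightarrow>\<^sub>M paths \<Otimes>\<^sub>M fields"
    by (rule measurable_Pair[OF measurable_increments measurable_fields])
  have A: "{z. R.strict_max n z \<le> m} \<in> sets (paths \<Otimes>\<^sub>M fields)"
    using R.sets_strict_max_le[of n m] by (simp add: sets_pair_measure_cong[OF sets_paths sets_fields])
  have "R.persist n m = measure (distr M (paths \<Otimes>\<^sub>M fields) ?\<Phi>) {z. R.strict_max n z \<le> m}"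
    unfolding R.persist_def distr_joint ..
  also have "\<dots> = measure M (?\<Phi> -` {z. R.strict_max n z \<le> m} \<inter> space M)"
    by (rule measure_distr[OF m A])
  also have "?\<Phi> -` {z. R.strict_max n z \<le> m} \<inter> space M = {\<omega> \<in> space M. rwrs_max S \<xi> (Suc n) \<omega> \<le> m}"
    by (auto simp: rwrs_max_eq)
  finally show ?thesis by (simp add: persistence_prob_def)
qed

lemma distr_of_increments:
  assumes "f \<in> borel_measurable step.steps"
  shows "distr M borel (\<lambda>\<omega>. f (increments \<omega>)) = distr step.steps borel f"
proof -
  have f: "f \<in> paths \<rightarrow>\<^sub>M borel" using assms by (simp only: measurable_from_paths)
  have "distr step.steps borel f = distr (distr M paths increments) borel f"
    by (simp only: distr_increments)
  also have "\<dots> = distr M borel (f \<circ> increments)" by (rule distr_distr[OF f measurable_increments])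
  finally show ?thesis by (simp add: comp_def)
qed

lemma integral_walk:
  fixes f :: "int ^ 'n \<Rightarrow> 'b::{banach, second_countable_topology}"
  shows "(\<integral>\<omega>. f (S n \<omega>) \<partial>M) = (\<integral>\<omega>. f (walk \<omega> n) \<partial>step.steps)"
proof -
  have m: "(\<lambda>\<omega>. f (walk \<omega> n)) \<in> borel_measurable paths"
  proof -
    have "(\<lambda>\<omega>. f (walk \<omega> n)) \<in> borel_measurable step.steps"
      by (rule measurable_compose[OF step.measurable_walk]) simp
    then show ?thesis by (simp only: measurable_from_paths)
  qed
  have "(\<integral>\<omega>. f (walk \<omega> n) \<partial>step.steps) = (\<integral>\<omega>. f (walk \<omega> n) \<partial>distr M paths increments)"
    by (simp only: distr_increments)
  also have "\<dots> = (\<integral>\<omega>. f (walk (increments \<omega>) n) \<partial>M)"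
    by (rule integral_distr[OF measurable_increments m])
  also have "\<dots> = (\<integral>\<omega>. f (S n \<omega>) \<partial>M)"
    by (intro Bochner_Integration.integral_cong) (auto simp: walk_increments)
  finally show ?thesis ..
qed

text \<open>By contraposition: an unbounded Green function would give infinitely many returns on the
  path space, hence for the given walk.\<close>

lemma green_bounded_if_transient:
  assumes "\<not> recurrent_walk M S"
  obtains B where "\<And>n. step.green n \<le> B"
proof (rule ccontr)
  assume "\<not> thesis"
  then have "\<exists>n. step.green n > B" for B using that by (meson not_le)
  then have "AE \<omega> in step.steps. \<exists>\<^sub>\<infinity>n. walk \<omega> n = 0"
    by (rule step.infinitely_many_returns)
  then have "AE \<omega> in distr M paths increments. \<exists>\<^sub>\<infinity>n. walk \<omega> n = 0"
    by (simp only: distr_increments)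
  then have "AE \<omega> in M. \<exists>\<^sub>\<infinity>n. walk (increments \<omega>) n = 0"
    by (rule AE_distrD[OF measurable_increments])
  then have "AE \<omega> in M. \<exists>\<^sub>\<infinity>n. S n \<omega> = 0"
    using AE_space by eventually_elim (simp add: walk_increments)
  then show False using assms by (simp add: recurrent_walk_def)
qed

text \<open>A centered variable without mass on the negative half-line is zero almost surely. The
  closed subgroup generated by its support would then be trivial, hence neither the integers nor the
  whole line.\<close>

lemma nondegenerate_scenery:
  obtains e where "e < 0" "measure \<mu> {..e} > 0"
proof (rule ccontr)
  assume "\<not> thesis"
  then have no: "\<not> (e < 0 \<and> measure \<mu> {..e} > 0)" for e
    using that by blast
  have zero: "measure \<mu> {..e} = 0" if "e < 0" for e
    using no[of e] that measure_nonneg[of \<mu> "{..e}"] by linarith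
  have "AE y in \<mu>. \<forall>k. y \<notin> {..- (1 / real (Suc k))}"
  proof (subst AE_all_countable, intro allI AE_not_in)
    fix k show "{..- (1 / real (Suc k))} \<in> null_sets \<mu>"
      using zero[of "- (1 / real (Suc k))"] by (simp add: null_sets_def field.emeasure_eq_measure)
  qed
  then have nonneg: "AE y in \<mu>. 0 \<le> y"
  proof eventually_elim
    case (elim y)
    show ?case
    proof (rule ccontr)
      assume "\<not> 0 \<le> y"
      then obtain k where "1 / real (Suc k) < - y" using nat_approx_posE[of "- y"] by auto
      then show False using elim by (auto dest!: spec[of _ k])
    qed
  qed
  have "AE y in \<mu>. y = 0"
    using integral_nonneg_eq_0_iff_AE[OF field.law_integrable nonneg] field.law_centered by simp
  then have "law_support \<mu> \<subseteq> {0}"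
  proof -
    have "x \<notin> law_support \<mu>" if x: "x \<noteq> 0" for x :: real
    proof -
      have "- {0} \<in> null_sets \<mu>"
        using \<open>AE y in \<mu>. y = 0\<close> AE_iff_null_sets[of "- {0::real}" \<mu>] by auto
      then have "measure \<mu> (- {0}) = 0" by (simp add: null_sets_def measure_def)
      then show ?thesis using x unfolding law_support_def by (auto intro!: exI[of _ "- {0}"])
    qed
    then show ?thesis by blast
  qed
  then have "generated_closed_subgroup (law_support \<mu>) \<subseteq> {0}"
    unfolding generated_closed_subgroup_def by (intro hull_minimal) (auto simp: add_subgroup_def)
  moreover have "1 \<in> generated_closed_subgroup (law_support \<mu>)"
  proof -
    have "generated_closed_subgroup (law_support \<mu>) = \<int> \<or> generated_closed_subgroup (law_support \<mu>) = UNIV"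
      using scenery_support by (simp only: \<mu>_def insert_iff empty_iff simp_thms)
    then show ?thesis by (elim disjE) (simp_all only: Ints_1 UNIV_I)
  qed
  ultimately have "(1::real) \<in> {0}" by (rule subsetD)
  then show False by simp
qed

section \<open>The attraction hypotheses as limits of characteristic functions\<close>

lemma measurable_coordinate: "(\<lambda>\<omega>. real_of_int (S n \<omega> $ i)) \<in> borel_measurable M"
  by (rule measurable_compose[OF measurable_S]) simp

lemma stationary_increments:
  "distr M borel (\<lambda>\<omega>. real_of_int (S (n + k) \<omega> $ i) - real_of_int (S n \<omega> $ i)) =
   distr M borel (\<lambda>\<omega>. real_of_int (S k \<omega> $ i))"
proof -
  let ?f = "\<lambda>\<omega>. real_of_int (walk \<omega> k $ i)"
  have f: "?f \<in> borel_measurable step.steps"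
    by (rule measurable_compose[OF step.measurable_walk]) simp
  have shift: "distr step.steps step.steps (\<lambda>\<omega> j. \<omega> (n + j)) = step.steps"
    using distr_PiM_reindex[of UNIV "\<lambda>_. \<nu>" "(+) n" UNIV] step.prob_space_axioms
    by (simp add: restrict_def)
  have fs: "(\<lambda>\<omega>. ?f (\<lambda>j. \<omega> (n + j))) \<in> borel_measurable step.steps"
    by (rule measurable_compose[OF step.measurable_shift f])
  have "distr M borel (\<lambda>\<omega>. real_of_int (S (n + k) \<omega> $ i) - real_of_int (S n \<omega> $ i)) =
      distr M borel (\<lambda>\<omega>. ?f (\<lambda>j. increments \<omega> (n + j)))"
  proof (rule distr_cong)
    fix \<omega> assume "\<omega> \<in> space M"
    from walk_increments[OF this] have "S (n + k) \<omega> = S n \<omega> + walk (\<lambda>j. increments \<omega> (n + j)) k"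
      by (metis walk_add_shift)
    then show "real_of_int (S (n + k) \<omega> $ i) - real_of_int (S n \<omega> $ i) = ?f (\<lambda>j. increments \<omega> (n + j))"
      by simp
  qed simp_all
  also have "\<dots> = distr step.steps borel (\<lambda>\<omega>. ?f (\<lambda>j. \<omega> (n + j)))"
    by (rule distr_of_increments[OF fs])
  also have "\<dots> = distr (distr step.steps step.steps (\<lambda>\<omega> j. \<omega> (n + j))) borel ?f"
    by (subst distr_distr[OF f step.measurable_shift]) (simp add: comp_def)
  also have "\<dots> = distr step.steps borel ?f" by (simp only: shift)
  also have "\<dots> = distr M borel (\<lambda>\<omega>. ?f (increments \<omega>))" by (rule distr_of_increments[OF f, symmetric])
  also have "\<dots> = distr M borel (\<lambda>\<omega>. real_of_int (S k \<omega> $ i))"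
    by (rule distr_cong) (simp_all add: walk_increments)
  finally show ?thesis .
qed

lemma attracted_if_weak_conv:
  assumes d: "CARD('n) = 1" and \<alpha>: "\<alpha> = 1" and m: "stable_law 1 m"
    and weak: "weak_conv_m (\<lambda>n. distr M borel (\<lambda>\<omega>. real_of_int (S n \<omega> $ i) / real n)) m"
  shows "attracted_walk \<nu> \<alpha>"
proof (rule step.attracted_walk_one_dim[OF d, of _ m i])
  show rd: "real_distribution m" and "\<nexists>c. m = return borel c" using m by (auto simp: stable_law_def)
  show "0 < \<alpha>" using \<alpha> by simp
  fix t
  have meas: "(\<lambda>\<omega>. real_of_int (S n \<omega> $ i) / real n) \<in> borel_measurable M" for n
    using measurable_coordinate by (rule borel_measurable_divide) simp
  have "(\<lambda>n. char (distr M borel (\<lambda>\<omega>. real_of_int (S n \<omega> $ i) / real n)) t) \<longlonglongrightarrow> char m t"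
    by (rule levy_continuity1[OF real_distribution_distr[OF meas] rd weak])
  moreover have "char (distr M borel (\<lambda>\<omega>. real_of_int (S n \<omega> $ i) / real n)) t =
      (\<integral>\<omega>. cis (t * (real n powr (- 1 / \<alpha>) * of_int (walk \<omega> n $ i))) \<partial>step.steps)" for n
  proof -
    have "char (distr M borel (\<lambda>\<omega>. real_of_int (S n \<omega> $ i) / real n)) t =
        (\<integral>\<omega>. cis (t * (real_of_int (S n \<omega> $ i) / real n)) \<partial>M)"
      unfolding char_def by (subst integral_distr[OF meas]) (simp_all add: cis_conv_exp)
    also have "\<dots> = (\<integral>\<omega>. cis (t * (real_of_int (walk \<omega> n $ i) / real n)) \<partial>step.steps)"
      by (rule integral_walk[of "\<lambda>x. cis (t * (real_of_int (x $ i) / real n))"])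
    finally show ?thesis by (simp add: \<alpha> powr_minus_divide)
  qed
  ultimately show "(\<lambda>n. \<integral>\<omega>. cis (t * (real n powr (- 1 / \<alpha>) * of_int (walk \<omega> n $ i))) \<partial>step.steps) \<longlonglongrightarrow> char m t"
    by simp
qed

text \<open>\<open>marginal_convergence\<close> is applied to the cosine and to the sine at time 1;
  together they give convergence to the characteristic function of \<open>L 1\<close>.\<close>

lemma attracted_if_J1_conv:
  fixes N :: "'v measure"
  assumes d: "CARD('n) = 1" and \<alpha>: "1 < \<alpha>" and L: "stable_levy_process \<alpha> N L"
    and conv: "converges_in_distribution J1_topology M
      (\<lambda>n \<omega> t. real n powr (- 1 / \<alpha>) * real_of_int (S (nat \<lfloor>real n * t\<rfloor>) \<omega> $ i)) N (\<lambda>\<omega> t. L t \<omega>)"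
  shows "attracted_walk \<nu> \<alpha>"
proof (rule step.attracted_walk_one_dim[OF d, of _ "distr N borel (L 1)" i])
  have levy: "levy_process N L" and stable: "stable_law \<alpha> (distr N borel (L 1))"
    using L by (auto simp: stable_levy_process_def)
  show rd: "real_distribution (distr N borel (L 1))" and "\<nexists>c. distr N borel (L 1) = return borel c"
    using stable by (auto simp: stable_law_def)
  show "0 < \<alpha>" using \<alpha> by simp
  interpret N: prob_space N using levy by (simp add: levy_process_def)
  have L1 [measurable]: "L 1 \<in> borel_measurable N" using levy by (simp add: levy_process_def)
  fix t :: real
  \<comment> \<open>A common modulus of continuity of \<open>cos (t * y)\<close> and
    \<open>sin (t * y)\<close>, truncated at 2 so as to be bounded.\<close>
  let ?K = "\<lambda>y. min 2 \<bar>t * y\<bar>"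
  have "(\<lambda>n. \<integral>\<omega>. f (t * (real n powr (- 1 / \<alpha>) * real_of_int (S n \<omega> $ i))) \<partial>M) \<longlonglongrightarrow> (\<integral>\<omega>. f (t * L 1 \<omega>) \<partial>N)"
    if f: "f = cos \<or> f = sin" for f :: "real \<Rightarrow> real"
  proof (rule marginal_convergence[where g="\<lambda>y. f (t * y)" and K="?K" and L=L])
    show "prob_space M" by (rule prob_space_axioms)
    show "(\<lambda>\<omega>. real_of_int (S k \<omega> $ i)) \<in> borel_measurable M" for k by (rule measurable_coordinate)
    show "distr M borel (\<lambda>\<omega>. real_of_int (S (n + k) \<omega> $ i) - real_of_int (S n \<omega> $ i)) =
        distr M borel (\<lambda>\<omega>. real_of_int (S k \<omega> $ i))" for n k by (rule stationary_increments)
    show "continuous_on UNIV (\<lambda>y. f (t * y))" using f by (auto intro!: continuous_intros)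
    show "\<bar>f (t * y)\<bar> \<le> 1" for y using f by auto
    show "continuous_on UNIV ?K" by (intro continuous_intros)
    show "\<bar>?K y\<bar> \<le> 2" for y by (simp add: abs_le_iff)
    show "?K 0 = 0" by simp
    show "\<bar>f (t * y) - f (t * z)\<bar> \<le> ?K (y - z)" for y z
    proof -
      have "\<bar>f (t * y) - f (t * z)\<bar> \<le> norm (cis (t * y) - cis (t * z))"
        using f abs_Re_le_cmod[of "cis (t * y) - cis (t * z)"] abs_Im_le_cmod[of "cis (t * y) - cis (t * z)"] by auto
      also have "\<dots> \<le> \<bar>t * y - t * z\<bar>" by (rule norm_cis_diff_le)
      finally have "\<bar>f (t * y) - f (t * z)\<bar> \<le> \<bar>t * (y - z)\<bar>" by (simp add: right_diff_distrib)
      moreover have "\<bar>f (t * y)\<bar> \<le> 1" "\<bar>f (t * z)\<bar> \<le> 1" using f by auto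
      then have "\<bar>f (t * y) - f (t * z)\<bar> \<le> 2" by linarith
      ultimately show ?thesis by simp
    qed
  qed (fact levy conv)+
  from this[of cos] this[of sin]
  have lim: "(\<lambda>n. complex_of_real (\<integral>\<omega>. cos (t * (real n powr (- 1 / \<alpha>) * real_of_int (S n \<omega> $ i))) \<partial>M) +
        \<i> * complex_of_real (\<integral>\<omega>. sin (t * (real n powr (- 1 / \<alpha>) * real_of_int (S n \<omega> $ i))) \<partial>M))
      \<longlonglongrightarrow> complex_of_real (\<integral>\<omega>. cos (t * L 1 \<omega>) \<partial>N) + \<i> * complex_of_real (\<integral>\<omega>. sin (t * L 1 \<omega>) \<partial>N)"
    by (intro tendsto_intros) auto
  have split: "complex_of_real (\<integral>\<omega>. cos (Y \<omega>) \<partial>P) + \<i> * complex_of_real (\<integral>\<omega>. sin (Y \<omega>) \<partial>P) = (\<integral>\<omega>. cis (Y \<omega>) \<partial>P)"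
    if P: "prob_space P" and Y: "Y \<in> borel_measurable P" for P :: "'b measure" and Y
  proof -
    interpret P: prob_space P by (rule P)
    note Y [measurable]
    have "integrable P (\<lambda>\<omega>. cis (Y \<omega>))" by (rule P.integrable_const_bound[where B=1]) auto
    from integral_Re[OF this] integral_Im[OF this] show ?thesis by (simp add: complex_eq_iff)
  qed
  have "(\<lambda>n. \<integral>\<omega>. cis (t * (real n powr (- 1 / \<alpha>) * real_of_int (S n \<omega> $ i))) \<partial>M) \<longlonglongrightarrow> (\<integral>\<omega>. cis (t * L 1 \<omega>) \<partial>N)"
  proof -
    have mS: "(\<lambda>\<omega>. t * (real n powr (- 1 / \<alpha>) * real_of_int (S n \<omega> $ i))) \<in> borel_measurable M" for n
      by (intro borel_measurable_times borel_measurable_const measurable_coordinate)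
    have mL: "(\<lambda>\<omega>. t * L 1 \<omega>) \<in> borel_measurable N"
      by (intro borel_measurable_times borel_measurable_const L1)
    show ?thesis
      using lim by (simp only: split[OF prob_space_axioms mS] split[OF N.prob_space_axioms mL])
  qed
  also have "(\<integral>\<omega>. cis (t * L 1 \<omega>) \<partial>N) = char (distr N borel (L 1)) t"
    unfolding char_def by (subst integral_distr[OF L1]) (simp_all add: cis_conv_exp)
  also have "(\<lambda>n. \<integral>\<omega>. cis (t * (real n powr (- 1 / \<alpha>) * real_of_int (S n \<omega> $ i))) \<partial>M) =
      (\<lambda>n. \<integral>\<omega>. cis (t * (real n powr (- 1 / \<alpha>) * of_int (walk \<omega> n $ i))) \<partial>step.steps)"
    by (rule ext) (rule integral_walk)
  finally show "(\<lambda>n. \<integral>\<omega>. cis (t * (real n powr (- 1 / \<alpha>) * of_int (walk \<omega> n $ i))) \<partial>step.steps)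
      \<longlonglongrightarrow> char (distr N borel (L 1)) t" .
qed

lemma attracted_if_gaussian:
  fixes N :: "(real ^ 'n) measure"
  assumes N: "gaussian_law N"
    and conv: "converges_in_distribution euclidean M
      (\<lambda>n \<omega>. (real n powr (- 1 / 2)) *\<^sub>R real_vec (S n \<omega>)) N (\<lambda>x. x)"
  shows "attracted_walk \<nu> 2"
proof (rule step.attracted_walk_gaussian[OF N])
  fix u :: "real ^ 'n"
  have "(\<lambda>n. \<integral>\<omega>. cis (u \<bullet> (real n powr (- 1 / 2) *\<^sub>R real_vec (S n \<omega>))) \<partial>M) \<longlonglongrightarrow> (\<integral>x. cis (u \<bullet> x) \<partial>N)"
  proof (rule converges_in_distribution_cis[OF prob_space_axioms _ _ _ conv])
    show "prob_space N" "sets N = sets borel" using N by (auto simp: gaussian_law_def)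
    show "(\<lambda>\<omega>. (real n powr (- 1 / 2)) *\<^sub>R real_vec (S n \<omega>)) \<in> borel_measurable M" for n
      by (rule measurable_compose[OF measurable_S]) simp
  qed
  also have "(\<lambda>n. \<integral>\<omega>. cis (u \<bullet> (real n powr (- 1 / 2) *\<^sub>R real_vec (S n \<omega>))) \<partial>M) =
      (\<lambda>n. \<integral>\<omega>. cis (u \<bullet> (real n powr (- 1 / 2) *\<^sub>R real_vec (walk \<omega> n))) \<partial>step.steps)"
    by (rule ext) (rule integral_walk)
  finally show "(\<lambda>n. \<integral>\<omega>. cis (u \<bullet> (real n powr (- 1 / 2) *\<^sub>R real_vec (walk \<omega> n))) \<partial>step.steps)
      \<longlonglongrightarrow> (\<integral>x. cis (u \<bullet> x) \<partial>N)" .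
qed

lemma recurrent_cases:
  assumes "recurrent_walk M S"
  shows "CARD('n) = 1 \<or> CARD('n) = 2" "real CARD('n) \<le> \<alpha>" "\<alpha> \<le> 2" "attracted_walk \<nu> \<alpha>"
proof -
  show \<alpha>: "real CARD('n) \<le> \<alpha>" "\<alpha> \<le> 2" using recurrent_index[OF assms] by auto
  have "0 < CARD('n)" by simp
  with \<alpha> show d: "CARD('n) = 1 \<or> CARD('n) = 2" by linarith
  note attr = recurrent_attraction[OF assms, unfolded normal_stable_attraction_def]
  show "attracted_walk \<nu> \<alpha>"
    using d
  proof
    assume d2: "CARD('n) = 2"
    then have "\<alpha> = 2" using \<alpha> by simp
    then show ?thesis using attr d2 attracted_if_gaussian by blast
  next
    assume d1: "CARD('n) = 1"
    obtain i :: 'n where True by blast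
    show ?thesis
    proof (cases "\<alpha> = 1")
      case True
      then obtain m where "stable_law 1 m" "weak_conv_m (\<lambda>n. distr M borel (\<lambda>\<omega>. real_of_int (S n \<omega> $ i) / real n)) m"
        using attr d1 by blast
      then show ?thesis by (rule attracted_if_weak_conv[OF d1 True])
    next
      case False
      then have \<alpha>1: "1 < \<alpha>" using \<alpha> d1 by simp
      then obtain N :: "(real \<Rightarrow> real) measure" and L where "stable_levy_process \<alpha> N L"
        "converges_in_distribution J1_topology M
           (\<lambda>n \<omega> t. real n powr (- 1 / \<alpha>) * real_of_int (S (nat \<lfloor>real n * t\<rfloor>) \<omega> $ i)) N (\<lambda>\<omega> t. L t \<omega>)"
        using attr d1 by blast
      then show ?thesis by (rule attracted_if_J1_conv[OF d1 \<alpha>1])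
    qed
  qed
qed

text \<open>In the recurrent case \<open>sqrt (n * L n)\<close> is the normalization, up to the 1
  added to the logarithm when \<open>\<alpha>\<close> equals the dimension; there the normalization
  vanishes at \<open>n = 1\<close>, so the second comparison starts at 2. In the transient case
  \<open>L\<close> is constant.\<close>

lemma profile:
  obtains L e0 c0 C0 where "green_profile \<nu> \<mu> L e0 c0 C0"
    "\<And>n. n \<ge> 1 \<Longrightarrow> rwrs_norm M S \<alpha> n \<le> sqrt (real n * L n)"
    "\<And>n. n \<ge> (if recurrent_walk M S \<and> \<alpha> = real CARD('n) then 2 else 1) \<Longrightarrow> sqrt (real n * L n) \<le> 2 * rwrs_norm M S \<alpha> n"
proof -
  obtain e0 where e0: "e0 < 0" "measure \<mu> {..e0} > 0" using nondegenerate_scenery by blast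
  show ?thesis
  proof (cases "recurrent_walk M S")
    case False
    obtain B where B: "\<And>n. step.green n \<le> B" using green_bounded_if_transient[OF False] by blast
    have "green_profile \<nu> \<mu> (\<lambda>_. 1) e0 1 B"
    proof
      show "0 < B" using B[of 0] step.green_ge_1[of 0] by linarith
      show "1 \<le> 2 * sqrt (real n / real j) * 1" if "1 \<le> j" "j \<le> n" for j n :: nat
      proof -
        have "1 \<le> real n / real j" using that by simp
        then have "1 \<le> sqrt (real n / real j)" by simp
        then show ?thesis by linarith
      qed
    qed (use e0 B step.green_ge_1 in auto)
    then show ?thesis by (rule that) (use False in \<open>auto simp: rwrs_norm_def\<close>)
  next
    case True
    note rec = recurrent_cases[OF True]
    let ?L = "growth CARD('n) \<alpha>"
    interpret A: attracted_walk \<nu> \<alpha> by (rule rec(4))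
    have \<alpha>1: "1 \<le> \<alpha>" using rec by auto
    obtain c C where cC: "c > 0" "C > 0" "\<And>n. n \<ge> 1 \<Longrightarrow> c * ?L n \<le> step.green n" "\<And>n. n \<ge> 1 \<Longrightarrow> step.green n \<le> C * ?L n"
      using A.green_growth[OF rec(1-3)] by blast
    have prof: "green_profile \<nu> \<mu> ?L e0 c C"
      by unfold_locales (use e0 cC growth_ge_1[OF _ \<alpha>1] growth_mono[OF _ _ \<alpha>1] growth_regular[OF _ _ \<alpha>1 rec(3)] in auto)
    show ?thesis
    proof (cases "\<alpha> = real CARD('n)")
      case eq: True
      have norm: "rwrs_norm M S \<alpha> n = sqrt (real n * ln (real n))" for n
        using True eq by (simp add: rwrs_norm_def)
      have L: "?L n = 1 + ln (real n)" for n using eq by (simp add: growth_def)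
      \<comment> \<open>For \<open>n \<ge> 2\<close> the logarithm is at least 2/3, so
        \<open>1 + ln n\<close> is at most \<open>4 * ln n\<close>; the root of 4 is the factor
        2.\<close>
      have upper: "sqrt (real n * (1 + ln (real n))) \<le> 2 * sqrt (real n * ln (real n))" if n: "n \<ge> 2" for n
      proof -
        have "ln 2 \<le> ln (real n)" using n by simp
        then have "1 + ln (real n) \<le> 4 * ln (real n)" using ln2_ge_two_thirds by linarith
        then have "real n * (1 + ln (real n)) \<le> 2\<^sup>2 * (real n * ln (real n))"
          using mult_left_mono[of "1 + ln (real n)" "4 * ln (real n)" "real n"] by simp
        then have "sqrt (real n * (1 + ln (real n))) \<le> sqrt (2\<^sup>2 * (real n * ln (real n)))" by (rule real_sqrt_le_mono)
        then show ?thesis by (simp add: real_sqrt_mult)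
      qed
      show ?thesis
      proof (rule that[OF prof])
        show "rwrs_norm M S \<alpha> n \<le> sqrt (real n * ?L n)" for n
          unfolding norm L by (intro real_sqrt_le_mono mult_left_mono) auto
        show "sqrt (real n * ?L n) \<le> 2 * rwrs_norm M S \<alpha> n"
          if "n \<ge> (if recurrent_walk M S \<and> \<alpha> = real CARD('n) then 2 else 1)" for n
          unfolding norm L using that True eq by (intro upper) (simp split: if_splits)
      qed
    next
      case False
      have norm: "rwrs_norm M S \<alpha> n = sqrt (real n * ?L n)" if n: "n \<ge> 1" for n
      proof -
        have "real n * ?L n = (real n powr (1 - 1 / (2 * \<alpha>)))\<^sup>2"
        proof -
          have "(real n powr (1 - 1 / (2 * \<alpha>)))\<^sup>2 = real n powr (1 + (1 - 1 / \<alpha>))"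
            using n by (simp add: power2_eq_square flip: powr_add)
          also have "\<dots> = real n powr 1 * real n powr (1 - 1 / \<alpha>)" by (rule powr_add)
          finally show ?thesis using False n by (simp add: growth_def)
        qed
        then show ?thesis using True False by (simp add: rwrs_norm_def)
      qed
      show ?thesis
      proof (rule that[OF prof])
        show "rwrs_norm M S \<alpha> n \<le> sqrt (real n * ?L n)" if "n \<ge> 1" for n
          using norm[OF that] by simp
        show "sqrt (real n * ?L n) \<le> 2 * rwrs_norm M S \<alpha> n"
          if "n \<ge> (if recurrent_walk M S \<and> \<alpha> = real CARD('n) then 2 else 1)" for n
        proof -
          have "0 \<le> rwrs_norm M S \<alpha> n" by (cases "n = 0") (simp_all add: rwrs_norm_def)
          moreover have "rwrs_norm M S \<alpha> n = sqrt (real n * ?L n)"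
            using that False by (intro norm) simp
          ultimately show ?thesis by linarith
        qed
      qed
    qed
  qed
qed

section \<open>Bounds on the persistence probabilities\<close>

lemma persistence_antimono: "1 \<le> m \<Longrightarrow> m \<le> n \<Longrightarrow> persistence_prob M S \<xi> t n \<le> persistence_prob M S \<xi> t m"
  using R.persist_antimono[of "m - 1" "n - 1" t] persistence_prob_eq[of t "m - 1"] persistence_prob_eq[of t "n - 1"] by simp

lemma persistence_upper:
  obtains c where "c > 0"
    "\<And>n. n \<ge> (if recurrent_walk M S \<and> \<alpha> = real CARD('n) then 2 else 1) \<Longrightarrow>
      persistence_prob M S \<xi> m n \<le> c * (rwrs_norm M S \<alpha> n / real n)"
proof -
  let ?n0 = "if recurrent_walk M S \<and> \<alpha> = real CARD('n) then 2 else 1 :: nat"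
  obtain L e0 c0 C0 where prof: "green_profile \<nu> \<mu> L e0 c0 C0"
    and scale: "\<And>n. n \<ge> ?n0 \<Longrightarrow> sqrt (real n * L n) \<le> 2 * rwrs_norm M S \<alpha> n"
    using profile by metis
  interpret G: green_profile \<nu> \<mu> L e0 c0 C0 by (rule prof)
  obtain C1 where C1: "C1 > 0" "\<And>n. R.persist n m \<le> C1 * R.deficit n"
    using R.persist_le_deficit[OF G.nondeg] by blast
  obtain C2 where C2: "C2 > 0" "\<And>n. R.deficit n \<le> C2 * (G.scale (Suc n) / real (Suc n))"
    using G.deficit_upper by blast
  have "persistence_prob M S \<xi> m n \<le> 2 * C1 * C2 * (rwrs_norm M S \<alpha> n / real n)" if n: "n \<ge> ?n0" for n
  proof -
    have n1: "n \<ge> 1" using n by (auto split: if_splits)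
    then obtain k where k: "n = Suc k" by (cases n) auto
    have "persistence_prob M S \<xi> m n \<le> C1 * R.deficit k" using C1(2)[of k] by (simp add: k persistence_prob_eq)
    also have "\<dots> \<le> C1 * (C2 * (G.scale n / real n))" using C1(1) C2(2)[of k] by (intro mult_left_mono) (auto simp: k)
    also have "\<dots> \<le> C1 * (C2 * (2 * rwrs_norm M S \<alpha> n / real n))"
      using C1(1) C2(1) scale[OF n] by (intro mult_left_mono divide_right_mono) (auto simp: G.scale_def)
    finally show ?thesis by (simp add: mult_ac)
  qed
  then show ?thesis using that[of "2 * C1 * C2"] C1(1) C2(1) by simp
qed

text \<open>\<open>deficit (n - 1)\<close> belongs to the horizon \<open>n\<close>; the bound for
  \<open>deficit n\<close> carries over by monotonicity.\<close>

lemma deficit_norm_lower: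
  obtains c where "c > 0" "\<And>n. n \<ge> 1 \<Longrightarrow> c * (rwrs_norm M S \<alpha> n / real n) \<le> R.deficit (n - 1)"
proof -
  obtain L e0 c0 C0 where prof: "green_profile \<nu> \<mu> L e0 c0 C0"
    and scale: "\<And>n. n \<ge> 1 \<Longrightarrow> rwrs_norm M S \<alpha> n \<le> sqrt (real n * L n)"
    using profile by metis
  interpret G: green_profile \<nu> \<mu> L e0 c0 C0 by (rule prof)
  obtain c where c: "c > 0" "\<And>n. n \<ge> 1 \<Longrightarrow> c * (G.scale n / real n) \<le> R.deficit n"
    using G.deficit_lower by blast
  have "c * (rwrs_norm M S \<alpha> n / real n) \<le> R.deficit (n - 1)" if n: "n \<ge> 1" for n
  proof -
    have "c * (rwrs_norm M S \<alpha> n / real n) \<le> c * (G.scale n / real n)"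
      using c(1) scale[OF n] by (intro mult_left_mono divide_right_mono) (auto simp: G.scale_def)
    also have "\<dots> \<le> R.deficit n" by (rule c(2)[OF n])
    also have "\<dots> \<le> R.deficit (n - 1)" by (rule R.deficit_antimono) simp
    finally show ?thesis .
  qed
  then show ?thesis using that c(1) by blast
qed

text \<open>One value at most \<open>m\<close> is put in front of a walk that persists below 0; the
  extra step of the horizon is given away by monotonicity.\<close>

lemma persistence_prepend:
  assumes "m < 0" "n \<ge> 1"
  shows "measure \<mu> {..m} * persistence_prob M S \<xi> 0 n \<le> persistence_prob M S \<xi> m n"
proof -
  obtain k where k: "n = Suc k" using assms(2) by (cases n) auto
  have "measure \<mu> {..m} * R.persist k 0 \<le> R.persist (Suc k) m"
    using R.strict_max_prepend[of m k 0] by (simp add: R.persist_def)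
  also have "\<dots> \<le> R.persist k m" by (rule R.persist_antimono) simp
  finally show ?thesis by (simp add: k persistence_prob_eq)
qed

lemma persistence_mono_level: "n \<ge> 1 \<Longrightarrow> s \<le> t \<Longrightarrow> persistence_prob M S \<xi> s n \<le> persistence_prob M S \<xi> t n"
  using R.persist_mono[of s t "n - 1"] persistence_prob_eq[of s "n - 1"] persistence_prob_eq[of t "n - 1"] by simp

lemma persistence_lower_bounded:
  assumes b: "prob {\<omega> \<in> space M. \<xi> 0 \<omega> \<ge> - b} = 1"
  obtains c where "c > 0" "\<And>n. n \<ge> 1 \<Longrightarrow> c * (rwrs_norm M S \<alpha> n / real n) \<le> persistence_prob M S \<xi> 0 n"
proof -
  obtain c where c: "c > 0" "\<And>n. n \<ge> 1 \<Longrightarrow> c * (rwrs_norm M S \<alpha> n / real n) \<le> R.deficit (n - 1)"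
    using deficit_norm_lower by blast
  define l where "l = max 1 b"
  have l: "l > 0" "b \<le> l" by (auto simp: l_def)
  have "{\<omega> \<in> space M. \<xi> 0 \<omega> \<ge> - b} \<in> events"
    using measurable_scenery[of 0] by measurable
  then have "AE \<omega> in M. \<xi> 0 \<omega> \<ge> - b" using b by (simp add: prob_Collect_eq_1)
  then have "AE y in \<mu>. y \<ge> - b"
    unfolding \<mu>_def by (subst AE_distr_iff[OF measurable_scenery]) auto
  then have "AE y in \<mu>. \<bar>y\<bar> * indicator {..<- l} y = 0"
    by eventually_elim (use l in \<open>auto simp: indicator_def\<close>)
  then have tail: "(\<integral>y. \<bar>y\<bar> * indicator {..<- l} y \<partial>\<mu>) = 0" by (rule integral_eq_zero_AE)
  have "c / l * (rwrs_norm M S \<alpha> n / real n) \<le> persistence_prob M S \<xi> 0 n" if n: "n \<ge> 1" for n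
  proof -
    obtain k where k: "n = Suc k" using n by (cases n) auto
    have "c * (rwrs_norm M S \<alpha> n / real n) \<le> l * R.persist k 0"
      using c(2)[OF n] R.deficit_le_persist[of l k] l tail by (simp add: k)
    then have "c * (rwrs_norm M S \<alpha> n / real n) / l \<le> persistence_prob M S \<xi> 0 n"
      unfolding k persistence_prob_eq using l by (simp only: pos_divide_le_eq mult.commute[of l])
    then show ?thesis by (simp add: mult.commute)
  qed
  then show ?thesis using that[of "c / l"] c(1) l by simp
qed

lemma persistence_lower_bounded_level:
  assumes b: "prob {\<omega> \<in> space M. \<xi> 0 \<omega> \<ge> - b} = 1" and m: "m \<ge> 0 \<or> measure \<mu> {..m} > 0"
  obtains c where "c > 0" "\<And>n. n \<ge> 1 \<Longrightarrow> c * (rwrs_norm M S \<alpha> n / real n) \<le> persistence_prob M S \<xi> m n"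
proof -
  obtain c where c: "c > 0" "\<And>n. n \<ge> 1 \<Longrightarrow> c * (rwrs_norm M S \<alpha> n / real n) \<le> persistence_prob M S \<xi> 0 n"
    using persistence_lower_bounded[OF b] by blast
  show ?thesis
  proof (cases "m \<ge> 0")
    case True
    show ?thesis
    proof (rule that[OF c(1)])
      show "c * (rwrs_norm M S \<alpha> n / real n) \<le> persistence_prob M S \<xi> m n" if "n \<ge> 1" for n
        using c(2)[OF that] persistence_mono_level[OF that True] by linarith
    qed
  next
    case False
    then have p: "measure \<mu> {..m} > 0" "m < 0" using m by auto
    show ?thesis
    proof (rule that[of "measure \<mu> {..m} * c"])
      show "measure \<mu> {..m} * c * (rwrs_norm M S \<alpha> n / real n) \<le> persistence_prob M S \<xi> m n" if "n \<ge> 1" for n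
        using mult_left_mono[OF c(2)[OF that], of "measure \<mu> {..m}"] persistence_prepend[OF p(2) that]
        by (simp add: mult.assoc)
    qed (use p c in simp)
  qed
qed

text \<open>The cutoff in \<open>deficit_le_persist\<close> has to push the Gaussian tail down to
  order \<open>1 / n\<close>, below the main term of order \<open>a n / n\<close>. Hence it grows
  like \<open>sqrt (ln n)\<close>, and this is the loss in the bound.\<close>

lemma persistence_lower_gaussian:
  assumes gauss: "distributed M lborel (\<xi> 0) (normal_density m0 \<sigma>)" and \<sigma>: "\<sigma> > 0"
  obtains c where "c > 0" "\<And>n. n \<ge> 2 \<Longrightarrow>
    c * (rwrs_norm M S \<alpha> n / (real n * sqrt (ln (real n)))) \<le> persistence_prob M S \<xi> m n"
proof -
  have "m0 = 0" using normal_distributed_expectation[OF \<sigma> gauss] scenery_centered by simp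
  then have gauss0: "distributed M lborel (\<xi> 0) (normal_density 0 \<sigma>)" using gauss by simp
  have \<mu>_density: "\<mu> = density lborel (normal_density 0 \<sigma>)"
    using distributed_distr_eq_density[OF gauss0] unfolding \<mu>_def by (simp cong: distr_cong)
  have tail: "(\<integral>y. \<bar>y\<bar> * indicator {..<- l} y \<partial>\<mu>) \<le> 4 * \<sigma> * exp (- (l\<^sup>2 / (8 * \<sigma>\<^sup>2)))" if "l \<ge> 0" for l
  proof -
    have "(\<integral>y. \<bar>y\<bar> * indicator {..<- l} y \<partial>\<mu>) = (\<integral>y. normal_density 0 \<sigma> y * (\<bar>y\<bar> * indicator {..<- l} y) \<partial>lborel)"
      unfolding \<mu>_density by (subst integral_density) (auto simp: normal_density_nonneg)
    then show ?thesis using normal_tail_le[OF \<sigma> that] by simp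
  qed
  have pos: "measure \<mu> {..t} > 0" for t
  proof (rule ccontr)
    assume "\<not> measure \<mu> {..t} > 0"
    then have "emeasure \<mu> {..t} = 0" using measure_nonneg[of \<mu> "{..t}"] by (simp add: field.emeasure_eq_measure)
    then have "(\<integral>\<^sup>+y. ennreal (normal_density 0 \<sigma> y) * indicator {..t} y \<partial>lborel) = 0"
      unfolding \<mu>_density by (subst (asm) emeasure_density) auto
    then have "AE y in lborel. ennreal (normal_density 0 \<sigma> y) * indicator {..t} y = 0"
      by (subst (asm) nn_integral_0_iff_AE) auto
    then have "AE y in lborel. y \<notin> {..t}"
    proof eventually_elim
      case (elim y)
      then show ?case using normal_density_pos[OF \<sigma>, of 0 y] by (auto simp: indicator_def)
    qed
    then have "{..t} \<in> null_sets lborel" by (subst (asm) AE_iff_null_sets[symmetric]) auto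
    then have "emeasure lborel {t - 1..t} = 0"
      using null_sets_subset[of "{..t}" lborel "{t - 1..t}"] by auto
    then show False by simp
  qed
  obtain \<kappa> where \<kappa>: "\<kappa> > 0" "\<And>n. n \<ge> 1 \<Longrightarrow> \<kappa> * persistence_prob M S \<xi> 0 n \<le> persistence_prob M S \<xi> m n"
  proof (cases "m \<ge> 0")
    case True
    show ?thesis by (rule that[of 1]) (use persistence_mono_level True in auto)
  next
    case False
    show ?thesis by (rule that[OF pos[of m]]) (use persistence_prepend False in auto)
  qed
  obtain c where c: "c > 0" "\<And>n. n \<ge> 1 \<Longrightarrow> c * (rwrs_norm M S \<alpha> n / real n) \<le> R.deficit (n - 1)"
    using deficit_norm_lower by blast
  define a where "a = rwrs_norm M S \<alpha>"
  have a_ge: "sqrt (real n) \<le> 2 * a n" if n: "n \<ge> 2" for n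
  proof -
    obtain L e0 c0 C0 where prof: "green_profile \<nu> \<mu> L e0 c0 C0"
      and scale: "\<And>n. n \<ge> (if recurrent_walk M S \<and> \<alpha> = real CARD('n) then 2 else 1) \<Longrightarrow> sqrt (real n * L n) \<le> 2 * rwrs_norm M S \<alpha> n"
      using profile by metis
    interpret G: green_profile \<nu> \<mu> L e0 c0 C0 by (rule prof)
    have "1 \<le> L n" using n by (intro G.L_ge_1) simp
    then have "sqrt (real n) \<le> sqrt (real n * L n)" using n by (intro real_sqrt_le_mono) (simp add: mult_le_cancel_left1)
    also have "\<dots> \<le> 2 * a n" unfolding a_def using n by (intro scale) simp
    finally show ?thesis .
  qed
  have a_pos: "a n > 0" if "n \<ge> 2" for n
  proof -
    have "0 < sqrt (real n)" using that by simp
    then show ?thesis using a_ge[OF that] by linarith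
  qed
  define d where "d = c / (2 * \<sigma> * sqrt 8)"
  have d: "d > 0" using c \<sigma> by (simp add: d_def)
  \<comment> \<open>For \<open>n\<close> at least \<open>N\<close>, \<open>a n\<close> is at least
    \<open>sqrt n / 2\<close>, hence at least \<open>8 * \<sigma> / c\<close>, so the tail
    \<open>4 * \<sigma> / n\<close> is at most half of \<open>c * a n / n\<close>.\<close>
  obtain N where N: "real N \<ge> (16 * \<sigma> / c)\<^sup>2" using real_arch_simple by blast
  have large: "d * (a n / (real n * sqrt (ln (real n)))) \<le> persistence_prob M S \<xi> 0 n" if n: "n \<ge> max N 2" for n
  proof -
    obtain k where k: "n = Suc k" using n by (cases n) auto
    have ln: "ln (real n) > 0" using n by simp
    \<comment> \<open>The factor \<open>sqrt 8\<close> turns the exponential in \<open>tail\<close>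
      into exactly \<open>1 / n\<close>.\<close>
    define l where "l = \<sigma> * sqrt 8 * sqrt (ln (real n))"
    have l: "l > 0" using \<sigma> ln by (simp add: l_def)
    have "l\<^sup>2 / (8 * \<sigma>\<^sup>2) = ln (real n)"
      using \<sigma> ln by (simp add: l_def power_mult_distrib)
    then have t: "(\<integral>y. \<bar>y\<bar> * indicator {..<- l} y \<partial>\<mu>) \<le> 4 * \<sigma> / real n"
      using tail[of l] l n by (simp add: exp_minus inverse_eq_divide)
    have "16 * \<sigma> / c \<le> sqrt (real n)" using N n by (intro real_le_rsqrt) simp
    also have "\<dots> \<le> 2 * a n" using n by (intro a_ge) simp
    finally have "16 * \<sigma> \<le> 2 * a n * c" using c(1) by (simp only: pos_divide_le_eq)
    then have "4 * \<sigma> / real n \<le> c * a n / 2 / real n" by (intro divide_right_mono) auto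
    moreover have "c * (a n / real n) \<le> l * persistence_prob M S \<xi> 0 n + 4 * \<sigma> / real n"
      using c(2)[of n] R.deficit_le_persist[of l k] l t n by (simp add: a_def k persistence_prob_eq)
    moreover have "c * (a n / real n) = 2 * (c * a n / 2 / real n)" by simp
    ultimately have "c * a n / 2 / real n \<le> l * persistence_prob M S \<xi> 0 n" by linarith
    then have "c * a n / 2 / real n / l \<le> persistence_prob M S \<xi> 0 n" using l by (simp only: pos_divide_le_eq mult.commute[of l])
    also have "c * a n / 2 / real n / l = d * (a n / (real n * sqrt (ln (real n))))"
      by (simp add: d_def l_def)
    finally show ?thesis .
  qed
  define N2 where "N2 = max N 2"
  define q where "q n = a n / (real n * sqrt (ln (real n)))" for n
  have q0: "q n \<ge> 0" if "n \<ge> 2" for n using a_pos[OF that] that by (auto simp: q_def)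
  have qN: "q N2 > 0" unfolding q_def using a_pos[of N2] by (auto simp: N2_def intro!: divide_pos_pos mult_pos_pos)
  \<comment> \<open>\<open>Q\<close> bounds \<open>q n\<close> for the finitely many
    \<open>n < N2\<close>, where the probability is at least its value at \<open>N2\<close>; the
    ratio \<open>q N2 / Q\<close> adjusts the constant for them.\<close>
  define Q where "Q = 1 + (\<Sum>n\<in>{2..<N2}. q n)"
  have Q: "Q \<ge> 1" unfolding Q_def using q0 by (auto intro!: sum_nonneg)
  define \<delta> where "\<delta> = d * min 1 (q N2 / Q)"
  have \<delta>: "\<delta> > 0" using d qN Q by (auto simp: \<delta>_def)
  have zero_level: "\<delta> * q n \<le> persistence_prob M S \<xi> 0 n" if n: "n \<ge> 2" for n
  proof (cases "n \<ge> N2")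
    case True
    have "\<delta> * q n \<le> d * q n" using q0[OF n] d by (intro mult_right_mono) (auto simp: \<delta>_def)
    then show ?thesis using large[of n] True unfolding q_def N2_def by linarith
  next
    case False
    have "q n \<le> (\<Sum>n\<in>{2..<N2}. q n)" using False n q0 by (intro member_le_sum) auto
    then have qQ: "q n \<le> Q" by (simp add: Q_def)
    have "\<delta> \<le> d * (q N2 / Q)" unfolding \<delta>_def using d by (intro mult_left_mono) auto
    then have "\<delta> * q n \<le> d * (q N2 / Q) * Q"
      using d qN Q q0[OF n] qQ by (intro mult_mono) auto
    also have "\<dots> = d * q N2" using Q by simp
    also have "\<dots> \<le> persistence_prob M S \<xi> 0 N2" using large[of N2] unfolding q_def N2_def by simp
    also have "\<dots> \<le> persistence_prob M S \<xi> 0 n" using False n by (intro persistence_antimono) auto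
    finally show ?thesis .
  qed
  show ?thesis
  proof (rule that[of "\<kappa> * \<delta>"])
    show "\<kappa> * \<delta> > 0" using \<kappa>(1) \<delta> by simp
    fix n :: nat assume n: "n \<ge> 2"
    have "\<kappa> * (\<delta> * q n) \<le> \<kappa> * persistence_prob M S \<xi> 0 n"
      using zero_level[OF n] \<kappa>(1) by (intro mult_left_mono) auto
    also have "\<dots> \<le> persistence_prob M S \<xi> m n" using \<kappa>(2)[of n] n by simp
    finally show "\<kappa> * \<delta> * (rwrs_norm M S \<alpha> n / (real n * sqrt (ln (real n)))) \<le> persistence_prob M S \<xi> m n"
      by (simp add: q_def a_def mult.assoc)
  qed
qed

end

theorem theorem13:
  fixes M :: "'w measure"
    and S :: "nat \<Rightarrow> 'w \<Rightarrow> int ^ 'n"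
    and \<xi> :: "int ^ 'n \<Rightarrow> 'w \<Rightarrow> real"
    and \<alpha> :: real
  assumes "random_walk_in_random_scenery M S \<xi> \<alpha>"
  shows
    "((\<exists>\<mu> \<sigma>. \<sigma> > 0 \<and> distributed M lborel (\<xi> 0) (normal_density \<mu> \<sigma>)) \<longrightarrow>
        (\<forall>m::real. \<exists>c>0. \<forall>n::nat\<ge>2.
           inverse c * (rwrs_norm M S \<alpha> n / (real n * sqrt (ln (real n))))
             \<le> persistence_prob M S \<xi> m n \<and>
           persistence_prob M S \<xi> m n \<le> c * (rwrs_norm M S \<alpha> n / real n)))
     \<and>
     ((\<exists>b::real. measure M {\<omega> \<in> space M. \<xi> 0 \<omega> \<ge> - b} = 1) \<longrightarrow>
        (\<forall>m::real. \<exists>c>0.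
           \<forall>n::nat \<ge> (if recurrent_walk M S \<and> \<alpha> = real CARD('n) then 2 else 1).
             persistence_prob M S \<xi> m n \<le> c * (rwrs_norm M S \<alpha> n / real n)) \<and>
        (\<forall>m::real\<ge>0. \<exists>c>0. \<forall>n::nat\<ge>1.
           persistence_prob M S \<xi> m n \<ge> c * (rwrs_norm M S \<alpha> n / real n)) \<and>
        (\<forall>m::real<0. measure M {\<omega> \<in> space M. \<xi> 0 \<omega> \<le> m} > 0 \<longrightarrow>
           (\<exists>c>0. \<forall>n::nat\<ge>1.
              persistence_prob M S \<xi> m n \<ge> c * (rwrs_norm M S \<alpha> n / real n))))"
proof -
  interpret rws: random_walk_in_random_scenery M S \<xi> \<alpha> by (rule assms)
  let ?a = "rwrs_norm M S \<alpha>" and ?p = "persistence_prob M S \<xi>"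
  show ?thesis
  proof (intro conjI impI allI)
    fix m :: real
    assume "\<exists>\<mu> \<sigma>. \<sigma> > 0 \<and> distributed M lborel (\<xi> 0) (normal_density \<mu> \<sigma>)"
    then obtain m0 \<sigma> where "\<sigma> > 0" "distributed M lborel (\<xi> 0) (normal_density m0 \<sigma>)" by blast
    then obtain c1 where c1: "c1 > 0" "\<And>n. n \<ge> 2 \<Longrightarrow> c1 * (?a n / (real n * sqrt (ln (real n)))) \<le> ?p m n"
      using rws.persistence_lower_gaussian by metis
    obtain c2 where c2: "c2 > 0" "\<And>n. n \<ge> (if recurrent_walk M S \<and> \<alpha> = real CARD('n) then 2 else 1) \<Longrightarrow> ?p m n \<le> c2 * (?a n / real n)"
      using rws.persistence_upper[of m] by blast
    \<comment> \<open>One constant for both bounds: it dominates \<open>c2\<close>, and its inverse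
      is at most \<open>c1\<close>.\<close>
    define c where "c = max (inverse c1) c2"
    have c: "c > 0" "inverse c \<le> c1" "c2 \<le> c"
      using c1(1) c2(1) le_imp_inverse_le[of "inverse c1" c] by (auto simp: c_def less_max_iff_disj)
    have a0: "0 \<le> ?a n" if "n \<ge> 1" for n using that by (simp add: rwrs_norm_def)
    show "\<exists>c>0. \<forall>n\<ge>2. inverse c * (?a n / (real n * sqrt (ln (real n)))) \<le> ?p m n \<and> ?p m n \<le> c * (?a n / real n)"
    proof (intro exI[of _ c] conjI allI impI c(1))
      fix n :: nat assume n: "2 \<le> n"
      have "inverse c * (?a n / (real n * sqrt (ln (real n)))) \<le> c1 * (?a n / (real n * sqrt (ln (real n))))"
        using c(2) a0[of n] n by (intro mult_right_mono) auto
      also have "\<dots> \<le> ?p m n" by (rule c1(2)[OF n])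
      finally show "inverse c * (?a n / (real n * sqrt (ln (real n)))) \<le> ?p m n" .
      have "?p m n \<le> c2 * (?a n / real n)" using n by (intro c2(2)) simp
      also have "\<dots> \<le> c * (?a n / real n)" using c(3) a0[of n] n by (intro mult_right_mono) auto
      finally show "?p m n \<le> c * (?a n / real n)" .
    qed
  next
    fix m :: real
    show "\<exists>c>0. \<forall>n\<ge>(if recurrent_walk M S \<and> \<alpha> = real CARD('n) then 2 else 1). ?p m n \<le> c * (?a n / real n)"
      using rws.persistence_upper[of m] by blast
  next
    fix m :: real
    assume "\<exists>b. measure M {\<omega> \<in> space M. \<xi> 0 \<omega> \<ge> - b} = 1" and m: "0 \<le> m"
    then obtain b where "measure M {\<omega> \<in> space M. \<xi> 0 \<omega> \<ge> - b} = 1" by blast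
    then show "\<exists>c>0. \<forall>n\<ge>1. ?p m n \<ge> c * (?a n / real n)"
      using rws.persistence_lower_bounded_level[of b m] m by blast
  next
    fix m :: real
    assume "\<exists>b. measure M {\<omega> \<in> space M. \<xi> 0 \<omega> \<ge> - b} = 1" and m: "measure M {\<omega> \<in> space M. \<xi> 0 \<omega> \<le> m} > 0"
    then obtain b where b: "measure M {\<omega> \<in> space M. \<xi> 0 \<omega> \<ge> - b} = 1" by blast
    have "measure rws.\<mu> {..m} = measure M {\<omega> \<in> space M. \<xi> 0 \<omega> \<le> m}"
      unfolding rws.\<mu>_def by (subst measure_distr[OF rws.measurable_scenery]) (auto intro!: arg_cong[where f="measure M"])
    then show "\<exists>c>0. \<forall>n\<ge>1. ?p m n \<ge> c * (?a n / real n)"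
      using rws.persistence_lower_bounded_level[OF b, of m] m by metis
  qed
qed

end
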